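(* Suppose that $n$ is odd and $\mathcal{A}$ is a cluster algebra of type $A_n$ ($n\ge1$), or $B_n$ or $C_n$ ($n\ge3$), with no frozen variables. The lineality space of $\mathcal{C}_{\mathcal{A}}$ is the span of the vector $\sum_{i=1}^N(-1)^iE_i$. The rays of $\mathcal{C}_{\mathcal{A}}$ modulo lineality space are generated by $\widetilde v(l)$ for $l$ an even diagonal of $\mathbf{P}_N$ of non-maximal length, and by $$\widetilde v(l)+\widetilde v(l')+H([\delta_+(l),\delta_+(l')])$$ for $l,l'$ odd diagonals or edges of $\mathbf{P}_N$ of non-maximal length satisfying $\delta_+(l)+\delta_+(l')\equiv1\pmod 2$.
   Context: **Gröbner cone.** Cluster algebras are over a field $\mathbb{K}$ of characteristic zero. For $\mathcal{A}$ of finite cluster type without frozen variables, with set of cluster variables $\mathcal{V}$, let $I_{\mathcal{A}}$ be the kernel of $\mathbb{K}[z_v\mid v\in\mathcal{V}]\to\mathcal{A}$, $z_v\mapsto v$, and $I_{\mathcal{A}}^{\times}$ the ideal generated by all $z_vz_w$ with $v,w\in\mathcal{V}$ not in a common cluster. For $\omega\in\mathbb{R}^{\mathcal{V}}$, $\mathrm{In}_\omega(f)$ is the sum of the terms of $f$ of maximal $\omega$-weight and $\mathrm{In}_\omega(I)=\langle\mathrm{In}_\omega(f):f\in I\rangle$. $\mathcal{C}_{\mathcal{A}}$ is the closure of $\{\omega\in\mathbb{R}^{\mathcal{V}}:\mathrm{In}_\omega(I_{\mathcal{A}})=I_{\mathcal{A}}^{\times}\}$. "Rays modulo lineality space" are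 the rays of the image of the cone in the quotient by its lineality space. **Polygon models (Fomin–Zelevinsky).** $\mathbf{P}_N$ is a regular $N$-gon with vertices $1,\dots,N$ (modulo $N$) labeled counterclockwise; $[i,j]$ is the edge or diagonal with endpoints $i,j$. For $N$ even, $\overline i$ is the vertex antipodal to $i$, $\overline{[i,j]}=[\overline i,\overline j]$, and a diameter is a diagonal $[i,\overline i]$. Type $A_n$, $N=n+3$: cluster variables $x_l$ correspond to diagonals $l$ of $\mathbf{P}_N$, clusters to triangulations, exchange relations are $x_{[a,c]}x_{[b,d]}=x_{[a,b]}x_{[c,d]}+x_{[a,d]}x_{[b,c]}$ for crossing diagonals $[a,c],[b,d]$. Types $B_n,C_n$, $N=2n+2$: cluster variables $x_l=x_{\overline l}$ correspond to diagonal pairs $\{l,\overline l\}$ (diameters being degenerate pairs), clusters to centrally symmetric triangulations. With $r=1$ for $B_n$, $r=2$ for $C_n$, exchange relations are: $x_{[a,c]}x_{[b,d]}=x_{[a,b]}x_{[c,d]}+x_{[a,d]}x_{[b,c]}$ for $a,b,c,d,\overline a$ in counterclockwise order; $x_{[a,c]}x_{[a,\overline b]}=x_{[a,b]}x_{[a,\overline c]}+x_{[a,\overline a]}^{2/r}x_{[b,c]}$ for $a,b,c,\overline a$ in counterclockwise order; $x_{[a,\overline a]}x_{[b,\overline b]}=x_{[a,b]}^r+x_{[a,\overline b]}^r$ for $b\neq a,\overline a$. In all these relations $x_l:=1$ when $l$ is an edge of $\mathbf{P}_N$ (no frozen variables). **Ambient space.** Let $\mathcal{W}$ be the set of edges (type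 $A_n$) resp. pairs of edges $\{l,\overline l\}$ (types $B_n,C_n$) of $\mathbf{P}_N$. $\mathbb{R}^{\mathcal{V}}$ is identified with the subspace of $\mathbb{R}^{\mathcal{V}\cup\mathcal{W}}$ where all $\mathcal{W}$-coordinates vanish, and $\mathcal{C}_{\mathcal{A}}$ is regarded as a subset of $\mathbb{R}^{\mathcal{V}\cup\mathcal{W}}$. Standard basis vectors are $e_l$ (type $A_n$) resp. $e_{\{l,\overline l\}}$ (types $B_n,C_n$; $e_l$ for a diameter). **Vectors.** The length $\mathrm{len}(l)$ of $l=[i,j]$ is the number of edges in a shortest boundary path (arc) between $i$ and $j$; if the arcs have different lengths the shorter is the minor arc; $l$ is of non-maximal length if $\mathrm{len}(l)<\lfloor N/2\rfloor$; $l$ is even/odd if $\mathrm{len}(l)$ is. For a diagonal or edge $l$ that is not a diameter, $\delta_-(l),\delta_+(l)$ are the first and last vertices of the minor arc of $l$ in counterclockwise order. For $l$ of non-maximal length, $F_l$ is the set of all diagonals and edges with both endpoints on the minor arc of $l$, and $v(l)=-\sum_{k\in F_l}e_k$ (type $A_n$), $v(l)=-\sum_{k\in F_l}e_{\{k,\overline k\}}$ (types $B_n,C_n$). For a vertex $i$: in type $A_n$, $E_i=\sum e_l$ over all edges and diagonals $l$ incident to $i$; in type $B_n$, $E_i=e_{[i,\overline i]}+\sum e_L$, and in type $C_n$, $E_i=2e_{[i,\overline i]}+\sum e_L$, the sums over all non-diameter diagonal pairs and edge pairs $L=\{l,\overline l\}$ with $i$ an endpoint of $l$ or $\overline l$.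 For any diagonal or edge $l$ that is not a diameter, $$E(l)=\sum_{k=1}^{\lfloor\mathrm{len}(l)/2\rfloor}E_{\delta_-(l)+2k-1},\qquad H(l)=\sum_{k=0}^{\mathrm{len}(l)-1}(-1)^kE_{\delta_-(l)+k}.$$ For $n$ odd in types $A_n,B_n,C_n$ and $l$ of non-maximal length, $\widetilde v(l)=v(l)+E(l)$. *)

theory Defs
  imports
    "HOL-Analysis.Analysis"
    "HOL-Library.Function_Algebras"
    "HOL-Library.Poly_Mapping"
begin

section \<open>The coordinate spaces\<close>

text \<open>The pointwise vector space structure on functions. For a finite index set \<open>I\<close>, the
  space of real vectors indexed by \<open>I\<close> is the set of functions vanishing outside \<open>I\<close>; the product
  topology on functions induces on it the Euclidean topology.\<close>

instantiation "fun" :: (type, real_vector) real_vector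
begin

definition scaleR_fun :: "real \<Rightarrow> ('a \<Rightarrow> 'b) \<Rightarrow> 'a \<Rightarrow> 'b" where
  "scaleR_fun c f = (\<lambda>i. c *\<^sub>R f i)"

instance
  by standard (simp_all add: scaleR_fun_def fun_eq_iff scaleR_add_right scaleR_add_left)

end

definition unit_vec :: "'i \<Rightarrow> 'i \<Rightarrow> real" where
  "unit_vec i = indicator {i}"


section \<open>Lineality space and rays of a convex cone\<close>

definition lineality_space :: "'a::real_vector set \<Rightarrow> 'a set" where
  "lineality_space C = {u. u \<in> C \<and> - u \<in> C}"

definition coset :: "'a::real_vector set \<Rightarrow> 'a \<Rightarrow> 'a set" where
  "coset L u = (+) u ` L"

text \<open>The ray generated by the image of \<open>u\<close> in the quotient by \<open>L\<close>; points of the quotient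
  are cosets.\<close>

definition quotient_ray :: "'a::real_vector set \<Rightarrow> 'a \<Rightarrow> 'a set set" where
  "quotient_ray L u = (\<lambda>c. coset L (c *\<^sub>R u)) ` {0..}"

text \<open>The rays (one-dimensional faces) of the image of the cone \<open>C\<close> in the quotient by its
  lineality space. A subcone \<open>R\<close> of a cone \<open>D\<close> is a face iff \<open>p + q \<in> R\<close> implies \<open>p, q \<in> R\<close>
  for \<open>p, q \<in> D\<close>.\<close>

definition rays_mod_lineality :: "'a::real_vector set \<Rightarrow> 'a set set set" where
  "rays_mod_lineality C =
     {R. \<exists>u\<in>C. u \<notin> lineality_space C \<and> R = quotient_ray (lineality_space C) u \<and>
        (\<forall>a\<in>C. \<forall>b\<in>C. coset (lineality_space C) (a + b) \<in> R \<longrightarrow>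
            coset (lineality_space C) a \<in> R \<and> coset (lineality_space C) b \<in> R)}"


section \<open>Polynomials\<close>

text \<open>A monomial in variables \<open>z\<^sub>v\<close> with \<open>v :: 'v\<close> is an element of \<open>'v \<Rightarrow>\<^sub>0 nat\<close>.\<close>

type_synonym ('v, 'k) mpolynomial = "('v \<Rightarrow>\<^sub>0 nat) \<Rightarrow>\<^sub>0 'k"

definition polys_in :: "'v set \<Rightarrow> ('v, 'k::zero) mpolynomial set" where
  "polys_in V = {p. \<forall>m\<in>Poly_Mapping.keys p. Poly_Mapping.keys m \<subseteq> V}"

definition var :: "'v \<Rightarrow> ('v, 'k::zero_neq_one) mpolynomial" where
  "var v = Poly_Mapping.single (Poly_Mapping.single v 1) 1"

definition field_embedding :: "('k::field \<Rightarrow> 'f::field) \<Rightarrow> bool" where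
  "field_embedding \<iota> \<longleftrightarrow> \<iota> 1 = 1 \<and>
     (\<forall>a b. \<iota> (a + b) = \<iota> a + \<iota> b) \<and> (\<forall>a b. \<iota> (a * b) = \<iota> a * \<iota> b)"

definition poly_eval :: "('k::zero \<Rightarrow> 'f::field) \<Rightarrow> ('v \<Rightarrow> 'f) \<Rightarrow> ('v, 'k) mpolynomial \<Rightarrow> 'f" where
  "poly_eval \<iota> x p =
     (\<Sum>m\<in>Poly_Mapping.keys p. \<iota> (Poly_Mapping.lookup p m) *
        (\<Prod>v\<in>Poly_Mapping.keys m. x v ^ Poly_Mapping.lookup m v))"

definition ideal_generated ::
  "'v set \<Rightarrow> ('v, 'k::comm_ring_1) mpolynomial set \<Rightarrow> ('v, 'k) mpolynomial set" where
  "ideal_generated V G =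
     {\<Sum>g\<in>S. q g * g | S q. finite S \<and> S \<subseteq> G \<and> (\<forall>g\<in>S. q g \<in> polys_in V)}"

definition weight :: "('v \<Rightarrow> real) \<Rightarrow> ('v \<Rightarrow>\<^sub>0 nat) \<Rightarrow> real" where
  "weight \<omega> m = (\<Sum>v\<in>Poly_Mapping.keys m. \<omega> v * real (Poly_Mapping.lookup m v))"

definition initial_form ::
  "('v \<Rightarrow> real) \<Rightarrow> ('v, 'k::comm_ring_1) mpolynomial \<Rightarrow> ('v, 'k) mpolynomial" where
  "initial_form \<omega> f =
     (\<Sum>m\<in>{m \<in> Poly_Mapping.keys f. weight \<omega> m = Max (weight \<omega> ` Poly_Mapping.keys f)}.
        Poly_Mapping.single m (Poly_Mapping.lookup f m))"

definition initial_ideal ::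
  "'v set \<Rightarrow> ('v \<Rightarrow> real) \<Rightarrow> ('v, 'k::comm_ring_1) mpolynomial set \<Rightarrow> ('v, 'k) mpolynomial set"
  where "initial_ideal V \<omega> I = ideal_generated V (initial_form \<omega> ` I)"


section \<open>Cluster algebras without frozen variables\<close>

text \<open>A labeled seed of rank \<open>n\<close> consists of a cluster and an exchange matrix, both indexed by
  \<open>{..<n}\<close>; values at other indices are irrelevant. The ambient field \<open>'f\<close> is an extension of
  \<open>'k\<close> via \<open>\<iota>\<close>; the cluster is a free generating set of it.\<close>

type_synonym 'f seed = "(nat \<Rightarrow> 'f) \<times> (nat \<Rightarrow> nat \<Rightarrow> int)"

definition free_generators :: "('k::field \<Rightarrow> 'f::field) \<Rightarrow> nat \<Rightarrow> (nat \<Rightarrow> 'f) \<Rightarrow> bool" where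
  "free_generators \<iota> n y \<longleftrightarrow>
     (\<forall>p\<in>polys_in {..<n}. poly_eval \<iota> y p = 0 \<longrightarrow> p = 0) \<and>
     (\<forall>z. \<exists>p\<in>polys_in {..<n}. \<exists>q\<in>polys_in {..<n}.
        poly_eval \<iota> y q \<noteq> 0 \<and> z = poly_eval \<iota> y p / poly_eval \<iota> y q)"

definition skew_symmetrizable :: "nat \<Rightarrow> (nat \<Rightarrow> nat \<Rightarrow> int) \<Rightarrow> bool" where
  "skew_symmetrizable n B \<longleftrightarrow>
     (\<exists>d::nat \<Rightarrow> int. (\<forall>i<n. d i > 0) \<and> (\<forall>i<n. \<forall>j<n. d i * B i j = - (d j * B j i)))"

definition is_seed :: "('k::field \<Rightarrow> 'f::field) \<Rightarrow> nat \<Rightarrow> 'f seed \<Rightarrow> bool" where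
  "is_seed \<iota> n S \<longleftrightarrow> free_generators \<iota> n (fst S) \<and> skew_symmetrizable n (snd S)"

definition mutate_cluster ::
  "nat \<Rightarrow> nat \<Rightarrow> (nat \<Rightarrow> 'f::field) \<Rightarrow> (nat \<Rightarrow> nat \<Rightarrow> int) \<Rightarrow> nat \<Rightarrow> 'f" where
  "mutate_cluster n k y B =
     y(k := ((\<Prod>i<n. y i ^ nat (B i k)) + (\<Prod>i<n. y i ^ nat (- B i k))) / y k)"

definition mutate_matrix :: "nat \<Rightarrow> (nat \<Rightarrow> nat \<Rightarrow> int) \<Rightarrow> nat \<Rightarrow> nat \<Rightarrow> int" where
  "mutate_matrix k B = (\<lambda>i j. if i = k \<or> j = k then - B i j
     else B i j + (\<bar>B i k\<bar> * B k j + B i k * \<bar>B k j\<bar>) div 2)"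

inductive_set mutation_class :: "nat \<Rightarrow> 'f::field seed \<Rightarrow> 'f seed set" for n S where
  initial: "S \<in> mutation_class n S"
| mutate: "(y, B) \<in> mutation_class n S \<Longrightarrow> k < n \<Longrightarrow>
    (mutate_cluster n k y B, mutate_matrix k B) \<in> mutation_class n S"

definition clusters :: "nat \<Rightarrow> 'f::field seed \<Rightarrow> 'f set set" where
  "clusters n S = (\<lambda>(y, B). y ` {..<n}) ` mutation_class n S"

definition cluster_variables :: "nat \<Rightarrow> 'f::field seed \<Rightarrow> 'f set" where
  "cluster_variables n S = \<Union> (clusters n S)"

text \<open>The kernel of \<open>z\<^sub>v \<mapsto> v\<close>; it does not matter whether the target is taken to be the cluster
  algebra or the ambient field.\<close>

definition relation_ideal ::
  "('k::field \<Rightarrow> 'f::field) \<Rightarrow> nat \<Rightarrow> 'f seed \<Rightarrow> ('f, 'k) mpolynomial set" where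
  "relation_ideal \<iota> n S = {p \<in> polys_in (cluster_variables n S). poly_eval \<iota> (\<lambda>v. v) p = 0}"

definition incompatibility_ideal :: "nat \<Rightarrow> 'f::field seed \<Rightarrow> ('f, 'k::field) mpolynomial set" where
  "incompatibility_ideal n S = ideal_generated (cluster_variables n S)
     {var v * var w | v w. v \<in> cluster_variables n S \<and> w \<in> cluster_variables n S \<and>
        \<not> (\<exists>K\<in>clusters n S. v \<in> K \<and> w \<in> K)}"

definition groebner_cone ::
  "('k::field \<Rightarrow> 'f::field) \<Rightarrow> nat \<Rightarrow> 'f seed \<Rightarrow> ('f \<Rightarrow> real) set" where
  "groebner_cone \<iota> n S = closure {\<omega>. (\<forall>v. v \<notin> cluster_variables n S \<longrightarrow> \<omega> v = 0) \<and>
     initial_ideal (cluster_variables n S) \<omega> (relation_ideal \<iota> n S) = incompatibility_ideal n S}"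


section \<open>Cartan types\<close>

datatype cartan_type = Type_A | Type_B | Type_C

text \<open>Convention of Kac and Fomin--Zelevinsky: \<open>a\<^sub>i\<^sub>j\<close> is the pairing of the coroot \<open>\<alpha>\<^sub>i\<^sup>\<or>\<close> with the
  root \<open>\<alpha>\<^sub>j\<close>, and the last simple root is short in type B and long in type C.\<close>

definition cartan_matrix :: "cartan_type \<Rightarrow> nat \<Rightarrow> nat \<Rightarrow> nat \<Rightarrow> int" where
  "cartan_matrix X n i j =
     (if i = j then 2
      else if X = Type_B \<and> i + 1 = n \<and> j + 2 = n then - 2
      else if X = Type_C \<and> i + 2 = n \<and> j + 1 = n then - 2
      else if i = j + 1 \<or> j = i + 1 then - 1
      else 0)"

definition cartan_counterpart :: "(nat \<Rightarrow> nat \<Rightarrow> int) \<Rightarrow> nat \<Rightarrow> nat \<Rightarrow> int" where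
  "cartan_counterpart B i j = (if i = j then 2 else - \<bar>B i j\<bar>)"

definition has_cartan_type :: "cartan_type \<Rightarrow> nat \<Rightarrow> 'f::field seed \<Rightarrow> bool" where
  "has_cartan_type X n S \<longleftrightarrow>
     (\<exists>(y, B)\<in>mutation_class n S. \<exists>\<pi>. bij_betw \<pi> {..<n} {..<n} \<and>
        (\<forall>i<n. \<forall>j<n. cartan_counterpart B i j = cartan_matrix X n (\<pi> i) (\<pi> j)))"


section \<open>Polygons\<close>

text \<open>The vertices of the \<open>N\<close>-gon are the residues \<open>0, \<dots>, N - 1\<close>, in counterclockwise order (so
  the vertex \<open>N\<close> is \<open>0\<close>). Edges and diagonals are two-element sets of vertices. Functions of a
  vertex accept arbitrary integers and reduce them modulo \<open>N\<close>.\<close>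

definition seg :: "int \<Rightarrow> int \<Rightarrow> int \<Rightarrow> int set" where
  "seg N i j = {i mod N, j mod N}"

definition segments :: "int \<Rightarrow> int set set" where
  "segments N = {seg N i j | i j. i mod N \<noteq> j mod N}"

definition edges :: "int \<Rightarrow> int set set" where
  "edges N = {seg N i (i + 1) | i. True}"

definition diagonals :: "int \<Rightarrow> int set set" where
  "diagonals N = segments N - edges N"

definition antipode :: "int \<Rightarrow> int \<Rightarrow> int" where
  "antipode N i = (i + N div 2) mod N"

definition diameters :: "int \<Rightarrow> int set set" where
  "diameters N = {seg N i (antipode N i) | i. True}"

text \<open>\<open>ccw N [a, b, \<dots>]\<close>: the listed vertices are distinct and occur in this order when going around
  counterclockwise from the first one.\<close>

definition ccw :: "int \<Rightarrow> int list \<Rightarrow> bool" where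
  "ccw N vs = sorted_wrt (<) (map (\<lambda>v. (v - hd vs) mod N) vs)"

definition crossing :: "int \<Rightarrow> int set \<Rightarrow> int set \<Rightarrow> bool" where
  "crossing N l m \<longleftrightarrow> (\<exists>a b c d. l = seg N a c \<and> m = seg N b d \<and> ccw N [a, b, c, d])"

definition triangulations :: "int \<Rightarrow> int set set set" where
  "triangulations N =
     {T. T \<subseteq> diagonals N \<and> (\<forall>l\<in>T. \<forall>m\<in>T. \<not> crossing N l m) \<and>
         (\<forall>l\<in>diagonals N. (\<forall>m\<in>T. \<not> crossing N l m) \<longrightarrow> l \<in> T)}"

definition len :: "int \<Rightarrow> int set \<Rightarrow> nat" where
  "len N l = (LEAST k. \<exists>i. l = seg N i (i + int k))"

text \<open>The first vertices of shortest arcs: a singleton unless \<open>l\<close> is a diameter, in which case it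
  consists of both endpoints.\<close>

definition first_vertices :: "int \<Rightarrow> int set \<Rightarrow> int set" where
  "first_vertices N l = {i \<in> {0..<N}. l = seg N i (i + int (len N l))}"

definition delta_minus :: "int \<Rightarrow> int set \<Rightarrow> int" where
  "delta_minus N l = the_elem (first_vertices N l)"

definition delta_plus :: "int \<Rightarrow> int set \<Rightarrow> int" where
  "delta_plus N l = (delta_minus N l + int (len N l)) mod N"

definition minor_arc :: "int \<Rightarrow> int set \<Rightarrow> int set" where
  "minor_arc N l = (\<lambda>k. (delta_minus N l + int k) mod N) ` {..len N l}"

definition non_maximal :: "int \<Rightarrow> int set \<Rightarrow> bool" where
  "non_maximal N l \<longleftrightarrow> int (len N l) < N div 2"


section \<open>Polygon models\<close>

definition polygon_size :: "cartan_type \<Rightarrow> nat \<Rightarrow> int" where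
  "polygon_size X n = (if X = Type_A then int n + 3 else 2 * int n + 2)"

text \<open>Labels of coordinates: \<open>{l}\<close> in type A, and the pair of \<open>l\<close> and its antipodal
  image in types B and C.\<close>

definition label :: "cartan_type \<Rightarrow> nat \<Rightarrow> int set \<Rightarrow> int set set" where
  "label X n l = (if X = Type_A then {l} else {l, antipode (polygon_size X n) ` l})"

definition variable_labels :: "cartan_type \<Rightarrow> nat \<Rightarrow> int set set set" where
  "variable_labels X n = label X n ` diagonals (polygon_size X n)"

definition edge_labels :: "cartan_type \<Rightarrow> nat \<Rightarrow> int set set set" where
  "edge_labels X n = label X n ` edges (polygon_size X n)"

definition type_r :: "cartan_type \<Rightarrow> nat" where
  "type_r X = (if X = Type_C then 2 else 1)"

definition model_triangulations :: "cartan_type \<Rightarrow> nat \<Rightarrow> int set set set" where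
  "model_triangulations X n =
     {T \<in> triangulations (polygon_size X n).
        X \<noteq> Type_A \<longrightarrow> (`) (antipode (polygon_size X n)) ` T = T}"

definition exchange_relations ::
  "cartan_type \<Rightarrow> nat \<Rightarrow> (int set set \<Rightarrow> 'f::field) \<Rightarrow> bool" where
  "exchange_relations X n x \<longleftrightarrow>
     (let N = polygon_size X n; r = type_r X; opp = antipode N;
          x' = (\<lambda>i j. x (label X n (seg N i j)))
      in if X = Type_A then
           (\<forall>a b c d. ccw N [a, b, c, d] \<longrightarrow>
              x' a c * x' b d = x' a b * x' c d + x' a d * x' b c)
         else
           (\<forall>a b c d. ccw N [a, b, c, d, opp a] \<longrightarrow>
              x' a c * x' b d = x' a b * x' c d + x' a d * x' b c) \<and>
           (\<forall>a b c. ccw N [a, b, c, opp a] \<longrightarrow>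
              x' a c * x' a (opp b) = x' a b * x' a (opp c) + x' a (opp a) ^ (2 div r) * x' b c) \<and>
           (\<forall>a b. b mod N \<noteq> a mod N \<and> b mod N \<noteq> opp a \<longrightarrow>
              x' a (opp a) * x' b (opp b) = x' a b ^ r + x' a (opp b) ^ r))"

definition polygon_model ::
  "cartan_type \<Rightarrow> nat \<Rightarrow> 'f::field seed \<Rightarrow> (int set set \<Rightarrow> 'f) \<Rightarrow> bool" where
  "polygon_model X n S x \<longleftrightarrow>
     bij_betw x (variable_labels X n) (cluster_variables n S) \<and>
     clusters n S = (\<lambda>T. (\<lambda>l. x (label X n l)) ` T) ` model_triangulations X n \<and>
     (\<forall>L\<in>edge_labels X n. x L = 1) \<and>
     exchange_relations X n x"

text \<open>The Groebner cone in the space indexed by \<open>variable_labels\<close> and \<open>edge_labels\<close>, with vanishing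
  coordinates at the latter.\<close>

definition polygon_groebner_cone ::
  "('k::field \<Rightarrow> 'f::field) \<Rightarrow> cartan_type \<Rightarrow> nat \<Rightarrow> 'f seed \<Rightarrow> (int set set \<Rightarrow> 'f)
     \<Rightarrow> (int set set \<Rightarrow> real) set" where
  "polygon_groebner_cone \<iota> X n S x =
     (\<lambda>\<omega> L. if L \<in> variable_labels X n then \<omega> (x L) else 0) ` groebner_cone \<iota> n S"


section \<open>The generating vectors\<close>

definition vec_v :: "cartan_type \<Rightarrow> nat \<Rightarrow> int set \<Rightarrow> int set set \<Rightarrow> real" where
  "vec_v X n l =
     (let N = polygon_size X n
      in - (\<Sum>k\<in>{k \<in> segments N. k \<subseteq> minor_arc N l}. unit_vec (label X n k)))"

definition vec_E :: "cartan_type \<Rightarrow> nat \<Rightarrow> int \<Rightarrow> int set set \<Rightarrow> real" where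
  "vec_E X n i =
     (let N = polygon_size X n
      in if X = Type_A then
           (\<Sum>l\<in>{l \<in> segments N. i mod N \<in> l}. unit_vec (label X n l))
         else
           real (type_r X) *\<^sub>R unit_vec (label X n (seg N i (antipode N i))) +
           (\<Sum>L\<in>{L \<in> label X n ` (segments N - diameters N). i mod N \<in> \<Union> L}. unit_vec L))"

definition vec_E_seg :: "cartan_type \<Rightarrow> nat \<Rightarrow> int set \<Rightarrow> int set set \<Rightarrow> real" where
  "vec_E_seg X n l =
     (let N = polygon_size X n
      in \<Sum>k = 1..len N l div 2. vec_E X n (delta_minus N l + 2 * int k - 1))"

definition vec_v_tilde :: "cartan_type \<Rightarrow> nat \<Rightarrow> int set \<Rightarrow> int set set \<Rightarrow> real" where
  "vec_v_tilde X n l = vec_v X n l + vec_E_seg X n l"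

text \<open>\<open>H(l)\<close>, with the first vertex of the shortest arc of \<open>l\<close> as an additional argument
  \<open>i \<in> first_vertices N l\<close>. For \<open>l\<close> not a diameter, \<open>i\<close> is \<open>delta_minus N l\<close>. The two
  choices for a diameter of odd length give vectors differing by a multiple of the alternating sum
  of all \<open>vec_E X n i\<close>.\<close>

definition vec_H :: "cartan_type \<Rightarrow> nat \<Rightarrow> int \<Rightarrow> int set \<Rightarrow> int set set \<Rightarrow> real" where
  "vec_H X n i l =
     (\<Sum>k<len (polygon_size X n) l. (- 1) ^ k *\<^sub>R vec_E X n (i + int k))"

definition even_generators :: "cartan_type \<Rightarrow> nat \<Rightarrow> (int set set \<Rightarrow> real) set" where
  "even_generators X n =
     (let N = polygon_size X n
      in {vec_v_tilde X n l | l. l \<in> diagonals N \<and> even (len N l) \<and> non_maximal N l})"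

definition odd_generators :: "cartan_type \<Rightarrow> nat \<Rightarrow> (int set set \<Rightarrow> real) set" where
  "odd_generators X n =
     (let N = polygon_size X n
      in {vec_v_tilde X n l + vec_v_tilde X n l' + vec_H X n i m | l l' i m.
            l \<in> segments N \<and> odd (len N l) \<and> non_maximal N l \<and>
            l' \<in> segments N \<and> odd (len N l') \<and> non_maximal N l' \<and>
            odd (delta_plus N l + delta_plus N l') \<and>
            m = seg N (delta_plus N l) (delta_plus N l') \<and> i \<in> first_vertices N m})"

end

theory Submission
  imports Defs
begin

text \<open>For weights \<open>u\<close> and vertices \<open>i\<close>, \<open>j\<close> at distance at least two let
  \<open>c i j = F i j + F (i + 1) (j + 1) - F i (j + 1) - F (i + 1) j\<close>, where \<open>F i j\<close> is the coordinate of
  \<open>u\<close> at the diagonal \<open>[i, j]\<close>, rescaled at diameters. If all \<open>c i j\<close> are positive, then the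
  exchange relations express every product of two incompatible cluster variables by monomials of
  smaller weight, and the relations \<open>x\<^sub>i\<^sub>j x\<^sub>i\<^sub>+\<^sub>1\<^sub>,\<^sub>j\<^sub>+\<^sub>1 = 1 + x\<^sub>i\<^sub>,\<^sub>j\<^sub>+\<^sub>1 x\<^sub>i\<^sub>+\<^sub>1\<^sub>,\<^sub>j\<close>
  show that positivity is also necessary for the incompatible products to be the leading terms.
  Cluster monomials are linearly independent because their leading exponents, in terms of the fan of
  diagonals at one vertex, are distinct. Hence the Groebner cone is given by the inequalities
  \<open>c i j \<ge> 0\<close>.

  If all \<open>c i j\<close> vanish, then \<open>F i j\<close> is proportional to \<open>(-1)\<^sup>i + (-1)\<^sup>j\<close>; this is the lineality
  space. The vectors \<open>v(l)\<close> are dual to the functionals \<open>c\<close>, and the vectors \<open>E\<^sub>i\<close> are annihilated by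
  them and serve to make the coordinates at edges vanish. On the vectors vanishing at edges the
  functionals of odd arcs satisfy an alternating linear relation, so an odd \<open>v(l)\<close> can be
  completed to an element of the cone only in pairs of opposite signs.\<close>

section \<open>Evaluation and weights of polynomials\<close>

text \<open>Two obstacles shape the proof. In types B and C the exchange relations cover only some
  pairs of crossing diagonals. Straightening relations for the others (an ordinary diagonal against
  a diameter, or against both members of an antipodal pair) are derived by multiplying with the
  diameter at one vertex and cancelling it. The factor \<open>kap\<close> at diameters then lets one
  inequality, the Monge condition for \<open>F\<close>, serve all three types. The second obstacle
  is to recover a multiset of pairwise compatible diagonals from its leading exponent. Laurent
  expansions are never computed. Exponents are found recursively with weights growing like powers of
  3, and two multisets with equal exponents are shown to share a diagonal, which is then removed
  from both. Oddness of \<open>n\<close> acts through the evenness of \<open>N\<close>: the signs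
  \<open>(-1) ^ i\<close> become well defined on vertices. This is the common source of the
  lineality vector and of the alternating relation between the functionals.\<close>

definition mono_eval :: "('v \<Rightarrow> 'f::field) \<Rightarrow> ('v \<Rightarrow>\<^sub>0 nat) \<Rightarrow> 'f" where
  "mono_eval x m = (\<Prod>v\<in>Poly_Mapping.keys m. x v ^ Poly_Mapping.lookup m v)"

lemma mono_eval_superset:
  assumes "finite A" "Poly_Mapping.keys m \<subseteq> A"
  shows "mono_eval x m = (\<Prod>v\<in>A. x v ^ Poly_Mapping.lookup m v)"
  unfolding mono_eval_def using assms
  by (intro prod.mono_neutral_left) (auto simp: in_keys_iff)

lemma mono_eval_add: "mono_eval x (m + m') = mono_eval x m * mono_eval x m'"
proof -
  let ?A = "Poly_Mapping.keys m \<union> Poly_Mapping.keys m'"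
  have "Poly_Mapping.keys (m + m') \<subseteq> ?A" by (rule keys_add)
  then show ?thesis
    by (simp add: mono_eval_superset[of ?A] lookup_add power_add prod.distrib)
qed

lemma mono_eval_zero [simp]: "mono_eval x 0 = 1"
  by (simp add: mono_eval_def)

lemma mono_eval_single [simp]: "mono_eval x (Poly_Mapping.single v k) = x v ^ k"
  by (simp add: mono_eval_def)

lemma weight_superset:
  assumes "finite A" "Poly_Mapping.keys m \<subseteq> A"
  shows "weight \<omega> m = (\<Sum>v\<in>A. \<omega> v * real (Poly_Mapping.lookup m v))"
  unfolding weight_def using assms
  by (intro sum.mono_neutral_left) (auto simp: in_keys_iff)

lemma weight_add: "weight \<omega> (m + m') = weight \<omega> m + weight \<omega> m'"
proof -
  let ?A = "Poly_Mapping.keys m \<union> Poly_Mapping.keys m'"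
  have "Poly_Mapping.keys (m + m') \<subseteq> ?A" by (rule keys_add)
  then show ?thesis
    by (simp add: weight_superset[of ?A] lookup_add distrib_left sum.distrib)
qed

lemma weight_zero [simp]: "weight \<omega> 0 = 0"
  by (simp add: weight_def)

lemma weight_single [simp]: "weight \<omega> (Poly_Mapping.single v k) = \<omega> v * real k"
  by (cases "k = 0") (auto simp: weight_def)

lemma nat_keys_add:
  fixes m m' :: "'v \<Rightarrow>\<^sub>0 nat"
  shows "Poly_Mapping.keys (m + m') = Poly_Mapping.keys m \<union> Poly_Mapping.keys m'"
  by (auto simp: in_keys_iff lookup_add)

lemma nat_poly_mapping_add_diff:
  fixes m u :: "'v \<Rightarrow>\<^sub>0 nat"
  assumes "\<And>v. Poly_Mapping.lookup u v \<le> Poly_Mapping.lookup m v"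
  shows "(m - u) + u = m"
  using assms by (intro poly_mapping_eqI) (simp add: lookup_add lookup_minus)

lemma poly_mapping_sum_single:
  "p = (\<Sum>m\<in>Poly_Mapping.keys p. Poly_Mapping.single m (Poly_Mapping.lookup p m))"
  by (rule poly_mapping_eqI)
    (simp add: lookup_sum lookup_single when_def sum.delta in_keys_iff)

lemma keys_sum_subset: "Poly_Mapping.keys (sum b I) \<subseteq> (\<Union>i\<in>I. Poly_Mapping.keys (b i))"
proof (induction I rule: infinite_finite_induct)
  case (insert i I)
  then show ?case using keys_add[of "b i" "sum b I"] by auto
qed auto

lemma keys_diff_subset:
  "Poly_Mapping.keys (p - q :: 'a \<Rightarrow>\<^sub>0 'b::ab_group_add) \<subseteq> Poly_Mapping.keys p \<union> Poly_Mapping.keys q"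
  by (auto simp: in_keys_iff lookup_minus)

lemma polys_in_zero [simp]: "0 \<in> polys_in V"
  by (simp add: polys_in_def)

lemma polys_in_add: "p \<in> polys_in V \<Longrightarrow> q \<in> polys_in V \<Longrightarrow> p + q \<in> polys_in V"
  using keys_add[of p q] by (fastforce simp: polys_in_def)

lemma polys_in_diff:
  "p \<in> polys_in V \<Longrightarrow> q \<in> polys_in V \<Longrightarrow> p - q \<in> polys_in V"
  for p :: "('v, 'k::ab_group_add) mpolynomial"
  using keys_diff_subset[of p q] by (fastforce simp: polys_in_def)

lemma polys_in_sum: "(\<And>i. i \<in> I \<Longrightarrow> f i \<in> polys_in V) \<Longrightarrow> sum f I \<in> polys_in V"
  by (induction I rule: infinite_finite_induct) (auto intro: polys_in_add)

lemma polys_in_single: "Poly_Mapping.keys m \<subseteq> V \<Longrightarrow> Poly_Mapping.single m c \<in> polys_in V"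
  by (auto simp: polys_in_def)

lemma polys_in_mult:
  fixes p q :: "('v, 'k::comm_ring_1) mpolynomial"
  assumes "p \<in> polys_in V" "q \<in> polys_in V" shows "p * q \<in> polys_in V"
  unfolding polys_in_def
proof (intro CollectI ballI)
  fix m assume "m \<in> Poly_Mapping.keys (p * q)"
  then obtain a b where "m = a + b" "a \<in> Poly_Mapping.keys p" "b \<in> Poly_Mapping.keys q"
    using keys_mult[of p q] by auto
  with assms show "Poly_Mapping.keys m \<subseteq> V" by (auto simp: polys_in_def nat_keys_add)
qed

lemma polys_in_one [simp]: "1 \<in> polys_in V"
  by (simp add: polys_in_def)

lemma polys_in_keysD: "p \<in> polys_in V \<Longrightarrow> m \<in> Poly_Mapping.keys p \<Longrightarrow> Poly_Mapping.keys m \<subseteq> V"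
  by (auto simp: polys_in_def)

section \<open>Evaluation as a ring homomorphism\<close>

locale embedded_field =
  fixes \<iota> :: "'k::field_char_0 \<Rightarrow> 'f::field"
  assumes embedding: "field_embedding \<iota>"
begin

lemma emb_add: "\<iota> (a + b) = \<iota> a + \<iota> b" and emb_mult: "\<iota> (a * b) = \<iota> a * \<iota> b"
  and emb_one [simp]: "\<iota> 1 = 1"
  using embedding by (auto simp: field_embedding_def)

lemma emb_zero [simp]: "\<iota> 0 = 0"
  using emb_add[of 0 0] by (metis add.right_neutral add_left_cancel)

lemma emb_of_nat: "\<iota> (of_nat k) = of_nat k"
  by (induction k) (auto simp: emb_add)

lemma emb_numeral: "\<iota> (numeral k) = numeral k"
  using emb_of_nat[of "numeral k"] by simp

lemma poly_eval_superset:
  assumes "finite A" "Poly_Mapping.keys p \<subseteq> A"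
  shows "poly_eval \<iota> x p = (\<Sum>m\<in>A. \<iota> (Poly_Mapping.lookup p m) * mono_eval x m)"
  unfolding poly_eval_def mono_eval_def[symmetric] using assms
  by (intro sum.mono_neutral_left) (auto simp: in_keys_iff)

lemma poly_eval_add: "poly_eval \<iota> x (p + q) = poly_eval \<iota> x p + poly_eval \<iota> x q"
proof -
  let ?A = "Poly_Mapping.keys p \<union> Poly_Mapping.keys q"
  have "Poly_Mapping.keys (p + q) \<subseteq> ?A" by (rule keys_add)
  then show ?thesis
    by (simp add: poly_eval_superset[of ?A] lookup_add emb_add distrib_right sum.distrib)
qed

lemma poly_eval_zero [simp]: "poly_eval \<iota> x 0 = 0"
  by (simp add: poly_eval_def)

lemma poly_eval_single [simp]: "poly_eval \<iota> x (Poly_Mapping.single m c) = \<iota> c * mono_eval x m"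
  using poly_eval_superset[of "{m}" "Poly_Mapping.single m c" x] by simp

lemma poly_eval_sum: "poly_eval \<iota> x (sum f A) = (\<Sum>a\<in>A. poly_eval \<iota> x (f a))"
  by (induction A rule: infinite_finite_induct) (auto simp: poly_eval_add)

lemma poly_eval_diff: "poly_eval \<iota> x (p - q) = poly_eval \<iota> x p - poly_eval \<iota> x q"
  using poly_eval_add[of x "p - q" q] by simp

text \<open>Both factors are split into terms, for which the claim is multiplicativity of
  \<open>\<iota>\<close> together with \<open>mono_eval_add\<close>; cancellations among the terms
  of the product then need no attention.\<close>

lemma poly_eval_mult: "poly_eval \<iota> x (p * q) = poly_eval \<iota> x p * poly_eval \<iota> x q"
proof -
  let ?s = "\<lambda>p m. Poly_Mapping.single m (Poly_Mapping.lookup p m)"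
  have "p * q = (\<Sum>m\<in>Poly_Mapping.keys p. ?s p m) * (\<Sum>m\<in>Poly_Mapping.keys q. ?s q m)"
    using poly_mapping_sum_single[of p] poly_mapping_sum_single[of q] by simp
  also have "\<dots> = (\<Sum>a\<in>Poly_Mapping.keys p. \<Sum>b\<in>Poly_Mapping.keys q.
      Poly_Mapping.single (a + b) (Poly_Mapping.lookup p a * Poly_Mapping.lookup q b))"
    by (simp add: sum_product mult_single)
  finally have "poly_eval \<iota> x (p * q) = (\<Sum>a\<in>Poly_Mapping.keys p. \<Sum>b\<in>Poly_Mapping.keys q.
      (\<iota> (Poly_Mapping.lookup p a) * mono_eval x a) * (\<iota> (Poly_Mapping.lookup q b) * mono_eval x b))"
    by (simp add: poly_eval_sum mono_eval_add emb_mult mult_ac)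
  also have "\<dots> = poly_eval \<iota> x p * poly_eval \<iota> x q"
    by (simp add: sum_product poly_eval_superset[OF finite_keys subset_refl])
  finally show ?thesis .
qed

lemma poly_eval_one [simp]: "poly_eval \<iota> x 1 = 1"
  using poly_eval_single[of x 0 1] by simp

lemma poly_eval_var [simp]: "poly_eval \<iota> x (var v) = x v"
  by (simp add: var_def)

lemma poly_eval_power: "poly_eval \<iota> x (p ^ k) = poly_eval \<iota> x p ^ k"
by (induction k) (simp_all add: poly_eval_mult)

end

section \<open>Initial ideals from straightening relations\<close>

lemma lookup_initial_form:
  "Poly_Mapping.lookup (initial_form \<omega> f) k =
     (if k \<in> Poly_Mapping.keys f \<and> weight \<omega> k = Max (weight \<omega> ` Poly_Mapping.keys f)
      then Poly_Mapping.lookup f k else 0)"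
  unfolding initial_form_def by (simp add: lookup_sum lookup_single when_def sum.delta)

lemma keys_initial_form:
  "Poly_Mapping.keys (initial_form \<omega> f) =
     {m \<in> Poly_Mapping.keys f. weight \<omega> m = Max (weight \<omega> ` Poly_Mapping.keys f)}"
  by (auto simp: in_keys_iff lookup_initial_form split: if_splits)

lemma keys_constant_mult:
  "Poly_Mapping.keys (Poly_Mapping.single 0 c * q) \<subseteq> Poly_Mapping.keys q"
  for q :: "('v, 'k::comm_ring_1) mpolynomial"
  using keys_mult[of "Poly_Mapping.single 0 c" q] by (auto split: if_splits)

lemma ideal_generated_keys:
  assumes "p \<in> ideal_generated V G" "k \<in> Poly_Mapping.keys p"
  obtains g a b where "g \<in> G" "b \<in> Poly_Mapping.keys g" "k = a + b"
proof -
  obtain S q where S: "finite S" "S \<subseteq> G" "p = (\<Sum>g\<in>S. q g * g)"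
    using assms(1) by (auto simp: ideal_generated_def)
  then obtain g where "g \<in> S" "k \<in> Poly_Mapping.keys (q g * g)"
    using assms(2) keys_sum_subset[of "\<lambda>g. q g * g" S] by auto
  then show thesis using keys_mult[of "q g" g] S that by blast
qed

lemma zero_in_ideal_generated [simp]: "0 \<in> ideal_generated V G"
  unfolding ideal_generated_def by (intro CollectI exI[of _ "{}"]) auto

lemma ideal_generated_add:
  assumes "p \<in> ideal_generated V G" "q \<in> ideal_generated V G"
  shows "p + q \<in> ideal_generated V G"
proof -
  obtain S a where S: "finite S" "S \<subseteq> G" "\<forall>g\<in>S. a g \<in> polys_in V" "p = (\<Sum>g\<in>S. a g * g)"
    using assms(1) by (auto simp: ideal_generated_def)
  obtain T b where T: "finite T" "T \<subseteq> G" "\<forall>g\<in>T. b g \<in> polys_in V" "q = (\<Sum>g\<in>T. b g * g)"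
    using assms(2) by (auto simp: ideal_generated_def)
  define c where "c g = (if g \<in> S then a g else 0) + (if g \<in> T then b g else 0)" for g
  have "(\<Sum>g\<in>S \<union> T. (if g \<in> S then a g else 0) * g) = p"
    unfolding S(4) using S(1) T(1) by (intro sum.mono_neutral_cong_right) auto
  moreover have "(\<Sum>g\<in>S \<union> T. (if g \<in> T then b g else 0) * g) = q"
    unfolding T(4) using S(1) T(1) by (intro sum.mono_neutral_cong_right) auto
  ultimately have "p + q = (\<Sum>g\<in>S \<union> T. c g * g)"
    by (simp add: c_def distrib_right sum.distrib)
  moreover have "\<forall>g\<in>S \<union> T. c g \<in> polys_in V"
    using S(3) T(3) by (auto simp: c_def intro: polys_in_add)
  ultimately show ?thesis
    unfolding ideal_generated_def using S T by (intro CollectI exI[of _ "S \<union> T"] exI[of _ c]) auto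
qed

lemma ideal_generated_sum:
  "(\<And>i. i \<in> I \<Longrightarrow> f i \<in> ideal_generated V G) \<Longrightarrow> sum f I \<in> ideal_generated V G"
  by (induction I rule: infinite_finite_induct) (auto intro: ideal_generated_add)

lemma ideal_generated_mult_generator:
  assumes "g \<in> G" "q \<in> polys_in V" shows "q * g \<in> ideal_generated V G"
  unfolding ideal_generated_def using assms
  by (intro CollectI exI[of _ "{g}"] exI[of _ "\<lambda>_. q"]) auto

lemma ideal_generated_mult:
  assumes "p \<in> ideal_generated V G" "r \<in> polys_in V" shows "r * p \<in> ideal_generated V G"
proof -
  obtain S a where S: "finite S" "S \<subseteq> G" "\<forall>g\<in>S. a g \<in> polys_in V" "p = (\<Sum>g\<in>S. a g * g)"
    using assms(1) by (auto simp: ideal_generated_def)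
  have "r * p = (\<Sum>g\<in>S. (r * a g) * g)" by (simp add: S(4) sum_distrib_left mult.assoc)
  then show ?thesis
    using S assms(2) by (auto intro!: ideal_generated_sum ideal_generated_mult_generator polys_in_mult)
qed

lemma ideal_generated_subset:
  assumes "G \<subseteq> ideal_generated V H" shows "ideal_generated V G \<subseteq> ideal_generated V H"
proof
  fix p assume "p \<in> ideal_generated V G"
  then obtain S a where S: "finite S" "S \<subseteq> G" "\<forall>g\<in>S. a g \<in> polys_in V" "p = (\<Sum>g\<in>S. a g * g)"
    by (auto simp: ideal_generated_def)
  show "p \<in> ideal_generated V H"
    unfolding S(4) using S assms by (intro ideal_generated_sum ideal_generated_mult) auto
qed

section \<open>The incompatibility ideal as a monomial ideal\<close>

lemma var_mult_var:
  "var v * var w = Poly_Mapping.single (Poly_Mapping.single v 1 + Poly_Mapping.single w 1) (1::'k::comm_ring_1)"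
  by (simp add: var_def mult_single)

text \<open>Compatibility is required pairwise instead of asking for one common cluster. The ideal
  to be compared with is generated by products of two variables, so a monomial avoids it exactly
  when no two of its variables are incompatible.\<close>

definition compatible_monomial :: "('v \<Rightarrow> 'v \<Rightarrow> bool) \<Rightarrow> ('v \<Rightarrow>\<^sub>0 nat) \<Rightarrow> bool" where
  "compatible_monomial cmp m \<longleftrightarrow> (\<forall>v\<in>Poly_Mapping.keys m. \<forall>w\<in>Poly_Mapping.keys m. cmp v w)"

locale straightening = embedded_field \<iota> for \<iota> :: "'k::field_char_0 \<Rightarrow> 'f::field" +
  fixes V :: "'f set" and cmp :: "'f \<Rightarrow> 'f \<Rightarrow> bool"
  assumes cmp_refl: "v \<in> V \<Longrightarrow> cmp v v"
begin

definition relations :: "('f, 'k) mpolynomial set" where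
  "relations = {p \<in> polys_in V. poly_eval \<iota> (\<lambda>v. v) p = 0}"

definition incompatibles :: "('f, 'k) mpolynomial set" where
  "incompatibles = {var v * var w | v w. v \<in> V \<and> w \<in> V \<and> \<not> cmp v w}"

text \<open>The generators are monomials, so every monomial of an element of the ideal is a multiple
  of a generator and inherits its incompatible pair.\<close>

lemma incompatible_ideal_keys:
  assumes "p \<in> ideal_generated V incompatibles" "k \<in> Poly_Mapping.keys p"
  shows "\<not> compatible_monomial cmp k"
proof -
  obtain g a b where *: "g \<in> incompatibles" "b \<in> Poly_Mapping.keys g" "k = a + b"
    using ideal_generated_keys[OF assms] .
  then obtain v w where "\<not> cmp v w" "b = Poly_Mapping.single v 1 + Poly_Mapping.single w 1"
    by (auto simp: incompatibles_def var_mult_var)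
  then show ?thesis using *(3) by (auto simp: compatible_monomial_def nat_keys_add)
qed

text \<open>Reflexivity of \<open>cmp\<close> makes the two incompatible variables distinct;
  otherwise their product would be a square, which need not divide the monomial.\<close>

lemma incompatible_monomial_split:
  assumes "Poly_Mapping.keys k \<subseteq> V" "\<not> compatible_monomial cmp k"
  obtains v w k' where "v \<in> V" "w \<in> V" "\<not> cmp v w"
    "k = k' + (Poly_Mapping.single v 1 + Poly_Mapping.single w 1)" "Poly_Mapping.keys k' \<subseteq> V"
proof -
  obtain v w where vw: "v \<in> Poly_Mapping.keys k" "w \<in> Poly_Mapping.keys k" "\<not> cmp v w"
    using assms(2) by (auto simp: compatible_monomial_def)
  then have "v \<noteq> w" using cmp_refl assms(1) by blast
  let ?u = "Poly_Mapping.single v (1::nat) + Poly_Mapping.single w 1"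
  have "Poly_Mapping.lookup ?u x \<le> Poly_Mapping.lookup k x" for x
    using vw \<open>v \<noteq> w\<close> by (auto simp: lookup_add lookup_single when_def in_keys_iff Suc_le_eq)
  then have "(k - ?u) + ?u = k" by (rule nat_poly_mapping_add_diff)
  moreover have "Poly_Mapping.keys (k - ?u) \<subseteq> Poly_Mapping.keys k"
    by (auto simp: in_keys_iff lookup_minus)
  ultimately show thesis using vw assms(1) by (intro that[of v w "k - ?u"]) auto
qed

lemma incompatible_monomial_in_ideal:
  assumes "Poly_Mapping.keys k \<subseteq> V" "\<not> compatible_monomial cmp k"
  shows "Poly_Mapping.single k c \<in> ideal_generated V incompatibles"
proof -
  obtain v w k' where k: "v \<in> V" "w \<in> V" "\<not> cmp v w"
    "k = k' + (Poly_Mapping.single v 1 + Poly_Mapping.single w 1)" "Poly_Mapping.keys k' \<subseteq> V"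
    using incompatible_monomial_split[OF assms] .
  have "Poly_Mapping.single k c = Poly_Mapping.single k' c * (var v * var w)"
    unfolding var_mult_var by (simp add: mult_single k(4))
  then show ?thesis
    using k by (auto intro!: ideal_generated_mult_generator polys_in_single simp: incompatibles_def)
qed

text \<open>The initial form of the relation \<open>v * w - 1 - M\<close> lies in a monomial ideal
  all of whose monomials are incompatible. Since 1 and \<open>M\<close> are compatible, neither
  attains the maximal weight, so the product must lie strictly above \<open>M\<close>.\<close>

lemma strict_weight:
  assumes eq: "initial_ideal V \<omega> relations = ideal_generated V incompatibles"
    and vw: "v \<in> V" "w \<in> V" "\<not> cmp v w"
    and M: "Poly_Mapping.keys M \<subseteq> V" "compatible_monomial cmp M" "v * w = 1 + mono_eval (\<lambda>v. v) M"
  shows "weight \<omega> M < \<omega> v + \<omega> w"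
proof (rule ccontr)
  assume neg: "\<not> ?thesis"
  let ?u = "Poly_Mapping.single v (1::nat) + Poly_Mapping.single w 1"
  define g :: "('f, 'k) mpolynomial"
    where "g = var v * var w - 1 - Poly_Mapping.single M 1"
  have u: "\<not> compatible_monomial cmp ?u"
    using vw(3) by (auto simp: compatible_monomial_def nat_keys_add)
  have c0: "compatible_monomial cmp 0" by (simp add: compatible_monomial_def)
  have ne: "?u \<noteq> M" "?u \<noteq> 0" using u M(2) c0 by metis+
  have g: "g = Poly_Mapping.single ?u 1 - 1 - Poly_Mapping.single M 1"
    by (simp add: g_def var_mult_var)
  have "poly_eval \<iota> (\<lambda>v. v) g = 0"
    unfolding g using M(3) by (simp add: poly_eval_diff mono_eval_add)
  moreover have "g \<in> polys_in V"
    unfolding g using vw M by (intro polys_in_diff polys_in_single) (auto simp: nat_keys_add)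
  ultimately have "g \<in> relations" by (simp add: relations_def)
  then have "initial_form \<omega> g \<in> initial_ideal V \<omega> relations"
    unfolding initial_ideal_def
    using ideal_generated_mult_generator[of "initial_form \<omega> g" "initial_form \<omega> ` relations" 1 V]
    by (auto simp: polys_in_def)
  then have *: "\<not> compatible_monomial cmp k" if "k \<in> Poly_Mapping.keys (initial_form \<omega> g)" for k
    using that eq incompatible_ideal_keys by blast
  have keysM: "M \<in> Poly_Mapping.keys g"
    using ne by (auto simp: g in_keys_iff lookup_minus lookup_single lookup_one when_def)
  have keys0: "0 \<in> Poly_Mapping.keys g"
    using ne by (auto simp: g in_keys_iff lookup_minus lookup_single lookup_one when_def)
  have keys: "Poly_Mapping.keys g \<subseteq> {?u, 0, M}"
    by (auto simp: g in_keys_iff lookup_minus lookup_single lookup_one when_def split: if_splits)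
  let ?W = "Max (weight \<omega> ` Poly_Mapping.keys g)"
  have "?W \<in> weight \<omega> ` Poly_Mapping.keys g" using keysM by (intro Max_in) auto
  then obtain k where k: "k \<in> Poly_Mapping.keys g" "weight \<omega> k = ?W" by auto
  \<comment> \<open>If the maximum is attained at the product, \<open>neg\<close> makes
    \<open>M\<close> attain it as well; so in every case 1 or \<open>M\<close> occurs in the initial
    form.\<close>
  have "?W \<ge> weight \<omega> M" using keysM by simp
  then have "?W = weight \<omega> M \<or> k \<noteq> ?u"
    using neg k(2) by (auto simp: weight_add)
  then have "weight \<omega> M = ?W \<or> k \<in> {0, M}" using keys k(1) by auto
  then obtain k' where "k' \<in> {0, M}" "k' \<in> Poly_Mapping.keys g" "weight \<omega> k' = ?W"
    using k keysM by (metis insertCI)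
  then show False using * c0 M(2) by (auto simp: keys_initial_form)
qed

end

text \<open>One polynomial \<open>R\<close> has to satisfy the bound for all weights of
  \<open>Str\<close> simultaneously: termination of the rewriting is measured by
  \<open>\<omega>0\<close>, while the resulting inequalities are wanted for an arbitrary weight of
  \<open>Str\<close>.\<close>

locale straightening_basis = straightening \<iota> V cmp
  for \<iota> :: "'k::field_char_0 \<Rightarrow> 'f::field" and V cmp +
  fixes Str :: "('f \<Rightarrow> real) set" and \<omega>0 :: "'f \<Rightarrow> real" and h :: "'f \<Rightarrow> nat"
  assumes straighten: "v \<in> V \<Longrightarrow> w \<in> V \<Longrightarrow> \<not> cmp v w \<Longrightarrow>
      \<exists>R\<in>polys_in V. poly_eval \<iota> (\<lambda>v. v) R = v * w \<and>
        (\<forall>\<omega>\<in>Str. \<forall>m\<in>Poly_Mapping.keys R. weight \<omega> m < \<omega> v + \<omega> w)"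
    and independent: "p \<in> polys_in V \<Longrightarrow> (\<And>m. m \<in> Poly_Mapping.keys p \<Longrightarrow> compatible_monomial cmp m)
      \<Longrightarrow> poly_eval \<iota> (\<lambda>v. v) p = 0 \<Longrightarrow> p = 0"
    and \<omega>0: "\<omega>0 \<in> Str" "\<And>v. v \<in> V \<Longrightarrow> \<omega>0 v = real (h v)"
begin

section \<open>Normal forms and the initial ideal\<close>

definition bounded_by :: "('f \<Rightarrow>\<^sub>0 nat) \<Rightarrow> ('f, 'k) mpolynomial \<Rightarrow> bool" where
  "bounded_by m r \<longleftrightarrow> (\<forall>\<omega>\<in>Str. \<forall>k\<in>Poly_Mapping.keys r. weight \<omega> k \<le> weight \<omega> m)"

definition strictly_bounded_by :: "('f \<Rightarrow>\<^sub>0 nat) \<Rightarrow> ('f, 'k) mpolynomial \<Rightarrow> bool" where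
  "strictly_bounded_by m r \<longleftrightarrow> (\<forall>\<omega>\<in>Str. \<forall>k\<in>Poly_Mapping.keys r. weight \<omega> k < weight \<omega> m)"

text \<open>Rewriting terminates because each step lowers the natural number given by the weight \<open>\<omega>0\<close>.\<close>

lemma normal_form:
  assumes "Poly_Mapping.keys m \<subseteq> V"
  shows "\<exists>r\<in>polys_in V. (\<forall>k\<in>Poly_Mapping.keys r. compatible_monomial cmp k) \<and>
    poly_eval \<iota> (\<lambda>v. v) r = mono_eval (\<lambda>v. v) m \<and> bounded_by m r \<and>
    (\<not> compatible_monomial cmp m \<longrightarrow> strictly_bounded_by m r)"
proof -
  define H where "H m = (\<Sum>v\<in>Poly_Mapping.keys m. h v * Poly_Mapping.lookup m v)" for m
  have H: "weight \<omega>0 k = real (H k)" if "Poly_Mapping.keys k \<subseteq> V" for k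
    unfolding weight_def H_def of_nat_sum using that by (intro sum.cong) (auto simp: \<omega>0)
  show ?thesis using assms
  proof (induction "H m" arbitrary: m rule: less_induct)
    case less
    show ?case
    proof (cases "compatible_monomial cmp m")
      case True
      then show ?thesis using less.prems
        by (intro bexI[of _ "Poly_Mapping.single m 1"]) (auto simp: bounded_by_def intro: polys_in_single)
    next
      case False
      obtain v w m' where m: "v \<in> V" "w \<in> V" "\<not> cmp v w"
        "m = m' + (Poly_Mapping.single v 1 + Poly_Mapping.single w 1)" "Poly_Mapping.keys m' \<subseteq> V"
        using incompatible_monomial_split[OF less.prems False] .
      obtain R where R: "R \<in> polys_in V" "poly_eval \<iota> (\<lambda>v. v) R = v * w"
        "\<And>\<omega> k. \<omega> \<in> Str \<Longrightarrow> k \<in> Poly_Mapping.keys R \<Longrightarrow> weight \<omega> k < \<omega> v + \<omega> w"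
        using straighten[OF m(1-3)] by blast
      have lt: "weight \<omega> (m' + k) < weight \<omega> m" if "\<omega> \<in> Str" "k \<in> Poly_Mapping.keys R" for \<omega> k
        using R(3)[OF that] by (simp add: m(4) weight_add)
      have kV: "Poly_Mapping.keys (m' + k) \<subseteq> V" if "k \<in> Poly_Mapping.keys R" for k
        using m(5) R(1) that by (auto simp: nat_keys_add polys_in_def)
      have "\<exists>r\<in>polys_in V. (\<forall>l\<in>Poly_Mapping.keys r. compatible_monomial cmp l) \<and>
        poly_eval \<iota> (\<lambda>v. v) r = mono_eval (\<lambda>v. v) (m' + k) \<and> bounded_by (m' + k) r"
        if k: "k \<in> Poly_Mapping.keys R" for k
      proof -
        have "H (m' + k) < H m"
          using lt[OF \<omega>0(1) k] H[OF kV[OF k]] H[OF less.prems] by simp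
        then show ?thesis using less.hyps[OF _ kV[OF k]] by blast
      qed
      then obtain r where r: "\<And>k. k \<in> Poly_Mapping.keys R \<Longrightarrow> r k \<in> polys_in V"
        "\<And>k l. k \<in> Poly_Mapping.keys R \<Longrightarrow> l \<in> Poly_Mapping.keys (r k) \<Longrightarrow> compatible_monomial cmp l"
        "\<And>k. k \<in> Poly_Mapping.keys R \<Longrightarrow> poly_eval \<iota> (\<lambda>v. v) (r k) = mono_eval (\<lambda>v. v) (m' + k)"
        "\<And>k. k \<in> Poly_Mapping.keys R \<Longrightarrow> bounded_by (m' + k) (r k)"
        by metis
      \<comment> \<open>The normal forms of the monomials \<open>m' + k\<close> are substituted into
        \<open>R\<close>; coefficients of \<open>R\<close> enter as constant polynomials.\<close>
      define s where "s = (\<Sum>k\<in>Poly_Mapping.keys R. Poly_Mapping.single 0 (Poly_Mapping.lookup R k) * r k)"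
      have keys_s: "\<exists>k\<in>Poly_Mapping.keys R. l \<in> Poly_Mapping.keys (r k)" if l: "l \<in> Poly_Mapping.keys s" for l
      proof -
        obtain k where k: "k \<in> Poly_Mapping.keys R"
          "l \<in> Poly_Mapping.keys (Poly_Mapping.single 0 (Poly_Mapping.lookup R k) * r k)"
          using l keys_sum_subset unfolding s_def by fast
        then show ?thesis using keys_constant_mult by blast
      qed
      have "poly_eval \<iota> (\<lambda>v. v) s = (\<Sum>k\<in>Poly_Mapping.keys R. \<iota> (Poly_Mapping.lookup R k) * mono_eval (\<lambda>v. v) (m' + k))"
        unfolding s_def poly_eval_sum by (intro sum.cong) (auto simp: poly_eval_mult r(3))
      also have "\<dots> = mono_eval (\<lambda>v. v) m' * poly_eval \<iota> (\<lambda>v. v) R"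
        by (simp add: poly_eval_superset[OF finite_keys subset_refl] mono_eval_add sum_distrib_left mult_ac)
      also have "\<dots> = mono_eval (\<lambda>v. v) m" by (simp add: R(2) m(4) mono_eval_add)
      finally have ev: "poly_eval \<iota> (\<lambda>v. v) s = mono_eval (\<lambda>v. v) m" .
      have "s \<in> polys_in V" unfolding s_def
        using r(1) by (intro polys_in_sum polys_in_mult polys_in_single) auto
      moreover have sb: "strictly_bounded_by m s"
        unfolding strictly_bounded_by_def
        using keys_s r(4) lt by (force simp: bounded_by_def)
      moreover have "bounded_by m s" using sb by (force simp: bounded_by_def strictly_bounded_by_def)
      ultimately show ?thesis using ev keys_s r(2) by blast
    qed
  qed
qed

text \<open>All monomials of \<open>f\<close> are replaced by normal forms, except that compatible
  monomials of maximal weight are left alone. The result is a combination of compatible monomials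
  with value zero, hence zero. Everything that was replaced stays below the maximal weight, so the
  monomials left alone cannot cancel. Thus there are none, and the initial form consists of
  incompatible monomials.\<close>

lemma initial_form_in_ideal:
  assumes f: "f \<in> relations" and \<omega>: "\<omega> \<in> Str"
  shows "initial_form \<omega> f \<in> ideal_generated V incompatibles"
proof -
  let ?W = "Max (weight \<omega> ` Poly_Mapping.keys f)"
  let ?L = "Poly_Mapping.lookup f"
  have fV: "Poly_Mapping.keys m \<subseteq> V" if "m \<in> Poly_Mapping.keys f" for m
    using f that by (auto simp: relations_def polys_in_def)
  define P where "P m r \<longleftrightarrow> r \<in> polys_in V \<and>
    (\<forall>l\<in>Poly_Mapping.keys r. compatible_monomial cmp l) \<and>
    poly_eval \<iota> (\<lambda>v. v) r = mono_eval (\<lambda>v. v) m \<and> bounded_by m r \<and>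
    (\<not> compatible_monomial cmp m \<longrightarrow> strictly_bounded_by m r)" for m r
  have "\<exists>r. \<forall>m\<in>Poly_Mapping.keys f. P m (r m)"
    using normal_form[OF fV] by (intro bchoice) (auto simp: P_def)
  then obtain r where P: "\<And>m. m \<in> Poly_Mapping.keys f \<Longrightarrow> P m (r m)" by blast
  have r: "\<And>m. m \<in> Poly_Mapping.keys f \<Longrightarrow> r m \<in> polys_in V"
    "\<And>m l. m \<in> Poly_Mapping.keys f \<Longrightarrow> l \<in> Poly_Mapping.keys (r m) \<Longrightarrow> compatible_monomial cmp l"
    "\<And>m. m \<in> Poly_Mapping.keys f \<Longrightarrow> poly_eval \<iota> (\<lambda>v. v) (r m) = mono_eval (\<lambda>v. v) m"
    "\<And>m. m \<in> Poly_Mapping.keys f \<Longrightarrow> bounded_by m (r m)"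
    "\<And>m. m \<in> Poly_Mapping.keys f \<Longrightarrow> \<not> compatible_monomial cmp m \<Longrightarrow> strictly_bounded_by m (r m)"
    using P by (auto simp: P_def)
  define top where "top m \<longleftrightarrow> compatible_monomial cmp m \<and> weight \<omega> m = ?W" for m
  define r' where "r' m = (if top m then Poly_Mapping.single m 1 else r m)" for m
  have r': "r' m \<in> polys_in V"
    "\<And>l. l \<in> Poly_Mapping.keys (r' m) \<Longrightarrow> compatible_monomial cmp l"
    "poly_eval \<iota> (\<lambda>v. v) (r' m) = mono_eval (\<lambda>v. v) m" if "m \<in> Poly_Mapping.keys f" for m
    using r(1-3)[OF that] fV[OF that] by (auto simp: r'_def top_def polys_in_single split: if_splits)
  define s where "s = (\<Sum>m\<in>Poly_Mapping.keys f. Poly_Mapping.single 0 (?L m) * r' m)"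
  have "poly_eval \<iota> (\<lambda>v. v) s = (\<Sum>m\<in>Poly_Mapping.keys f. \<iota> (?L m) * mono_eval (\<lambda>v. v) m)"
    unfolding s_def poly_eval_sum by (intro sum.cong) (auto simp: poly_eval_mult r'(3))
  also have "\<dots> = 0"
    using f by (simp add: relations_def poly_eval_superset[OF finite_keys subset_refl])
  finally have "poly_eval \<iota> (\<lambda>v. v) s = 0" .
  moreover have "s \<in> polys_in V" unfolding s_def
    using r'(1) by (intro polys_in_sum polys_in_mult polys_in_single) auto
  moreover have "compatible_monomial cmp l" if l: "l \<in> Poly_Mapping.keys s" for l
  proof -
    obtain m where "m \<in> Poly_Mapping.keys f" "l \<in> Poly_Mapping.keys (Poly_Mapping.single 0 (?L m) * r' m)"
      using l keys_sum_subset unfolding s_def by fast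
    then show ?thesis using r'(2) keys_constant_mult by blast
  qed
  ultimately have s0: "s = 0" by (intro independent) auto
  have no_top: "\<not> top k" if k: "k \<in> Poly_Mapping.keys f" for k
  proof
    assume tk: "top k"
    have "Poly_Mapping.lookup (Poly_Mapping.single 0 (?L m) * r' m) k = (if m = k then ?L k else 0)"
      if m: "m \<in> Poly_Mapping.keys f" for m
    proof (cases "top m")
      case True
      then show ?thesis by (auto simp: r'_def mult_single lookup_single when_def)
    next
      case False
      then have "m \<noteq> k" using tk by auto
      have "weight \<omega> m \<le> ?W" using m by simp
      have "k \<notin> Poly_Mapping.keys (r m)"
      proof
        assume "k \<in> Poly_Mapping.keys (r m)"
        \<comment> \<open>A compatible \<open>m\<close> that is not top already has smaller weight;
          an incompatible \<open>m\<close> has a strictly lighter normal form.\<close>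
        then have "weight \<omega> k < ?W"
          using False r(4)[OF m] r(5)[OF m] \<omega> \<open>weight \<omega> m \<le> ?W\<close>
          unfolding top_def bounded_by_def strictly_bounded_by_def by force
        then show False using tk by (simp add: top_def)
      qed
      then have "k \<notin> Poly_Mapping.keys (Poly_Mapping.single 0 (?L m) * r' m)"
        using keys_constant_mult False unfolding r'_def by auto
      then show ?thesis using \<open>m \<noteq> k\<close> by (simp add: in_keys_iff)
    qed
    then have "Poly_Mapping.lookup s k = ?L k"
      using k by (simp add: s_def lookup_sum)
    then show False using s0 k by (simp add: in_keys_iff)
  qed
  show ?thesis unfolding initial_form_def
    using no_top fV by (intro ideal_generated_sum incompatible_monomial_in_ideal) (auto simp: top_def)
qed

text \<open>The straightening relation of a pair has the product as its initial form, because all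
  other terms are strictly lighter.\<close>

lemma incompatibles_initial:
  assumes \<omega>: "\<omega> \<in> Str"
  shows "incompatibles \<subseteq> initial_form \<omega> ` relations"
proof
  fix g assume "g \<in> incompatibles"
  then obtain v w where vw: "v \<in> V" "w \<in> V" "\<not> cmp v w" "g = var v * var w"
    by (auto simp: incompatibles_def)
  obtain R where R: "R \<in> polys_in V" "poly_eval \<iota> (\<lambda>v. v) R = v * w"
    "\<And>k. k \<in> Poly_Mapping.keys R \<Longrightarrow> weight \<omega> k < \<omega> v + \<omega> w"
    using straighten[OF vw(1-3)] \<omega> by blast
  define u where "u = Poly_Mapping.single v (1::nat) + Poly_Mapping.single w 1"
  let ?f = "Poly_Mapping.single u 1 - R"
  have wu: "weight \<omega> u = \<omega> v + \<omega> w" by (simp add: u_def weight_add)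
  then have uR: "Poly_Mapping.lookup R u = 0" using R(3)[of u] by (auto simp: in_keys_iff)
  have "?f \<in> relations"
    using vw R by (auto simp: relations_def u_def poly_eval_diff mono_eval_add nat_keys_add
        intro!: polys_in_diff polys_in_single)
  moreover have g: "g = Poly_Mapping.single u 1"
    unfolding vw(4) u_def by (rule var_mult_var)
  have "initial_form \<omega> ?f = g"
  proof (rule poly_mapping_eqI)
    fix k
    have ku: "u \<in> Poly_Mapping.keys ?f" using uR by (simp add: in_keys_iff lookup_minus)
    have keys: "k = u \<or> weight \<omega> k < \<omega> v + \<omega> w" if "k \<in> Poly_Mapping.keys ?f" for k
      using that R(3)[of k] by (auto simp: in_keys_iff lookup_minus lookup_single when_def split: if_splits)
    have le: "weight \<omega> k \<le> weight \<omega> u" if "k \<in> Poly_Mapping.keys ?f" for k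
      using keys[OF that] wu by auto
    have "Max (weight \<omega> ` Poly_Mapping.keys ?f) = weight \<omega> u"
    proof (rule Max_eqI)
      fix y assume "y \<in> weight \<omega> ` Poly_Mapping.keys ?f"
      then show "y \<le> weight \<omega> u" using le by (elim imageE) simp
    qed (use ku in \<open>auto intro: imageI\<close>)
    then show "Poly_Mapping.lookup (initial_form \<omega> ?f) k = Poly_Mapping.lookup g k"
      using ku uR keys[of k] wu
      by (auto simp: lookup_initial_form g lookup_minus lookup_single when_def)
  qed
  ultimately show "g \<in> initial_form \<omega> ` relations" by blast
qed

theorem initial_ideal_eq:
  assumes "\<omega> \<in> Str"
  shows "initial_ideal V \<omega> relations = ideal_generated V incompatibles"
proof
  show "initial_ideal V \<omega> relations \<subseteq> ideal_generated V incompatibles"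
    unfolding initial_ideal_def using initial_form_in_ideal assms by (intro ideal_generated_subset) auto
  show "ideal_generated V incompatibles \<subseteq> initial_ideal V \<omega> relations"
    unfolding initial_ideal_def
  proof (intro ideal_generated_subset subsetI)
    fix g assume "g \<in> incompatibles"
    then have "1 * g \<in> ideal_generated V (initial_form \<omega> ` relations)"
      using incompatibles_initial[OF assms]
      by (intro ideal_generated_mult_generator) (auto simp: polys_in_def)
    then show "g \<in> ideal_generated V (initial_form \<omega> ` relations)" by simp
  qed
qed

end

section \<open>Algebraic independence of clusters\<close>

definition alg_independent :: "('k::field \<Rightarrow> 'f::field) \<Rightarrow> 'i set \<Rightarrow> ('i \<Rightarrow> 'f) \<Rightarrow> bool" where
  "alg_independent \<iota> I y \<longleftrightarrow> (\<forall>p\<in>polys_in I. poly_eval \<iota> y p = 0 \<longrightarrow> p = 0)"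

lemma mono_eval_cong:
  "(\<And>v. v \<in> Poly_Mapping.keys m \<Longrightarrow> x v = y v) \<Longrightarrow> mono_eval x m = mono_eval y m"
  by (simp add: mono_eval_def cong: prod.cong)

definition delete_var :: "'i \<Rightarrow> ('i \<Rightarrow>\<^sub>0 nat) \<Rightarrow> ('i \<Rightarrow>\<^sub>0 nat)" where
  "delete_var k m = m - Poly_Mapping.single k (Poly_Mapping.lookup m k)"

lemma delete_var_split: "m = delete_var k m + Poly_Mapping.single k (Poly_Mapping.lookup m k)"
  unfolding delete_var_def
  by (rule nat_poly_mapping_add_diff[symmetric]) (simp add: lookup_single when_def)

lemma keys_delete_var: "Poly_Mapping.keys (delete_var k m) = Poly_Mapping.keys m - {k}"
  by (auto simp: delete_var_def in_keys_iff lookup_minus lookup_single when_def split: if_splits)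

context embedded_field
begin

lemma alg_independent_nonzero:
  assumes "alg_independent \<iota> I y" "i \<in> I" shows "y i \<noteq> 0"
proof
  assume "y i = 0"
  then have "poly_eval \<iota> y (var i) = 0" by simp
  moreover have "var i \<in> (polys_in I :: ('a, 'k) mpolynomial set)"
    using assms(2) by (auto simp: var_def intro: polys_in_single)
  ultimately have "(var i :: ('a, 'k) mpolynomial) = 0"
    using assms(1) by (auto simp: alg_independent_def)
  then have "Poly_Mapping.lookup (var i :: ('a, 'k) mpolynomial) (Poly_Mapping.single i 1) = 0" by simp
  then show False by (simp add: var_def)
qed

text \<open>The coefficients avoid \<open>k\<close>, so attaching the exponent \<open>j\<close> to
  the terms of \<open>P j\<close> yields distinct monomials for distinct \<open>j\<close>. The
  combined polynomial therefore vanishes only if every \<open>P j\<close> does.\<close>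

lemma independent_coefficients:
  assumes indep: "alg_independent \<iota> I y" and k: "k \<in> I"
    and P: "\<And>j. j \<le> D \<Longrightarrow> P j \<in> polys_in (I - {k})"
    and zero: "(\<Sum>j\<le>D. poly_eval \<iota> y (P j) * y k ^ j) = 0" and i: "i \<le> D"
  shows "P i = 0"
proof (rule poly_mapping_eqI)
  fix m
  let ?s = "\<lambda>j. Poly_Mapping.single k (j::nat)"
  have kP: "Poly_Mapping.lookup a k = 0" if "a \<in> Poly_Mapping.keys (P j)" "j \<le> D" for a j
    using polys_in_keysD[OF P[OF that(2)] that(1)] by (auto simp: in_keys_iff)
  define p where "p = (\<Sum>j\<le>D. \<Sum>a\<in>Poly_Mapping.keys (P j).
      Poly_Mapping.single (a + ?s j) (Poly_Mapping.lookup (P j) a))"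
  have "poly_eval \<iota> y p = (\<Sum>j\<le>D. poly_eval \<iota> y (P j) * y k ^ j)"
    unfolding p_def poly_eval_sum poly_eval_superset[OF finite_keys subset_refl, of y "P _"]
    by (simp add: mono_eval_add sum_distrib_right sum_distrib_left mult_ac)
  moreover have "p \<in> polys_in I"
    unfolding p_def using P k
    by (intro polys_in_sum polys_in_single) (fastforce simp: nat_keys_add polys_in_def split: if_splits)
  ultimately have p0: "p = 0" using indep zero by (simp add: alg_independent_def)
  show "Poly_Mapping.lookup (P i) m = Poly_Mapping.lookup 0 m"
  proof (cases "m \<in> Poly_Mapping.keys (P i)")
    case True
    have eq: "a + ?s j = m + ?s i \<longleftrightarrow> j = i \<and> a = m" if "a \<in> Poly_Mapping.keys (P j)" "j \<le> D" for a j
    proof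
      assume *: "a + ?s j = m + ?s i"
      then have "Poly_Mapping.lookup (a + ?s j) k = Poly_Mapping.lookup (m + ?s i) k" by simp
      then have "j = i" using kP[OF that] kP[OF True i] by (simp add: lookup_add)
      then show "j = i \<and> a = m" using * by simp
    qed auto
    have "Poly_Mapping.lookup p (m + ?s i) = (\<Sum>j\<le>D. \<Sum>a\<in>Poly_Mapping.keys (P j).
      (if j = i \<and> a = m then Poly_Mapping.lookup (P j) a else 0))"
      unfolding p_def lookup_sum by (intro sum.cong refl) (simp add: lookup_single when_def eq)
    also have "\<dots> = (\<Sum>j\<le>D. if j = i then Poly_Mapping.lookup (P i) m else 0)"
      using True by (intro sum.cong refl) (auto simp: sum.delta)
    also have "\<dots> = Poly_Mapping.lookup (P i) m" using i by (simp add: sum.delta)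
    finally show ?thesis using p0 by simp
  qed (simp add: in_keys_iff)
qed

text \<open>A relation for the new family is multiplied by \<open>y k ^ D\<close>. A term with
  exponent \<open>a\<close> at \<open>k\<close> becomes \<open>?c ^ a * y k ^ (D - a)\<close> times
  a part free of \<open>k\<close>, so the powers of \<open>y k\<close> separate the exponents
  \<open>a\<close>, and the factors \<open>?c\<close> cancel since \<open>?c\<close> is
  nonzero.\<close>

lemma alg_independent_exchange:
  assumes indep: "alg_independent \<iota> I y" and k: "k \<in> I"
    and C: "C \<in> polys_in (I - {k})" "C \<noteq> 0"
  shows "alg_independent \<iota> I (y(k := poly_eval \<iota> y C / y k))"
  unfolding alg_independent_def
proof (intro ballI impI)
  let ?y = "y(k := poly_eval \<iota> y C / y k)" and ?c = "poly_eval \<iota> y C"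
  fix p assume p: "p \<in> polys_in I" "poly_eval \<iota> ?y p = 0"
  define D where "D = Max ((\<lambda>m. Poly_Mapping.lookup m k) ` Poly_Mapping.keys p)"
  have D: "Poly_Mapping.lookup m k \<le> D" if "m \<in> Poly_Mapping.keys p" for m
    using that by (simp add: D_def)
  \<comment> \<open>Terms are grouped by the power \<open>i\<close> of \<open>y k\<close> that
    remains after clearing denominators; \<open>Q i\<close> collects their parts free of
    \<open>k\<close>.\<close>
  define K where "K i = {m \<in> Poly_Mapping.keys p. Poly_Mapping.lookup m k + i = D}" for i
  define Q where "Q i = (\<Sum>m\<in>K i. Poly_Mapping.single (delete_var k m) (Poly_Mapping.lookup p m))" for i
  define P where "P i = Q i * C ^ (D - i)" for i
  have yk: "y k \<noteq> 0" using alg_independent_nonzero[OF indep k] .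
  have I: "polys_in (I - {k}) \<subseteq> polys_in I" by (auto simp: polys_in_def)
  have c: "?c \<noteq> 0" using indep C I by (auto simp: alg_independent_def)
  have Q: "Q i \<in> polys_in (I - {k})" for i
    unfolding Q_def using p(1) by (intro polys_in_sum polys_in_single)
      (auto simp: K_def keys_delete_var polys_in_def)
  have "C ^ j \<in> polys_in (I - {k})" for j
    using C(1) by (induction j) (auto intro: polys_in_mult)
  then have P: "P i \<in> polys_in (I - {k})" for i
    using Q by (auto simp: P_def intro: polys_in_mult)
  have mono: "mono_eval ?y m * y k ^ D =
      mono_eval y (delete_var k m) * ?c ^ Poly_Mapping.lookup m k * y k ^ (D - Poly_Mapping.lookup m k)"
    if "m \<in> Poly_Mapping.keys p" for m
  proof -
    have "mono_eval ?y m = mono_eval ?y (delete_var k m) * (?c / y k) ^ Poly_Mapping.lookup m k"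
      by (subst delete_var_split[of m k]) (simp add: mono_eval_add)
    moreover have "mono_eval ?y (delete_var k m) = mono_eval y (delete_var k m)"
      by (intro mono_eval_cong) (auto simp: keys_delete_var)
    moreover have "y k ^ D = y k ^ Poly_Mapping.lookup m k * y k ^ (D - Poly_Mapping.lookup m k)"
      using D[OF that] by (simp flip: power_add)
    ultimately show ?thesis using yk by (simp add: power_divide)
  qed
  have "(\<Sum>i\<le>D. poly_eval \<iota> y (P i) * y k ^ i) =
      (\<Sum>i\<le>D. \<Sum>m\<in>K i. \<iota> (Poly_Mapping.lookup p m) * (mono_eval ?y m * y k ^ D))"
  proof (intro sum.cong refl)
    fix i assume "i \<in> {..D}"
    have "poly_eval \<iota> y (P i) * y k ^ i =
      (\<Sum>m\<in>K i. \<iota> (Poly_Mapping.lookup p m) * (mono_eval y (delete_var k m) * ?c ^ (D - i) * y k ^ i))"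
      by (simp add: P_def Q_def poly_eval_mult poly_eval_power poly_eval_sum sum_distrib_right sum_distrib_left mult_ac)
    also have "\<dots> = (\<Sum>m\<in>K i. \<iota> (Poly_Mapping.lookup p m) * (mono_eval ?y m * y k ^ D))"
    proof (intro sum.cong refl)
      fix m assume m: "m \<in> K i"
      then have "D - i = Poly_Mapping.lookup m k" "i = D - Poly_Mapping.lookup m k"
        by (auto simp: K_def)
      then show "\<iota> (Poly_Mapping.lookup p m) * (mono_eval y (delete_var k m) * ?c ^ (D - i) * y k ^ i) =
        \<iota> (Poly_Mapping.lookup p m) * (mono_eval ?y m * y k ^ D)"
        using m mono[of m] by (auto simp: K_def)
    qed
    finally show "poly_eval \<iota> y (P i) * y k ^ i =
      (\<Sum>m\<in>K i. \<iota> (Poly_Mapping.lookup p m) * (mono_eval ?y m * y k ^ D))" .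
  qed
  also have "\<dots> = (\<Sum>m\<in>Poly_Mapping.keys p. \<iota> (Poly_Mapping.lookup p m) * (mono_eval ?y m * y k ^ D))"
  proof -
    have K: "K i = {m \<in> Poly_Mapping.keys p. D - Poly_Mapping.lookup m k = i}" if "i \<in> {..D}" for i
      using that D by (force simp: K_def)
    show ?thesis
      by (subst sum.group[of "Poly_Mapping.keys p" "{..D}" "\<lambda>m. D - Poly_Mapping.lookup m k", symmetric])
        (auto simp: K intro!: sum.cong)
  qed
  also have "\<dots> = poly_eval \<iota> ?y p * y k ^ D"
    by (simp add: poly_eval_superset[OF finite_keys subset_refl] sum_distrib_right sum_distrib_left mult_ac)
  finally have P0: "P i = 0" if "i \<le> D" for i
    using independent_coefficients[OF indep k P] p(2) that by auto
  show "p = 0"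
  proof (rule ccontr)
    assume "p \<noteq> 0"
    then obtain m where m: "m \<in> Poly_Mapping.keys p"
      by (metis in_keys_iff lookup_zero poly_mapping_eqI)
    define i where "i = D - Poly_Mapping.lookup m k"
    have mK: "m \<in> K i" using m D[OF m] by (simp add: K_def i_def)
    have "poly_eval \<iota> y (Q i) * ?c ^ (D - i) = 0"
      using P0[of i] by (simp add: P_def i_def poly_eval_mult[symmetric] poly_eval_power[symmetric])
    then have "poly_eval \<iota> y (Q i) = 0" using c by simp
    then have "Q i = 0" using Q I indep by (auto simp: alg_independent_def)
    moreover have "Poly_Mapping.lookup (Q i) (delete_var k m) =
        (\<Sum>a\<in>K i. if a = m then Poly_Mapping.lookup p m else 0)"
      unfolding Q_def lookup_sum
    proof (intro sum.cong refl)
      fix a assume a: "a \<in> K i"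
      have "delete_var k a = delete_var k m \<longleftrightarrow> a = m"
      proof
        assume *: "delete_var k a = delete_var k m"
        have "Poly_Mapping.lookup a k = Poly_Mapping.lookup m k" using a mK by (simp add: K_def)
        then show "a = m" using * delete_var_split[of a k] delete_var_split[of m k] by simp
      qed simp
      then show "Poly_Mapping.lookup (Poly_Mapping.single (delete_var k a) (Poly_Mapping.lookup p a)) (delete_var k m)
        = (if a = m then Poly_Mapping.lookup p m else 0)"
        by (simp add: lookup_single when_def)
    qed
    ultimately have "Poly_Mapping.lookup p m = 0" using mK by (simp add: K_def)
    then show False using m by (simp add: in_keys_iff)
  qed
qed

lemma alg_independent_mutate:
  fixes y :: "nat \<Rightarrow> 'f"
  assumes indep: "alg_independent \<iota> {..<n} y" and B: "B k k = 0" and k: "k < n"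
  shows "alg_independent \<iota> {..<n} (mutate_cluster n k y B)"
proof -
  define a where "a = (\<Sum>i\<in>{..<n} - {k}. Poly_Mapping.single i (nat (B i k)))"
  define b where "b = (\<Sum>i\<in>{..<n} - {k}. Poly_Mapping.single i (nat (- B i k)))"
  define C where "C = Poly_Mapping.single a (1::'k) + Poly_Mapping.single b 1"
  have mono_sum: "mono_eval y (\<Sum>i\<in>A. Poly_Mapping.single i (f i)) = (\<Prod>i\<in>A. y i ^ f i)" for f A
    by (induction A rule: infinite_finite_induct) (auto simp: mono_eval_add)
  have drop: "(\<Prod>i\<in>{..<n} - {k}. y i ^ f i) = (\<Prod>i<n. y i ^ f i)" if "f k = 0" for f :: "nat \<Rightarrow> nat"
    using that by (intro prod.mono_neutral_left) auto
  \<comment> \<open>If the two exchange monomials coincide, this coefficient is 2, which is nonzero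
    in characteristic zero.\<close>
  have "Poly_Mapping.lookup C a \<noteq> 0" by (auto simp: C_def lookup_add lookup_single when_def)
  then have "C \<noteq> 0" by auto
  moreover have "Poly_Mapping.keys a \<subseteq> {..<n} - {k}" "Poly_Mapping.keys b \<subseteq> {..<n} - {k}"
    unfolding a_def b_def
    using keys_sum_subset[of "\<lambda>i. Poly_Mapping.single i (nat (B i k))" "{..<n} - {k}"]
      keys_sum_subset[of "\<lambda>i. Poly_Mapping.single i (nat (- B i k))" "{..<n} - {k}"]
    by (auto split: if_splits)
  then have "C \<in> polys_in ({..<n} - {k})" unfolding C_def by (intro polys_in_add polys_in_single)
  moreover have "poly_eval \<iota> y C = (\<Prod>i<n. y i ^ nat (B i k)) + (\<Prod>i<n. y i ^ nat (- B i k))"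
    by (simp add: C_def poly_eval_add a_def b_def mono_sum drop B)
  ultimately show ?thesis
    using alg_independent_exchange[OF indep, of k C] k by (simp add: mutate_cluster_def)
qed

end

text \<open>The same symmetrizer \<open>d\<close> works before and after mutation; the integer
  division in \<open>mutate_matrix\<close> is the only delicate point.\<close>

lemma skew_symmetrizable_mutate:
  assumes "skew_symmetrizable n B" "k < n"
  shows "skew_symmetrizable n (mutate_matrix k B)"
proof -
  obtain d :: "nat \<Rightarrow> int" where d: "\<And>i. i < n \<Longrightarrow> d i > 0"
    "\<And>i j. i < n \<Longrightarrow> j < n \<Longrightarrow> d i * B i j = - (d j * B j i)"
    using assms(1) by (auto simp: skew_symmetrizable_def)
  define e where "e i j = \<bar>B i k\<bar> * B k j + B i k * \<bar>B k j\<bar>" for i j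
  have dabs: "d i * \<bar>B i j\<bar> = d j * \<bar>B j i\<bar>" if "i < n" "j < n" for i j
  proof -
    have "d i * \<bar>B i j\<bar> = \<bar>d i * B i j\<bar>" using d(1)[OF that(1)] by (simp add: abs_mult)
    also have "\<dots> = \<bar>d j * B j i\<bar>" by (subst d(2)[OF that]) simp
    also have "\<dots> = d j * \<bar>B j i\<bar>" using d(1)[OF that(2)] by (simp add: abs_mult)
    finally show ?thesis .
  qed
  \<comment> \<open>Depending on the signs of the two entries, \<open>e i j\<close> is zero or plus
    or minus twice their product, so the division is exact.\<close>
  have e2: "2 * (e i j div 2) = e i j" for i j
  proof -
    have "even (e i j)" unfolding e_def by (cases "B i k < 0"; cases "B k j < 0") auto
    then show ?thesis by simp
  qed
  have "d i * e i j = - (d j * e j i)" if "i < n" "j < n" for i j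
  proof -
    have "d i * e i j = (d i * \<bar>B i k\<bar>) * B k j + (d i * B i k) * \<bar>B k j\<bar>"
      by (simp add: e_def algebra_simps)
    also have "\<dots> = \<bar>B k i\<bar> * (d k * B k j) - B k i * (d k * \<bar>B k j\<bar>)"
      using dabs[OF that(1) assms(2)] d(2)[OF that(1) assms(2)] by (simp add: algebra_simps)
    also have "\<dots> = - (d j * e j i)"
      using dabs[OF assms(2) that(2)] d(2)[OF assms(2) that(2)] by (simp add: e_def algebra_simps)
    finally show ?thesis .
  qed
  then have "2 * (d i * (e i j div 2)) = 2 * (- (d j * (e j i div 2)))" if "i < n" "j < n" for i j
    using that e2[of i j] e2[of j i] by (metis mult.left_commute mult_minus_right)
  then have "d i * (e i j div 2) = - (d j * (e j i div 2))" if "i < n" "j < n" for i j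
    using that by (metis mult_cancel_left zero_neq_numeral)
  note e = this
  have "d i * mutate_matrix k B i j = - (d j * mutate_matrix k B j i)" if "i < n" "j < n" for i j
  proof (cases "i = k \<or> j = k")
    case True
    then show ?thesis using d(2)[OF that] by (auto simp: mutate_matrix_def)
  next
    case False
    then show ?thesis
      using d(2)[OF that] e[OF that] by (simp add: mutate_matrix_def e_def[symmetric] distrib_left)
  qed
  then show ?thesis using d(1) by (auto simp: skew_symmetrizable_def)
qed

text \<open>Skew-symmetrizability is carried along in the induction because it makes the diagonal
  entries vanish, which keeps \<open>y k\<close> out of its own exchange binomial.\<close>

lemma (in embedded_field) mutation_class_independent:
  assumes "is_seed \<iota> n S" "(y, B) \<in> mutation_class n S"
  shows "alg_independent \<iota> {..<n} y"
proof -
  have "alg_independent \<iota> {..<n} (fst T) \<and> skew_symmetrizable n (snd T)" if "T \<in> mutation_class n S" for T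
    using that
  proof (induction rule: mutation_class.induct)
    case initial
    then show ?case using assms(1) by (auto simp: is_seed_def free_generators_def alg_independent_def)
  next
    case (mutate y B k)
    then obtain d :: "nat \<Rightarrow> int" where "\<forall>i<n. d i > 0" "\<forall>i<n. \<forall>j<n. d i * B i j = - (d j * B j i)"
      by (auto simp: skew_symmetrizable_def)
    then have "d k > 0" "d k * B k k = - (d k * B k k)" using mutate by blast+
    then have "B k k = 0" by simp
    then show ?case using mutate by (auto intro: alg_independent_mutate skew_symmetrizable_mutate)
  qed
  from this[OF assms(2)] show ?thesis by simp
qed

section \<open>Leading exponents of rational functions\<close>

locale leading_exponents = embedded_field \<iota> for \<iota> :: "'k::field_char_0 \<Rightarrow> 'f::field" +
  fixes J :: "'i set" and t :: "'i \<Rightarrow> 'f" and w :: "'i \<Rightarrow> real"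
  assumes finite_J: "finite J" and indep: "alg_independent \<iota> J t"
begin

text \<open>Exponents outside \<open>J\<close> are fixed to zero so that distinct elements give
  distinct Laurent monomials.\<close>

definition lattice :: "('i \<Rightarrow> int) set" where
  "lattice = {\<alpha>. \<forall>k. k \<notin> J \<longrightarrow> \<alpha> k = 0}"

definition T :: "('i \<Rightarrow> int) \<Rightarrow> 'f" where
  "T \<alpha> = (\<Prod>j\<in>J. t j powi \<alpha> j)"

definition wt :: "('i \<Rightarrow> int) \<Rightarrow> real" where
  "wt \<alpha> = (\<Sum>j\<in>J. w j * real_of_int (\<alpha> j))"

lemma t_nonzero: "j \<in> J \<Longrightarrow> t j \<noteq> 0"
  using alg_independent_nonzero[OF indep] .

lemma T_add: "T (\<alpha> + \<beta>) = T \<alpha> * T \<beta>"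
  unfolding T_def prod.distrib[symmetric] by (intro prod.cong) (auto simp: power_int_add t_nonzero)

lemma T_zero [simp]: "T 0 = 1"
  by (simp add: T_def)

lemma wt_add: "wt (\<alpha> + \<beta>) = wt \<alpha> + wt \<beta>"
  by (simp add: wt_def distrib_left sum.distrib)

lemma wt_diff: "wt (\<alpha> - \<beta>) = wt \<alpha> - wt \<beta>"
  by (simp add: wt_def right_diff_distrib sum_subtractf)

lemma wt_zero [simp]: "wt 0 = 0"
  by (simp add: wt_def)

lemma lattice_add: "\<alpha> \<in> lattice \<Longrightarrow> \<beta> \<in> lattice \<Longrightarrow> \<alpha> + \<beta> \<in> lattice"
  and lattice_diff: "\<alpha> \<in> lattice \<Longrightarrow> \<beta> \<in> lattice \<Longrightarrow> \<alpha> - \<beta> \<in> lattice"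
  and lattice_zero: "0 \<in> lattice"
  by (auto simp: lattice_def)

text \<open>Multiplication by a common high power \<open>D\<close> of all \<open>t j\<close> turns
  the Laurent monomials into distinct monomials, to which algebraic independence applies.\<close>

lemma T_independent:
  assumes A: "finite A" "A \<subseteq> lattice" and zero: "(\<Sum>\<alpha>\<in>A. \<iota> (c \<alpha>) * T \<alpha>) = 0" and a: "a \<in> A"
  shows "c a = 0"
proof -
  define D where "D = (\<Sum>\<alpha>\<in>A. \<Sum>j\<in>J. \<bar>\<alpha> j\<bar>)"
  have D: "0 \<le> \<alpha> j + D" if "\<alpha> \<in> A" "j \<in> J" for \<alpha> j
  proof -
    have "\<bar>\<alpha> j\<bar> \<le> (\<Sum>j\<in>J. \<bar>\<alpha> j\<bar>)" using finite_J that by (intro member_le_sum) auto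
    also have "\<dots> \<le> D" unfolding D_def
      using A(1) that by (intro member_le_sum[of _ A "\<lambda>\<alpha>. \<Sum>j\<in>J. \<bar>\<alpha> j\<bar>"]) (auto intro: sum_nonneg)
    finally show ?thesis by linarith
  qed
  define m where "m \<alpha> = (\<Sum>j\<in>J. Poly_Mapping.single j (nat (\<alpha> j + D)))" for \<alpha>
  have lm: "Poly_Mapping.lookup (m \<alpha>) j = (if j \<in> J then nat (\<alpha> j + D) else 0)" for \<alpha> j
    using finite_J by (simp add: m_def lookup_sum lookup_single when_def)
  have minj: "m \<alpha> = m \<beta> \<longleftrightarrow> \<alpha> = \<beta>" if "\<alpha> \<in> A" "\<beta> \<in> A" for \<alpha> \<beta>
  proof
    assume "m \<alpha> = m \<beta>"
    then have "(if j \<in> J then nat (\<alpha> j + D) else 0) = (if j \<in> J then nat (\<beta> j + D) else 0)" for j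
      using lm[of \<alpha> j] lm[of \<beta> j] by simp
    note eq = this
    have "\<alpha> j = \<beta> j" for j
    proof (cases "j \<in> J")
      case True
      then show ?thesis
        using eq[of j] eq_nat_nat_iff[OF D[OF that(1) True] D[OF that(2) True]] by simp
    next
      case False
      have "\<alpha> \<in> lattice" "\<beta> \<in> lattice" using that A(2) by auto
      with False show ?thesis by (simp add: lattice_def)
    qed
    then show "\<alpha> = \<beta>" by auto
  qed auto
  have keysm: "Poly_Mapping.keys (m \<alpha>) \<subseteq> J" for \<alpha> by (auto simp: in_keys_iff lm split: if_splits)
  have ev: "mono_eval t (m \<alpha>) = T \<alpha> * (\<Prod>j\<in>J. t j powi D)" if "\<alpha> \<in> A" for \<alpha>
    unfolding T_def prod.distrib[symmetric] mono_eval_superset[OF finite_J keysm]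
  proof (intro prod.cong refl)
    fix j assume j: "j \<in> J"
    have "t j ^ Poly_Mapping.lookup (m \<alpha>) j = t j powi (\<alpha> j + D)"
      using D[OF that j] j by (simp add: lm power_int_def)
    then show "t j ^ Poly_Mapping.lookup (m \<alpha>) j = t j powi \<alpha> j * t j powi D"
      using j by (simp add: power_int_add t_nonzero)
  qed
  define p where "p = (\<Sum>\<alpha>\<in>A. Poly_Mapping.single (m \<alpha>) (c \<alpha>))"
  have "poly_eval \<iota> t p = (\<Sum>\<alpha>\<in>A. \<iota> (c \<alpha>) * T \<alpha>) * (\<Prod>j\<in>J. t j powi D)"
    by (simp add: p_def poly_eval_sum ev sum_distrib_right mult.assoc)
  moreover have "p \<in> polys_in J" unfolding p_def using keysm by (intro polys_in_sum polys_in_single)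
  ultimately have "p = 0" using zero indep by (simp add: alg_independent_def)
  moreover have "Poly_Mapping.lookup p (m a) = (\<Sum>\<alpha>\<in>A. if \<alpha> = a then c a else 0)"
    unfolding p_def lookup_sum using a minj by (intro sum.cong) (auto simp: lookup_single when_def)
  ultimately show ?thesis using A a by (simp add: sum.delta)
qed

text \<open>The span over the base field of the Laurent monomials of weight less than
  \<open>W\<close>. Generating it one term at a time makes closure under sums and products plain
  inductions; \<open>Below_lincomb\<close> recovers a finite linear combination.\<close>

inductive_set Below :: "real \<Rightarrow> 'f set" for W where
  zero: "0 \<in> Below W"
| add: "b \<in> Below W \<Longrightarrow> \<alpha> \<in> lattice \<Longrightarrow> wt \<alpha> < W \<Longrightarrow> b + \<iota> c * T \<alpha> \<in> Below W"

lemma Below_add: "a \<in> Below W \<Longrightarrow> b \<in> Below W \<Longrightarrow> a + b \<in> Below W"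
  by (induction a rule: Below.induct) (auto intro: Below.intros simp: add_ac(2) add.left_commute
      dest: Below.add simp flip: add.assoc)

lemma Below_single: "\<alpha> \<in> lattice \<Longrightarrow> wt \<alpha> < W \<Longrightarrow> \<iota> c * T \<alpha> \<in> Below W"
  using Below.add[OF Below.zero] by simp

lemma Below_mono: "a \<in> Below W \<Longrightarrow> W \<le> W' \<Longrightarrow> a \<in> Below W'"
  by (induction a rule: Below.induct) (auto intro: Below.intros)

lemma Below_shift:
  assumes "a \<in> Below W" "\<beta> \<in> lattice" shows "\<iota> d * T \<beta> * a \<in> Below (wt \<beta> + W)"
  using assms(1)
proof (induction a rule: Below.induct)
  case (add b \<alpha> c)
  have "\<iota> d * T \<beta> * b + \<iota> (d * c) * T (\<beta> + \<alpha>) \<in> Below (wt \<beta> + W)"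
    using add assms(2) by (intro Below.add) (auto simp: wt_add lattice_add)
  then show ?case by (simp add: distrib_left T_add emb_mult mult_ac)
qed (simp add: Below.zero)

lemma Below_mult:
  assumes "a \<in> Below W" "b \<in> Below W'" shows "a * b \<in> Below (W + W')"
  using assms(1)
proof (induction a rule: Below.induct)
  case (add a \<alpha> c)
  have "\<iota> c * T \<alpha> * b \<in> Below (W + W')"
    using Below_shift[OF assms(2) add(2), of c] add(3) by (elim Below_mono) simp
  then show ?case using add by (simp add: distrib_right Below_add)
qed (simp add: Below.zero)

lemma Below_scale: "a \<in> Below W \<Longrightarrow> \<iota> c * a \<in> Below W"
  using Below_shift[of a W 0 c] by (simp add: lattice_zero)

lemma Below_sum: "(\<And>i. i \<in> I \<Longrightarrow> f i \<in> Below W) \<Longrightarrow> sum f I \<in> Below W"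
  by (induction I rule: infinite_finite_induct) (auto intro: Below_add Below.zero)

lemma Below_lincomb:
  assumes "b \<in> Below W"
  shows "\<exists>A c. finite A \<and> A \<subseteq> lattice \<and> (\<forall>\<alpha>\<in>A. wt \<alpha> < W) \<and> b = (\<Sum>\<alpha>\<in>A. \<iota> (c \<alpha>) * T \<alpha>)"
  using assms
proof (induction b rule: Below.induct)
  case zero
  show ?case by (intro exI[of _ "{}"]) auto
next
  case (add b \<alpha> d)
  then obtain A c where A: "finite A" "A \<subseteq> lattice" "\<forall>\<alpha>\<in>A. wt \<alpha> < W" "b = (\<Sum>\<alpha>\<in>A. \<iota> (c \<alpha>) * T \<alpha>)"
    by blast
  define c' where "c' = (\<lambda>\<beta>. (if \<beta> \<in> A then c \<beta> else 0) + (if \<beta> = \<alpha> then d else 0))"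
  have "(\<Sum>\<beta>\<in>insert \<alpha> A. \<iota> (c' \<beta>) * T \<beta>) =
      (\<Sum>\<beta>\<in>insert \<alpha> A. \<iota> (if \<beta> \<in> A then c \<beta> else 0) * T \<beta>) + (\<Sum>\<beta>\<in>insert \<alpha> A. \<iota> (if \<beta> = \<alpha> then d else 0) * T \<beta>)"
    by (simp only: c'_def emb_add distrib_right sum.distrib)
  also have "(\<Sum>\<beta>\<in>insert \<alpha> A. \<iota> (if \<beta> \<in> A then c \<beta> else 0) * T \<beta>) = b"
    unfolding A(4) using A(1) by (intro sum.mono_neutral_cong_right) auto
  also have "(\<Sum>\<beta>\<in>insert \<alpha> A. \<iota> (if \<beta> = \<alpha> then d else 0) * T \<beta>) = \<iota> d * T \<alpha>"
    using A(1) by (subst sum.mono_neutral_cong_right[of _ "{\<alpha>}" _ "\<lambda>\<beta>. \<iota> d * T \<beta>"]) auto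
  finally show ?case using A add
    by (intro exI[of _ "insert \<alpha> A"] exI[of _ c']) auto
qed

text \<open>The weight is real and need not separate exponents, so having a single heaviest term is
  a property of an element and not automatic.\<close>

definition leads :: "'k \<Rightarrow> ('i \<Rightarrow> int) \<Rightarrow> 'f \<Rightarrow> bool" where
  "leads c \<alpha> p \<longleftrightarrow> c \<noteq> 0 \<and> \<alpha> \<in> lattice \<and> p - \<iota> c * T \<alpha> \<in> Below (wt \<alpha>)"

lemma leads_mult:
  assumes "leads c \<alpha> p" "leads d \<beta> q" shows "leads (c * d) (\<alpha> + \<beta>) (p * q)"
proof -
  let ?a = "p - \<iota> c * T \<alpha>" and ?b = "q - \<iota> d * T \<beta>"
  have a: "?a \<in> Below (wt \<alpha>)" "\<alpha> \<in> lattice" and b: "?b \<in> Below (wt \<beta>)" "\<beta> \<in> lattice"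
    using assms by (auto simp: leads_def)
  have "p * q - \<iota> (c * d) * T (\<alpha> + \<beta>) = ?a * ?b + \<iota> c * T \<alpha> * ?b + \<iota> d * T \<beta> * ?a"
    by (simp add: emb_mult T_add algebra_simps)
  moreover have "?a * ?b \<in> Below (wt \<alpha> + wt \<beta>)" using Below_mult[OF a(1) b(1)] .
  moreover have "\<iota> c * T \<alpha> * ?b \<in> Below (wt \<alpha> + wt \<beta>)" using Below_shift[OF b(1) a(2)] .
  moreover have "\<iota> d * T \<beta> * ?a \<in> Below (wt \<alpha> + wt \<beta>)"
    using Below_shift[OF a(1) b(2)] by (simp add: add.commute)
  ultimately show ?thesis using assms
    by (auto simp: leads_def lattice_add wt_add intro: Below_add)
qed

lemma leads_add:
  assumes "leads c \<alpha> p" "leads d \<beta> q" "wt \<beta> < wt \<alpha>" shows "leads c \<alpha> (p + q)"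
proof -
  have "q - \<iota> d * T \<beta> \<in> Below (wt \<alpha>)" "\<iota> d * T \<beta> \<in> Below (wt \<alpha>)"
    using assms by (auto simp: leads_def intro: Below_mono Below_single)
  then have "(q - \<iota> d * T \<beta>) + \<iota> d * T \<beta> \<in> Below (wt \<alpha>)" by (rule Below_add)
  then have "q \<in> Below (wt \<alpha>)" by simp
  then have "(p - \<iota> c * T \<alpha>) + q \<in> Below (wt \<alpha>)"
    using assms(1) by (intro Below_add) (auto simp: leads_def)
  then show ?thesis using assms(1) by (simp add: leads_def algebra_simps)
qed

lemma leads_T: "\<alpha> \<in> lattice \<Longrightarrow> c \<noteq> 0 \<Longrightarrow> leads c \<alpha> (\<iota> c * T \<alpha>)"
  by (simp add: leads_def Below.zero)

text \<open>For a fraction \<open>p / q\<close> the leading exponent is the difference of those of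
  numerator and denominator. Stating it through \<open>y * q = p\<close> lets fractions be combined
  by multiplying equations.\<close>

definition lead :: "'f \<Rightarrow> ('i \<Rightarrow> int) \<Rightarrow> bool" where
  "lead y \<alpha> \<longleftrightarrow> \<alpha> \<in> lattice \<and> (\<exists>p q \<beta> c d. leads c (\<alpha> + \<beta>) p \<and> leads d \<beta> q \<and> y * q = p)"

lemma lead_lattice: "lead y \<alpha> \<Longrightarrow> \<alpha> \<in> lattice"
  by (simp add: lead_def)

lemma lead_polynomial:
  assumes "leads c \<alpha> p" shows "lead p \<alpha>"
proof -
  have "leads c (\<alpha> + 0) p" "leads 1 0 1" "p * 1 = p" "\<alpha> \<in> lattice"
    using assms leads_T[OF lattice_zero, of 1] by (auto simp: leads_def)
  then show ?thesis unfolding lead_def by blast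
qed

lemma lead_const: "c \<noteq> 0 \<Longrightarrow> lead (\<iota> c) 0"
  using leads_T[OF lattice_zero, of c] by (auto intro: lead_polynomial)

lemma lead_one: "lead 1 0"
  using lead_const[of 1] by simp

definition basis_exp :: "'i \<Rightarrow> 'i \<Rightarrow> int" where
  "basis_exp j = (\<lambda>k. if k = j \<and> j \<in> J then 1 else 0)"

lemma wt_basis: "wt (basis_exp j) = (if j \<in> J then w j else 0)"
proof -
  have "wt (basis_exp j) = (\<Sum>k\<in>J. if k = j then w j else 0)"
    unfolding wt_def by (intro sum.cong) (auto simp: basis_exp_def)
  then show ?thesis using finite_J by (simp add: sum.delta)
qed

lemma basis_lattice: "basis_exp j \<in> lattice"
  by (auto simp: basis_exp_def lattice_def)

lemma basis_outside: "j \<notin> J \<Longrightarrow> basis_exp j = 0"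
  by (auto simp: basis_exp_def)

lemma lead_generator: assumes "j \<in> J" shows "lead (t j) (basis_exp j)"
proof -
  have "T (basis_exp j) = (\<Prod>k\<in>J. if k = j then t j else 1)"
    unfolding T_def using assms by (intro prod.cong) (auto simp: basis_exp_def)
  then have "T (basis_exp j) = t j" using assms finite_J by (simp add: prod.delta)
  then have "leads 1 (basis_exp j) (t j)" using leads_T[OF basis_lattice, of 1 j] by simp
  then show ?thesis by (rule lead_polynomial)
qed

lemma lead_mult:
  assumes "lead y \<alpha>" "lead z \<beta>" shows "lead (y * z) (\<alpha> + \<beta>)"
proof -
  obtain p q \<gamma> c d where 1: "leads c (\<alpha> + \<gamma>) p" "leads d \<gamma> q" "y * q = p"
    using assms(1) by (auto simp: lead_def)
  obtain p' q' \<gamma>' c' d' where 2: "leads c' (\<beta> + \<gamma>') p'" "leads d' \<gamma>' q'" "z * q' = p'"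
    using assms(2) by (auto simp: lead_def)
  have "leads (c * c') (\<alpha> + \<beta> + (\<gamma> + \<gamma>')) (p * p')" using leads_mult[OF 1(1) 2(1)] by (simp add: add_ac)
  moreover have "leads (d * d') (\<gamma> + \<gamma>') (q * q')" using leads_mult[OF 1(2) 2(2)] .
  moreover have "y * z * (q * q') = p * p'" using 1(3) 2(3) by (auto simp: mult_ac)
  ultimately show ?thesis unfolding lead_def
    using lead_lattice[OF assms(1)] lead_lattice[OF assms(2)] lattice_add by blast
qed

lemma lead_add:
  assumes "lead y \<alpha>" "lead z \<beta>" "wt \<beta> < wt \<alpha>" shows "lead (y + z) \<alpha>"
proof -
  obtain p q \<gamma> c d where 1: "leads c (\<alpha> + \<gamma>) p" "leads d \<gamma> q" "y * q = p"
    using assms(1) by (auto simp: lead_def)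
  obtain p' q' \<gamma>' c' d' where 2: "leads c' (\<beta> + \<gamma>') p'" "leads d' \<gamma>' q'" "z * q' = p'"
    using assms(2) by (auto simp: lead_def)
  have "leads (c * d') (\<alpha> + (\<gamma> + \<gamma>')) (p * q')" using leads_mult[OF 1(1) 2(2)] by (simp add: add_ac)
  moreover have "leads (c' * d) (\<beta> + (\<gamma> + \<gamma>')) (p' * q)" using leads_mult[OF 2(1) 1(2)] by (simp add: add_ac)
  ultimately have "leads (c * d') (\<alpha> + (\<gamma> + \<gamma>')) (p * q' + p' * q)"
    by (rule leads_add) (simp add: wt_add assms(3))
  moreover have "leads (d * d') (\<gamma> + \<gamma>') (q * q')" using leads_mult[OF 1(2) 2(2)] .
  moreover have "(y + z) * (q * q') = p * q' + p' * q" using 1(3) 2(3) by (auto simp: algebra_simps)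
  ultimately show ?thesis unfolding lead_def
    using lead_lattice[OF assms(1)] by blast
qed

lemma lead_divide:
  assumes "y * s = z" "lead z \<gamma>" "lead s \<sigma>" shows "lead y (\<gamma> - \<sigma>)"
proof -
  obtain p q \<beta> c d where 1: "leads c (\<gamma> + \<beta>) p" "leads d \<beta> q" "z * q = p"
    using assms(2) by (auto simp: lead_def)
  obtain p' q' \<beta>' c' d' where 2: "leads c' (\<sigma> + \<beta>') p'" "leads d' \<beta>' q'" "s * q' = p'"
    using assms(3) by (auto simp: lead_def)
  have "leads (c * d') ((\<gamma> - \<sigma>) + (\<sigma> + \<beta>' + \<beta>)) (p * q')"
    using leads_mult[OF 1(1) 2(2)] by (simp add: algebra_simps)
  moreover have "leads (c' * d) (\<sigma> + \<beta>' + \<beta>) (p' * q)" using leads_mult[OF 2(1) 1(2)] .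
  moreover have "y * (p' * q) = p * q'" using assms(1) 1(3) 2(3) by (auto simp: mult_ac)
  ultimately show ?thesis unfolding lead_def
    using lead_lattice[OF assms(2)] lead_lattice[OF assms(3)] lattice_diff by blast
qed

lemma lead_prod:
  "finite A \<Longrightarrow> (\<And>a. a \<in> A \<Longrightarrow> lead (f a) (\<alpha> a)) \<Longrightarrow> lead (prod f A) (sum \<alpha> A)"
proof (induction A rule: finite_induct)
  case empty
  show ?case using lead_one by (simp add: zero_fun_def)
next
  case (insert a A)
  then have "lead (f a * prod f A) (\<alpha> a + sum \<alpha> A)" by (intro lead_mult) auto
  then show ?case using insert.hyps by (simp only: prod.insert sum.insert not_False_eq_True)
qed

text \<open>The product of all denominators moves finitely many elements into the Laurent
  polynomials and shifts all leading exponents by the same vector.\<close>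

lemma common_denominator:
  assumes "finite M" "\<And>m. m \<in> M \<Longrightarrow> lead (f m) (\<alpha> m)"
  shows "\<exists>Q \<beta>. (\<exists>d. leads d \<beta> Q) \<and> (\<forall>m\<in>M. \<exists>c. leads c (\<alpha> m + \<beta>) (f m * Q))"
  using assms
proof (induction M rule: finite_induct)
  case empty
  show ?case using leads_T[OF lattice_zero, of 1] by auto
next
  case (insert m0 M)
  then obtain Q \<beta> d where Q: "leads d \<beta> Q" "\<And>m. m \<in> M \<Longrightarrow> \<exists>c. leads c (\<alpha> m + \<beta>) (f m * Q)" by blast
  obtain p q \<gamma> c e where m0: "leads c (\<alpha> m0 + \<gamma>) p" "leads e \<gamma> q" "f m0 * q = p"
    using insert.prems[of m0] by (auto simp: lead_def)
  show ?case
  proof (intro exI[of _ "Q * q"] exI[of _ "\<beta> + \<gamma>"] conjI ballI)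
    show "\<exists>d. leads d (\<beta> + \<gamma>) (Q * q)" using leads_mult[OF Q(1) m0(2)] by blast
    fix m assume m: "m \<in> insert m0 M"
    show "\<exists>c. leads c (\<alpha> m + (\<beta> + \<gamma>)) (f m * (Q * q))"
    proof (cases "m = m0")
      case True
      have "leads (c * d) (\<alpha> m + (\<beta> + \<gamma>)) (p * Q)"
        using leads_mult[OF m0(1) Q(1)] True by (simp add: add_ac)
      moreover have "p * Q = f m * (Q * q)" using m0(3) True by (auto simp: mult_ac)
      ultimately show ?thesis by metis
    next
      case False
      then obtain b where "leads b (\<alpha> m + \<beta>) (f m * Q)" using Q(2) m by blast
      from leads_mult[OF this m0(2)] show ?thesis by (auto simp: add.assoc mult.assoc)
    qed
  qed
qed

text \<open>Distinct exponents may have equal weight, so all terms of maximal weight are treated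
  together: their leading Laurent monomials are pairwise distinct and cannot be cancelled by
  strictly lighter ones.\<close>

theorem lead_independent:
  assumes M: "finite M" "\<And>m. m \<in> M \<Longrightarrow> lead (f m) (\<alpha> m)" "inj_on \<alpha> M"
    and zero: "(\<Sum>m\<in>M. \<iota> (c m) * f m) = 0" and m: "m \<in> M"
  shows "c m = 0"
proof (rule ccontr)
  assume cm: "c m \<noteq> 0"
  define M' where "M' = {m \<in> M. c m \<noteq> 0}"
  have M': "finite M'" "m \<in> M'" "M' \<subseteq> M" using M(1) m cm by (auto simp: M'_def)
  obtain Q \<beta> where Q: "\<And>m. m \<in> M \<Longrightarrow> \<exists>c. leads c (\<alpha> m + \<beta>) (f m * Q)"
    using common_denominator[of M f \<alpha>] M by blast
  then obtain e where e: "\<And>m. m \<in> M \<Longrightarrow> leads (e m) (\<alpha> m + \<beta>) (f m * Q)" by metis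
  define W where "W = Max ((\<lambda>m. wt (\<alpha> m + \<beta>)) ` M')"
  have W: "wt (\<alpha> k + \<beta>) \<le> W" if "k \<in> M'" for k using M'(1) that by (simp add: W_def)
  have "W \<in> (\<lambda>m. wt (\<alpha> m + \<beta>)) ` M'" unfolding W_def using M' by (intro Max_in) auto
  then obtain m0 where m0: "m0 \<in> M'" "wt (\<alpha> m0 + \<beta>) = W" by auto
  define Top where "Top = {m \<in> M'. wt (\<alpha> m + \<beta>) = W}"
  have Top: "finite Top" "Top \<subseteq> M'" "m0 \<in> Top" using M'(1) m0 by (auto simp: Top_def)
  define b where "b k = f k * Q - \<iota> (e k) * T (\<alpha> k + \<beta>)" for k
  have b: "b k \<in> Below W" if "k \<in> M'" for k
    using e[of k] that M'(3) W[OF that] by (auto simp: b_def leads_def intro: Below_mono)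
  have neg: "x = - (y + z)" if "0 = x + y + z" for x y z :: 'f
    using that by (metis add.assoc eq_neg_iff_add_eq_0)
  have "(\<Sum>m\<in>M'. \<iota> (c m) * f m) = 0"
    using zero M(1) by (subst (asm) sum.mono_neutral_right[of M M']) (auto simp: M'_def)
  then have "0 = (\<Sum>m\<in>M'. \<iota> (c m) * (f m * Q))"
    by (metis (no_types, lifting) mult.assoc mult_zero_left sum.cong sum_distrib_right)
  also have "\<dots> = (\<Sum>m\<in>M'. \<iota> (c m * e m) * T (\<alpha> m + \<beta>) + \<iota> (c m) * b m)"
    by (intro sum.cong) (auto simp: b_def emb_mult algebra_simps)
  also have "\<dots> = (\<Sum>m\<in>M'. \<iota> (c m * e m) * T (\<alpha> m + \<beta>)) + (\<Sum>m\<in>M'. \<iota> (c m) * b m)"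
    by (rule sum.distrib)
  also have "(\<Sum>m\<in>M'. \<iota> (c m * e m) * T (\<alpha> m + \<beta>)) =
      (\<Sum>m\<in>Top. \<iota> (c m * e m) * T (\<alpha> m + \<beta>)) + (\<Sum>m\<in>M' - Top. \<iota> (c m * e m) * T (\<alpha> m + \<beta>))"
    using sum.subset_diff[OF Top(2) M'(1), of "\<lambda>m. \<iota> (c m * e m) * T (\<alpha> m + \<beta>)"]
    by (simp only: add.commute)
  finally have eq: "(\<Sum>m\<in>Top. \<iota> (c m * e m) * T (\<alpha> m + \<beta>)) =
      - ((\<Sum>m\<in>M' - Top. \<iota> (c m * e m) * T (\<alpha> m + \<beta>)) + (\<Sum>m\<in>M'. \<iota> (c m) * b m))"
    by (rule neg)
  have lat: "\<alpha> k + \<beta> \<in> lattice" if "k \<in> M" for k using e[OF that] by (simp add: leads_def)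
  have "(\<Sum>m\<in>M' - Top. \<iota> (c m * e m) * T (\<alpha> m + \<beta>)) \<in> Below W"
  proof (intro Below_sum Below_single)
    fix k assume k: "k \<in> M' - Top"
    show "\<alpha> k + \<beta> \<in> lattice" using k lat M'(3) by blast
    have "wt (\<alpha> k + \<beta>) \<noteq> W" using k by (simp add: Top_def)
    then show "wt (\<alpha> k + \<beta>) < W" using W[of k] k by simp
  qed
  moreover have "(\<Sum>m\<in>M'. \<iota> (c m) * b m) \<in> Below W" using b by (intro Below_sum Below_scale)
  ultimately have "- (\<Sum>m\<in>Top. \<iota> (c m * e m) * T (\<alpha> m + \<beta>)) \<in> Below W"
    unfolding eq minus_minus by (rule Below_add)
  from Below_lincomb[OF this] obtain A d where A: "finite A" "A \<subseteq> lattice" "\<forall>\<alpha>\<in>A. wt \<alpha> < W"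
    "- (\<Sum>m\<in>Top. \<iota> (c m * e m) * T (\<alpha> m + \<beta>)) = (\<Sum>\<alpha>\<in>A. \<iota> (d \<alpha>) * T \<alpha>)"
    by (elim exE conjE) (erule (3) that)
  define g where "g m = \<alpha> m + \<beta>" for m
  have inj: "inj_on g Top" using M(3) M'(3) Top(2) by (auto simp: g_def inj_on_def)
  define B where "B = g ` Top"
  \<comment> \<open>Coefficients of one relation among Laurent monomials: products of leading
    coefficients on the heaviest exponents \<open>B\<close>, and \<open>d\<close> on the lighter
    exponents \<open>A\<close>.\<close>
  define u where "u \<gamma> = (if \<gamma> \<in> B then c (inv_into Top g \<gamma>) * e (inv_into Top g \<gamma>) else d \<gamma>)" for \<gamma>
  have disj: "A \<inter> B = {}" using A(3) by (auto simp: B_def g_def Top_def)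
  have sumB: "(\<Sum>\<gamma>\<in>B. \<iota> (u \<gamma>) * T \<gamma>) = (\<Sum>m\<in>Top. \<iota> (c m * e m) * T (\<alpha> m + \<beta>))"
    unfolding B_def sum.reindex[OF inj] using inj
    by (intro sum.cong) (auto simp: u_def B_def g_def[symmetric])
  have sumA: "(\<Sum>\<gamma>\<in>A. \<iota> (u \<gamma>) * T \<gamma>) = (\<Sum>\<gamma>\<in>A. \<iota> (d \<gamma>) * T \<gamma>)"
    using disj by (intro sum.cong) (auto simp: u_def)
  have finB: "finite B" using Top(1) by (simp add: B_def)
  have "(\<Sum>\<gamma>\<in>A \<union> B. \<iota> (u \<gamma>) * T \<gamma>) = 0"
    unfolding sum.union_disjoint[OF A(1) finB disj] sumA sumB A(4)[symmetric] by simp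
  moreover have "B \<subseteq> lattice" using lat M'(3) Top(2)
    by (auto simp: B_def g_def)
  ultimately have "u (g m0) = 0"
    using A(1,2) finB Top(3) by (intro T_independent[of "A \<union> B" u]) (auto simp: B_def)
  then have "c m0 * e m0 = 0" using Top(3) inj by (auto simp: u_def B_def)
  then show False using m0(1) e[of m0] M'(3) by (auto simp: M'_def leads_def)
qed

end

section \<open>Polygon models in integer coordinates\<close>

lemma seg_commute: "seg N i j = seg N j i"
  by (auto simp: seg_def)

lemma seg_mod: "seg N (i mod N) j = seg N i j" "seg N i (j mod N) = seg N i j"
  by (auto simp: seg_def)

lemma seg_cong: "i mod N = i' mod N \<Longrightarrow> j mod N = j' mod N \<Longrightarrow> seg N i j = seg N i' j'"
  by (auto simp: seg_def)

lemma seg_shift: "seg N (i + N) j = seg N i j" "seg N i (j + N) = seg N i j"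
  by (auto simp: seg_def)

lemma seg_eq_iff:
  "seg N i j = seg N a c \<longleftrightarrow>
     i mod N = a mod N \<and> j mod N = c mod N \<or> i mod N = c mod N \<and> j mod N = a mod N"
  by (auto simp: seg_def doubleton_eq_iff)

text \<open>The standard passage from congruent vertices to equal integers once the representatives
  are known to be less than \<open>N\<close> apart.\<close>

lemma mod_window: 
  fixes u v N :: int
  assumes "u mod N = v mod N" "u - v < N" "v - u < N" shows "u = v"
proof -
  have "N dvd u - v" using assms(1) by (simp add: mod_eq_dvd_iff)
  moreover have "\<bar>u - v\<bar> < N" using assms by linarith
  ultimately show ?thesis using dvd_imp_le_int[of "u - v" N] by fastforce
qed

lemma mod_represent:
  fixes a b N :: int
  assumes "N > 0"
  obtains b' where "a \<le> b'" "b' < a + N" "b' mod N = b mod N" "b' = a + (b - a) mod N"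
proof
  show "(a + (b - a) mod N) mod N = b mod N" by (simp add: mod_add_right_eq)
qed (use assms in auto)

lemma ccw4: "ccw N [a, b, c, d] \<longleftrightarrow>
  0 < (b - a) mod N \<and> (b - a) mod N < (c - a) mod N \<and> (c - a) mod N < (d - a) mod N"
  by (auto simp: ccw_def)

lemma ccw4_I:
  "a < b \<Longrightarrow> b < c \<Longrightarrow> c < d \<Longrightarrow> d < a + N \<Longrightarrow> ccw N [a, b, c, d]" for a b c d N :: int
  by (auto simp: ccw4 mod_pos_pos_trivial)

text \<open>Unwinds the cyclic order: the four vertices are represented by integers in one window of
  length \<open>N\<close>, so that later arguments about crossings are linear inequalities.\<close>

lemma crossing_iff:
  assumes "N > 0"
  shows "crossing N l m \<longleftrightarrow>
    (\<exists>a b c d. a < b \<and> b < c \<and> c < d \<and> d < a + N \<and> l = seg N a c \<and> m = seg N b d)"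
proof
  assume "crossing N l m"
  then obtain a b c d where *: "l = seg N a c" "m = seg N b d" "ccw N [a, b, c, d]"
    by (auto simp: crossing_def)
  obtain b' where b': "b' < a + N" "b' mod N = b mod N" "b' = a + (b - a) mod N"
    using mod_represent[OF assms, of a b] .
  obtain c' where c': "c' < a + N" "c' mod N = c mod N" "c' = a + (c - a) mod N"
    using mod_represent[OF assms, of a c] .
  obtain d' where d': "d' < a + N" "d' mod N = d mod N" "d' = a + (d - a) mod N"
    using mod_represent[OF assms, of a d] .
  have "a < b'" "b' < c'" "c' < d'" using *(3) b'(3) c'(3) d'(3) by (auto simp: ccw4)
  moreover have "l = seg N a c'" "m = seg N b' d'"
    unfolding * using seg_cong[OF refl c'(2)[symmetric], of a] seg_cong[OF b'(2)[symmetric] d'(2)[symmetric]]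
    by simp_all
  ultimately show "\<exists>a b c d. a < b \<and> b < c \<and> c < d \<and> d < a + N \<and> l = seg N a c \<and> m = seg N b d"
    using d'(1) by blast
next
  assume "\<exists>a b c d. a < b \<and> b < c \<and> c < d \<and> d < a + N \<and> l = seg N a c \<and> m = seg N b d"
  then show "crossing N l m" unfolding crossing_def using ccw4_I by blast
qed

lemma crossing_commute: "N > 0 \<Longrightarrow> crossing N l m \<Longrightarrow> crossing N m l"
proof -
  assume N: "N > 0" "crossing N l m"
  then obtain a b c d where "a < b" "b < c" "c < d" "d < a + N" "l = seg N a c" "m = seg N b d"
    using crossing_iff by auto
  then have "b < c \<and> c < d \<and> d < a + N \<and> a + N < b + N \<and> m = seg N b d \<and> l = seg N c (a + N)"
    by (auto simp: seg_commute seg_shift)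
  then show ?thesis unfolding crossing_iff[OF N(1)] by blast
qed

text \<open>The inner segment stays strictly between the ends of the outer one, hence on one side of
  it. The work lies in matching representatives modulo \<open>N\<close>.\<close>

lemma crossing_nested_False:
  assumes "N > 0" "i < k" "k \<le> l" "l < j" "j < i + N"
  shows "\<not> crossing N (seg N i j) (seg N k l)"
proof
  assume "crossing N (seg N i j) (seg N k l)"
  then obtain a b c d where *: "a < b" "b < c" "c < d" "d < a + N"
    "seg N i j = seg N a c" "seg N k l = seg N b d" unfolding crossing_iff[OF assms(1)] by auto
  \<comment> \<open>Rotating the quadruple by two places exchanges the ends of the first segment, so
    these may be assumed to match in the given order.\<close>
  have *: "\<exists>a b c d. a < b \<and> b < c \<and> c < d \<and> d < a + N \<and>
      seg N i j = seg N a c \<and> (seg N k l = seg N b d) \<and> i mod N = a mod N \<and> j mod N = c mod N"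
  proof (cases "i mod N = a mod N \<and> j mod N = c mod N")
    case True
    then show ?thesis using * by blast
  next
    case False
    then have "i mod N = c mod N" "j mod N = a mod N" using *(5) by (auto simp: seg_eq_iff)
    then show ?thesis using *
      by (intro exI[of _ c] exI[of _ d] exI[of _ "a + N"] exI[of _ "b + N"])
        (auto simp: seg_shift seg_commute)
  qed
  then obtain a b c d where *: "a < b" "b < c" "c < d" "d < a + N"
    "seg N k l = seg N b d" "i mod N = a mod N" "j mod N = c mod N" by blast
  \<comment> \<open>The shift moving \<open>a\<close> to \<open>i\<close> is a multiple of
    \<open>N\<close>, and it moves \<open>c\<close> to \<open>j\<close> as well.\<close>
  define s where "s = i - a"
  have sN: "s mod N = 0" using *(6) by (simp add: s_def mod_eq_dvd_iff)
  have sh: "(u + s) mod N = u mod N" for u using sN by (metis add.right_neutral mod_add_right_eq)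
  have j: "j = c + s"
  proof (rule mod_window[of j N])
    show "j mod N = (c + s) mod N" using *(7) sh[of c] by simp
  qed (use * assms in \<open>auto simp: s_def\<close>)
  have b: "b + s \<in> {i<..<j}" "d + s \<in> {j<..<i + N}" using * j by (auto simp: s_def)
  have "k mod N = (d + s) mod N \<or> l mod N = (d + s) mod N"
    using *(5) by (auto simp: seg_eq_iff sh)
  then show False
  proof
    assume "k mod N = (d + s) mod N"
    then have "k = d + s" using b assms by (intro mod_window[of k N]) auto
    then show False using b assms by auto
  next
    assume "l mod N = (d + s) mod N"
    then have "l = d + s" using b assms by (intro mod_window[of l N]) auto
    then show False using b assms by auto
  qed
qed

lemma diagonals_iff:
  assumes "N \<ge> 4"
  shows "l \<in> diagonals N \<longleftrightarrow> (\<exists>i j. i + 2 \<le> j \<and> j \<le> i + N - 2 \<and> l = seg N i j)"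
proof
  assume l: "l \<in> diagonals N"
  then obtain i j where ij: "l = seg N i j" "i mod N \<noteq> j mod N"
    by (auto simp: diagonals_def segments_def)
  define j' where "j' = i + (j - i) mod N"
  have j': "i \<le> j'" "j' < i + N" "j' mod N = j mod N"
    using assms by (auto simp: j'_def mod_add_right_eq)
  have l': "l = seg N i j'" using ij(1) seg_cong[OF refl j'(3)[symmetric], of i] by simp
  have "j' \<noteq> i" using ij j' by auto
  moreover have "j' \<noteq> i + 1" using l l' by (auto simp: diagonals_def edges_def)
  moreover have "j' \<noteq> i + N - 1"
  proof
    assume "j' = i + N - 1"
    then have "l = seg N j' (j' + 1)" using l' by (simp add: seg_shift seg_commute)
    then show False using l by (auto simp: diagonals_def edges_def)
  qed
  ultimately have "i + 2 \<le> j' \<and> j' \<le> i + N - 2" using j' by linarith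
  then show "\<exists>i j. i + 2 \<le> j \<and> j \<le> i + N - 2 \<and> l = seg N i j" using l' by blast
next
  assume "\<exists>i j. i + 2 \<le> j \<and> j \<le> i + N - 2 \<and> l = seg N i j"
  then obtain i j where ij: "i + 2 \<le> j" "j \<le> i + N - 2" "l = seg N i j" by auto
  have "i mod N \<noteq> j mod N" using mod_window[of i N j] ij assms by auto
  moreover have "seg N i j \<noteq> seg N k (k + 1)" for k
  proof
    assume "seg N i j = seg N k (k + 1)"
    then consider "i mod N = k mod N" "j mod N = (k + 1) mod N" | "i mod N = (k + 1) mod N" "j mod N = k mod N"
      by (auto simp: seg_eq_iff)
    then show False
    proof cases
      case 1
      then have "j mod N = (i + 1) mod N" by (metis mod_add_left_eq)
      then show False using mod_window[of j N "i + 1"] ij assms by auto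
    next
      case 2
      then have "i mod N = (j + 1) mod N" by (metis mod_add_left_eq)
      then have "(i + N) mod N = (j + 1) mod N" by simp
      then show False using mod_window[of "i + N" N "j + 1"] ij assms by auto
    qed
  qed
  ultimately show "l \<in> diagonals N" using ij by (auto simp: diagonals_def segments_def edges_def)
qed

lemma finite_segments: assumes "N > 0" shows "finite (segments N)"
proof (rule finite_subset)
  show "segments N \<subseteq> Pow {0..<N}" using assms by (auto simp: segments_def seg_def)
qed simp

lemma antipode_image_seg: "antipode N ` seg N i j = seg N (i + N div 2) (j + N div 2)"
  by (simp add: seg_def antipode_def mod_add_left_eq)

section \<open>Polygons with antipodal symmetry and their triangulations\<close>

locale polygon =
  fixes X :: cartan_type and n :: nat
  assumes odd_n: "odd n"
    and type_n: "X = Type_A \<and> n \<ge> 1 \<or> (X = Type_B \<or> X = Type_C) \<and> n \<ge> 3"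
begin

definition N :: int where "N = polygon_size X n"
text \<open>Since \<open>n\<close> is odd, \<open>N\<close> is even in every type, so half a turn is
  an integer in type A too. In types B and C moreover \<open>M = n + 1\<close> is even, hence
  antipodal vertices have the same parity.\<close>

definition M :: int where "M = N div 2"

abbreviation "bc \<equiv> X \<noteq> Type_A"

lemma N_2M: "N = 2 * M"
proof -
  have "even N" using odd_n by (auto simp: N_def polygon_size_def)
  then show ?thesis by (simp add: M_def)
qed

lemma M_ge: "M \<ge> 2" and M_bc: "bc \<Longrightarrow> M = int n + 1" "bc \<Longrightarrow> M \<ge> 4" "bc \<Longrightarrow> even M"
proof -
  have "N = (if bc then 2 * int n + 2 else int n + 3)"
    by (simp add: N_def polygon_size_def)
  then have A: "\<not> bc \<Longrightarrow> 2 * M = int n + 3" and BC: "bc \<Longrightarrow> 2 * M = 2 * int n + 2"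
    unfolding N_2M by presburger+
  show M: "M = int n + 1" if bc using BC[OF that] by simp
  show "M \<ge> 2" using A BC type_n by (cases bc) auto
  show "M \<ge> 4" if bc using M[OF that] that type_n by auto
  show "even M" if bc using M[OF that] odd_n by simp
qed

lemma N_ge: "N \<ge> 4"
  using N_2M M_ge by linarith

lemma N_pos: "N > 0"
  using N_ge by linarith

lemma shift_N: "(i + M + M) mod N = i mod N"
  using N_2M by (metis add.assoc mod_add_self2 mult_2)

definition lab :: "int \<Rightarrow> int \<Rightarrow> int set set" where
  "lab i j = label X n (seg N i j)"

lemma lab_eq: "lab i j = (if bc then {seg N i j, seg N (i + M) (j + M)} else {seg N i j})"
  by (auto simp: lab_def label_def N_def[symmetric] M_def antipode_image_seg)

lemma lab_commute: "lab i j = lab j i"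
  by (simp add: lab_def seg_commute)

lemma lab_cong: "i mod N = i' mod N \<Longrightarrow> j mod N = j' mod N \<Longrightarrow> lab i j = lab i' j'"
  unfolding lab_def by (simp add: seg_cong[of i N i' j j'])

lemma lab_shift: "lab (i + N) j = lab i j" "lab i (j + N) = lab i j"
  by (rule lab_cong; simp)+

lemma lab_antipode: assumes bc shows "lab (i + M) (j + M) = lab i j"
proof -
  have "seg N (i + M + M) (j + M + M) = seg N i j" by (intro seg_cong shift_N)
  then show ?thesis using assms by (auto simp: lab_eq)
qed

lemma seg_diagonal: "i + 2 \<le> j \<Longrightarrow> j \<le> i + N - 2 \<Longrightarrow> seg N i j \<in> diagonals N"
  unfolding diagonals_iff[OF N_ge] by blast

lemma variable_labels_eq: "variable_labels X n = {lab i j | i j. i + 2 \<le> j \<and> j \<le> i + N - 2}"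
proof (intro set_eqI iffI)
  fix L assume "L \<in> variable_labels X n"
  then obtain l where "l \<in> diagonals N" "L = label X n l"
    by (auto simp: variable_labels_def N_def)
  then show "L \<in> {lab i j | i j. i + 2 \<le> j \<and> j \<le> i + N - 2}"
    unfolding diagonals_iff[OF N_ge] lab_def by blast
next
  fix L assume "L \<in> {lab i j | i j. i + 2 \<le> j \<and> j \<le> i + N - 2}"
  then obtain i j where "i + 2 \<le> j" "j \<le> i + N - 2" "L = lab i j" by blast
  then show "L \<in> variable_labels X n"
    using seg_diagonal unfolding variable_labels_def N_def[symmetric] lab_def by blast
qed

lemma edge_labels_eq: "edge_labels X n = {lab i (i + 1) | i. True}"
  unfolding edge_labels_def N_def[symmetric] lab_def edges_def by auto

lemma finite_diagonals: "finite (diagonals N)"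
  using finite_segments[OF N_pos] by (simp add: diagonals_def)

lemma finite_variable_labels: "finite (variable_labels X n)"
  unfolding variable_labels_def N_def[symmetric] using finite_diagonals by simp

definition opp :: "int set \<Rightarrow> int set" where "opp l = antipode N ` l"

lemma opp_seg: "opp (seg N i j) = seg N (i + M) (j + M)"
  by (simp add: opp_def antipode_image_seg M_def)

lemma opp_diagonals: "l \<in> diagonals N \<Longrightarrow> opp l \<in> diagonals N"
proof -
  assume "l \<in> diagonals N"
  then obtain i j where "i + 2 \<le> j" "j \<le> i + N - 2" "l = seg N i j" using diagonals_iff[OF N_ge] by auto
  then show ?thesis unfolding diagonals_iff[OF N_ge]
    by (intro exI[of _ "i + M"] exI[of _ "j + M"]) (auto simp: opp_seg)
qed

lemma opp_opp: "l \<in> diagonals N \<Longrightarrow> opp (opp l) = l"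
proof -
  assume "l \<in> diagonals N"
  then obtain i j where "l = seg N i j" using diagonals_iff[OF N_ge] by auto
  then show ?thesis using seg_cong[OF shift_N shift_N] by (simp add: opp_seg)
qed

lemma crossing_opp: "crossing N l m \<Longrightarrow> crossing N (opp l) (opp m)"
proof -
  assume "crossing N l m"
  then obtain a b c d where "a < b" "b < c" "c < d" "d < a + N" "l = seg N a c" "m = seg N b d"
    using crossing_iff[OF N_pos] by auto
  then show ?thesis unfolding crossing_iff[OF N_pos]
    by (intro exI[of _ "a + M"] exI[of _ "b + M"] exI[of _ "c + M"] exI[of _ "d + M"]) (auto simp: opp_seg)
qed

lemma not_crossing_self: "\<not> crossing N l l"
proof
  assume "crossing N l l"
  then obtain a b c d where *: "a < b" "b < c" "c < d" "d < a + N" "seg N a c = seg N b d"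
    using crossing_iff[OF N_pos] by auto
  then have "a mod N = b mod N \<or> a mod N = d mod N" by (auto simp: seg_eq_iff)
  then show False using mod_window[of a N b] mod_window[of a N d] * by auto
qed

text \<open>Each of the two ways of matching the endpoints under a half turn contradicts
  \<open>a < b < c < d < a + N\<close>. This is what allows a diagonal and its antipodal image to be
  added to a symmetric set together.\<close>

lemma not_crossing_opp: "\<not> crossing N l (opp l)"
proof
  assume "crossing N l (opp l)"
  then obtain a b c d where *: "a < b" "b < c" "c < d" "d < a + N" "seg N (a + M) (c + M) = seg N b d"
    unfolding crossing_iff[OF N_pos] by (auto simp: opp_seg)
  then consider "(a + M) mod N = b mod N" "(c + M) mod N = d mod N"
    | "(a + M) mod N = d mod N" "(c + M) mod N = b mod N" by (auto simp: seg_eq_iff)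
  then show False
  proof cases
    case 1
    then have "a + M = b" "c + M = d"
      using mod_window[of "a + M" N b] mod_window[of "c + M" N d] * N_2M by auto
    then show False using * N_2M by auto
  next
    case 2
    have "(c - M) mod N = (c + M) mod N" using shift_N[of "c - M"] by simp
    with 2 have "a + M = d" "c - M = b"
      using mod_window[of "a + M" N d] mod_window[of "c - M" N b] * N_2M by auto
    then show False using * N_2M by auto
  qed
qed

text \<open>A maximal set among the symmetric noncrossing ones is maximal among all noncrossing
  ones: if \<open>l\<close> crosses nothing in it, neither does \<open>opp l\<close>, and both can
  be added at once.\<close>

lemma extend_to_triangulation:
  assumes D: "D \<subseteq> diagonals N" "\<And>l m. l \<in> D \<Longrightarrow> m \<in> D \<Longrightarrow> \<not> crossing N l m"
    and sym: "bc \<Longrightarrow> opp ` D = D"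
  shows "\<exists>T\<in>model_triangulations X n. D \<subseteq> T"
proof -
  define \<F> where "\<F> = {T. T \<subseteq> diagonals N \<and> (\<forall>l\<in>T. \<forall>m\<in>T. \<not> crossing N l m) \<and> (bc \<longrightarrow> opp ` T = T)}"
  have fin: "finite \<F>" by (rule finite_subset[of _ "Pow (diagonals N)"]) (auto simp: \<F>_def finite_diagonals)
  have "D \<in> \<F>" using assms by (auto simp: \<F>_def)
  from finite_has_maximal2[OF fin this]
  obtain T where T0: "T \<in> \<F>" "D \<subseteq> T \<and> (\<forall>T'\<in>\<F>. T \<subseteq> T' \<longrightarrow> T = T')" by (rule bexE)
  then have T: "T \<in> \<F>" "D \<subseteq> T" "\<And>T'. T' \<in> \<F> \<Longrightarrow> T \<subseteq> T' \<Longrightarrow> T = T'" by simp_all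
  have "l \<in> T" if l: "l \<in> diagonals N" "\<And>m. m \<in> T \<Longrightarrow> \<not> crossing N l m" for l
  proof (cases bc)
    case False
    then have "insert l T \<in> \<F>"
      using T(1) l not_crossing_self crossing_commute[OF N_pos] by (auto simp: \<F>_def)
    then show ?thesis using T(3) by blast
  next
    case True
    have symT: "opp ` T = T" "T \<subseteq> diagonals N" using T(1) True by (auto simp: \<F>_def)
    have lo: "\<not> crossing N (opp l) m" if "m \<in> T" for m
    proof
      assume "crossing N (opp l) m"
      then have "crossing N l (opp m)" using crossing_opp opp_opp[OF l(1)] by metis
      then show False using l(2) symT(1) that by blast
    qed
    have TT: "\<not> crossing N u v" if "u \<in> T" "v \<in> T" for u v
      using T(1) that by (simp add: \<F>_def)
    have lm: "\<not> crossing N m l" if "m \<in> T" for m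
      using l(2)[OF that] crossing_commute[OF N_pos] by blast
    have om: "\<not> crossing N m (opp l)" if "m \<in> T" for m
      using lo[OF that] crossing_commute[OF N_pos] by blast
    have ol: "\<not> crossing N (opp l) l"
      using not_crossing_opp crossing_commute[OF N_pos] by blast
    \<comment> \<open>Crossings with \<open>opp l\<close> reduce to crossings with \<open>l\<close>
      by the symmetry of \<open>T\<close>, and \<open>l\<close> does not cross
      \<open>opp l\<close>.\<close>
    have "insert l (insert (opp l) T) \<in> \<F>"
      unfolding \<F>_def
    proof (intro CollectI conjI ballI impI)
      show "insert l (insert (opp l) T) \<subseteq> diagonals N" using l opp_diagonals symT(2) by auto
      fix a b assume "a \<in> insert l (insert (opp l) T)" "b \<in> insert l (insert (opp l) T)"
      then show "\<not> crossing N a b"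
        by (elim insertE) (simp_all add: TT lm om ol l(2) lo not_crossing_self not_crossing_opp)
    next
      show "opp ` insert l (insert (opp l) T) = insert l (insert (opp l) T)"
        using symT(1) opp_opp[OF l(1)] by auto
    qed
    then show ?thesis using T(3) by blast
  qed
  then have "T \<in> model_triangulations X n"
    using T(1) by (auto simp: \<F>_def model_triangulations_def triangulations_def N_def[symmetric] opp_def
        image_image)
  then show ?thesis using T(2) by blast
qed

end

section \<open>Cluster variables and clusters in polygon coordinates\<close>

locale polygon_seed = polygon X n + embedded_field \<iota>
  for X :: cartan_type and n :: nat and \<iota> :: "'k::field_char_0 \<Rightarrow> 'f::field" +
  fixes S :: "'f seed" and x :: "int set set \<Rightarrow> 'f"
  assumes seed: "is_seed \<iota> n S" and model: "polygon_model X n S x"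
begin

definition xx :: "int \<Rightarrow> int \<Rightarrow> 'f" where "xx i j = x (lab i j)"

abbreviation "V \<equiv> cluster_variables n S"

definition cmp :: "'f \<Rightarrow> 'f \<Rightarrow> bool" where
  "cmp v w \<longleftrightarrow> (\<exists>K\<in>clusters n S. v \<in> K \<and> w \<in> K)"

lemma bij_x: "bij_betw x (variable_labels X n) V"
  and clusters_x: "clusters n S = (\<lambda>T. (\<lambda>l. x (label X n l)) ` T) ` model_triangulations X n"
  and edges_x: "L \<in> edge_labels X n \<Longrightarrow> x L = 1"
  and relations_x: "exchange_relations X n x"
  using model by (auto simp: polygon_model_def)

lemma xx_commute: "xx i j = xx j i"
  by (simp add: xx_def lab_commute)

lemma xx_cong: "i mod N = i' mod N \<Longrightarrow> j mod N = j' mod N \<Longrightarrow> xx i j = xx i' j'"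
  unfolding xx_def by (simp add: lab_cong[of i i' j j'])

lemma xx_shift: "xx (i + N) j = xx i j" "xx i (j + N) = xx i j"
  by (auto simp: xx_def lab_shift)

lemma xx_antipode: "bc \<Longrightarrow> xx (i + M) (j + M) = xx i j"
  by (simp add: xx_def lab_antipode)

lemma xx_edge: "xx i (i + 1) = 1"
  unfolding xx_def by (rule edges_x) (auto simp: edge_labels_eq)

lemma finite_V: "finite V"
  using bij_x finite_variable_labels by (simp add: bij_betw_def) (metis finite_imageI)

lemma V_eq: "V = {xx i j | i j. i + 2 \<le> j \<and> j \<le> i + N - 2}"
  using bij_x unfolding bij_betw_def variable_labels_eq xx_def by blast

lemma xx_in_V: "i + 2 \<le> j \<Longrightarrow> j \<le> i + N - 2 \<Longrightarrow> xx i j \<in> V"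
  unfolding V_eq by blast

lemma lab_in_variables: "i + 2 \<le> j \<Longrightarrow> j \<le> i + N - 2 \<Longrightarrow> lab i j \<in> variable_labels X n"
  unfolding variable_labels_eq by blast

lemma xx_eq_iff:
  assumes "i + 2 \<le> j" "j \<le> i + N - 2" "k + 2 \<le> l" "l \<le> k + N - 2"
  shows "xx i j = xx k l \<longleftrightarrow> lab i j = lab k l"
  using bij_x lab_in_variables[OF assms(1,2)] lab_in_variables[OF assms(3,4)]
  by (auto simp: xx_def bij_betw_def inj_on_def)

text \<open>Variables belong to labels, not to diagonals. In types B and C a label stands for an
  antipodal pair, and a symmetric triangulation contains both members or neither, so the
  representatives may be chosen freely.\<close>

lemma cmp_iff:
  assumes "l \<in> diagonals N" "m \<in> diagonals N"
  shows "cmp (x (label X n l)) (x (label X n m)) \<longleftrightarrow> (\<exists>T\<in>model_triangulations X n. l \<in> T \<and> m \<in> T)"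
proof
  assume "cmp (x (label X n l)) (x (label X n m))"
  then obtain T l' m' where T: "T \<in> model_triangulations X n" "l' \<in> T" "m' \<in> T"
    "x (label X n l) = x (label X n l')" "x (label X n m) = x (label X n m')"
    by (auto simp: cmp_def clusters_x)
  have sub: "T \<subseteq> diagonals N" using T(1) by (auto simp: model_triangulations_def triangulations_def N_def)
  have in_T: "k \<in> T" if k: "k \<in> diagonals N" "k' \<in> T" "x (label X n k) = x (label X n k')" for k k'
  proof -
    have "label X n k \<in> variable_labels X n" "label X n k' \<in> variable_labels X n"
      using k sub by (auto simp: variable_labels_def N_def)
    then have eq: "label X n k = label X n k'" using bij_x k(3) by (auto simp: bij_betw_def inj_on_def)
    show ?thesis
    proof (cases bc)
      case True
      then have "k \<in> {k', opp k'}" using eq by (auto simp: label_def opp_def N_def)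
      moreover have "opp ` T = T"
        using T(1) True by (auto simp: model_triangulations_def opp_def N_def)
      ultimately show ?thesis using k(2) by blast
    qed (use eq k(2) in \<open>auto simp: label_def\<close>)
  qed
  show "\<exists>T\<in>model_triangulations X n. l \<in> T \<and> m \<in> T"
    using T in_T[OF assms(1) T(2,4)] in_T[OF assms(2) T(3,5)] by blast
qed (auto simp: cmp_def clusters_x)

lemma crossing_incompatible:
  assumes "a < b" "b < c" "c < d" "d < a + N"
  shows "\<not> cmp (xx a c) (xx b d)"
proof
  assume *: "cmp (xx a c) (xx b d)"
  have "seg N a c \<in> diagonals N" "seg N b d \<in> diagonals N"
    using assms by (auto intro!: seg_diagonal)
  then obtain T where "T \<in> model_triangulations X n" "seg N a c \<in> T" "seg N b d \<in> T"
    using * cmp_iff by (auto simp: xx_def lab_def)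
  moreover have "crossing N (seg N a c) (seg N b d)" using assms crossing_iff[OF N_pos] by blast
  ultimately show False by (auto simp: model_triangulations_def triangulations_def N_def)
qed

text \<open>In types B and C the diagonals \<open>l\<close>, \<open>m\<close> and their images form
  a symmetric noncrossing set, which extends to a symmetric triangulation.\<close>

lemma not_crossing_compatible:
  assumes "l \<in> diagonals N" "m \<in> diagonals N" "\<not> crossing N l m" "bc \<Longrightarrow> \<not> crossing N l (opp m)"
  shows "cmp (x (label X n l)) (x (label X n m))"
proof (cases bc)
  case True
  let ?D = "{l, m, opp l, opp m}"
  have o: "\<not> crossing N (opp l) m"
  proof
    assume "crossing N (opp l) m"
    then have "crossing N l (opp m)" using crossing_opp opp_opp[OF assms(1)] by metis
    then show False using assms(4) True by blast
  qed
  have oo: "\<not> crossing N (opp l) (opp m)"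
  proof
    assume "crossing N (opp l) (opp m)"
    then have "crossing N l m"
      using crossing_opp[of "opp l" "opp m"] opp_opp[OF assms(1)] opp_opp[OF assms(2)] by simp
    then show False using assms(3) by blast
  qed
  have nc: "\<not> crossing N u v" if "u \<in> ?D" "v \<in> ?D" for u v
    using that assms(3) assms(4)[OF True] o oo not_crossing_self not_crossing_opp crossing_commute[OF N_pos] by blast
  have sy: "opp ` ?D = ?D" using opp_opp[OF assms(1)] opp_opp[OF assms(2)] by auto
  have "?D \<subseteq> diagonals N" using assms(1,2) opp_diagonals by simp
  from extend_to_triangulation[OF this nc sy]
  obtain T where "T \<in> model_triangulations X n" "?D \<subseteq> T" by (rule bexE)
  then show ?thesis using cmp_iff[OF assms(1,2)] by blast
next
  case False
  have "\<not> crossing N u v" if "u \<in> {l, m}" "v \<in> {l, m}" for u v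
    using that assms(3) not_crossing_self crossing_commute[OF N_pos] by blast
  then obtain T where "T \<in> model_triangulations X n" "{l, m} \<subseteq> T"
    using extend_to_triangulation[of "{l, m}"] assms False by blast
  then show ?thesis using cmp_iff[OF assms(1,2)] by blast
qed

text \<open>If \<open>[k, l]\<close> does not cross \<open>[i, j]\<close>, its antipodal image does,
  and that image carries the same variable; so incompatibility is always witnessed by an actual
  crossing.\<close>

lemma incompatible_crossing:
  assumes "v \<in> V" "w \<in> V" "\<not> cmp v w"
  obtains a b c d where "a < b" "b < c" "c < d" "d < a + N" "v = xx a c" "w = xx b d"
proof -
  obtain i j where v: "i + 2 \<le> j" "j \<le> i + N - 2" "v = xx i j" using assms(1) by (auto simp: V_eq)
  obtain k l where w: "k + 2 \<le> l" "l \<le> k + N - 2" "w = xx k l" using assms(2) by (auto simp: V_eq)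
  have diag: "seg N i j \<in> diagonals N" "seg N k l \<in> diagonals N"
    unfolding diagonals_iff[OF N_ge] using v w by blast+
  have "crossing N (seg N i j) (seg N k l) \<or> bc \<and> crossing N (seg N i j) (seg N (k + M) (l + M))"
    using not_crossing_compatible[OF diag] assms(3) v(3) w(3) by (auto simp: xx_def lab_def opp_seg)
  moreover have "xx k l = xx (k + M) (l + M)" if bc using xx_antipode[OF that] by simp
  ultimately obtain k' l' where "crossing N (seg N i j) (seg N k' l')" "w = xx k' l'" using w by blast
  then obtain a b c d where "a < b" "b < c" "c < d" "d < a + N" "seg N i j = seg N a c" "seg N k' l' = seg N b d"
    unfolding crossing_iff[OF N_pos] by auto
  then show thesis using that[of a b c d] v(3) \<open>w = xx k' l'\<close> by (auto simp: xx_def lab_def)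
qed

lemma cmp_refl: "v \<in> V \<Longrightarrow> cmp v v"
  by (auto simp: cmp_def cluster_variables_def)

lemma cmp_sym: "cmp v w \<Longrightarrow> cmp w v"
  by (auto simp: cmp_def)

lemma V_nonzero: assumes "v \<in> V" shows "v \<noteq> 0"
proof -
  obtain y B where yB: "(y, B) \<in> mutation_class n S" "v \<in> y ` {..<n}"
    using assms by (auto simp: cluster_variables_def clusters_def)
  then show ?thesis
    using alg_independent_nonzero[OF mutation_class_independent[OF seed yB(1)]] by auto
qed

section \<open>Exchange relations for integer vertices\<close>

lemma relation_A:
  assumes "\<not> bc" "a < b" "b < c" "c < d" "d < a + N"
  shows "xx a c * xx b d = xx a b * xx c d + xx a d * xx b c"
  using relations_x ccw4_I[OF assms(2-5)] assms(1)
  unfolding exchange_relations_def Let_def xx_def lab_def N_def by auto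

lemma relation_1:
  assumes bc "a < b" "b < c" "c < d" "d < a + M"
  shows "xx a c * xx b d = xx a b * xx c d + xx a d * xx b c"
proof -
  have "(antipode N a - a) mod N = M"
    using N_2M M_ge by (simp add: antipode_def M_def[symmetric] mod_diff_left_eq mod_pos_pos_trivial)
  then have "ccw N [a, b, c, d, antipode N a]"
    using assms N_2M by (auto simp: ccw_def mod_pos_pos_trivial)
  then show ?thesis
    using relations_x assms(1) by (auto simp: exchange_relations_def Let_def xx_def lab_def N_def)
qed

lemma seg_antipode: "seg N i (antipode N j) = seg N i (j + M)" "seg N (antipode N i) j = seg N (i + M) j"
  by (auto simp: seg_def antipode_def M_def)

lemma relation_2:
  assumes bc "a < b" "b < c" "c < a + M"
  shows "xx a c * xx a (b + M) = xx a b * xx a (c + M) + xx a (a + M) ^ (2 div type_r X) * xx b c"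
proof -
  have "(antipode N a - a) mod N = M"
    using N_2M M_ge by (simp add: antipode_def M_def[symmetric] mod_diff_left_eq mod_pos_pos_trivial)
  then have "ccw N [a, b, c, antipode N a]"
    using assms N_2M by (auto simp: ccw_def mod_pos_pos_trivial)
  then show ?thesis
    using relations_x assms(1) seg_antipode
    by (auto simp: exchange_relations_def Let_def xx_def lab_def N_def[symmetric])
qed

lemma relation_3:
  assumes bc "a < b" "b < a + M"
  shows "xx a (a + M) * xx b (b + M) = xx a b ^ type_r X + xx a (b + M) ^ type_r X"
proof -
  have "b mod N \<noteq> a mod N" using mod_window[of b N a] assms N_2M by auto
  moreover have "b mod N \<noteq> antipode N a"
    using mod_window[of b N "a + M"] assms N_2M M_ge by (auto simp: antipode_def M_def[symmetric])
  ultimately show ?thesis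
    using relations_x assms(1) seg_antipode
    by (auto simp: exchange_relations_def Let_def xx_def lab_def N_def[symmetric])
qed

end

section \<open>Weights in polygon coordinates and straightening relations\<close>

text \<open>The difference over a rectangle is the sum over its unit cells; the cells with rows from
  \<open>a\<close> to \<open>b - 1\<close> and columns from \<open>c\<close> to \<open>d - 1\<close>
  all lie in the range of \<open>loc\<close>.\<close>

lemma monge_from_local:
  fixes G :: "int \<Rightarrow> int \<Rightarrow> real"
  assumes loc: "\<And>i j. i + 2 \<le> j \<Longrightarrow> j \<le> i + N - 2 \<Longrightarrow> G i (j + 1) + G (i + 1) j < G i j + G (i + 1) (j + 1)"
    and "a < b" "b < c" "c < d" "d < a + N"
  shows "G a d + G b c < G a c + G b d"
proof -
  have row: "G i d + G (i + 1) c < G i c + G (i + 1) d" if "c < d" "i + 2 \<le> c" "d \<le> i + N - 1" for i d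
    using that(1,3)
  proof (induction d rule: int_gr_induct)
    case base
    then show ?case using loc[of i c] that(2) by simp
  next
    case (step d)
    then show ?case using loc[of i d] that(2) by simp
  qed
  show ?thesis using \<open>a < b\<close> \<open>b < c\<close>
  proof (induction b rule: int_gr_induct)
    case base
    then show ?case using row[of d a] assms by simp
  next
    case (step b)
    then show ?case using row[of d b] assms by simp
  qed
qed

context polygon
begin

text \<open>A diameter enters the second family of relations with exponent \<open>2 / r\<close>.
  Counting its weight with this factor, 2 in type B and 1 in type C, also turns the relation of two
  diameters into a quadrilateral inequality, whose opposite sides have equal weight by
  symmetry.\<close>

definition kap :: "int \<Rightarrow> int \<Rightarrow> real" where
  "kap i j = (if bc \<and> (j - i) mod N = M then 2 / real (type_r X) else 1)"

text \<open>Exchange inequalities in types B and C take the form of type A for these coordinates of the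
  polygon with \<open>2 n + 2\<close> vertices.\<close>

definition F :: "(int set set \<Rightarrow> real) \<Rightarrow> int \<Rightarrow> int \<Rightarrow> real" where
  "F u i j = kap i j * u (lab i j)"

text \<open>The difference of the weights of \<open>x\<^sub>i\<^sub>j x\<^sub>i\<^sub>+\<^sub>1\<^sub>,\<^sub>j\<^sub>+\<^sub>1\<close> and of the nontrivial monomial on the right
  of its exchange relation.\<close>

definition cc :: "(int set set \<Rightarrow> real) \<Rightarrow> int \<Rightarrow> int \<Rightarrow> real" where
  "cc u i j = F u i j + F u (i + 1) (j + 1) - F u i (j + 1) - F u (i + 1) j"

definition strict :: "(int set set \<Rightarrow> real) \<Rightarrow> bool" where
  "strict u \<longleftrightarrow> (\<forall>i j. i + 2 \<le> j \<longrightarrow> j \<le> i + N - 2 \<longrightarrow> 0 < cc u i j)"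

lemma type_r_cases: "type_r X = 1 \<or> type_r X = 2"
  by (auto simp: type_r_def)

lemma mod_diff_M_commute: "(j - i) mod N = M \<longleftrightarrow> (i - j) mod N = M"
proof -
  have "(i - j) mod N = M" if "(j - i) mod N = M" for i j
  proof -
    have "(i - j) mod N = (- ((j - i) mod N)) mod N" by (simp add: mod_minus_eq)
    also have "\<dots> = (- M + N) mod N" using that by simp
    also have "- M + N = M" using N_2M by simp
    finally show ?thesis using N_2M M_ge by (simp add: mod_pos_pos_trivial)
  qed
  then show ?thesis by blast
qed

lemma F_commute: "F u i j = F u j i"
  by (simp add: F_def lab_commute kap_def mod_diff_M_commute[of i j])

lemma F_shift: "F u (i + N) j = F u i j" "F u i (j + N) = F u i j"
proof -
  have "(j - (i + N)) mod N = (j - i) mod N" "(j + N - i) mod N = (j - i) mod N"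
    by (simp_all add: mod_eq_dvd_iff)
  then show "F u (i + N) j = F u i j" "F u i (j + N) = F u i j"
    by (simp_all add: F_def lab_shift kap_def)
qed

lemma F_antipode: "bc \<Longrightarrow> F u (i + M) (j + M) = F u i j"
  by (simp add: F_def lab_antipode kap_def)

lemma F_nondiameter: "i < j \<Longrightarrow> j < i + N \<Longrightarrow> \<not> bc \<or> j \<noteq> i + M \<Longrightarrow> F u i j = u (lab i j)"
  by (auto simp: F_def kap_def mod_pos_pos_trivial)

lemma F_diameter: "bc \<Longrightarrow> F u i (i + M) = 2 / real (type_r X) * u (lab i (i + M))"
  using N_2M M_ge by (auto simp: F_def kap_def mod_pos_pos_trivial)

lemma cc_commute: "cc u i j = cc u j (i + N)"
proof -
  have "F u (j + 1) (i + N + 1) = F u (i + 1) (j + 1)" "F u j (i + N + 1) = F u (i + 1) j"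
    using F_shift(2)[of u "j + 1" "i + 1"] F_shift(2)[of u j "i + 1"]
      F_commute[of u "j + 1" "i + 1"] F_commute[of u j "i + 1"]
    by (simp_all add: algebra_simps)
  then show ?thesis by (simp add: cc_def F_shift F_commute[of u j i] F_commute[of u "j + 1" i])
qed

text \<open>The second inequality is the first one for the rotated quadruple
  \<open>b, c, d, a + N\<close>.\<close>

lemma strict_monge:
  assumes "strict u" "a < b" "b < c" "c < d" "d < a + N"
  shows "F u a d + F u b c < F u a c + F u b d" "F u a b + F u c d < F u a c + F u b d"
proof -
  have *: "F u a d + F u b c < F u a c + F u b d" if "a < b" "b < c" "c < d" "d < a + N" for a b c d
  proof (rule monge_from_local[where N = N, OF _ that])
    fix i j assume "i + 2 \<le> j" "j \<le> i + N - 2"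
    then show "F u i (j + 1) + F u (i + 1) j < F u i j + F u (i + 1) (j + 1)"
      using assms(1) unfolding strict_def cc_def by force
  qed
  show "F u a d + F u b c < F u a c + F u b d" using * assms by blast
  have "F u b (a + N) + F u c d < F u b d + F u c (a + N)" using *[of b c d "a + N"] assms by simp
  then show "F u a b + F u c d < F u a c + F u b d"
    by (simp add: F_shift F_commute[of u b a] F_commute[of u c a])
qed

lemma edge_not_variable: "lab i (i + 1) \<notin> variable_labels X n"
proof
  assume "lab i (i + 1) \<in> variable_labels X n"
  then obtain k l where kl: "k + 2 \<le> l" "l \<le> k + N - 2" "lab i (i + 1) = lab k l"
    by (auto simp: variable_labels_eq)
  then have "seg N k l = seg N i (i + 1) \<or> seg N k l = seg N (i + M) (i + 1 + M)"
    by (auto simp: lab_eq split: if_splits)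
  moreover have "i + 1 + M = i + M + 1" by simp
  ultimately have "seg N k l \<in> edges N" unfolding edges_def by (metis (mono_tags, lifting) mem_Collect_eq)
  moreover have "seg N k l \<in> diagonals N" using kl by (intro seg_diagonal)
  ultimately show False by (simp add: diagonals_def)
qed

lemma lab_long_edge: "lab i (i + N - 1) = lab (i - 1) (i - 1 + 1)"
proof -
  have "lab i (i + N - 1) = lab i (i - 1)" by (rule lab_cong) (simp_all add: mod_eq_dvd_iff)
  then show ?thesis by (simp add: lab_commute)
qed

lemma long_edge_not_variable: "lab i (i + N - 1) \<notin> variable_labels X n"
  unfolding lab_long_edge by (rule edge_not_variable)

lemma lab_eqD:
  assumes "lab i j = lab k l"
  shows "(j - i) mod N = (l - k) mod N \<or> (j - i) mod N = (k - l) mod N"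
proof -
  have d: "(j - i) mod N = (l - k) mod N \<or> (j - i) mod N = (k - l) mod N" if "seg N i j = seg N k l" for k l
    using that unfolding seg_eq_iff by (metis mod_diff_cong)
  have "seg N i j \<in> lab k l" using assms by (auto simp: lab_eq split: if_splits)
  then have "seg N i j = seg N k l \<or> seg N i j = seg N (k + M) (l + M)"
    by (auto simp: lab_eq split: if_splits)
  then show ?thesis using d[of k l] d[of "k + M" "l + M"] by auto
qed

end

context polygon_seed
begin

sublocale straightening \<iota> V cmp
  by unfold_locales (rule cmp_refl)

text \<open>Edges receive weight zero, in accordance with \<open>x L = 1\<close> there.\<close>

definition Om :: "('f \<Rightarrow> real) \<Rightarrow> int set set \<Rightarrow> real" where
  "Om \<omega> L = (if L \<in> variable_labels X n then \<omega> (x L) else 0)"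

definition Str :: "('f \<Rightarrow> real) set" where
  "Str = {\<omega>. strict (Om \<omega>)}"

lemma Om_variable: "i + 2 \<le> j \<Longrightarrow> j \<le> i + N - 2 \<Longrightarrow> Om \<omega> (lab i j) = \<omega> (xx i j)"
  by (simp add: Om_def xx_def lab_in_variables)

lemma xx_long_edge: "xx i (i + N - 1) = 1"
  unfolding xx_def lab_long_edge by (rule xx_edge[unfolded xx_def])

lemma xx_one_or_V:
  assumes "i < j" "j < i + N"
  shows "lab i j \<in> variable_labels X n \<and> xx i j \<in> V \<or> lab i j \<notin> variable_labels X n \<and> xx i j = 1"
proof -
  consider "j = i + 1" | "j = i + N - 1" | "i + 2 \<le> j" "j \<le> i + N - 2" using assms by linarith
  then show ?thesis
  proof cases
    case 2
    then show ?thesis using xx_long_edge[of i] long_edge_not_variable[of i] by simp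
  qed (simp_all add: xx_edge edge_not_variable xx_in_V lab_in_variables)
qed

text \<open>Edges carry no variable; the trivial monomial represents their value 1, so the relations
  can be translated without a case distinction at the boundary.\<close>

definition mono :: "nat \<Rightarrow> int \<Rightarrow> int \<Rightarrow> 'f \<Rightarrow>\<^sub>0 nat" where
  "mono e i j = (if lab i j \<in> variable_labels X n then Poly_Mapping.single (xx i j) e else 0)"

lemma mono_eval_mono: "i < j \<Longrightarrow> j < i + N \<Longrightarrow> mono_eval (\<lambda>v. v) (mono e i j) = xx i j ^ e"
  using xx_one_or_V[of i j] by (auto simp: mono_def)

lemma weight_mono: "weight \<omega> (mono e i j) = real e * Om \<omega> (lab i j)"
  by (simp add: mono_def Om_def xx_def)

lemma keys_mono: "i < j \<Longrightarrow> j < i + N \<Longrightarrow> Poly_Mapping.keys (mono e i j) \<subseteq> V"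
  using xx_one_or_V[of i j] by (auto simp: mono_def)

section \<open>Straightening of crossing pairs\<close>

definition bounded_rep :: "'f \<Rightarrow> (('f \<Rightarrow> real) \<Rightarrow> real) \<Rightarrow> bool" where
  "bounded_rep y W \<longleftrightarrow> (\<exists>R\<in>polys_in V. poly_eval \<iota> (\<lambda>v. v) R = y \<and>
     (\<forall>\<omega>\<in>Str. \<forall>m\<in>Poly_Mapping.keys R. weight \<omega> m < W \<omega>))"

lemma bounded_rep_add: "bounded_rep y W \<Longrightarrow> bounded_rep z W \<Longrightarrow> bounded_rep (y + z) W"
proof -
  assume "bounded_rep y W" "bounded_rep z W"
  then obtain R Q where *: "R \<in> polys_in V" "poly_eval \<iota> (\<lambda>v. v) R = y"
    "\<forall>\<omega>\<in>Str. \<forall>m\<in>Poly_Mapping.keys R. weight \<omega> m < W \<omega>"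
    "Q \<in> polys_in V" "poly_eval \<iota> (\<lambda>v. v) Q = z"
    "\<forall>\<omega>\<in>Str. \<forall>m\<in>Poly_Mapping.keys Q. weight \<omega> m < W \<omega>" by (auto simp: bounded_rep_def)
  have "\<forall>\<omega>\<in>Str. \<forall>m\<in>Poly_Mapping.keys (R + Q). weight \<omega> m < W \<omega>"
    using *(3,6) keys_add[of R Q] by blast
  then show ?thesis unfolding bounded_rep_def
    using * by (intro bexI[of _ "R + Q"]) (auto simp: poly_eval_add polys_in_add)
qed

lemma bounded_rep_product:
  assumes "i < j" "j < i + N" "k < l" "l < k + N"
    and "\<And>\<omega>. \<omega> \<in> Str \<Longrightarrow> real e * Om \<omega> (lab i j) + real f * Om \<omega> (lab k l) < W \<omega>"
  shows "bounded_rep (xx i j ^ e * xx k l ^ f) W"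
  unfolding bounded_rep_def
proof (intro bexI conjI)
  let ?m = "mono e i j + mono f k l"
  show "Poly_Mapping.single ?m 1 \<in> polys_in V"
    using keys_mono assms by (intro polys_in_single) (auto simp: nat_keys_add)
  show "poly_eval \<iota> (\<lambda>v. v) (Poly_Mapping.single ?m 1) = xx i j ^ e * xx k l ^ f"
    using assms by (simp add: mono_eval_add mono_eval_mono)
  show "\<forall>\<omega>\<in>Str. \<forall>m\<in>Poly_Mapping.keys (Poly_Mapping.single ?m (1::'k)). weight \<omega> m < W \<omega>"
    using assms(5) by (simp add: weight_add weight_mono)
qed

lemma bounded_rep_product1:
  assumes "i < j" "j < i + N" "k < l" "l < k + N"
    and "\<And>\<omega>. \<omega> \<in> Str \<Longrightarrow> Om \<omega> (lab i j) + Om \<omega> (lab k l) < W \<omega>"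
  shows "bounded_rep (xx i j * xx k l) W"
  using bounded_rep_product[OF assms(1-4), of 1 1 W] assms(5) by simp

lemma bounded_rep_power:
  assumes "i < j" "j < i + N"
    and "\<And>\<omega>. \<omega> \<in> Str \<Longrightarrow> real e * Om \<omega> (lab i j) < W \<omega>"
  shows "bounded_rep (xx i j ^ e) W"
  using bounded_rep_product[OF assms(1,2,1,2), of e 0 W] assms(3) by simp

definition straightens :: "int \<Rightarrow> int \<Rightarrow> int \<Rightarrow> int \<Rightarrow> bool" where
  "straightens a b c d \<longleftrightarrow>
     bounded_rep (xx a c * xx b d) (\<lambda>\<omega>. Om \<omega> (lab a c) + Om \<omega> (lab b d))"

text \<open>The diagonals of a quadrilateral do not depend on the corner from which its vertices are
  listed.\<close>

lemma straightens_rotate: "straightens b c d (a + N) \<Longrightarrow> straightens a b c d"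
  by (simp add: straightens_def xx_shift lab_shift xx_commute[of c a] lab_commute[of c a] mult.commute add.commute)

lemma straightens_A:
  assumes "\<not> bc" "a < b" "b < c" "c < d" "d < a + N"
  shows "straightens a b c d"
  unfolding straightens_def relation_A[OF assms]
proof (intro bounded_rep_add bounded_rep_product1)
  fix \<omega> assume "\<omega> \<in> Str"
  then have "strict (Om \<omega>)" by (simp add: Str_def)
  note m = strict_monge[OF this assms(2-5)]
  show "Om \<omega> (lab a b) + Om \<omega> (lab c d) < Om \<omega> (lab a c) + Om \<omega> (lab b d)"
    "Om \<omega> (lab a d) + Om \<omega> (lab b c) < Om \<omega> (lab a c) + Om \<omega> (lab b d)"
    using m assms by (simp_all add: F_nondiameter)
qed (use assms in auto)

lemma straightens_1:
  assumes bc "a < b" "b < c" "c < d" "d < a + M"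
  shows "straightens a b c d"
  unfolding straightens_def relation_1[OF assms]
proof (intro bounded_rep_add bounded_rep_product1)
  fix \<omega> assume "\<omega> \<in> Str"
  then have st: "strict (Om \<omega>)" by (simp add: Str_def)
  have "d < a + N" using assms(5) N_2M M_ge by simp
  note m = strict_monge[OF st assms(2-4) this]
  show "Om \<omega> (lab a b) + Om \<omega> (lab c d) < Om \<omega> (lab a c) + Om \<omega> (lab b d)"
    "Om \<omega> (lab a d) + Om \<omega> (lab b c) < Om \<omega> (lab a c) + Om \<omega> (lab b d)"
    using m assms N_2M M_ge by (simp_all add: F_nondiameter)
qed (use assms N_2M M_ge in auto)

lemma xx_half: "bc \<Longrightarrow> xx i (j + M) = xx j (i + M)"
proof -
  assume b: bc
  have "xx i (j + M) = xx (i + M) (j + M + M)" by (rule xx_antipode[OF b, symmetric])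
  also have "\<dots> = xx (i + M) j" by (rule xx_cong[OF refl shift_N])
  finally show ?thesis by (simp add: xx_commute)
qed

lemma F_half: "bc \<Longrightarrow> F u i (j + M) = F u j (i + M)"
  using F_antipode[of u i "j + M"] F_shift(2)[of u "i + M" j] N_2M
  by (simp add: F_commute[of u j] algebra_simps)

text \<open>Replacing \<open>[a, b + M]\<close> by its antipodal image \<open>[b, a + M]\<close>,
  and likewise for \<open>c\<close>, turns the second family of relations into one for the
  quadrilateral \<open>a, b, c, a + M\<close>, with the diameter at \<open>a\<close> as a
  side.\<close>

lemma straightens_2:
  assumes bc "a < b" "b < c" "c < a + M"
  shows "straightens a b c (a + M)"
proof -
  have eq: "xx a c * xx b (a + M) = xx a b * xx c (a + M) + xx a (a + M) ^ (2 div type_r X) * xx b c ^ 1"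
    using relation_2[OF assms] assms(1) by (simp add: xx_half[of b a] xx_half[of c a])
  show ?thesis unfolding straightens_def eq
  proof (intro bounded_rep_add bounded_rep_product1 bounded_rep_product)
    fix \<omega> assume "\<omega> \<in> Str"
    then have st: "strict (Om \<omega>)" by (simp add: Str_def)
    have "a + M < a + N" using N_2M M_ge by simp
    note m = strict_monge[OF st assms(2-4) this]
    show "Om \<omega> (lab a b) + Om \<omega> (lab c (a + M)) < Om \<omega> (lab a c) + Om \<omega> (lab b (a + M))"
      using m assms N_2M M_ge by (simp add: F_nondiameter)
    show "real (2 div type_r X) * Om \<omega> (lab a (a + M)) + real 1 * Om \<omega> (lab b c)
        < Om \<omega> (lab a c) + Om \<omega> (lab b (a + M))"
      using m(1) assms N_2M M_ge type_r_cases by (auto simp: F_nondiameter F_diameter)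
  qed (use assms N_2M M_ge in auto)
qed

lemma straightens_3:
  assumes bc "a < b" "b < a + M"
  shows "straightens a b (a + M) (b + M)"
  unfolding straightens_def relation_3[OF assms]
proof (intro bounded_rep_add bounded_rep_power)
  fix \<omega> assume "\<omega> \<in> Str"
  then have st: "strict (Om \<omega>)" by (simp add: Str_def)
  have "a + M < b + M" "b + M < a + N" using assms N_2M M_ge by auto
  note m = strict_monge[OF st assms(2,3) this]
  have eqs: "F (Om \<omega>) (a + M) (b + M) = F (Om \<omega>) a b" "F (Om \<omega>) b (a + M) = F (Om \<omega>) a (b + M)"
    using F_antipode[OF assms(1)] F_half[OF assms(1)] by auto
  show "real (type_r X) * Om \<omega> (lab a b) < Om \<omega> (lab a (a + M)) + Om \<omega> (lab b (b + M))"
    "real (type_r X) * Om \<omega> (lab a (b + M)) < Om \<omega> (lab a (a + M)) + Om \<omega> (lab b (b + M))"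
    using m assms N_2M M_ge type_r_cases unfolding eqs
    by (auto simp: F_nondiameter F_diameter[OF assms(1)])
qed (use assms N_2M M_ge in auto)

lemma xx_nonzero: assumes "i < j" "j < i + N" shows "xx i j \<noteq> 0"
  using xx_one_or_V[OF assms] V_nonzero by auto

text \<open>The third formula is the second family of relations read from the vertex
  \<open>b\<close>, for the vertices \<open>b, c, a + M\<close>.\<close>

lemma base_formulas:
  assumes bc "a < b" "b < c" "c < a + M"
  shows "xx a c * xx a (b + M) = xx a b * xx a (c + M) + xx a (a + M) ^ (2 div type_r X) * xx b c"
    "xx a (a + M) * xx b (b + M) = xx a b ^ type_r X + xx a (b + M) ^ type_r X"
    "xx a (b + M) * xx b (c + M) = xx b c * xx a b + xx b (b + M) ^ (2 div type_r X) * xx a (c + M)"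
    "xx a (a + M) \<noteq> 0" "xx a (b + M) \<noteq> 0"
proof -
  show "xx a c * xx a (b + M) = xx a b * xx a (c + M) + xx a (a + M) ^ (2 div type_r X) * xx b c"
    using relation_2[OF assms] .
  show "xx a (a + M) * xx b (b + M) = xx a b ^ type_r X + xx a (b + M) ^ type_r X"
    using relation_3 assms by auto
  have "xx b (a + M + M) = xx b a" by (rule xx_cong[OF refl shift_N])
  then have "xx b (a + M + M) = xx a b" by (simp only: xx_commute)
  then show "xx a (b + M) * xx b (c + M) = xx b c * xx a b + xx b (b + M) ^ (2 div type_r X) * xx a (c + M)"
    using relation_2[of b c "a + M"] assms by (simp add: xx_half[of b a] xx_half[of c a])
  show "xx a (a + M) \<noteq> 0" "xx a (b + M) \<noteq> 0"
    using xx_nonzero assms N_2M M_ge by auto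
qed

text \<open>Expresses the diagonals between the pairs of \<open>b\<close> and \<open>c\<close> by
  those at \<open>a\<close>, with the diameter at \<open>a\<close> as denominator. The second
  formula is checked after multiplication by the nonzero \<open>xx a (b + M)\<close>.\<close>

lemma base_C:
  assumes "type_r X = 2" bc "a < b" "b < c" "c < a + M"
  shows "xx a (a + M) * xx b c = xx a c * xx a (b + M) - xx a b * xx a (c + M)"
    "xx a (a + M) * xx b (c + M) = xx a b * xx a c + xx a (b + M) * xx a (c + M)"
proof -
  note f = base_formulas[OF assms(2-5)]
  show 1: "xx a (a + M) * xx b c = xx a c * xx a (b + M) - xx a b * xx a (c + M)"
    using f(1) assms(1) by (simp add: algebra_simps)
  have "xx a (b + M) * (xx a (a + M) * xx b (c + M)) =
      (xx a (a + M) * xx b c) * xx a b + (xx a (a + M) * xx b (b + M)) * xx a (c + M)"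
    using f(3) assms(1) by (simp add: algebra_simps)
  also have "\<dots> = xx a (b + M) * (xx a b * xx a c + xx a (b + M) * xx a (c + M))"
    unfolding 1 f(2) using assms(1) by (simp add: algebra_simps power2_eq_square)
  finally show "xx a (a + M) * xx b (c + M) = xx a b * xx a c + xx a (b + M) * xx a (c + M)"
    using f(5) by simp
qed

text \<open>The type B analogue of \<open>base_C\<close>, with the diameter at \<open>a\<close>
  squared. The term with factor 2 is the cross term in the square of the relation of two
  diameters.\<close>

lemma base_B:
  assumes "type_r X = 1" bc "a < b" "b < c" "c < a + M"
  shows "xx a (a + M) ^ 2 * xx b c = xx a c * xx a (b + M) - xx a b * xx a (c + M)"
    "xx a (a + M) ^ 2 * xx b (c + M) =
       xx a b * xx a c + 2 * xx a b * xx a (c + M) + xx a (b + M) * xx a (c + M)"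
proof -
  note f = base_formulas[OF assms(2-5)]
  show 1: "xx a (a + M) ^ 2 * xx b c = xx a c * xx a (b + M) - xx a b * xx a (c + M)"
    using f(1) assms(1) by (simp add: algebra_simps)
  have f3: "xx a (b + M) * xx b (c + M) = xx b c * xx a b + xx b (b + M) ^ 2 * xx a (c + M)"
    using f(3) assms(1) by simp
  have "xx a (b + M) * (xx a (a + M) ^ 2 * xx b (c + M)) =
      xx a (a + M) ^ 2 * (xx a (b + M) * xx b (c + M))" by (simp add: mult_ac)
  also have "\<dots> = (xx a (a + M) ^ 2 * xx b c) * xx a b + (xx a (a + M) * xx b (b + M)) ^ 2 * xx a (c + M)"
    unfolding f3 by (simp add: algebra_simps power_mult_distrib)
  also have "\<dots> = xx a (b + M) *
      (xx a b * xx a c + 2 * xx a b * xx a (c + M) + xx a (b + M) * xx a (c + M))"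
    unfolding 1 f(2) using assms(1) by (simp add: algebra_simps power2_eq_square)
  finally show "xx a (a + M) ^ 2 * xx b (c + M) =
       xx a b * xx a c + 2 * xx a b * xx a (c + M) + xx a (b + M) * xx a (c + M)"
    using f(5) by simp
qed

text \<open>An ordinary diagonal against a diameter is not among the given relations; multiplication
  by the diameter at \<open>a\<close> reduces it to formulas for diagonals at \<open>a\<close>. In
  type B both products on the right contain a diameter, in type C neither does.\<close>

lemma straightens_diameter:
  assumes bc "a < b" "b < c" "c < a + M"
  shows "straightens a b c (b + M)"
proof -
  let ?d = "xx a (a + M)"
  have d: "?d \<noteq> 0" using base_formulas[OF assms] by blast
  have c3: "?d * xx c (c + M) = xx a c ^ type_r X + xx a (c + M) ^ type_r X"
    using relation_3 assms by auto
  have b3: "?d * xx b (b + M) = xx a b ^ type_r X + xx a (b + M) ^ type_r X"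
    using relation_3 assms by auto
  consider "type_r X = 1" | "type_r X = 2" using type_r_cases by blast
  then show ?thesis
  proof cases
    case 1
    have "?d * (xx a c * xx b (b + M)) = xx a c * (?d * xx b (b + M))" by simp
    also have "\<dots> = xx a b * (?d * xx c (c + M)) + ?d ^ 2 * xx b c"
      unfolding b3 c3 base_B(1)[OF 1 assms] using 1 by (simp add: algebra_simps)
    also have "\<dots> = ?d * (xx a b * xx c (c + M) + xx b c * ?d)" by (simp add: algebra_simps power2_eq_square)
    finally have eq: "xx a c * xx b (b + M) = xx a b * xx c (c + M) + xx b c * ?d" using d by simp
    show ?thesis unfolding straightens_def eq
    proof (intro bounded_rep_add bounded_rep_product1)
      fix \<omega> assume "\<omega> \<in> Str"
      then have st: "strict (Om \<omega>)" by (simp add: Str_def)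
      have m1: "F (Om \<omega>) a (b + M) + F (Om \<omega>) b c < F (Om \<omega>) a c + F (Om \<omega>) b (b + M)"
        "F (Om \<omega>) a b + F (Om \<omega>) c (b + M) < F (Om \<omega>) a c + F (Om \<omega>) b (b + M)"
        using strict_monge[OF st, of a b c "b + M"] assms N_2M M_ge by auto
      have m2: "F (Om \<omega>) a (a + M) + F (Om \<omega>) (b + M) (c + M) < F (Om \<omega>) a (b + M) + F (Om \<omega>) (a + M) (c + M)"
        using strict_monge[OF st, of a "a + M" "b + M" "c + M"] assms N_2M M_ge by auto
      have m3: "F (Om \<omega>) c (c + M) + F (Om \<omega>) (a + M) (b + M) < F (Om \<omega>) c (b + M) + F (Om \<omega>) (a + M) (c + M)"
        using strict_monge[OF st, of c "a + M" "b + M" "c + M"] assms N_2M M_ge by auto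
      \<comment> \<open>In type B the weight of a diameter is half of \<open>F\<close>. Each
        inequality is half the sum of one part of \<open>m1\<close> and one of \<open>m2\<close>,
        \<open>m3\<close>.\<close>
      have "F (Om \<omega>) a b + F (Om \<omega>) c (c + M) / 2 < F (Om \<omega>) a c + F (Om \<omega>) b (b + M) / 2"
        "F (Om \<omega>) b c + F (Om \<omega>) a (a + M) / 2 < F (Om \<omega>) a c + F (Om \<omega>) b (b + M) / 2"
        using m1 m2 m3 by (simp_all add: F_antipode[OF assms(1)])
      then show "Om \<omega> (lab a b) + Om \<omega> (lab c (c + M)) < Om \<omega> (lab a c) + Om \<omega> (lab b (b + M))"
        "Om \<omega> (lab b c) + Om \<omega> (lab a (a + M)) < Om \<omega> (lab a c) + Om \<omega> (lab b (b + M))"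
        using assms N_2M M_ge 1 by (auto simp: F_nondiameter F_diameter)
    qed (use assms N_2M M_ge in auto)
  next
    case 2
    have "?d * (xx a c * xx b (b + M)) = xx a c * (?d * xx b (b + M))" by simp
    also have "\<dots> = xx a b * (?d * xx b (c + M)) + (?d * xx b c) * xx a (b + M)"
      unfolding b3 base_C[OF 2 assms] using 2 by (simp add: algebra_simps power2_eq_square)
    also have "\<dots> = ?d * (xx a b * xx c (b + M) + xx b c * xx a (b + M))"
      using xx_half[OF assms(1), of b c] by (simp add: algebra_simps)
    finally have eq: "xx a c * xx b (b + M) = xx a b * xx c (b + M) + xx b c * xx a (b + M)" using d by simp
    show ?thesis unfolding straightens_def eq
    proof (intro bounded_rep_add bounded_rep_product1)
      fix \<omega> assume "\<omega> \<in> Str"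
      then have st: "strict (Om \<omega>)" by (simp add: Str_def)
      have m1: "F (Om \<omega>) a (b + M) + F (Om \<omega>) b c < F (Om \<omega>) a c + F (Om \<omega>) b (b + M)"
        "F (Om \<omega>) a b + F (Om \<omega>) c (b + M) < F (Om \<omega>) a c + F (Om \<omega>) b (b + M)"
        using strict_monge[OF st, of a b c "b + M"] assms N_2M M_ge by auto
      then show "Om \<omega> (lab a b) + Om \<omega> (lab c (b + M)) < Om \<omega> (lab a c) + Om \<omega> (lab b (b + M))"
        "Om \<omega> (lab b c) + Om \<omega> (lab a (b + M)) < Om \<omega> (lab a c) + Om \<omega> (lab b (b + M))"
        using assms N_2M M_ge 2 by (auto simp: F_nondiameter F_diameter)
    qed (use assms N_2M M_ge in auto)
  qed
qed

text \<open>Here \<open>[a, c]\<close> crosses both members \<open>[b, e + M]\<close> and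
  \<open>[e, b + M]\<close> of the antipodal pair. In type B this leads to four terms, with
  \<open>xx b c * xx a e\<close> occurring twice.\<close>

lemma straightens_double:
  assumes bc "a < e" "e < b" "b < c" "c < a + M"
  shows "straightens a b c (e + M)"
proof -
  let ?d = "xx a (a + M)"
  have ebc: "a < b" "e < c" "b < a + M" "e < a + M" using assms by auto
  have d: "?d \<noteq> 0" using base_formulas[OF assms(1) ebc(1) assms(4,5)] by blast
  have m: "F (Om \<omega>) a (e + M) + F (Om \<omega>) b c < F (Om \<omega>) a c + F (Om \<omega>) b (e + M)"
      "F (Om \<omega>) a b + F (Om \<omega>) c (e + M) < F (Om \<omega>) a c + F (Om \<omega>) b (e + M)"
    if "strict (Om \<omega>)" for \<omega>
    using strict_monge[OF that, of a b c "e + M"] assms N_2M M_ge by auto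
  consider "type_r X = 1" | "type_r X = 2" using type_r_cases by blast
  then show ?thesis
  proof cases
    case 1
    note bB = base_B[OF 1 assms(1)]
    have "?d ^ 2 * (xx a c * xx e (b + M)) = xx a c * (?d ^ 2 * xx e (b + M))" by simp
    also have "\<dots> = xx a b * (?d ^ 2 * xx e (c + M)) + (?d ^ 2 * xx b c) * (xx a (e + M) + 2 * xx a e)"
      unfolding bB(2)[OF assms(2,3) ebc(3)] bB(2)[OF assms(2) ebc(2) assms(5)] bB(1)[OF ebc(1) assms(4,5)]
      by (simp add: algebra_simps)
    also have "\<dots> = ?d ^ 2 * (xx a b * xx e (c + M) + xx b c * (xx a (e + M) + 2 * xx a e))"
      by (simp add: algebra_simps)
    finally have "xx a c * xx e (b + M) = xx a b * xx e (c + M) + xx b c * (xx a (e + M) + 2 * xx a e)"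
      using d by simp
    then have eq: "xx a c * xx b (e + M) =
        xx a b * xx c (e + M) + (xx b c * xx a (e + M) + (xx b c * xx a e + xx b c * xx a e))"
      using xx_half[OF assms(1), of b e] xx_half[OF assms(1), of c e] by (simp add: algebra_simps)
    show ?thesis unfolding straightens_def eq
    proof (intro bounded_rep_add bounded_rep_product1)
      fix \<omega> assume "\<omega> \<in> Str"
      then have st: "strict (Om \<omega>)" by (simp add: Str_def)
      have m1: "F (Om \<omega>) a (a + M) + F (Om \<omega>) b c < F (Om \<omega>) a c + F (Om \<omega>) b (a + M)"
        using strict_monge[OF st, of a b c "a + M"] assms N_2M M_ge by auto
      have m2: "F (Om \<omega>) e (e + M) + F (Om \<omega>) b (a + M) < F (Om \<omega>) e (a + M) + F (Om \<omega>) b (e + M)"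
        using strict_monge[OF st, of e b "a + M" "e + M"] assms N_2M M_ge by auto
      have m3: "F (Om \<omega>) a (e + M) + F (Om \<omega>) e (a + M) < F (Om \<omega>) a (a + M) + F (Om \<omega>) e (e + M)"
        "F (Om \<omega>) a e + F (Om \<omega>) (a + M) (e + M) < F (Om \<omega>) a (a + M) + F (Om \<omega>) e (e + M)"
        using strict_monge[OF st, of a e "a + M" "e + M"] assms N_2M M_ge by auto
      \<comment> \<open>\<open>m1\<close> and \<open>m2\<close> add up to an inequality with two
        diameters on its left side; half the sum of the two parts of \<open>m3\<close> replaces
        them.\<close>
      have "F (Om \<omega>) b c + F (Om \<omega>) a e < F (Om \<omega>) a c + F (Om \<omega>) b (e + M)"
        using m1 m2 m3 by (simp add: F_antipode[OF assms(1)] F_half[OF assms(1), of _ a e])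
      then show "Om \<omega> (lab b c) + Om \<omega> (lab a e) < Om \<omega> (lab a c) + Om \<omega> (lab b (e + M))"
        "Om \<omega> (lab b c) + Om \<omega> (lab a e) < Om \<omega> (lab a c) + Om \<omega> (lab b (e + M))"
        using assms N_2M M_ge by (auto simp: F_nondiameter)
      show "Om \<omega> (lab a b) + Om \<omega> (lab c (e + M)) < Om \<omega> (lab a c) + Om \<omega> (lab b (e + M))"
        "Om \<omega> (lab b c) + Om \<omega> (lab a (e + M)) < Om \<omega> (lab a c) + Om \<omega> (lab b (e + M))"
        using m[OF st] assms N_2M M_ge by (auto simp: F_nondiameter)
    qed (use assms N_2M M_ge in auto)
  next
    case 2
    note bC = base_C[OF 2 assms(1)]
    have "?d * (xx a c * xx e (b + M)) = xx a c * (?d * xx e (b + M))" by simp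
    also have "\<dots> = xx a b * (?d * xx e (c + M)) + (?d * xx b c) * xx a (e + M)"
      unfolding bC(2)[OF assms(2,3) ebc(3)] bC(2)[OF assms(2) ebc(2) assms(5)] bC(1)[OF ebc(1) assms(4,5)]
      by (simp add: algebra_simps)
    also have "\<dots> = ?d * (xx a b * xx e (c + M) + xx b c * xx a (e + M))"
      by (simp add: algebra_simps)
    finally have "xx a c * xx e (b + M) = xx a b * xx e (c + M) + xx b c * xx a (e + M)"
      using d by simp
    then have eq: "xx a c * xx b (e + M) = xx a b * xx c (e + M) + xx b c * xx a (e + M)"
      using xx_half[OF assms(1), of b e] xx_half[OF assms(1), of c e] by simp
    show ?thesis unfolding straightens_def eq
    proof (intro bounded_rep_add bounded_rep_product1)
      fix \<omega> assume "\<omega> \<in> Str"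
      then have st: "strict (Om \<omega>)" by (simp add: Str_def)
      show "Om \<omega> (lab a b) + Om \<omega> (lab c (e + M)) < Om \<omega> (lab a c) + Om \<omega> (lab b (e + M))"
        "Om \<omega> (lab b c) + Om \<omega> (lab a (e + M)) < Om \<omega> (lab a c) + Om \<omega> (lab b (e + M))"
        using m[OF st] assms N_2M M_ge by (auto simp: F_nondiameter)
    qed (use assms N_2M M_ge in auto)
  qed
qed

text \<open>With both arcs at most half a turn, the antipode \<open>e\<close> of \<open>d\<close>
  satisfies \<open>e \<le> b\<close>. Its position relative to \<open>a\<close> and
  \<open>b\<close>, and that of \<open>c\<close> relative to \<open>a + M\<close>, distinguish the
  configurations already treated.\<close>

lemma straightens_short:
  assumes bc "a < b" "b < c" "c < d" "d < a + N" "c \<le> a + M" "d \<le> b + M"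
  shows "straightens a b c d"
proof -
  define e where "e = d - M"
  have d: "d = e + M" by (simp add: e_def)
  consider "d < a + M" | "d = a + M" | "a + M < d" "c = a + M" "e = b" | "a + M < d" "c < a + M" "e = b"
    | "a + M < d" "c = a + M" "e < b" | "a + M < d" "c < a + M" "e < b"
    using assms(6,7) unfolding e_def by linarith
  then show ?thesis
  proof cases
    case 1 then show ?thesis using straightens_1 assms by blast
  next
    case 2 then show ?thesis using straightens_2 assms by blast
  next
    case 3 then show ?thesis using straightens_3[of a b] assms by (simp add: d)
  next
    case 4 then show ?thesis using straightens_diameter[of a b c] assms by (simp add: d)
  next
    case 5
    \<comment> \<open>Here \<open>[a, c]\<close> is the diameter; one rotation makes it the second
      diagonal, as \<open>straightens_diameter\<close> expects.\<close>
    then have "straightens b c d (c + M)" using straightens_diameter[of b c d] assms by (simp add: d)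
    moreover have "c + M = a + N" using 5 N_2M by simp
    ultimately show ?thesis using straightens_rotate by simp
  next
    case 6 then show ?thesis using straightens_double[of a e b c] assms by (simp add: d)
  qed
qed

text \<open>Rotations replace a diagonal by its complementary arc; in each of the four cases a
  suitable number of them makes both arcs at most half a turn.\<close>

lemma straightens_crossing:
  assumes "a < b" "b < c" "c < d" "d < a + N"
  shows "straightens a b c d"
proof (cases bc)
  case False
  then show ?thesis using straightens_A assms by blast
next
  case True
  consider "c \<le> a + M" "d \<le> b + M" | "a + M < c" "d \<le> b + M" | "a + M < c" "b + M < d" | "c \<le> a + M" "b + M < d"
    by linarith
  then show ?thesis
  proof cases
    case 1 then show ?thesis using straightens_short[OF True assms] by blast
  next
    case 2
    then show ?thesis
      using straightens_rotate[OF straightens_short[of b c d "a + N"]] True assms N_2M by simp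
  next
    case 3
    then show ?thesis
      using straightens_rotate[OF straightens_rotate[OF straightens_short[of c d "a + N" "b + N"]]] True assms N_2M
      by simp
  next
    case 4
    then show ?thesis
      using straightens_rotate[OF straightens_rotate[OF straightens_rotate[OF
            straightens_short[of d "a + N" "b + N" "c + N"]]]] True assms N_2M
      by simp
  qed
qed

lemma straighten_pair:
  assumes "v \<in> V" "w \<in> V" "\<not> cmp v w"
  shows "\<exists>R\<in>polys_in V. poly_eval \<iota> (\<lambda>v. v) R = v * w \<and>
        (\<forall>\<omega>\<in>Str. \<forall>m\<in>Poly_Mapping.keys R. weight \<omega> m < \<omega> v + \<omega> w)"
proof -
  obtain a b c d where *: "a < b" "b < c" "c < d" "d < a + N" "v = xx a c" "w = xx b d"
    using incompatible_crossing[OF assms] .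
  have "Om \<omega> (lab a c) = \<omega> v" "Om \<omega> (lab b d) = \<omega> w" for \<omega>
    using * Om_variable[of a c] Om_variable[of b d] by auto
  then show ?thesis
    using straightens_crossing[OF *(1-4)] unfolding straightens_def bounded_rep_def *(5,6) by simp
qed

lemma nested_compatible:
  assumes "i + 2 \<le> j" "j \<le> i + N - 2" "bc \<Longrightarrow> j < i + M"
    and "i + 2 \<le> j + 1" "j + 1 \<le> i + N - 2" "i + 1 + 2 \<le> j"
  shows "cmp (xx i (j + 1)) (xx (i + 1) j)"
proof -
  have d: "seg N i (j + 1) \<in> diagonals N" "seg N (i + 1) j \<in> diagonals N"
    using assms by (auto intro!: seg_diagonal)
  have "\<not> crossing N (seg N i (j + 1)) (seg N (i + 1) j)"
    using crossing_nested_False[OF N_pos, of i "i + 1" j "j + 1"] assms by simp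
  moreover have "\<not> crossing N (seg N i (j + 1)) (opp (seg N (i + 1) j))" if bc
  proof -
    have "\<not> crossing N (seg N (j + 1) (i + N)) (seg N (i + 1 + M) (j + M))"
      using assms(1,3) that N_2M M_ge by (intro crossing_nested_False[OF N_pos]) auto
    then show ?thesis by (simp add: opp_seg seg_shift seg_commute)
  qed
  ultimately show ?thesis
    using not_crossing_compatible[OF d] by (simp add: xx_def lab_def)
qed

text \<open>In the quadrilateral \<open>i, i + 1, j, j + 1\<close> two opposite sides are edges, so
  the right side is 1 plus one compatible monomial and \<open>strict_weight\<close> applies. Its
  exponents \<open>e\<close>, \<open>f\<close> are \<open>1, 1\<close> in general,
  \<open>2 div type_r X, 1\<close> if \<open>[i, j + 1]\<close> is a diameter, and
  \<open>type_r X, 0\<close> if \<open>[i, j]\<close> is one.\<close>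

lemma strict_of_initial_ideal:
  assumes eq: "initial_ideal V \<omega> relations = ideal_generated V incompatibles"
  shows "strict (Om \<omega>)"
proof -
  have pos: "0 < cc (Om \<omega>) i j" if ij: "i + 2 \<le> j" "j \<le> i + N - 2" "bc \<Longrightarrow> j \<le> i + M" for i j
  proof -
    have key: "real e * Om \<omega> (lab i (j + 1)) + real f * Om \<omega> (lab (i + 1) j) < Om \<omega> (lab i j) + Om \<omega> (lab (i + 1) (j + 1))"
      if rel: "xx i j * xx (i + 1) (j + 1) = 1 + xx i (j + 1) ^ e * xx (i + 1) j ^ f"
        and c: "f = 0 \<or> (bc \<longrightarrow> j < i + M)" for e f
    proof -
      let ?m = "mono e i (j + 1) + mono f (i + 1) j"
      have "weight \<omega> ?m < \<omega> (xx i j) + \<omega> (xx (i + 1) (j + 1))"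
      proof (rule strict_weight[OF eq])
        show "xx i j \<in> V" "xx (i + 1) (j + 1) \<in> V" using ij by (auto intro: xx_in_V)
        show "\<not> cmp (xx i j) (xx (i + 1) (j + 1))" using ij by (intro crossing_incompatible) auto
        show "Poly_Mapping.keys ?m \<subseteq> V"
          using ij keys_mono[of i "j + 1" e] keys_mono[of "i + 1" j f] by (auto simp: nat_keys_add)
        show "xx i j * xx (i + 1) (j + 1) = 1 + mono_eval (\<lambda>v. v) ?m"
          using rel ij by (simp add: mono_eval_add mono_eval_mono)
        have cm: "cmp (xx i (j + 1)) (xx (i + 1) j)"
          if "lab i (j + 1) \<in> variable_labels X n" "lab (i + 1) j \<in> variable_labels X n" "f \<noteq> 0"
        proof (rule nested_compatible[OF ij(1,2)])
          show "j < i + M" if bc using c \<open>f \<noteq> 0\<close> that by blast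
          have "j + 1 \<noteq> i + N - 1"
          proof
            assume *: "j + 1 = i + N - 1"
            show False using long_edge_not_variable[of i] that(1) unfolding * by blast
          qed
          then show "j + 1 \<le> i + N - 2" using ij by simp
          have "j \<noteq> i + 1 + 1" using edge_not_variable that(2) by blast
          then show "i + 1 + 2 \<le> j" using ij by simp
          show "i + 2 \<le> j + 1" using ij by simp
        qed
        show "compatible_monomial cmp ?m"
          using cm cmp_sym ij keys_mono[of i "j + 1" e] keys_mono[of "i + 1" j f] cmp_refl
          unfolding compatible_monomial_def nat_keys_add by (auto simp: mono_def split: if_splits)
      qed
      moreover have "\<omega> (xx i j) = Om \<omega> (lab i j)" "\<omega> (xx (i + 1) (j + 1)) = Om \<omega> (lab (i + 1) (j + 1))"
        using ij Om_variable[of i j \<omega>] Om_variable[of "i + 1" "j + 1" \<omega>] by auto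
      ultimately show ?thesis by (simp add: weight_add weight_mono)
    qed
    consider "\<not> bc" | "bc" "j + 1 < i + M" | "bc" "j + 1 = i + M" | "bc" "j = i + M" using ij(3) by linarith
    then show ?thesis
    proof cases
      case 1
      have "xx i j * xx (i + 1) (j + 1) = 1 + xx i (j + 1) ^ 1 * xx (i + 1) j ^ 1"
        using relation_A[of i "i + 1" j "j + 1"] 1 ij by (simp add: xx_edge)
      from key[OF this] have "Om \<omega> (lab i (j + 1)) + Om \<omega> (lab (i + 1) j) < Om \<omega> (lab i j) + Om \<omega> (lab (i + 1) (j + 1))"
        using 1 by simp
      moreover have "F (Om \<omega>) i j = Om \<omega> (lab i j)" "F (Om \<omega>) (i + 1) (j + 1) = Om \<omega> (lab (i + 1) (j + 1))"
        "F (Om \<omega>) i (j + 1) = Om \<omega> (lab i (j + 1))" "F (Om \<omega>) (i + 1) j = Om \<omega> (lab (i + 1) j)"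
        by (rule F_nondiameter; use 1 ij in simp)+
      ultimately show ?thesis by (simp add: cc_def)
    next
      case 2
      have "xx i j * xx (i + 1) (j + 1) = 1 + xx i (j + 1) ^ 1 * xx (i + 1) j ^ 1"
        using relation_1[of i "i + 1" j "j + 1"] 2 ij by (simp add: xx_edge)
      from key[OF this] 2 ij N_2M M_ge show ?thesis by (simp add: cc_def F_nondiameter)
    next
      case 3
      have "j + M = i + N - 1" using 3(2) N_2M by simp
      then have "xx i (j + M) = 1" using xx_long_edge by simp
      moreover have "xx i (i + 1 + M) = xx (i + 1) (j + 1)" using 3 xx_half by simp
      ultimately have "xx i j * xx (i + 1) (j + 1) = 1 + xx i (j + 1) ^ (2 div type_r X) * xx (i + 1) j ^ 1"
        using relation_2[of i "i + 1" j] 3 ij by (simp add: xx_edge)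
      from key[OF this] 3 ij N_2M M_ge type_r_cases show ?thesis
        by (auto simp: cc_def F_nondiameter F_diameter)
    next
      case 4
      have "xx i j * xx (i + 1) (j + 1) = 1 + xx i (j + 1) ^ type_r X * xx (i + 1) j ^ 0"
        using relation_3[of i "i + 1"] 4 ij M_ge xx_edge[of i] by (simp add: add_ac)
      from key[OF this] have *: "real (type_r X) * Om \<omega> (lab i (j + 1)) < Om \<omega> (lab i j) + Om \<omega> (lab (i + 1) (j + 1))"
        by simp
      have "F (Om \<omega>) (i + 1) j = F (Om \<omega>) i (j + 1)"
        using F_half[OF 4(1), of "Om \<omega>" "i + 1" i] 4(2) by (simp add: algebra_simps)
      moreover have "F (Om \<omega>) i (j + 1) = Om \<omega> (lab i (j + 1))" using 4 ij by (intro F_nondiameter) auto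
      moreover have "F (Om \<omega>) (i + 1) (j + 1) = 2 / real (type_r X) * Om \<omega> (lab (i + 1) (j + 1))"
        "F (Om \<omega>) i j = 2 / real (type_r X) * Om \<omega> (lab i j)"
        using F_diameter[OF 4(1), of "Om \<omega>" "i + 1"] F_diameter[OF 4(1), of "Om \<omega>" i] 4(2) by (simp_all add: algebra_simps)
      ultimately show ?thesis using * type_r_cases by (auto simp: cc_def)
    qed
  qed
  show ?thesis unfolding strict_def
  proof (intro allI impI)
    fix i j assume ij: "i + 2 \<le> j" "j \<le> i + N - 2"
    show "0 < cc (Om \<omega>) i j"
    proof (cases "bc \<longrightarrow> j \<le> i + M")
      case True
      then show ?thesis using pos ij by blast
    next
      case False
      \<comment> \<open>Beyond half a turn the ends are exchanged.\<close>
      then have "0 < cc (Om \<omega>) j (i + N)" using pos[of j "i + N"] ij N_2M by simp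
      then show ?thesis using cc_commute[of "Om \<omega>" i j] by simp
    qed
  qed
qed

text \<open>The function \<open>d (N - d)\<close> of the length \<open>d\<close> of a diagonal is strictly concave; subtracting
  \<open>N - 1\<close> makes it vanish at edges. The factor in \<open>h0\<close> clears the denominators of \<open>kap\<close>.\<close>

definition q0 :: "int \<Rightarrow> int \<Rightarrow> int" where
  "q0 i j = ((j - i) mod N) * (N - (j - i) mod N) - (N - 1)"

definition h0 :: "'f \<Rightarrow> nat" where
  "h0 v = (let (i, j) = (SOME (i, j). i + 2 \<le> j \<and> j \<le> i + N - 2 \<and> v = xx i j)
     in nat ((if bc \<and> (j - i) mod N = M then int (type_r X) else 2) * q0 i j))"

definition \<omega>0 :: "'f \<Rightarrow> real" where
  "\<omega>0 v = (if v \<in> V then real (h0 v) else 0)"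

text \<open>The representative picked by \<open>SOME\<close> may be a reversed or antipodal one. Its
  length is then \<open>d\<close> or \<open>N - d\<close>, between which neither \<open>q0\<close>
  nor the test for a diameter distinguishes.\<close>

lemma F_\<omega>0:
  assumes ij: "i < j" "j < i + N"
  shows "F (Om \<omega>0) i j = 2 * real_of_int ((j - i) * (N - (j - i)) - (N - 1))"
proof (cases "i + 2 \<le> j \<and> j \<le> i + N - 2")
  case False
  then have "j = i + 1 \<or> j = i + N - 1" using ij by linarith
  moreover have "lab i j \<notin> variable_labels X n"
  proof -
    have "lab i (i + N - 1) = lab (i + N - 1) (i + N - 1 + 1)"
      using lab_shift(2)[of "i + N - 1" i] by (simp add: lab_commute[of i])
    then show ?thesis using edge_not_variable calculation by metis
  qed
  ultimately show ?thesis by (auto simp: F_def Om_def)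
next
  case True
  have V: "xx i j \<in> V" using True xx_in_V by blast
  let ?P = "\<lambda>(k, l). k + 2 \<le> l \<and> l \<le> k + N - 2 \<and> xx i j = xx k l"
  obtain k l where kl: "(SOME p. ?P p) = (k, l)" by fastforce
  have "?P (SOME p. ?P p)" by (rule someI[of ?P "(i, j)"]) (use True in simp)
  then have P: "k + 2 \<le> l" "l \<le> k + N - 2" "xx i j = xx k l" unfolding kl by auto
  then have "lab i j = lab k l" using True xx_eq_iff by blast
  from lab_eqD[OF this]
  have d: "(l - k) mod N = (j - i) mod N \<or> (l - k) mod N = N - (j - i) mod N"
  proof
    assume "(j - i) mod N = (k - l) mod N"
    then have "(j - i) mod N = (- (l - k)) mod N" by simp
    also have "\<dots> = N - (l - k) mod N"
      using P(1,2) by (subst zmod_zminus1_eq_if) (auto simp: mod_pos_pos_trivial)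
    finally show ?thesis by simp
  qed simp
  have e: "(j - i) mod N = j - i" using ij by (simp add: mod_pos_pos_trivial)
  have q: "q0 k l = q0 i j" using d by (elim disjE) (simp_all add: q0_def mult.commute)
  have dM: "(l - k) mod N = M \<longleftrightarrow> (j - i) mod N = M" using d N_2M by auto
  \<comment> \<open>Removes \<open>nat\<close> from \<open>h0\<close>: a length \<open>d\<close>
    between 2 and \<open>N - 2\<close> satisfies
    \<open>d * (N - d) \<ge> 2 * (N - 2) \<ge> N - 1\<close>.\<close>
  have qpos: "0 \<le> q0 i j"
  proof -
    define d where "d = j - i"
    have "2 \<le> d" "d \<le> N - 2" using True by (auto simp: d_def)
    then have "0 \<le> (d - 2) * (N - 2 - d)" by simp
    then have "2 * (N - 2) \<le> d * (N - d)" by (simp add: algebra_simps)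
    then show ?thesis using N_ge unfolding q0_def e by (simp add: d_def)
  qed
  have "h0 (xx i j) = nat ((if bc \<and> (l - k) mod N = M then int (type_r X) else 2) * q0 k l)"
    unfolding h0_def kl by simp
  then have "real (h0 (xx i j)) = (if bc \<and> (j - i) mod N = M then real (type_r X) else 2) * real_of_int (q0 i j)"
    using qpos unfolding q dM by simp
  then have "Om \<omega>0 (lab i j) = (if bc \<and> (j - i) mod N = M then real (type_r X) else 2) * real_of_int (q0 i j)"
    using Om_variable[of i j \<omega>0] True V by (simp add: \<omega>0_def)
  then have "F (Om \<omega>0) i j = 2 * real_of_int (q0 i j)"
    using type_r_cases by (auto simp: F_def kap_def)
  then show ?thesis by (simp add: q0_def e)
qed

text \<open>For \<open>g d = d * (N - d)\<close> the second difference
  \<open>2 * g d - g (d + 1) - g (d - 1)\<close> is 2, and \<open>F\<close> is twice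
  \<open>g\<close> up to a constant.\<close>

lemma \<omega>0_Str: "\<omega>0 \<in> Str"
proof -
  have "cc (Om \<omega>0) i j = 4" if "i + 2 \<le> j" "j \<le> i + N - 2" for i j
  proof -
    have "F (Om \<omega>0) i j = 2 * real_of_int ((j - i) * (N - (j - i)) - (N - 1))"
      "F (Om \<omega>0) (i + 1) (j + 1) = 2 * real_of_int ((j - i) * (N - (j - i)) - (N - 1))"
      "F (Om \<omega>0) i (j + 1) = 2 * real_of_int ((j + 1 - i) * (N - (j + 1 - i)) - (N - 1))"
      "F (Om \<omega>0) (i + 1) j = 2 * real_of_int ((j - (i + 1)) * (N - (j - (i + 1))) - (N - 1))"
      using that F_\<omega>0[of i j] F_\<omega>0[of "i + 1" "j + 1"] F_\<omega>0[of i "j + 1"] F_\<omega>0[of "i + 1" j] by simp_all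
    then show ?thesis by (simp add: cc_def algebra_simps)
  qed
  then show ?thesis by (simp add: Str_def strict_def)
qed

lemma Om_supported: "L \<notin> variable_labels X n \<Longrightarrow> Om \<omega> L = 0"
  by (simp add: Om_def)

end

section \<open>Linear independence of cluster monomials\<close>

text \<open>Renaming variables by the injective \<open>\<sigma>\<close> keeps distinct monomials
  distinct, so a nontrivial relation in the subfamily would be one among \<open>y\<close>.\<close>

lemma (in embedded_field) alg_independent_reindex:
  assumes indep: "alg_independent \<iota> I y" and \<sigma>: "inj_on \<sigma> J" "\<sigma> ` J \<subseteq> I"
  shows "alg_independent \<iota> J (y \<circ> \<sigma>)"
  unfolding alg_independent_def
proof (intro ballI impI)
  fix p assume p: "p \<in> polys_in J" "poly_eval \<iota> (y \<circ> \<sigma>) p = 0"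
  define g where "g m = (\<Sum>j\<in>Poly_Mapping.keys m. Poly_Mapping.single (\<sigma> j) (Poly_Mapping.lookup m j))"
    for m :: "'b \<Rightarrow>\<^sub>0 nat"
  have ev: "mono_eval y (\<Sum>j\<in>A. Poly_Mapping.single (\<sigma> j) (f j)) = (\<Prod>j\<in>A. (y \<circ> \<sigma>) j ^ f j)" for A f
    by (induction A rule: infinite_finite_induct) (auto simp: mono_eval_add)
  have evg: "mono_eval y (g m) = mono_eval (y \<circ> \<sigma>) m" for m
    unfolding g_def ev by (simp add: mono_eval_def)
  have lg: "Poly_Mapping.lookup (g m) (\<sigma> i) = Poly_Mapping.lookup m i"
    if "Poly_Mapping.keys m \<subseteq> J" "i \<in> J" for m i
  proof -
    have "Poly_Mapping.lookup (g m) (\<sigma> i) =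
        (\<Sum>j\<in>Poly_Mapping.keys m. if j = i then Poly_Mapping.lookup m i else 0)"
      unfolding g_def lookup_sum using \<sigma>(1) that
      by (intro sum.cong) (auto simp: lookup_single when_def inj_on_def)
    then show ?thesis by (simp add: sum.delta in_keys_iff)
  qed
  have keysJ: "Poly_Mapping.keys m \<subseteq> J" if "m \<in> Poly_Mapping.keys p" for m
    using polys_in_keysD[OF p(1) that] .
  have inj: "g m = g m' \<longleftrightarrow> m = m'" if "m \<in> Poly_Mapping.keys p" "m' \<in> Poly_Mapping.keys p" for m m'
  proof
    assume eq: "g m = g m'"
    show "m = m'"
    proof (rule poly_mapping_eqI)
      fix i
      show "Poly_Mapping.lookup m i = Poly_Mapping.lookup m' i"
      proof (cases "i \<in> J")
        case True
        then show ?thesis using lg[OF keysJ[OF that(1)]] lg[OF keysJ[OF that(2)]] eq by metis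
      next
        case False
        then have "i \<notin> Poly_Mapping.keys m" "i \<notin> Poly_Mapping.keys m'" using keysJ that by auto
        then show ?thesis by (simp add: in_keys_iff)
      qed
    qed
  qed simp
  define q where "q = (\<Sum>m\<in>Poly_Mapping.keys p. Poly_Mapping.single (g m) (Poly_Mapping.lookup p m))"
  have "poly_eval \<iota> y q = poly_eval \<iota> (y \<circ> \<sigma>) p"
    unfolding q_def poly_eval_sum poly_eval_superset[OF finite_keys subset_refl, of "y \<circ> \<sigma>" p]
    by (simp add: evg)
  moreover have "Poly_Mapping.keys (g m) \<subseteq> I" if "m \<in> Poly_Mapping.keys p" for m
  proof -
    have "Poly_Mapping.keys (g m) \<subseteq> \<sigma> ` Poly_Mapping.keys m"
      unfolding g_def using keys_sum_subset[of "\<lambda>j. Poly_Mapping.single (\<sigma> j) (Poly_Mapping.lookup m j)"]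
      by (fastforce split: if_splits)
    then show ?thesis using keysJ[OF that] \<sigma>(2) by blast
  qed
  then have "q \<in> polys_in I" unfolding q_def by (intro polys_in_sum polys_in_single)
  ultimately have q0: "q = 0" using indep p(2) by (simp add: alg_independent_def)
  show "p = 0"
  proof (rule poly_mapping_eqI)
    fix m
    show "Poly_Mapping.lookup p m = Poly_Mapping.lookup 0 m"
    proof (cases "m \<in> Poly_Mapping.keys p")
      case True
      have "Poly_Mapping.lookup q (g m) =
          (\<Sum>m'\<in>Poly_Mapping.keys p. if m' = m then Poly_Mapping.lookup p m else 0)"
        unfolding q_def lookup_sum using inj True
        by (intro sum.cong) (auto simp: lookup_single when_def)
      then show ?thesis using q0 True by simp
    qed (simp add: in_keys_iff)
  qed
qed

text \<open>Two multisets with equal exponents share an element by \<open>share\<close>. Removing it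
  from both preserves all hypotheses, so induction on the size shows that they agree; only a common
  chord remains to be found in each type.\<close>

lemma multiplicities_determined:
  fixes \<alpha> :: "'c \<Rightarrow> 'p \<Rightarrow> int" and \<mu> \<mu>' :: "'c \<Rightarrow> nat"
  assumes "finite C"
    and share: "\<And>\<mu> \<mu>'. NC {c \<in> C. 0 < \<mu> c} \<Longrightarrow> NC {c \<in> C. 0 < \<mu>' c} \<Longrightarrow>
      (\<And>p. (\<Sum>c\<in>C. int (\<mu> c) * \<alpha> c p) = (\<Sum>c\<in>C. int (\<mu>' c) * \<alpha> c p)) \<Longrightarrow>
      {c \<in> C. 0 < \<mu> c} \<noteq> {} \<Longrightarrow> {c \<in> C. 0 < \<mu> c} \<inter> {c \<in> C. 0 < \<mu>' c} \<noteq> {}"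
    and mono: "\<And>A B. NC B \<Longrightarrow> A \<subseteq> B \<Longrightarrow> NC A"
    and NC: "NC {c \<in> C. 0 < \<mu> c}" "NC {c \<in> C. 0 < \<mu>' c}"
    and eq: "\<And>p. (\<Sum>c\<in>C. int (\<mu> c) * \<alpha> c p) = (\<Sum>c\<in>C. int (\<mu>' c) * \<alpha> c p)"
    and c: "c \<in> C"
  shows "\<mu> c = \<mu>' c"
  using NC eq c
proof (induction "\<Sum>c\<in>C. \<mu> c" arbitrary: \<mu> \<mu>' c rule: less_induct)
  case less
  show ?case
  proof (cases "{c \<in> C. 0 < \<mu> c} = {}")
    case True
    \<comment> \<open>\<open>share\<close> speaks about a nonempty first support, hence the exchange
      of roles.\<close>
    have "{c \<in> C. 0 < \<mu>' c} = {}"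
      using share[OF less.prems(2,1) less.prems(3)[symmetric]] True by blast
    then show ?thesis using True less.prems(4) by auto
  next
    case False
    obtain d where d: "d \<in> C" "0 < \<mu> d" "0 < \<mu>' d"
      using share[OF less.prems(1-3) False] by auto
    let ?\<mu> = "\<mu>(d := \<mu> d - 1)" and ?\<mu>' = "\<mu>'(d := \<mu>' d - 1)"
    have sum_upd: "(\<Sum>c\<in>C. int ((f(d := f d - 1)) c) * \<alpha> c p) = (\<Sum>c\<in>C. int (f c) * \<alpha> c p) - \<alpha> d p"
      if "0 < f d" for f p
    proof -
      have "(\<Sum>c\<in>C. int ((f(d := f d - 1)) c) * \<alpha> c p)
          = (\<Sum>c\<in>C. int (f c) * \<alpha> c p - (if c = d then \<alpha> d p else 0))"
        using that by (intro sum.cong) (auto simp: algebra_simps of_nat_diff)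
      then show ?thesis using assms(1) d(1) by (simp add: sum_subtractf sum.delta)
    qed
    have "?\<mu> c = ?\<mu>' c"
    proof (rule less.hyps)
      show "(\<Sum>c\<in>C. ?\<mu> c) < (\<Sum>c\<in>C. \<mu> c)"
        using assms(1) d by (intro sum_strict_mono_ex1) auto
      show "NC {c \<in> C. 0 < ?\<mu> c}" by (rule mono[OF less.prems(1)]) auto
      show "NC {c \<in> C. 0 < ?\<mu>' c}" by (rule mono[OF less.prems(2)]) auto
      show "(\<Sum>c\<in>C. int (?\<mu> c) * \<alpha> c p) = (\<Sum>c\<in>C. int (?\<mu>' c) * \<alpha> c p)" for p
        unfolding sum_upd[where f = \<mu>, OF d(2)] sum_upd[where f = \<mu>', OF d(3)] using less.prems(3)[of p] by simp
    qed (rule less.prems(4))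
    then show ?thesis using d by (cases "c = d") auto
  qed
qed

text \<open>\<open>P\<close>, \<open>P'\<close> are chords inside an interval; \<open>B\<close>,
  \<open>B'\<close> are the feet of chords leaving it. The shortest chord \<open>(i, j)\<close> of
  \<open>P\<close> is common: a chord of \<open>P'\<close> ending at \<open>j\<close> cannot start
  between \<open>i\<close> and \<open>j\<close>, since an opener of \<open>P\<close> there would
  contradict minimality or noncrossing. If it starts before \<open>i\<close>, then \<open>i\<close>
  opens a chord of \<open>P'\<close>, whose end is forced to be \<open>j\<close>.\<close>

lemma shared_inner_chord:
  fixes P P' :: "(int \<times> int) set" and B B' :: "int set"
  assumes fin: "finite P" and inner: "\<And>i j. (i, j) \<in> P \<union> P' \<Longrightarrow> 0 \<le> i \<and> i + 2 \<le> j \<and> j \<le> R"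
    and ncP: "\<And>i j k l. (i, j) \<in> P \<Longrightarrow> (k, l) \<in> P \<Longrightarrow> \<not> (i < k \<and> k < j \<and> j < l)"
    and ncP': "\<And>i j k l. (i, j) \<in> P' \<Longrightarrow> (k, l) \<in> P' \<Longrightarrow> \<not> (i < k \<and> k < j \<and> j < l)"
    and ncB: "\<And>i j v. (i, j) \<in> P \<Longrightarrow> v \<in> B \<Longrightarrow> \<not> (i < v \<and> v < j)"
    and ncB': "\<And>i j v. (i, j) \<in> P' \<Longrightarrow> v \<in> B' \<Longrightarrow> \<not> (i < v \<and> v < j)"
    and closers: "\<And>p. 2 \<le> p \<Longrightarrow> p \<le> R \<Longrightarrow> (\<exists>i. (i, p) \<in> P) \<longleftrightarrow> (\<exists>i. (i, p) \<in> P')"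
    and openers: "\<And>v. 1 \<le> v \<Longrightarrow> v \<le> R - 1 \<Longrightarrow>
      ((\<exists>j. (v, j) \<in> P) \<or> v \<in> B) \<longleftrightarrow> ((\<exists>j. (v, j) \<in> P') \<or> v \<in> B')"
    and ne: "P \<noteq> {}"
  shows "P \<inter> P' \<noteq> {}"
proof -
  define c where "c = arg_min_on (\<lambda>(i, j). j - i) P"
  obtain i j where ij: "c = (i, j)" by fastforce
  have iP: "(i, j) \<in> P" using arg_min_if_finite(1)[OF fin ne, of "\<lambda>(i, j). j - i"] ij by (simp add: c_def)
  have min: "j - i \<le> l - k" if "(k, l) \<in> P" for k l
    using arg_min_if_finite(2)[OF fin ne, of "\<lambda>(i, j). j - i"] ij that unfolding c_def by force
  have bij: "0 \<le> i" "i + 2 \<le> j" "j \<le> R" using inner[of i j] iP by auto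
  obtain i' where i': "(i', j) \<in> P'" using closers[of j] bij iP by auto
  have bi': "0 \<le> i'" "i' + 2 \<le> j" using inner[of i' j] i' by auto
  have le: "i' \<le> i"
  proof (rule ccontr)
    assume "\<not> i' \<le> i"
    then have "(\<exists>l. (i', l) \<in> P) \<or> i' \<in> B" using openers[of i'] i' bi' bij by auto
    then show False
    proof
      assume "\<exists>l. (i', l) \<in> P"
      then obtain l where l: "(i', l) \<in> P" by blast
      show False using min[OF l] ncP[OF iP l] \<open>\<not> i' \<le> i\<close> bi' by auto
    next
      assume "i' \<in> B"
      then show False using ncB[OF iP, of i'] \<open>\<not> i' \<le> i\<close> bi' by auto
    qed
  qed
  show ?thesis
  proof (cases "i' = i")
    case True
    then show ?thesis using iP i' by auto
  next
    case False
    then have "1 \<le> i" using le bi' by simp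
    then have "(\<exists>l. (i, l) \<in> P') \<or> i \<in> B'" using openers[of i] iP bij by auto
    moreover have "i \<notin> B'" using ncB'[OF i', of i] le False bij by auto
    ultimately obtain l where l: "(i, l) \<in> P'" by blast
    have "j \<le> l"
    proof (rule ccontr)
      assume "\<not> j \<le> l"
      have bl: "i + 2 \<le> l" "l \<le> R" using inner[of i l] l by auto
      then obtain k where k: "(k, l) \<in> P" using closers[of l] l bij by auto
      show False using min[OF k] ncP[OF k iP] \<open>\<not> j \<le> l\<close> bl by auto
    qed
    moreover have "\<not> j < l" using ncP'[OF i' l] le False bij by auto
    ultimately show ?thesis using l iP by auto
  qed
qed

lemma sum_pos_iff_support:
  fixes f :: "'c \<Rightarrow> int"
  assumes "finite C" "\<And>c. c \<in> C \<Longrightarrow> 0 \<le> f c"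
  shows "0 < (\<Sum>c\<in>C. f c) \<longleftrightarrow> (\<exists>c\<in>C. 0 < f c)"
proof
  assume *: "0 < (\<Sum>c\<in>C. f c)"
  show "\<exists>c\<in>C. 0 < f c"
  proof (rule ccontr)
    assume "\<not> (\<exists>c\<in>C. 0 < f c)"
    then have "\<forall>c\<in>C. f c = 0" using assms(2) by force
    then show False using * by simp
  qed
next
  assume "\<exists>c\<in>C. 0 < f c"
  then obtain c where "c \<in> C" "0 < f c" by blast
  then show "0 < (\<Sum>c\<in>C. f c)" using assms by (intro sum_pos2) auto
qed

text \<open>Within each family positive and negative contributions exclude each other, so the value
  of the difference determines both sums.\<close>

lemma split_difference:
  fixes f g f' g' :: "'c \<Rightarrow> int"
  assumes fin: "finite C" and nn: "\<And>c. c \<in> C \<Longrightarrow> 0 \<le> f c \<and> 0 \<le> g c \<and> 0 \<le> f' c \<and> 0 \<le> g' c"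
    and ex: "\<And>c d. c \<in> C \<Longrightarrow> d \<in> C \<Longrightarrow> 0 < f c \<Longrightarrow> 0 < g d \<Longrightarrow> False"
    and ex': "\<And>c d. c \<in> C \<Longrightarrow> d \<in> C \<Longrightarrow> 0 < f' c \<Longrightarrow> 0 < g' d \<Longrightarrow> False"
    and eq: "(\<Sum>c\<in>C. f c - g c) = (\<Sum>c\<in>C. f' c - g' c)"
  shows "(\<exists>c\<in>C. 0 < f c) \<longleftrightarrow> (\<exists>c\<in>C. 0 < f' c)" "(\<exists>c\<in>C. 0 < g c) \<longleftrightarrow> (\<exists>c\<in>C. 0 < g' c)"
proof -
  have nnS: "0 \<le> sum f C" "0 \<le> sum g C" "0 \<le> sum f' C" "0 \<le> sum g' C"
    using nn by (auto intro: sum_nonneg)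
  have e: "sum f C = 0 \<or> sum g C = 0" "sum f' C = 0 \<or> sum g' C = 0"
    using sum_pos_iff_support[OF fin, of f] sum_pos_iff_support[OF fin, of g]
      sum_pos_iff_support[OF fin, of f'] sum_pos_iff_support[OF fin, of g'] nn ex ex' nnS
    by (metis order_le_less)+
  have "sum f C = sum f' C" "sum g C = sum g' C"
    using e nnS eq by (auto simp: sum_subtractf)
  then show "(\<exists>c\<in>C. 0 < f c) \<longleftrightarrow> (\<exists>c\<in>C. 0 < f' c)" "(\<exists>c\<in>C. 0 < g c) \<longleftrightarrow> (\<exists>c\<in>C. 0 < g' c)"
    using sum_pos_iff_support[OF fin, of f] sum_pos_iff_support[OF fin, of g]
      sum_pos_iff_support[OF fin, of f'] sum_pos_iff_support[OF fin, of g'] nn by auto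
qed

context leading_exponents
begin

definition smul :: "nat \<Rightarrow> ('i \<Rightarrow> int) \<Rightarrow> 'i \<Rightarrow> int" where
  "smul k \<alpha> = (\<lambda>i. int k * \<alpha> i)"

lemma wt_smul: "wt (smul k \<alpha>) = real k * wt \<alpha>"
  by (simp add: wt_def smul_def sum_distrib_left mult_ac)

lemma lead_eqI: "lead y \<alpha> \<Longrightarrow> (\<And>p. \<alpha> p = \<beta> p) \<Longrightarrow> lead y \<beta>"
  by (metis ext)

lemma lead_power: "lead y \<alpha> \<Longrightarrow> lead (y ^ k) (smul k \<alpha>)"
proof (induction k)
  case 0
  have "smul 0 \<alpha> = 0" by (simp add: smul_def zero_fun_def)
  then show ?case using lead_one by (simp only: power_0)
next
  case (Suc k)
  have "smul (Suc k) \<alpha> = \<alpha> + smul k \<alpha>" by (simp add: smul_def fun_eq_iff algebra_simps)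
  then show ?case using lead_mult[OF Suc.prems Suc.IH[OF Suc.prems]] by (simp only: power_Suc)
qed

lemma lead_monomial:
  assumes "finite C" "\<And>c. c \<in> C \<Longrightarrow> lead (f c) (\<alpha> c)"
  shows "lead (\<Prod>c\<in>C. f c ^ k c) (\<lambda>p. \<Sum>c\<in>C. int (k c) * \<alpha> c p)"
proof -
  have "lead (\<Prod>c\<in>C. f c ^ k c) (\<Sum>c\<in>C. smul (k c) (\<alpha> c))"
    using assms by (intro lead_prod lead_power)
  moreover have "(\<Sum>c\<in>C. smul (k c) (\<alpha> c)) p = (\<Sum>c\<in>C. int (k c) * \<alpha> c p)" for p
    using assms(1) by (induction C rule: finite_induct) (auto simp: smul_def)
  then have "(\<Sum>c\<in>C. smul (k c) (\<alpha> c)) = (\<lambda>p. \<Sum>c\<in>C. int (k c) * \<alpha> c p)" by (rule ext)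
  ultimately show ?thesis by simp
qed

end

context polygon
begin

lemma not_crossing_common_vertex: "\<not> crossing N (seg N i j) (seg N i k)"
proof
  assume "crossing N (seg N i j) (seg N i k)"
  then obtain a b c d where *: "a < b" "b < c" "c < d" "d < a + N" "seg N i j = seg N a c" "seg N i k = seg N b d"
    unfolding crossing_iff[OF N_pos] by auto
  then have "i mod N = a mod N \<or> i mod N = c mod N" "i mod N = b mod N \<or> i mod N = d mod N"
    by (auto simp: seg_eq_iff)
  then have "a mod N = b mod N \<or> a mod N = d mod N \<or> c mod N = b mod N \<or> c mod N = d mod N" by auto
  then show False
    using mod_window[of a N b] mod_window[of a N d] mod_window[of c N b] mod_window[of c N d] * by auto
qed

text \<open>Indices of the fan at vertex 0. In types B and C it stops at the diameter
  \<open>[0, M]\<close>, and the antipodal image supplies the other half of a symmetric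
  triangulation.\<close>

definition J :: "int set" where "J = (if bc then {2..M} else {2..N - 2})"

text \<open>The factor at \<open>M\<close> gives the exponent vector \<open>ehat M\<close> the weight \<open>3 ^ nat M\<close>.\<close>

definition wt_fan :: "int \<Rightarrow> real" where
  "wt_fan j = (if bc \<and> j = M then real (type_r X) / 2 * 3 ^ nat j else 3 ^ nat j)"

lemma finite_J: "finite J"
  by (simp add: J_def)

lemma J_bc: "bc \<Longrightarrow> j \<in> J \<longleftrightarrow> 2 \<le> j \<and> j \<le> M"
  by (simp add: J_def)

lemma J_bounds: "j \<in> J \<Longrightarrow> 2 \<le> j \<and> j \<le> N - 2 \<and> (bc \<longrightarrow> j \<le> M)"
  using N_2M M_ge by (auto simp: J_def split: if_splits)

lemma fan_not_crossing_opp: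
  assumes bc "j \<in> J" "k \<in> J" shows "\<not> crossing N (seg N 0 j) (opp (seg N 0 k))"
proof (cases "j = M \<or> k = M")
  case False
  then have "\<not> crossing N (seg N j (0 + N)) (seg N M (k + M))"
    using J_bounds[OF assms(2)] J_bounds[OF assms(3)] assms(1) N_2M
    by (intro crossing_nested_False[OF N_pos]) auto
  moreover have "seg N j (0 + N) = seg N 0 j" unfolding seg_shift by (rule seg_commute)
  moreover have "opp (seg N 0 k) = seg N M (k + M)" by (simp add: opp_seg)
  ultimately show ?thesis by simp
next
  case True
  then show ?thesis
  proof
    assume "j = M"
    then show ?thesis using not_crossing_common_vertex[of M 0 "k + M"] by (simp add: opp_seg seg_commute)
  next
    assume k: "k = M"
    have "seg N M (M + M) = seg N 0 M" using seg_cong[of M N M "M + M" 0] N_2M by (simp add: seg_commute)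
    then have "opp (seg N 0 k) = seg N 0 M" using k by (simp add: opp_seg)
    then show ?thesis using not_crossing_common_vertex by simp
  qed
qed

text \<open>Fan diagonals share the vertex 0, and those of the antipodal fan lie on the other side
  of the diameter \<open>[0, M]\<close>, so the union is noncrossing.\<close>

lemma fan_extends: "\<exists>T\<in>model_triangulations X n. (\<lambda>j. seg N 0 j) ` J \<subseteq> T"
proof -
  let ?D = "(\<lambda>j. seg N 0 j) ` J"
  have D: "?D \<subseteq> diagonals N" using J_bounds seg_diagonal by fastforce
  have nc: "\<not> crossing N u v" if "u \<in> ?D" "v \<in> ?D" for u v
    using that not_crossing_common_vertex by auto
  show ?thesis
  proof (cases bc)
    case False
    from extend_to_triangulation[OF D nc] False show ?thesis by blast
  next
    case True
    have oD: "opp (opp u) = u" if "u \<in> ?D" for u using opp_opp D that by blast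
    have sub: "?D \<union> opp ` ?D \<subseteq> diagonals N" using D opp_diagonals by blast
    have uo: "\<not> crossing N u (opp v)" if "u \<in> ?D" "v \<in> ?D" for u v
      using that fan_not_crossing_opp[OF True] by auto
    have nc2: "\<not> crossing N u v" if uv: "u \<in> ?D \<union> opp ` ?D" "v \<in> ?D \<union> opp ` ?D" for u v
    proof -
      have "\<not> crossing N (opp u) v" if "u \<in> ?D" "v \<in> ?D" for u v
        using uo[OF that(2,1)] crossing_commute[OF N_pos] by blast
      moreover have "\<not> crossing N (opp u) (opp v)" if "u \<in> ?D" "v \<in> ?D" for u v
        using nc[OF that] crossing_opp[of "opp u" "opp v"] oD that by metis
      ultimately show ?thesis using uv nc uo by (elim UnE imageE) auto
    qed
    have sy: "opp ` (?D \<union> opp ` ?D) = ?D \<union> opp ` ?D"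
    proof -
      have "opp ` opp ` ?D = ?D" using oD by (force simp: image_iff)
      then show ?thesis by (auto simp: image_Un)
    qed
    from extend_to_triangulation[OF sub nc2 sy]
    obtain T where "T \<in> model_triangulations X n" "?D \<union> opp ` ?D \<subseteq> T" by (rule bexE)
    then show ?thesis by blast
  qed
qed

lemma fan_injective: assumes "j \<in> J" "k \<in> J" "lab 0 j = lab 0 k" shows "j = k"
proof -
  note b = J_bounds[OF assms(1)] J_bounds[OF assms(2)]
  have "seg N 0 j \<in> lab 0 k" using assms(3) by (auto simp: lab_eq split: if_splits)
  then have "seg N 0 j = seg N 0 k \<or> bc \<and> seg N 0 j = seg N M (k + M)"
    by (auto simp: lab_eq split: if_splits)
  then show ?thesis
  proof
    assume "seg N 0 j = seg N 0 k"
    then have "j mod N = k mod N \<or> 0 mod N = k mod N" by (auto simp: seg_eq_iff)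
    then show ?thesis using mod_window[of j N k] mod_window[of 0 N k] b by auto
  next
    assume *: "bc \<and> seg N 0 j = seg N M (k + M)"
    have "0 mod N \<noteq> M mod N" using mod_window[of 0 N M] N_2M M_ge by auto
    then have **: "0 mod N = (k + M) mod N" "j mod N = M mod N" using * by (auto simp: seg_eq_iff)
    then have "N mod N = (k + M) mod N" by simp
    then have "N = k + M" using mod_window[of N N "k + M"] b * N_2M M_ge by auto
    moreover have "j = M" using mod_window[of j N M] ** b * N_2M M_ge by auto
    ultimately show ?thesis using N_2M by simp
  qed
qed

end

context polygon_seed
begin

section \<open>Leading exponents of the cluster variables\<close>

definition t :: "int \<Rightarrow> 'f" where "t j = xx 0 j"

text \<open>The fan is part of a cluster, and clusters of the mutation class are algebraically
  independent; \<open>\<sigma>\<close> locates the fan variables among the entries of a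
  seed.\<close>

lemma fan_independent: "alg_independent \<iota> J t"
proof -
  obtain T where T: "T \<in> model_triangulations X n" "(\<lambda>j. seg N 0 j) ` J \<subseteq> T" using fan_extends by blast
  define K where "K = (\<lambda>l. x (label X n l)) ` T"
  have "K \<in> clusters n S" using T(1) clusters_x by (simp add: K_def)
  then obtain y B where y: "(y, B) \<in> mutation_class n S" "K = y ` {..<n}" by (auto simp: clusters_def)
  have tK: "t j \<in> y ` {..<n}" if "j \<in> J" for j
    using that T(2) unfolding y(2)[symmetric] K_def t_def xx_def lab_def by blast
  have "\<forall>j\<in>J. \<exists>i. i < n \<and> y i = t j"
  proof
    fix j assume "j \<in> J"
    from tK[OF this] show "\<exists>i. i < n \<and> y i = t j" by auto
  qed
  from bchoice[OF this] obtain \<sigma> where "\<forall>j\<in>J. \<sigma> j < n \<and> y (\<sigma> j) = t j" by (rule exE)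
  then have \<sigma>: "\<And>j. j \<in> J \<Longrightarrow> \<sigma> j < n \<and> y (\<sigma> j) = t j" by blast
  have "inj_on \<sigma> J"
  proof (rule inj_onI)
    fix j k assume jk: "j \<in> J" "k \<in> J" "\<sigma> j = \<sigma> k"
    then have "xx 0 j = xx 0 k" using \<sigma> unfolding t_def by metis
    then have "lab 0 j = lab 0 k" using xx_eq_iff[of 0 j 0 k] J_bounds[OF jk(1)] J_bounds[OF jk(2)] by simp
    then show "j = k" using fan_injective jk by blast
  qed
  then have "alg_independent \<iota> J (y \<circ> \<sigma>)"
    using alg_independent_reindex[OF mutation_class_independent[OF seed y(1)]] \<sigma> by auto
  moreover have "poly_eval \<iota> (y \<circ> \<sigma>) p = poly_eval \<iota> t p" if "p \<in> polys_in J" for p :: "(int, 'k) mpolynomial"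
    unfolding poly_eval_superset[OF finite_keys subset_refl]
    using polys_in_keysD[OF that] \<sigma> by (intro sum.cong refl arg_cong2[where f = times] mono_eval_cong) auto
  ultimately show ?thesis by (simp add: alg_independent_def)
qed

sublocale L: leading_exponents \<iota> J t wt_fan
  by unfold_locales (rule finite_J, rule fan_independent)

abbreviation e :: "int \<Rightarrow> int \<Rightarrow> int" where "e j \<equiv> L.basis_exp j"

lemma e_outside: "j \<notin> J \<Longrightarrow> e j = 0"
  by (rule L.basis_outside)

text \<open>The factor 3 from one index to the next leaves enough room for comparisons such as
  \<open>4 * W i + 4 * W j < 2 * W M\<close> with \<open>i < j < M\<close> in
  \<open>lead_outer\<close>.\<close>

definition W :: "int \<Rightarrow> real" where "W j = 3 ^ nat j"

lemma W_Suc: "0 \<le> j \<Longrightarrow> W (j + 1) = 3 * W j"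
  by (simp add: W_def nat_add_distrib)

lemma W_pos: "0 < W j"
  by (simp add: W_def)

lemma W_less: "0 \<le> i \<Longrightarrow> i < j \<Longrightarrow> 3 * W i \<le> W j"
proof -
  assume *: "0 \<le> i" "i < j"
  have "3 * W i = 3 ^ (nat (i + 1))" using W_Suc[OF *(1)] by (simp add: W_def)
  also have "\<dots> \<le> W j" unfolding W_def using * by (intro power_increasing) auto
  finally show ?thesis .
qed

lemma wt_e: "L.wt (e j) = (if j \<in> J then (if bc \<and> j = M then real (type_r X) / 2 * W M else W j) else 0)"
  by (simp add: L.wt_basis wt_fan_def W_def)

lemma wt_e_bc: "bc \<Longrightarrow> L.wt (e j) =
    (if 2 \<le> j \<and> j \<le> M then (if j = M then real (type_r X) / 2 * W M else W j) else 0)"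
  by (simp add: wt_e J_bc)

lemma e_one: "e 1 = 0"
  by (rule e_outside) (use J_bounds[of 1] in auto)

lemma wt_e_le: "\<not> bc \<or> j < M \<Longrightarrow> L.wt (e j) \<le> W j"
  using W_pos[of j] by (auto simp: wt_e)

lemma lead_t:
  assumes "1 \<le> j" "j \<le> N - 1" "bc \<Longrightarrow> j \<le> M" shows "L.lead (xx 0 j) (e j)"
proof (cases "j \<in> J")
  case True
  then show ?thesis using L.lead_generator unfolding t_def by blast
next
  case False
  then have "j = 1 \<or> j = N - 1" using assms by (auto simp: J_def split: if_splits)
  then have "xx 0 j = 1" using xx_edge[of 0] xx_long_edge[of 0] by auto
  then show ?thesis using L.lead_one e_outside[OF False] by simp
qed

text \<open>Recall that \<open>e 1 = e (N - 1) = 0\<close>. The exceptional case comes from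
  \<open>x\<^sub>0\<^sub>,\<^sub>N\<^sub>-\<^sub>2 x\<^sub>N\<^sub>-\<^sub>3\<^sub>,\<^sub>N\<^sub>-\<^sub>1 = x\<^sub>0\<^sub>,\<^sub>N\<^sub>-\<^sub>3 + 1\<close>.\<close>

definition \<alpha>A :: "int \<Rightarrow> int \<Rightarrow> int \<Rightarrow> int" where
  "\<alpha>A i j = (if i = N - 3 \<and> j = N - 1 then e i - e (i + 1) else e j - e (i + 1))"

text \<open>Induction on \<open>j\<close> by
  \<open>xx i (j + 1) * xx 0 j = xx 0 i + xx 0 (j + 1) * xx i j\<close>. Normally the last product
  dominates and the exponents telescope. For \<open>i = N - 3\<close> and
  \<open>j + 1 = N - 1\<close> its exponent is zero and \<open>xx 0 i\<close> takes over.\<close>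

lemma lead_A:
  assumes A: "\<not> bc" and "0 \<le> i" "i < j" "j \<le> N - 1"
  shows "L.lead (xx i j) (\<alpha>A i j)"
proof (cases "i = 0")
  case True
  have "\<alpha>A 0 j = e j" using e_one N_ge by (simp add: \<alpha>A_def)
  moreover have "L.lead (xx 0 j) (e j)" using assms True by (intro lead_t) auto
  ultimately show ?thesis using True by simp
next
  case False
  then have i: "1 \<le> i" using assms by simp
  define P where "P j \<longleftrightarrow> L.lead (xx i j) (\<alpha>A i j)" for j
  have Jm: "k \<in> J \<longleftrightarrow> 2 \<le> k \<and> k \<le> N - 2" for k unfolding J_def using A by simp
  have wtA: "L.wt (e k) = (if 2 \<le> k \<and> k \<le> N - 2 then W k else 0)" for k
    unfolding wt_e Jm using A by simp
  have lt: "L.lead (xx 0 k) (e k)" if "1 \<le> k" "k \<le> N - 1" for k using lead_t[OF that] A by blast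
  have "P j" using assms(3,4)
  proof (induction j rule: int_gr_induct)
    case base
    have "\<alpha>A i (i + 1) = 0" by (auto simp: \<alpha>A_def)
    then show ?case using xx_edge[of i] L.lead_one by (simp add: P_def)
  next
    case (step j)
    have "\<alpha>A i j = e j - e (i + 1)" using step by (auto simp: \<alpha>A_def)
    then have IH: "L.lead (xx i j) (e j - e (i + 1))" using step by (simp add: P_def)
    have rel: "xx i (j + 1) * xx 0 j = xx 0 i + xx 0 (j + 1) * xx i j"
      using relation_A[OF A, of 0 i j "j + 1"] i step xx_edge[of j] by (simp add: mult.commute)
    have l1: "L.lead (xx 0 i) (e i)" using i step by (intro lt) auto
    have l2: "L.lead (xx 0 (j + 1) * xx i j) (e (j + 1) + (e j - e (i + 1)))"
      using i step by (intro L.lead_mult lt IH) auto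
    have lj: "L.lead (xx 0 j) (e j)" using i step by (intro lt) auto
    have wi: "L.wt (e i) \<le> W i" "L.wt (e (i + 1)) = W (i + 1)" "L.wt (e j) = W j"
      using i step W_pos[of i] by (auto simp: wtA)
    show ?case
    proof (cases "i = N - 3 \<and> j + 1 = N - 1")
      case False
      have "L.wt (e i) < L.wt (e (j + 1) + (e j - e (i + 1)))"
      proof (cases "j + 1 \<le> N - 2")
        case True
        then have "L.wt (e (j + 1)) = W (j + 1)" using i step by (simp add: wtA)
        then show ?thesis
          using wi W_less[of i j] W_Suc[of i] W_Suc[of j] W_pos[of i] i step by (simp add: L.wt_add L.wt_diff)
      next
        case jN: False
        then have "L.wt (e (j + 1)) = 0" using step by (simp add: wtA)
        moreover have "i + 1 < j" using False jN step by auto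
        ultimately show ?thesis
          using wi W_less[of "i + 1" j] W_Suc[of i] W_pos[of i] i by (simp add: L.wt_add L.wt_diff)
      qed
      then have "L.lead (xx 0 (j + 1) * xx i j + xx 0 i) (e (j + 1) + (e j - e (i + 1)))"
        by (rule L.lead_add[OF l2 l1])
      then have "L.lead (xx 0 i + xx 0 (j + 1) * xx i j) (e (j + 1) + (e j - e (i + 1)))"
        by (simp only: add.commute)
      from L.lead_eqI[OF L.lead_divide[OF rel this lj], of "\<alpha>A i (j + 1)"] False
      show ?thesis unfolding P_def by (auto simp: \<alpha>A_def)
    next
      case True
      have eN: "e (N - 1) = 0" by (rule e_outside) (use J_bounds[of "N - 1"] in auto)
      have ij: "j + 1 = N - 1" "i + 1 = j" "i = N - 3" "j = N - 2" using True by auto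
      have z: "e (j + 1) + (e j - e (i + 1)) = 0" unfolding ij(1,2) eN by simp
      have "L.lead (xx 0 i + xx 0 (j + 1) * xx i j) (e i)"
      proof (cases "i = 1")
        \<comment> \<open>Here \<open>N = 4\<close>: both summands are 1, and their sum 2 is a
          nonzero constant in characteristic zero.\<close>
        case i1: True
        have "xx 0 i = 1" "xx i j = 1" using xx_edge[of 0] xx_edge[of i] i1 unfolding ij(2) by auto
        moreover have "xx 0 (j + 1) = 1" using xx_long_edge[of 0] unfolding ij(1) by simp
        moreover have "L.lead (\<iota> 2) 0" by (rule L.lead_const) simp
        ultimately show ?thesis unfolding i1 e_one by (simp add: emb_numeral)
      next
        case False
        then have "L.wt (e i) = W i" using i ij by (simp add: wtA)
        then have "L.wt (e (j + 1) + (e j - e (i + 1))) < L.wt (e i)" unfolding z using W_pos[of i] by simp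
        then show ?thesis by (rule L.lead_add[OF l1 l2])
      qed
      from L.lead_eqI[OF L.lead_divide[OF rel this lj], of "\<alpha>A i (j + 1)"] ij
      show ?thesis unfolding P_def by (auto simp: \<alpha>A_def)
    qed
  qed
  then show ?thesis by (simp add: P_def)
qed

text \<open>At \<open>M\<close> this is the exponent of \<open>xx 0 M ^ (2 div type_r X)\<close>,
  the power in which the diameter at 0 enters the second family of relations.\<close>

definition ehat :: "int \<Rightarrow> int \<Rightarrow> int" where
  "ehat j = (if j = M then L.smul (2 div type_r X) (e M) else e j)"

lemma wt_ehat: assumes bc "2 \<le> j" "j \<le> M" shows "L.wt (ehat j) = W j"
  using assms type_r_cases by (auto simp: ehat_def L.wt_smul wt_e_bc)

lemma lead_inner:
  assumes bc "0 \<le> i" "i < j" "j \<le> M - 1"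
  shows "L.lead (xx i j) (e j - e (i + 1))"
proof (cases "i = 0")
  case True
  have "L.lead (xx 0 j) (e j)" using assms True N_2M M_ge by (intro lead_t) auto
  then show ?thesis using True e_one by simp
next
  case False
  then have i: "1 \<le> i" using assms by simp
  define P where "P j \<longleftrightarrow> L.lead (xx i j) (e j - e (i + 1))" for j
  have "P j" using assms(3,4)
  proof (induction j rule: int_gr_induct)
    case base
    then show ?case using xx_edge[of i] L.lead_one by (simp add: P_def)
  next
    case (step j)
    have IH: "L.lead (xx i j) (e j - e (i + 1))" using step unfolding P_def by auto
    have rel: "xx i (j + 1) * xx 0 j = xx 0 i + xx 0 (j + 1) * xx i j"
      using relation_1[OF assms(1), of 0 i j "j + 1"] i step xx_edge[of j] by (simp add: mult.commute)
    have l1: "L.lead (xx 0 i) (e i)" using i step N_2M by (intro lead_t) auto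
    have l2: "L.lead (xx 0 (j + 1) * xx i j) (e (j + 1) + (e j - e (i + 1)))"
      using i step N_2M by (intro L.lead_mult lead_t IH) auto
    have lj: "L.lead (xx 0 j) (e j)" using i step N_2M by (intro lead_t) auto
    have "L.wt (e i) \<le> W i" "L.wt (e (i + 1)) = W (i + 1)" "L.wt (e j) = W j" "L.wt (e (j + 1)) = W (j + 1)"
      using wt_e_le[of i] i step assms(1) by (auto simp: wt_e_bc)
    then have "L.wt (e i) < L.wt (e (j + 1) + (e j - e (i + 1)))"
      using W_less[of i j] W_Suc[of i] W_Suc[of j] W_pos[of i] i step by (simp add: L.wt_add L.wt_diff)
    then have "L.lead (xx 0 (j + 1) * xx i j + xx 0 i) (e (j + 1) + (e j - e (i + 1)))"
      by (rule L.lead_add[OF l2 l1])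
    then have "L.lead (xx 0 i + xx 0 (j + 1) * xx i j) (e (j + 1) + (e j - e (i + 1)))"
      by (simp only: add.commute)
    from L.lead_eqI[OF L.lead_divide[OF rel this lj], of "e (j + 1) - e (i + 1)"]
    show ?case unfolding P_def by auto
  qed
  then show ?thesis unfolding P_def .
qed

text \<open>The second family of relations at vertex 0 replaces the type A recursion in the last
  step, from \<open>[i, M - 1]\<close> to \<open>[i, M]\<close>.\<close>

lemma lead_middle:
  assumes bc "1 \<le> i" "i \<le> M - 1"
  shows "L.lead (xx i M) (ehat M - ehat (i + 1))"
proof (cases "i = M - 1")
  case True
  then have "xx i M = 1" using xx_edge[of i] by simp
  moreover have "ehat M - ehat (i + 1) = 0" using True by simp
  ultimately show ?thesis using L.lead_one by (simp only:)
next
  case False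
  then have i: "i + 1 \<le> M - 1" using assms by simp
  have "xx 0 (M - 1 + M) = 1" using xx_long_edge[of 0] N_2M by (simp add: algebra_simps)
  then have rel: "xx i M * xx 0 (M - 1) = xx 0 i + xx 0 M ^ (2 div type_r X) * xx i (M - 1)"
    using relation_2[OF assms(1), of 0 i "M - 1"] xx_half[OF assms(1), of 0 i] assms i by (simp add: mult.commute)
  have l1: "L.lead (xx 0 i) (e i)" using lead_t assms N_2M by auto
  have lM: "L.lead (xx 0 M ^ (2 div type_r X)) (ehat M)"
    unfolding ehat_def using lead_t[of M] N_2M M_ge by (auto intro: L.lead_power)
  have l2: "L.lead (xx 0 M ^ (2 div type_r X) * xx i (M - 1)) (ehat M + (e (M - 1) - e (i + 1)))"
    using lead_inner[of i "M - 1"] assms i by (intro L.lead_mult[OF lM]) auto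
  have lj: "L.lead (xx 0 (M - 1)) (e (M - 1))" using lead_t[of "M - 1"] assms N_2M by auto
  have "L.wt (e i) \<le> W i" "L.wt (e (i + 1)) = W (i + 1)" "L.wt (e (M - 1)) = W (M - 1)" "L.wt (ehat M) = W M"
    using wt_e_le[of i] assms i wt_ehat[of M] by (auto simp: wt_e_bc)
  then have "L.wt (e i) < L.wt (ehat M + (e (M - 1) - e (i + 1)))"
    using W_less[of i "M - 1"] W_less[of "M - 1" M] W_Suc[of i] W_pos[of i] i assms by (simp add: L.wt_add L.wt_diff)
  then have "L.lead (xx 0 M ^ (2 div type_r X) * xx i (M - 1) + xx 0 i) (ehat M + (e (M - 1) - e (i + 1)))"
    by (rule L.lead_add[OF l2 l1])
  then have "L.lead (xx 0 i + xx 0 M ^ (2 div type_r X) * xx i (M - 1)) (ehat M + (e (M - 1) - e (i + 1)))"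
    by (simp only: add.commute)
  from L.lead_eqI[OF L.lead_divide[OF rel this lj], of "ehat M - ehat (i + 1)"] i
  show ?thesis by (auto simp: ehat_def[of "i + 1"])
qed

text \<open>By the relation of two diameters, \<open>xx i (i + M) * xx 0 M\<close> is the sum of the
  \<open>type_r X\<close>-th powers of \<open>xx 0 i\<close> and \<open>xx i M\<close>. The second
  power dominates unless \<open>i = M - 1\<close>, where \<open>[i, M]\<close> is an edge.\<close>

definition \<alpha>D :: "int \<Rightarrow> int \<Rightarrow> int" where
  "\<alpha>D i = (if i = M - 1 then L.smul (type_r X) (e (M - 1)) - e M else e M - L.smul (type_r X) (e (i + 1)))"

text \<open>As \<open>type_r X * (2 div type_r X) = 2\<close>, the power contains \<open>e M\<close>
  twice, and one copy remains after division by \<open>xx 0 M\<close>.\<close>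

lemma smul_ehat: "L.smul (type_r X) (ehat M - \<beta>) - e M = e M - L.smul (type_r X) \<beta>"
  using type_r_cases by (auto simp: ehat_def L.smul_def fun_eq_iff)

lemma lead_diameter:
  assumes bc "0 \<le> i" "i \<le> M - 1"
  shows "L.lead (xx i (i + M)) (\<alpha>D i)"
proof (cases "i = 0")
  case True
  have "L.lead (xx 0 M) (e M)" using N_2M M_ge by (intro lead_t) auto
  moreover have "e M p = \<alpha>D 0 p" for p
    using M_bc(2)[OF assms(1)] e_one by (simp add: \<alpha>D_def L.smul_def)
  ultimately show ?thesis unfolding True by (auto intro: L.lead_eqI)
next
  case False
  then have i: "1 \<le> i" using assms by simp
  have rel: "xx i (i + M) * xx 0 M = xx 0 i ^ type_r X + xx 0 (i + M) ^ type_r X"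
    using relation_3[OF assms(1), of 0 i] i assms by (simp add: mult.commute)
  have li: "L.lead (xx 0 i ^ type_r X) (L.smul (type_r X) (e i))"
    using lead_t[of i] i assms N_2M by (auto intro: L.lead_power)
  have xs: "xx 0 (i + M) = xx i M" using xx_half[OF assms(1), of 0 i] by simp
  have ls: "L.lead (xx 0 (i + M) ^ type_r X) (L.smul (type_r X) (ehat M - ehat (i + 1)))"
    unfolding xs using lead_middle[OF assms(1) i assms(3)] by (rule L.lead_power)
  have lM: "L.lead (xx 0 M) (e M)" using lead_t[of M] N_2M M_ge by auto
  have r: "0 < real (type_r X)" using type_r_cases by auto
  show ?thesis
  proof (cases "i = M - 1")
    case True
    have "L.wt (e i) = W i" using True M_bc[OF assms(1)] assms(1) by (auto simp: wt_e_bc)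
    then have "L.wt (L.smul (type_r X) (ehat M - ehat (i + 1))) < L.wt (L.smul (type_r X) (e i))"
      using True r W_pos[of i] by (simp add: L.wt_smul L.wt_diff)
    from L.lead_eqI[OF L.lead_divide[OF rel L.lead_add[OF li ls this] lM], of "\<alpha>D i"] True
    show ?thesis by (auto simp: \<alpha>D_def)
  next
    case False
    then have i1: "i + 1 \<le> M - 1" using assms by simp
    have "L.wt (e i) \<le> W i" "L.wt (ehat (i + 1)) = W (i + 1)" "L.wt (ehat M) = W M"
      using wt_e_le[of i] wt_ehat i i1 assms(1) by auto
    then have "L.wt (e i) < L.wt (ehat M) - L.wt (ehat (i + 1))"
      using W_less[of "i + 1" M] W_Suc[of i] W_pos[of i] i i1 by simp
    then have "L.wt (L.smul (type_r X) (e i)) < L.wt (L.smul (type_r X) (ehat M - ehat (i + 1)))"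
      using r by (simp add: L.wt_smul L.wt_diff)
    from L.lead_add[OF ls li this]
    have "L.lead (xx 0 i ^ type_r X + xx 0 (i + M) ^ type_r X) (L.smul (type_r X) (ehat M - ehat (i + 1)))"
      by (simp only: add.commute)
    note l = L.lead_divide[OF rel this lM]
    have "(L.smul (type_r X) (ehat M - ehat (i + 1)) - e M) p = \<alpha>D i p" for p
      unfolding smul_ehat using i1 by (simp add: \<alpha>D_def ehat_def[of "i + 1"])
    from L.lead_eqI[OF l this] show ?thesis .
  qed
qed

text \<open>Uses the second family of relations at vertex \<open>i\<close> for
  \<open>i, j, M\<close>, where the diagonal from \<open>i\<close> to \<open>M + M\<close> belongs
  to the fan at 0. The other diagonals in it have known leading exponents.\<close>

lemma lead_outer:
  assumes bc "0 \<le> i" "i < j" "j \<le> M - 1"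
  shows "L.lead (xx j (i + M)) (ehat M - e (i + 1) - ehat (j + 1))"
proof (cases "i = 0")
  case True
  have "L.lead (xx j M) (ehat M - ehat (j + 1))" using assms True by (intro lead_middle) auto
  then show ?thesis using True e_one by simp
next
  case False
  then have i: "1 \<le> i" "i + 1 \<le> M - 1" using assms by auto
  have "xx i (M + M) = xx 0 i" using xx_cong[of i i "M + M" 0] N_2M by (simp add: xx_commute)
  then have rel: "xx j (i + M) * xx i M = xx i j * xx 0 i + xx i (i + M) ^ (2 div type_r X) * xx j M"
    using relation_2[OF assms(1), of i j M] xx_half[OF assms(1), of i j] assms i by (simp add: mult.commute)
  have l1: "L.lead (xx i j * xx 0 i) ((e j - e (i + 1)) + e i)"
    using lead_inner[OF assms] i assms N_2M by (intro L.lead_mult lead_t) auto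
  have l2: "L.lead (xx i (i + M) ^ (2 div type_r X) * xx j M)
      (L.smul (2 div type_r X) (\<alpha>D i) + (ehat M - ehat (j + 1)))"
    using i assms by (intro L.lead_mult L.lead_power lead_diameter lead_middle) auto
  have D: "L.smul (2 div type_r X) (\<alpha>D i) = ehat M - e (i + 1) - e (i + 1)"
    using i type_r_cases by (auto simp: \<alpha>D_def ehat_def L.smul_def fun_eq_iff)
  have lM: "L.lead (xx i M) (ehat M - e (i + 1))" using lead_middle[of i] i assms by (simp add: ehat_def)
  have "L.wt (e i) \<le> W i" "L.wt (e (i + 1)) = W (i + 1)" "L.wt (e j) = W j" "L.wt (ehat (j + 1)) = W (j + 1)"
    "L.wt (ehat M) = W M"
    using wt_e_le[of i] i wt_ehat assms by (auto simp: wt_e_bc)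
  \<comment> \<open>Since \<open>W M \<ge> 3 * W j\<close> and \<open>W j \<ge> 3 * W i\<close>, the
    left side is at most \<open>16 / 9\<close> times \<open>W M\<close>.\<close>
  moreover have "4 * W i + 4 * W j < 2 * W M"
    using W_less[of i j] W_less[of j M] W_pos[of i] W_pos[of j] W_pos[of M] i assms by simp
  ultimately have "L.wt ((e j - e (i + 1)) + e i) <
      L.wt (L.smul (2 div type_r X) (\<alpha>D i) + (ehat M - ehat (j + 1)))"
    unfolding D L.wt_add L.wt_diff using W_Suc[of i] W_Suc[of j] i assms by linarith
  from L.lead_add[OF l2 l1 this]
  have "L.lead (xx i j * xx 0 i + xx i (i + M) ^ (2 div type_r X) * xx j M)
      (L.smul (2 div type_r X) (\<alpha>D i) + (ehat M - ehat (j + 1)))"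
    by (simp only: add.commute)
  from L.lead_eqI[OF L.lead_divide[OF rel this lM], of "ehat M - e (i + 1) - ehat (j + 1)"]
  show ?thesis unfolding D by auto
qed

end

text \<open>Endpoint counts determine the innermost interval. Up to its lower end a family has at
  least as many endpoints as intervals; a family whose innermost interval starts later has fewer
  there, since no upper end and not every lower end has been reached. The same holds from above for
  upper ends.\<close>

lemma nested_intervals_shared:
  fixes lo hi :: "'c \<Rightarrow> int" and \<nu> \<nu>' :: "'c \<Rightarrow> int"
  assumes fin: "finite C"
    and nn: "\<And>c. c \<in> C \<Longrightarrow> 0 \<le> \<nu> c \<and> 0 \<le> \<nu>' c"
    and rng: "\<And>c. c \<in> C \<Longrightarrow> 0 < \<nu> c \<or> 0 < \<nu>' c \<Longrightarrow> 0 \<le> lo c \<and> lo c \<le> hi c \<and> hi c \<le> R"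
    and inj: "\<And>c d. c \<in> C \<Longrightarrow> d \<in> C \<Longrightarrow> lo c = lo d \<Longrightarrow> hi c = hi d \<Longrightarrow> c = d"
    and nest: "\<And>c d. c \<in> C \<Longrightarrow> d \<in> C \<Longrightarrow> 0 < \<nu> c \<Longrightarrow> 0 < \<nu> d \<Longrightarrow> \<not> (lo c < lo d \<and> hi c < hi d)"
    and nest': "\<And>c d. c \<in> C \<Longrightarrow> d \<in> C \<Longrightarrow> 0 < \<nu>' c \<Longrightarrow> 0 < \<nu>' d \<Longrightarrow> \<not> (lo c < lo d \<and> hi c < hi d)"
    and cnt: "\<And>v. 0 \<le> v \<Longrightarrow> v \<le> R \<Longrightarrow>
      (\<Sum>c\<in>C. \<nu> c * ((if lo c = v then 1 else 0) + (if hi c = v then 1 else 0))) =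
      (\<Sum>c\<in>C. \<nu>' c * ((if lo c = v then 1 else 0) + (if hi c = v then 1 else 0)))"
    and ne: "c0 \<in> C" "0 < \<nu> c0"
  shows "\<exists>c\<in>C. 0 < \<nu> c \<and> 0 < \<nu>' c"
proof -
  define q where "q \<kappa> = (\<Sum>c\<in>C. \<kappa> c)" for \<kappa> :: "'c \<Rightarrow> int"
  have count: "(\<Sum>v\<in>{s..t}. \<Sum>c\<in>C. \<kappa> c * ((if lo c = v then 1 else 0) + (if hi c = v then 1 else 0))) =
      (\<Sum>c\<in>C. \<kappa> c * ((if s \<le> lo c \<and> lo c \<le> t then 1 else 0) + (if s \<le> hi c \<and> hi c \<le> t then 1 else 0)))"
    for \<kappa> :: "'c \<Rightarrow> int" and s t
    by (subst sum.swap) (simp add: sum_distrib_left[symmetric] sum.distrib sum.delta sum.delta')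
  have eq: "(\<Sum>c\<in>C. \<nu> c * ((if s \<le> lo c \<and> lo c \<le> t then 1 else 0) + (if s \<le> hi c \<and> hi c \<le> t then 1 else 0))) =
      (\<Sum>c\<in>C. \<nu>' c * ((if s \<le> lo c \<and> lo c \<le> t then 1 else 0) + (if s \<le> hi c \<and> hi c \<le> t then 1 else 0)))"
    if "0 \<le> s" "t \<le> R" for s t
    unfolding count[symmetric] using that by (intro sum.cong refl cnt) auto
  have total: "(\<Sum>c\<in>C. \<kappa> c * ((if 0 \<le> lo c \<and> lo c \<le> R then 1 else 0) + (if 0 \<le> hi c \<and> hi c \<le> R then 1 else 0)))
      = 2 * q \<kappa>" if "\<And>c. c \<in> C \<Longrightarrow> \<kappa> c \<noteq> 0 \<Longrightarrow> 0 \<le> lo c \<and> lo c \<le> hi c \<and> hi c \<le> R" for \<kappa> :: "'c \<Rightarrow> int"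
    unfolding q_def sum_distrib_left using that by (intro sum.cong) force+
  have "\<nu> c \<noteq> 0 \<Longrightarrow> 0 \<le> lo c \<and> lo c \<le> hi c \<and> hi c \<le> R"
    "\<nu>' c \<noteq> 0 \<Longrightarrow> 0 \<le> lo c \<and> lo c \<le> hi c \<and> hi c \<le> R" if "c \<in> C" for c
    using rng[OF that] nn[OF that] by force+
  then have qq: "q \<nu> = q \<nu>'"
    using eq[of 0 R] total[of \<nu>] total[of \<nu>'] by simp
  have qpos: "0 < q \<nu>" unfolding q_def using fin ne nn by (intro sum_pos2[of _ c0]) auto
  \<comment> \<open>In a nested family the shortest interval is innermost.\<close>
  have small: "\<exists>d\<in>C. 0 < \<kappa> d \<and> (\<forall>c\<in>C. 0 < \<kappa> c \<longrightarrow> lo c \<le> lo d \<and> hi d \<le> hi c)"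
    if pos: "0 < q \<kappa>" and n: "\<And>c. c \<in> C \<Longrightarrow> 0 \<le> \<kappa> c"
      and ns: "\<And>c d. c \<in> C \<Longrightarrow> d \<in> C \<Longrightarrow> 0 < \<kappa> c \<Longrightarrow> 0 < \<kappa> d \<Longrightarrow> \<not> (lo c < lo d \<and> hi c < hi d)"
    for \<kappa> :: "'c \<Rightarrow> int"
  proof -
    let ?S = "{c \<in> C. 0 < \<kappa> c}"
    have "\<exists>c\<in>C. 0 < \<kappa> c" using pos sum_pos_iff_support[OF fin n] by (simp add: q_def)
    then have S: "finite ?S" "?S \<noteq> {}" using fin by auto
    define d where "d = arg_min_on (\<lambda>c. hi c - lo c) ?S"
    have d: "d \<in> ?S" unfolding d_def using arg_min_if_finite(1)[OF S] .
    have min: "hi d - lo d \<le> hi c - lo c" if "c \<in> ?S" for c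
      using arg_min_if_finite(2)[OF S, of "\<lambda>c. hi c - lo c"] that unfolding d_def by force
    have "lo c \<le> lo d \<and> hi d \<le> hi c" if "c \<in> C" "0 < \<kappa> c" for c
      using min[of c] ns[of c d] ns[of d c] d that by force
    then show ?thesis using d by blast
  qed
  obtain d where d: "d \<in> C" "0 < \<nu> d" "\<And>c. c \<in> C \<Longrightarrow> 0 < \<nu> c \<Longrightarrow> lo c \<le> lo d \<and> hi d \<le> hi c"
    using small[OF qpos] nn nest by metis
  obtain d' where d': "d' \<in> C" "0 < \<nu>' d'" "\<And>c. c \<in> C \<Longrightarrow> 0 < \<nu>' c \<Longrightarrow> lo c \<le> lo d' \<and> hi d' \<le> hi c"
    using small[of \<nu>'] qpos qq nn nest' by metis
  have lo_le: "\<not> lo a < lo b"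
    if a: "a \<in> C" "0 < \<kappa> a" "\<And>c. c \<in> C \<Longrightarrow> 0 < \<kappa> c \<Longrightarrow> lo c \<le> lo a \<and> hi a \<le> hi c"
      and b: "b \<in> C" "0 < \<kappa>' b" "\<And>c. c \<in> C \<Longrightarrow> 0 < \<kappa>' c \<Longrightarrow> lo c \<le> lo b \<and> hi b \<le> hi c"
      and n: "\<And>c. c \<in> C \<Longrightarrow> 0 \<le> \<kappa> c \<and> 0 \<le> \<kappa>' c" and q: "q \<kappa> = q \<kappa>'"
      and r: "\<And>c. c \<in> C \<Longrightarrow> 0 < \<kappa> c \<or> 0 < \<kappa>' c \<Longrightarrow> 0 \<le> lo c \<and> lo c \<le> hi c \<and> hi c \<le> R"
      and e: "\<And>s t. 0 \<le> s \<Longrightarrow> t \<le> R \<Longrightarrow>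
      (\<Sum>c\<in>C. \<kappa> c * ((if s \<le> lo c \<and> lo c \<le> t then 1 else 0) + (if s \<le> hi c \<and> hi c \<le> t then 1 else 0))) =
      (\<Sum>c\<in>C. \<kappa>' c * ((if s \<le> lo c \<and> lo c \<le> t then 1 else 0) + (if s \<le> hi c \<and> hi c \<le> t then 1 else 0)))"
    for a b and \<kappa> \<kappa>' :: "'c \<Rightarrow> int"
  proof
    assume lt: "lo a < lo b"
    let ?f = "\<lambda>\<kappa> c. \<kappa> c * ((if 0 \<le> lo c \<and> lo c \<le> lo a then 1 else 0) + (if 0 \<le> hi c \<and> hi c \<le> lo a then 1 else 0))"
    have "q \<kappa> \<le> (\<Sum>c\<in>C. ?f \<kappa> c)" unfolding q_def
    proof (rule sum_mono)
      fix c assume c: "c \<in> C"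
      show "\<kappa> c \<le> ?f \<kappa> c" using n[OF c] a(3)[OF c] r[OF c] by (cases "0 < \<kappa> c") auto
    qed
    also have "\<dots> = (\<Sum>c\<in>C. ?f \<kappa>' c)" using r[OF a(1)] a(2) by (intro e) auto
    also have "\<dots> < q \<kappa>'" unfolding q_def
    proof (rule sum_strict_mono_ex1[OF fin])
      show "\<forall>c\<in>C. ?f \<kappa>' c \<le> \<kappa>' c"
      proof
        fix c assume c: "c \<in> C"
        show "?f \<kappa>' c \<le> \<kappa>' c"
          using n[OF c] b(3)[OF c] r[OF b(1)] b(2) lt by (cases "0 < \<kappa>' c") auto
      qed
      show "\<exists>c\<in>C. ?f \<kappa>' c < \<kappa>' c" using b(1,2) r[OF b(1)] lt by (intro bexI[of _ b]) auto
    qed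
    finally show False using q by simp
  qed
  have hi_le: "\<not> hi b < hi a"
    if a: "a \<in> C" "0 < \<kappa> a" "\<And>c. c \<in> C \<Longrightarrow> 0 < \<kappa> c \<Longrightarrow> lo c \<le> lo a \<and> hi a \<le> hi c"
      and b: "b \<in> C" "0 < \<kappa>' b" "\<And>c. c \<in> C \<Longrightarrow> 0 < \<kappa>' c \<Longrightarrow> lo c \<le> lo b \<and> hi b \<le> hi c"
      and n: "\<And>c. c \<in> C \<Longrightarrow> 0 \<le> \<kappa> c \<and> 0 \<le> \<kappa>' c" and q: "q \<kappa> = q \<kappa>'"
      and r: "\<And>c. c \<in> C \<Longrightarrow> 0 < \<kappa> c \<or> 0 < \<kappa>' c \<Longrightarrow> 0 \<le> lo c \<and> lo c \<le> hi c \<and> hi c \<le> R"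
      and e: "\<And>s t. 0 \<le> s \<Longrightarrow> t \<le> R \<Longrightarrow>
      (\<Sum>c\<in>C. \<kappa> c * ((if s \<le> lo c \<and> lo c \<le> t then 1 else 0) + (if s \<le> hi c \<and> hi c \<le> t then 1 else 0))) =
      (\<Sum>c\<in>C. \<kappa>' c * ((if s \<le> lo c \<and> lo c \<le> t then 1 else 0) + (if s \<le> hi c \<and> hi c \<le> t then 1 else 0)))"
    for a b and \<kappa> \<kappa>' :: "'c \<Rightarrow> int"
  proof
    assume lt: "hi b < hi a"
    let ?f = "\<lambda>\<kappa> c. \<kappa> c * ((if hi a \<le> lo c \<and> lo c \<le> R then 1 else 0) + (if hi a \<le> hi c \<and> hi c \<le> R then 1 else 0))"
    have "q \<kappa> \<le> (\<Sum>c\<in>C. ?f \<kappa> c)" unfolding q_def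
    proof (rule sum_mono)
      fix c assume c: "c \<in> C"
      show "\<kappa> c \<le> ?f \<kappa> c" using n[OF c] a(3)[OF c] r[OF c] by (cases "0 < \<kappa> c") auto
    qed
    also have "\<dots> = (\<Sum>c\<in>C. ?f \<kappa>' c)" using r[OF a(1)] a(2) by (intro e) auto
    also have "\<dots> < q \<kappa>'" unfolding q_def
    proof (rule sum_strict_mono_ex1[OF fin])
      show "\<forall>c\<in>C. ?f \<kappa>' c \<le> \<kappa>' c"
      proof
        fix c assume c: "c \<in> C"
        show "?f \<kappa>' c \<le> \<kappa>' c"
          using n[OF c] b(3)[OF c] r[OF b(1)] b(2) lt by (cases "0 < \<kappa>' c") auto
      qed
      show "\<exists>c\<in>C. ?f \<kappa>' c < \<kappa>' c" using b(1,2) r[OF b(1)] lt by (intro bexI[of _ b]) auto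
    qed
    finally show False using q by simp
  qed
  have "\<not> lo d < lo d'" by (rule lo_le[OF d d' nn qq rng eq])
  moreover have "\<not> lo d' < lo d"
    by (rule lo_le[OF d' d _ qq[symmetric] _ eq[symmetric]]) (use nn rng in auto)
  moreover have "\<not> hi d' < hi d" by (rule hi_le[OF d d' nn qq rng eq])
  moreover have "\<not> hi d < hi d'"
    by (rule hi_le[OF d' d _ qq[symmetric] _ eq[symmetric]]) (use nn rng in auto)
  ultimately have "d = d'" by (intro inj d(1) d'(1)) auto
  then show ?thesis using d d' by blast
qed

context polygon_seed
begin

section \<open>Recovering compatible chords from their exponent vectors\<close>

definition xxp :: "int \<times> int \<Rightarrow> 'f" where "xxp c = xx (fst c) (snd c)"

definition NC :: "(int \<times> int) set \<Rightarrow> bool" where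
  "NC A \<longleftrightarrow> (\<forall>c\<in>A. \<forall>d\<in>A. cmp (xxp c) (xxp d))"

lemma NC_mono: "NC B \<Longrightarrow> A \<subseteq> B \<Longrightarrow> NC A"
  by (auto simp: NC_def)

lemma NC_not_crossing:
  assumes "NC A" "(a, c) \<in> A" "(b, d) \<in> A" shows "\<not> (a < b \<and> b < c \<and> c < d \<and> d < a + N)"
  using crossing_incompatible[of a b c d] assms by (force simp: NC_def xxp_def)

lemma basis_at: "p \<in> J \<Longrightarrow> e j p = (if j = p then 1 else 0)"
  by (auto simp: L.basis_exp_def)

text \<open>One representative with ends in \<open>0, ..., N - 1\<close> for each diagonal; the last
  condition excludes the edge \<open>[0, N - 1]\<close>.\<close>

definition Ch_A :: "(int \<times> int) set" where
  "Ch_A = {(a, c). 0 \<le> a \<and> a + 2 \<le> c \<and> c \<le> N - 1 \<and> c \<le> a + N - 2}"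

definition \<alpha>pA :: "int \<times> int \<Rightarrow> int \<Rightarrow> int" where "\<alpha>pA c = \<alpha>A (fst c) (snd c)"

lemma finite_Ch_A: "finite Ch_A"
  by (rule finite_subset[of _ "{0..N} \<times> {0..N}"]) (auto simp: Ch_A_def)

text \<open>Apart from the exceptional chord \<open>D\<close>, coordinate \<open>p\<close> counts
  the chords ending at \<open>p\<close> minus those starting at \<open>p - 1\<close>. Such chords
  cross, so a compatible family has only one kind, and \<open>split_difference\<close> yields the
  closers and openers for \<open>shared_inner_chord\<close>. The chord \<open>D\<close> breaks this
  pattern and is settled beforehand by coordinate \<open>N - 2\<close>.\<close>

lemma share_A:
  fixes \<mu> \<mu>' :: "int \<times> int \<Rightarrow> nat"
  assumes Jm: "\<And>k. k \<in> J \<longleftrightarrow> 2 \<le> k \<and> k \<le> N - 2"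
    and nc: "NC {c \<in> Ch_A. 0 < \<mu> c}" and nc': "NC {c \<in> Ch_A. 0 < \<mu>' c}"
    and eq: "\<And>p. (\<Sum>c\<in>Ch_A. int (\<mu> c) * \<alpha>pA c p) = (\<Sum>c\<in>Ch_A. int (\<mu>' c) * \<alpha>pA c p)"
    and ne: "{c \<in> Ch_A. 0 < \<mu> c} \<noteq> {}"
  shows "{c \<in> Ch_A. 0 < \<mu> c} \<inter> {c \<in> Ch_A. 0 < \<mu>' c} \<noteq> {}"
proof -
  define D where "D = (N - 3, N - 1)"
  define f where "f \<kappa> p c = int (\<kappa> c) * (if snd c = p then 1 else 0)" for \<kappa> :: "int \<times> int \<Rightarrow> nat" and p c
  define g where "g \<kappa> p c = int (\<kappa> c) * (if fst c + 1 = p then 1 else 0)" for \<kappa> :: "int \<times> int \<Rightarrow> nat" and p c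
  define gD where "gD \<kappa> c = int (\<kappa> c) * (if c = D then 1 else 0)" for \<kappa> :: "int \<times> int \<Rightarrow> nat" and c
  have DC: "D \<in> Ch_A" using N_ge by (auto simp: Ch_A_def D_def)
  have val: "\<alpha>pA c p = (if snd c = p then 1 else 0) - (if fst c + 1 = p then 1 else 0)"
    if "c \<noteq> D" "p \<in> J" for c p
    using that by (cases c) (auto simp: \<alpha>pA_def \<alpha>A_def D_def basis_at)
  have valD: "\<alpha>pA c (N - 2) = (if snd c = N - 2 then 1 else 0) - (if c = D then 1 else 0)"
    if "c \<in> Ch_A" for c
  proof (cases "c = D")
    case True
    then show ?thesis using N_ge by (simp add: \<alpha>pA_def \<alpha>A_def D_def basis_at Jm)
  next
    case False
    then have "\<not> (fst c + 1 = N - 2 \<and> snd c \<noteq> N - 2)" using that by (auto simp: Ch_A_def D_def)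
    then show ?thesis using val[OF False, of "N - 2"] False N_ge that by (auto simp: Jm Ch_A_def)
  qed
  have exD: False if "NC {c \<in> Ch_A. 0 < \<kappa> c}" "c \<in> Ch_A" "d \<in> Ch_A" "0 < f \<kappa> (N - 2) c" "0 < gD \<kappa> d" for \<kappa> c d
    using NC_not_crossing[OF that(1), of "fst c" "N - 2" "N - 3" "N - 1"] that(2-)
    by (cases c) (auto simp: f_def gD_def D_def Ch_A_def split: if_splits)
  have f0: "0 \<le> f \<kappa> p c" "0 \<le> g \<kappa> p c" "0 \<le> gD \<kappa> c" for \<kappa> p c
    by (auto simp: f_def g_def gD_def)
  have sD: "(\<Sum>c\<in>Ch_A. f \<mu> (N - 2) c - gD \<mu> c) = (\<Sum>c\<in>Ch_A. f \<mu>' (N - 2) c - gD \<mu>' c)"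
    using eq[of "N - 2"] by (simp add: f_def gD_def valD right_diff_distrib cong: sum.cong)
  have "(\<exists>c\<in>Ch_A. 0 < gD \<mu> c) \<longleftrightarrow> (\<exists>c\<in>Ch_A. 0 < gD \<mu>' c)"
    by (rule split_difference(2)[OF finite_Ch_A _ exD[OF nc] exD[OF nc'] sD]) (simp_all add: f0)
  then have D: "0 < \<mu> D \<longleftrightarrow> 0 < \<mu>' D" using DC by (auto simp: gD_def split: if_splits)
  show ?thesis
  proof (cases "0 < \<mu> D")
    case True
    then show ?thesis using D DC by auto
  next
    case False
    then have D0: "\<mu> D = 0" "\<mu>' D = 0" using D by auto
    have ex: False if "NC {c \<in> Ch_A. 0 < \<kappa> c}" "c \<in> Ch_A" "d \<in> Ch_A" "0 < f \<kappa> p c" "0 < g \<kappa> p d" for \<kappa> c d p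
      using NC_not_crossing[OF that(1), of "fst c" p "p - 1" "snd d"] that(2-)
      by (cases c; cases d) (auto simp: f_def g_def Ch_A_def split: if_splits)
    have "(\<exists>c\<in>Ch_A. 0 < f \<mu> p c) \<longleftrightarrow> (\<exists>c\<in>Ch_A. 0 < f \<mu>' p c)"
      "(\<exists>c\<in>Ch_A. 0 < g \<mu> p c) \<longleftrightarrow> (\<exists>c\<in>Ch_A. 0 < g \<mu>' p c)" if p: "2 \<le> p" "p \<le> N - 2" for p
    proof -
      have v: "int (\<kappa> c) * \<alpha>pA c p = f \<kappa> p c - g \<kappa> p c" if "\<kappa> D = 0" for \<kappa> c
        using val[of c p] p that by (cases "c = D") (auto simp: Jm f_def g_def)
      have s: "(\<Sum>c\<in>Ch_A. f \<mu> p c - g \<mu> p c) = (\<Sum>c\<in>Ch_A. f \<mu>' p c - g \<mu>' p c)"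
        using eq[of p] v[where \<kappa> = \<mu>, OF D0(1)] v[where \<kappa> = \<mu>', OF D0(2)] by simp
      show "(\<exists>c\<in>Ch_A. 0 < f \<mu> p c) \<longleftrightarrow> (\<exists>c\<in>Ch_A. 0 < f \<mu>' p c)"
        by (rule split_difference(1)[OF finite_Ch_A _ ex[OF nc] ex[OF nc'] s]) (simp_all add: f0)
      show "(\<exists>c\<in>Ch_A. 0 < g \<mu> p c) \<longleftrightarrow> (\<exists>c\<in>Ch_A. 0 < g \<mu>' p c)"
        by (rule split_difference(2)[OF finite_Ch_A _ ex[OF nc] ex[OF nc'] s]) (simp_all add: f0)
    qed
    note fg = this
    \<comment> \<open>Chords ending at \<open>N - 1\<close> are recorded only by their starting
      vertex, because \<open>e (N - 1) = 0\<close>; they supply the feet \<open>B\<close>.\<close>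
    define P where "P \<kappa> = {c \<in> Ch_A. 0 < \<kappa> c \<and> snd c \<le> N - 2}" for \<kappa> :: "int \<times> int \<Rightarrow> nat"
    define B where "B \<kappa> = {v. (v, N - 1) \<in> Ch_A \<and> 0 < \<kappa> (v, N - 1)}" for \<kappa> :: "int \<times> int \<Rightarrow> nat"
    have clo: "(\<exists>c\<in>Ch_A. 0 < f \<kappa> p c) \<longleftrightarrow> (\<exists>i. (i, p) \<in> P \<kappa>)" if p: "p \<le> N - 2" for \<kappa> p
    proof
      assume "\<exists>c\<in>Ch_A. 0 < f \<kappa> p c"
      then obtain i j where ij: "(i, j) \<in> Ch_A" "0 < f \<kappa> p (i, j)" by auto
      then have "j = p" "0 < \<kappa> (i, j)" by (auto simp: f_def split: if_splits)
      then show "\<exists>i. (i, p) \<in> P \<kappa>" using ij p by (auto simp: P_def)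
    next
      assume "\<exists>i. (i, p) \<in> P \<kappa>"
      then obtain i where "(i, p) \<in> P \<kappa>" by blast
      then show "\<exists>c\<in>Ch_A. 0 < f \<kappa> p c" by (intro bexI[of _ "(i, p)"]) (auto simp: f_def P_def)
    qed
    have ope: "(\<exists>c\<in>Ch_A. 0 < g \<kappa> (v + 1) c) \<longleftrightarrow> (\<exists>j. (v, j) \<in> P \<kappa>) \<or> v \<in> B \<kappa>" for \<kappa> v
    proof
      assume "\<exists>c\<in>Ch_A. 0 < g \<kappa> (v + 1) c"
      then obtain j where j: "(v, j) \<in> Ch_A" "0 < \<kappa> (v, j)" by (force simp: g_def split: if_splits)
      then have "j \<le> N - 2 \<or> j = N - 1" by (auto simp: Ch_A_def)
      then show "(\<exists>j. (v, j) \<in> P \<kappa>) \<or> v \<in> B \<kappa>" using j by (auto simp: P_def B_def)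
    next
      assume "(\<exists>j. (v, j) \<in> P \<kappa>) \<or> v \<in> B \<kappa>"
      then obtain j where "(v, j) \<in> Ch_A" "0 < \<kappa> (v, j)" by (auto simp: P_def B_def)
      then show "\<exists>c\<in>Ch_A. 0 < g \<kappa> (v + 1) c" by (intro bexI[of _ "(v, j)"]) (auto simp: g_def)
    qed
    have inner: "P \<kappa> \<inter> P \<kappa>' \<noteq> {}"
      if ncs: "NC {c \<in> Ch_A. 0 < \<kappa> c}" "NC {c \<in> Ch_A. 0 < \<kappa>' c}" and "P \<kappa> \<noteq> {}"
        and F: "\<And>p. 2 \<le> p \<Longrightarrow> p \<le> N - 2 \<Longrightarrow> (\<exists>c\<in>Ch_A. 0 < f \<kappa> p c) \<longleftrightarrow> (\<exists>c\<in>Ch_A. 0 < f \<kappa>' p c)"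
        and G: "\<And>p. 2 \<le> p \<Longrightarrow> p \<le> N - 2 \<Longrightarrow> (\<exists>c\<in>Ch_A. 0 < g \<kappa> p c) \<longleftrightarrow> (\<exists>c\<in>Ch_A. 0 < g \<kappa>' p c)"
      for \<kappa> \<kappa>'
    proof (rule shared_inner_chord[of "P \<kappa>" "P \<kappa>'" "N - 2" "B \<kappa>" "B \<kappa>'"])
      show "finite (P \<kappa>)" using finite_Ch_A by (simp add: P_def)
      show "0 \<le> i \<and> i + 2 \<le> j \<and> j \<le> N - 2" if "(i, j) \<in> P \<kappa> \<union> P \<kappa>'" for i j
        using that by (auto simp: P_def Ch_A_def)
      show "\<not> (i < k \<and> k < j \<and> j < l)" if "(i, j) \<in> P \<kappa>" "(k, l) \<in> P \<kappa>" for i j k l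
        using NC_not_crossing[OF ncs(1), of i j k l] that by (auto simp: P_def Ch_A_def)
      show "\<not> (i < k \<and> k < j \<and> j < l)" if "(i, j) \<in> P \<kappa>'" "(k, l) \<in> P \<kappa>'" for i j k l
        using NC_not_crossing[OF ncs(2), of i j k l] that by (auto simp: P_def Ch_A_def)
      show "\<not> (i < v \<and> v < j)" if "(i, j) \<in> P \<kappa>" "v \<in> B \<kappa>" for i j v
        using NC_not_crossing[OF ncs(1), of i j v "N - 1"] that by (auto simp: P_def B_def Ch_A_def)
      show "\<not> (i < v \<and> v < j)" if "(i, j) \<in> P \<kappa>'" "v \<in> B \<kappa>'" for i j v
        using NC_not_crossing[OF ncs(2), of i j v "N - 1"] that by (auto simp: P_def B_def Ch_A_def)
      show "(\<exists>i. (i, p) \<in> P \<kappa>) \<longleftrightarrow> (\<exists>i. (i, p) \<in> P \<kappa>')" if "2 \<le> p" "p \<le> N - 2" for p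
        using F[OF that] clo[OF that(2)] by simp
      show "((\<exists>j. (v, j) \<in> P \<kappa>) \<or> v \<in> B \<kappa>) \<longleftrightarrow> ((\<exists>j. (v, j) \<in> P \<kappa>') \<or> v \<in> B \<kappa>')"
        if "1 \<le> v" "v \<le> N - 2 - 1" for v
        using G[of "v + 1"] ope that by simp
    qed fact
    have sub: "P \<mu> \<inter> P \<mu>' \<subseteq> {c \<in> Ch_A. 0 < \<mu> c} \<inter> {c \<in> Ch_A. 0 < \<mu>' c}" by (auto simp: P_def)
    consider "P \<mu> \<noteq> {}" | "P \<mu>' \<noteq> {}" | "P \<mu> = {}" "P \<mu>' = {}" by blast
    then show ?thesis
    proof cases
      case 1
      then show ?thesis using inner[OF nc nc' _ fg] sub by blast
    next
      case 2
      then show ?thesis using inner[OF nc' nc _ fg[symmetric]] sub by blast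
    next
      case 3
      \<comment> \<open>Without inner chords every chord ends at \<open>N - 1\<close> and is
        determined by its starting vertex.\<close>
      obtain v j where vj: "(v, j) \<in> Ch_A" "0 < \<mu> (v, j)" using ne by auto
      have "(v, j) \<notin> P \<mu>" using 3(1) by blast
      then have "\<not> j \<le> N - 2" using vj by (simp add: P_def)
      then have j: "j = N - 1" "1 \<le> v" "v \<le> N - 3" using vj by (auto simp: Ch_A_def)
      then have "v \<in> B \<mu>" using vj by (simp add: B_def)
      then have "v \<in> B \<mu>'" using fg(2)[of "v + 1"] ope[of \<mu> v] ope[of \<mu>' v] j 3(2) by auto
      then show ?thesis using vj j by (auto simp: B_def)
    qed
  qed
qed

text \<open>Representatives modulo the antipodal map: the first end is in
  \<open>0, ..., M - 1\<close> and the arc is at most half a turn. \<open>\<alpha>pBC\<close>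
  distinguishes chords inside \<open>0, ..., M - 1\<close>, diameters, and the rest.\<close>

definition Ch_BC :: "(int \<times> int) set" where
  "Ch_BC = {(a, c). 0 \<le> a \<and> a \<le> M - 1 \<and> a + 2 \<le> c \<and> c \<le> a + M}"

definition \<alpha>pBC :: "int \<times> int \<Rightarrow> int \<Rightarrow> int" where
  "\<alpha>pBC c = (if snd c \<le> M - 1 then e (snd c) - e (fst c + 1)
     else if snd c = fst c + M then \<alpha>D (fst c)
     else ehat M - e (snd c - M + 1) - ehat (fst c + 1))"

lemma finite_Ch_BC: "finite Ch_BC"
  by (rule finite_subset[of _ "{0..N} \<times> {0..N}"]) (use N_2M in \<open>auto simp: Ch_BC_def\<close>)

text \<open>Inner chords are handled as in type A, the ends of the other chords reduced modulo
  \<open>M\<close> being the feet. Without inner chords, the remaining chords \<open>(a, c)\<close>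
  become nested intervals from \<open>c - M\<close> to \<open>a\<close>, and
  \<open>nested_intervals_shared\<close> applies once all endpoint counts are known. The diameter
  \<open>D\<close> at \<open>M - 1\<close> is settled beforehand by coordinate
  \<open>M\<close>.\<close>

lemma share_BC:
  fixes \<mu> \<mu>' :: "int \<times> int \<Rightarrow> nat"
  assumes b: bc
    and nc: "NC {c \<in> Ch_BC. 0 < \<mu> c}" and nc': "NC {c \<in> Ch_BC. 0 < \<mu>' c}"
    and eq: "\<And>p. (\<Sum>c\<in>Ch_BC. int (\<mu> c) * \<alpha>pBC c p) = (\<Sum>c\<in>Ch_BC. int (\<mu>' c) * \<alpha>pBC c p)"
    and ne: "{c \<in> Ch_BC. 0 < \<mu> c} \<noteq> {}"
  shows "{c \<in> Ch_BC. 0 < \<mu> c} \<inter> {c \<in> Ch_BC. 0 < \<mu>' c} \<noteq> {}"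
proof -
  note Jm = J_bc[OF b]
  have M4: "4 \<le> M" using M_bc(2)[OF b] .
  define r where "r = int (type_r X)"
  define \<rho> where "\<rho> = int (2 div type_r X)"
  have rr: "r = 1 \<and> \<rho> = 2 \<or> r = 2 \<and> \<rho> = 1" using type_r_cases by (auto simp: r_def \<rho>_def)
  define D where "D = (M - 1, 2 * M - 1)"
  have DC: "D \<in> Ch_BC" using M4 by (auto simp: Ch_BC_def D_def)
  have eM: "e M p = (if p = M then 1 else 0)" for p using M4 by (simp add: L.basis_exp_def Jm)
  have ehM: "ehat j p = (if j = p then (if j = M then \<rho> else 1) else 0)" if "p \<in> J" for j p
    using that by (auto simp: ehat_def L.smul_def \<rho>_def basis_at)
  \<comment> \<open>The positive part of coordinate \<open>M\<close>: 1 for a diameter other than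
    \<open>D\<close> and \<open>\<rho> = 2 / r\<close> for other chords reaching \<open>M\<close>,
    except that the two terms at \<open>M\<close> cancel when the chord starts at
    \<open>M - 1\<close>.\<close>
  define fM where "fM \<kappa> c = int (\<kappa> c) * (if snd c \<le> M - 1 \<or> c = D then 0 else if snd c = fst c + M then 1
    else if fst c = M - 1 then 0 else \<rho>)" for \<kappa> :: "int \<times> int \<Rightarrow> nat" and c
  define gD where "gD \<kappa> c = int (\<kappa> c) * (if c = D then 1 else 0)" for \<kappa> :: "int \<times> int \<Rightarrow> nat" and c
  define f where "f \<kappa> p c = int (\<kappa> c) * (if snd c = p then 1 else 0)" for \<kappa> :: "int \<times> int \<Rightarrow> nat" and p c
  define g where "g \<kappa> p c = int (\<kappa> c) * (if snd c \<le> M - 1 then (if fst c + 1 = p then 1 else 0)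
     else if snd c = fst c + M then r * (if fst c + 1 = p then 1 else 0)
     else (if snd c - M + 1 = p then 1 else 0) + (if fst c + 1 = p then 1 else 0))"
    for \<kappa> :: "int \<times> int \<Rightarrow> nat" and p c
  have valM: "int (\<kappa> c) * \<alpha>pBC c M = fM \<kappa> c - gD \<kappa> c" if "c \<in> Ch_BC" for \<kappa> c
    using that M4 Jm[of M] rr
    by (cases c) (auto simp: \<alpha>pBC_def \<alpha>D_def fM_def gD_def D_def basis_at ehM eM L.smul_def Ch_BC_def)
  have val: "int (\<kappa> c) * \<alpha>pBC c p = f \<kappa> p c - g \<kappa> p c"
    if "c \<in> Ch_BC" "2 \<le> p" "p \<le> M - 1" "\<kappa> D = 0" for \<kappa> c p
  proof (cases "c = D")
    case True
    then show ?thesis using that by (simp add: f_def g_def)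
  next
    case False
    have "p \<in> J" using that Jm by auto
    then show ?thesis using that False
      by (cases c) (auto simp: \<alpha>pBC_def \<alpha>D_def f_def g_def D_def basis_at ehM eM L.smul_def Ch_BC_def r_def)
  qed
  have fM0: "0 \<le> fM \<kappa> c" "0 \<le> gD \<kappa> c" "0 \<le> f \<kappa> p c" "0 \<le> g \<kappa> p c" for \<kappa> c p
    using rr by (auto simp: fM_def gD_def f_def g_def)
  have exD: False if "NC {c \<in> Ch_BC. 0 < \<kappa> c}" "c \<in> Ch_BC" "d \<in> Ch_BC" "0 < fM \<kappa> c" "0 < gD \<kappa> d" for \<kappa> c d
  proof -
    obtain i j where c: "c = (i, j)" by fastforce
    have "d = D" "0 < \<kappa> D" using that(5) by (auto simp: gD_def split: if_splits)
    moreover have "0 < \<kappa> (i, j)" using that(4) by (cases "\<kappa> (i, j) = 0") (auto simp: c fM_def)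
    moreover have "M \<le> j" "i < M - 1"
      using that(2,4) by (auto simp: c fM_def Ch_BC_def D_def split: if_splits)
    ultimately show False
      using NC_not_crossing[OF that(1), of i j "M - 1" "2 * M - 1"] that(2) DC N_2M
      by (auto simp: c D_def Ch_BC_def)
  qed
  have "(\<Sum>c\<in>Ch_BC. fM \<mu> c - gD \<mu> c) = (\<Sum>c\<in>Ch_BC. fM \<mu>' c - gD \<mu>' c)"
    using eq[of M] by (simp add: valM cong: sum.cong)
  note sM = this
  have Diff: "(\<exists>c\<in>Ch_BC. 0 < gD \<mu> c) \<longleftrightarrow> (\<exists>c\<in>Ch_BC. 0 < gD \<mu>' c)"
    by (rule split_difference(2)[OF finite_Ch_BC _ exD[OF nc] exD[OF nc'] sM]) (simp_all add: fM0)
  then have D: "0 < \<mu> D \<longleftrightarrow> 0 < \<mu>' D" using DC by (auto simp: gD_def split: if_splits)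
  show ?thesis
  proof (cases "0 < \<mu> D")
    case True
    then show ?thesis using D DC by auto
  next
    case False
    then have D0: "\<mu> D = 0" "\<mu>' D = 0" using D by auto
    define P where "P \<kappa> = {c \<in> Ch_BC. 0 < \<kappa> c \<and> snd c \<le> M - 1}" for \<kappa> :: "int \<times> int \<Rightarrow> nat"
    define B where "B \<kappa> = {v. \<exists>c\<in>Ch_BC. 0 < \<kappa> c \<and> M \<le> snd c \<and> (v = fst c \<or> v = snd c - M)}"
      for \<kappa> :: "int \<times> int \<Rightarrow> nat"
    \<comment> \<open>A chord \<open>(a, c)\<close> with a foot strictly below an inner chord would
      cross it, either itself or through its antipodal image from \<open>c - M\<close> to
      \<open>a + M\<close>, which has the same variable.\<close>
    have foot: "\<not> (i < v \<and> v < j)"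
      if ncs: "NC {c \<in> Ch_BC. 0 < \<kappa> c}" and ij: "(i, j) \<in> P \<kappa>" and v: "v \<in> B \<kappa>" for \<kappa> i j v
    proof
      assume *: "i < v \<and> v < j"
      obtain a c where ac: "(a, c) \<in> Ch_BC" "0 < \<kappa> (a, c)" "M \<le> c" "v = a \<or> v = c - M"
        using v by (auto simp: B_def)
      have bij: "0 \<le> i" "j \<le> M - 1" "(i, j) \<in> Ch_BC" "0 < \<kappa> (i, j)" using ij by (auto simp: P_def Ch_BC_def)
      have cmp: "cmp (xx i j) (xx a c)" using ncs bij ac by (force simp: NC_def xxp_def)
      show False using ac(4)
      proof
        assume "v = a"
        then show False
          using crossing_incompatible[of i a j c] cmp * bij ac N_2M by (auto simp: Ch_BC_def)
      next
        assume v: "v = c - M"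
        have "xx a c = xx v (a + M)" using xx_half[OF b, of a "c - M"] v by simp
        then show False
          using crossing_incompatible[of i v j "a + M"] cmp * bij ac N_2M v by (auto simp: Ch_BC_def)
      qed
    qed
    have clo: "(\<exists>c\<in>Ch_BC. 0 < f \<kappa> p c) \<longleftrightarrow> (\<exists>i. (i, p) \<in> P \<kappa>)" if p: "p \<le> M - 1" for \<kappa> p
    proof
      assume "\<exists>c\<in>Ch_BC. 0 < f \<kappa> p c"
      then obtain i j where ij: "(i, j) \<in> Ch_BC" "0 < f \<kappa> p (i, j)" by auto
      then have "j = p" "0 < \<kappa> (i, j)" by (auto simp: f_def split: if_splits)
      then show "\<exists>i. (i, p) \<in> P \<kappa>" using ij p by (auto simp: P_def)
    next
      assume "\<exists>i. (i, p) \<in> P \<kappa>"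
      then obtain i where "(i, p) \<in> P \<kappa>" by blast
      then show "\<exists>c\<in>Ch_BC. 0 < f \<kappa> p c" by (intro bexI[of _ "(i, p)"]) (auto simp: f_def P_def)
    qed
    have ope: "(\<exists>c\<in>Ch_BC. 0 < g \<kappa> (v + 1) c) \<longleftrightarrow> (\<exists>j. (v, j) \<in> P \<kappa>) \<or> v \<in> B \<kappa>" for \<kappa> v
    proof
      assume "\<exists>c\<in>Ch_BC. 0 < g \<kappa> (v + 1) c"
      then obtain a c where ac: "(a, c) \<in> Ch_BC" "0 < g \<kappa> (v + 1) (a, c)" by auto
      then have "0 < \<kappa> (a, c)" by (cases "\<kappa> (a, c) = 0") (auto simp: g_def)
      then show "(\<exists>j. (v, j) \<in> P \<kappa>) \<or> v \<in> B \<kappa>"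
        using ac by (cases "c \<le> M - 1") (force simp: P_def B_def g_def split: if_splits)+
    next
      assume "(\<exists>j. (v, j) \<in> P \<kappa>) \<or> v \<in> B \<kappa>"
      then show "\<exists>c\<in>Ch_BC. 0 < g \<kappa> (v + 1) c"
      proof
        assume "\<exists>j. (v, j) \<in> P \<kappa>"
        then obtain j where "(v, j) \<in> P \<kappa>" by blast
        then show ?thesis by (intro bexI[of _ "(v, j)"]) (auto simp: P_def g_def)
      next
        assume "v \<in> B \<kappa>"
        then obtain c where "c \<in> Ch_BC" "0 < \<kappa> c" "M \<le> snd c" "v = fst c \<or> v = snd c - M"
          by (auto simp: B_def)
        then show ?thesis using rr by (intro bexI[of _ c]) (auto simp: g_def)
      qed
    qed
    have ex: False if ncs: "NC {c \<in> Ch_BC. 0 < \<kappa> c}" and cd: "c \<in> Ch_BC" "d \<in> Ch_BC" "0 < f \<kappa> p c" "0 < g \<kappa> p d"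
      and p: "p \<le> M - 1" for \<kappa> c d p
    proof -
      obtain i where i: "(i, p) \<in> P \<kappa>" using clo[OF p] cd(1,3) by blast
      then have i2: "i + 2 \<le> p" "0 \<le> i" by (auto simp: P_def Ch_BC_def)
      have "(\<exists>j. (p - 1, j) \<in> P \<kappa>) \<or> p - 1 \<in> B \<kappa>" using ope[of \<kappa> "p - 1"] cd(2,4) by auto
      then show False
      proof
        assume "\<exists>j. (p - 1, j) \<in> P \<kappa>"
        then obtain j where "(p - 1, j) \<in> P \<kappa>" by blast
        then show False
          using NC_not_crossing[OF ncs, of i p "p - 1" j] i i2 N_2M by (auto simp: P_def Ch_BC_def)
      next
        assume "p - 1 \<in> B \<kappa>"
        then show False using foot[OF ncs i, of "p - 1"] i2 by auto
      qed
    qed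
    have s: "(\<Sum>c\<in>Ch_BC. f \<mu> p c - g \<mu> p c) = (\<Sum>c\<in>Ch_BC. f \<mu>' p c - g \<mu>' p c)"
      if "2 \<le> p" "p \<le> M - 1" for p
      using eq[of p] val[where \<kappa> = \<mu>, OF _ that D0(1)] val[where \<kappa> = \<mu>', OF _ that D0(2)] by (simp cong: sum.cong)
    have fg: "(\<exists>c\<in>Ch_BC. 0 < f \<mu> p c) \<longleftrightarrow> (\<exists>c\<in>Ch_BC. 0 < f \<mu>' p c)"
      "(\<exists>c\<in>Ch_BC. 0 < g \<mu> p c) \<longleftrightarrow> (\<exists>c\<in>Ch_BC. 0 < g \<mu>' p c)" if p: "2 \<le> p" "p \<le> M - 1" for p
    proof -
      show "(\<exists>c\<in>Ch_BC. 0 < f \<mu> p c) \<longleftrightarrow> (\<exists>c\<in>Ch_BC. 0 < f \<mu>' p c)"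
        by (rule split_difference(1)[OF finite_Ch_BC _ ex[OF nc _ _ _ _ p(2)] ex[OF nc' _ _ _ _ p(2)] s[OF p]])
          (simp_all add: fM0)
      show "(\<exists>c\<in>Ch_BC. 0 < g \<mu> p c) \<longleftrightarrow> (\<exists>c\<in>Ch_BC. 0 < g \<mu>' p c)"
        by (rule split_difference(2)[OF finite_Ch_BC _ ex[OF nc _ _ _ _ p(2)] ex[OF nc' _ _ _ _ p(2)] s[OF p]])
          (simp_all add: fM0)
    qed
    have inner: "P \<kappa> \<inter> P \<kappa>' \<noteq> {}"
      if ncs: "NC {c \<in> Ch_BC. 0 < \<kappa> c}" "NC {c \<in> Ch_BC. 0 < \<kappa>' c}" and "P \<kappa> \<noteq> {}"
        and F: "\<And>p. 2 \<le> p \<Longrightarrow> p \<le> M - 1 \<Longrightarrow> (\<exists>c\<in>Ch_BC. 0 < f \<kappa> p c) \<longleftrightarrow> (\<exists>c\<in>Ch_BC. 0 < f \<kappa>' p c)"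
        and G: "\<And>p. 2 \<le> p \<Longrightarrow> p \<le> M - 1 \<Longrightarrow> (\<exists>c\<in>Ch_BC. 0 < g \<kappa> p c) \<longleftrightarrow> (\<exists>c\<in>Ch_BC. 0 < g \<kappa>' p c)"
      for \<kappa> \<kappa>'
    proof (rule shared_inner_chord[of "P \<kappa>" "P \<kappa>'" "M - 1" "B \<kappa>" "B \<kappa>'"])
      show "finite (P \<kappa>)" using finite_Ch_BC by (simp add: P_def)
      show "0 \<le> i \<and> i + 2 \<le> j \<and> j \<le> M - 1" if "(i, j) \<in> P \<kappa> \<union> P \<kappa>'" for i j
        using that by (auto simp: P_def Ch_BC_def)
      show "\<not> (i < k \<and> k < j \<and> j < l)" if "(i, j) \<in> P \<kappa>" "(k, l) \<in> P \<kappa>" for i j k l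
        using NC_not_crossing[OF ncs(1), of i j k l] that N_2M by (auto simp: P_def Ch_BC_def)
      show "\<not> (i < k \<and> k < j \<and> j < l)" if "(i, j) \<in> P \<kappa>'" "(k, l) \<in> P \<kappa>'" for i j k l
        using NC_not_crossing[OF ncs(2), of i j k l] that N_2M by (auto simp: P_def Ch_BC_def)
      show "\<not> (i < v \<and> v < j)" if "(i, j) \<in> P \<kappa>" "v \<in> B \<kappa>" for i j v
        using foot[OF ncs(1) that] .
      show "\<not> (i < v \<and> v < j)" if "(i, j) \<in> P \<kappa>'" "v \<in> B \<kappa>'" for i j v
        using foot[OF ncs(2) that] .
      show "(\<exists>i. (i, p) \<in> P \<kappa>) \<longleftrightarrow> (\<exists>i. (i, p) \<in> P \<kappa>')" if "2 \<le> p" "p \<le> M - 1" for p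
        using F[OF that] clo[OF that(2)] by simp
      show "((\<exists>j. (v, j) \<in> P \<kappa>) \<or> v \<in> B \<kappa>) \<longleftrightarrow> ((\<exists>j. (v, j) \<in> P \<kappa>') \<or> v \<in> B \<kappa>')"
        if "1 \<le> v" "v \<le> M - 1 - 1" for v
        using G[of "v + 1"] ope that by simp
    qed fact
    have sub: "P \<mu> \<inter> P \<mu>' \<subseteq> {c \<in> Ch_BC. 0 < \<mu> c} \<inter> {c \<in> Ch_BC. 0 < \<mu>' c}" by (auto simp: P_def)
    consider "P \<mu> \<noteq> {}" | "P \<mu>' \<noteq> {}" | "P \<mu> = {}" "P \<mu>' = {}" by blast
    then show ?thesis
    proof cases
      case 1
      then show ?thesis using inner[OF nc nc' _ fg] sub by blast
    next
      case 2
      then show ?thesis using inner[OF nc' nc _ fg[symmetric]] sub by blast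
    next
      case 3
      define lo hi where "lo c = snd c - M" and "hi c = fst c" for c :: "int \<times> int"
      \<comment> \<open>With weight \<open>r\<close> for diameters, whose two ends coincide, and 2
        for other chords, \<open>cnt\<close> at a vertex \<open>v\<close> from 1 to
        \<open>M - 2\<close> is twice the sum of \<open>g\<close> read from coordinate
        \<open>v + 1\<close>.\<close>
      define \<nu> where "\<nu> \<kappa> c = (if snd c = fst c + M then r else 2) * int (\<kappa> c)" for \<kappa> :: "int \<times> int \<Rightarrow> nat" and c
      define cnt where "cnt \<kappa> v = (\<Sum>c\<in>Ch_BC. \<nu> \<kappa> c * ((if lo c = v then 1 else 0) + (if hi c = v then 1 else 0)))"
        for \<kappa> :: "int \<times> int \<Rightarrow> nat" and v
      have \<nu>pos: "0 < \<nu> \<kappa> c \<longleftrightarrow> 0 < \<kappa> c" "0 \<le> \<nu> \<kappa> c" for \<kappa> c using rr by (auto simp: \<nu>_def)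
      \<comment> \<open>The coordinates below \<open>M\<close> determine \<open>cnt\<close> only at
        vertices 1 to \<open>M - 2\<close>. Coordinate \<open>M\<close> and the total number of
        endpoints give the difference of the counts at \<open>M - 1\<close> and 0, and noncrossing
        leaves at most one of these two nonzero.\<close>
      have main: "cnt \<mu> v = cnt \<mu>' v" if v: "0 \<le> v" "v \<le> M - 1" for v
      proof -
        define q where "q \<kappa> = (\<Sum>c\<in>Ch_BC. \<nu> \<kappa> c)" for \<kappa> :: "int \<times> int \<Rightarrow> nat"
        define sf where "sf \<kappa> = (\<Sum>c\<in>Ch_BC. fM \<kappa> c)" for \<kappa> :: "int \<times> int \<Rightarrow> nat"
        have outer: "M \<le> c" if "P \<kappa> = {}" "(a, c) \<in> Ch_BC" "\<kappa> (a, c) \<noteq> 0" for \<kappa> a c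
          using that by (force simp: P_def)
        have mid: "cnt \<kappa> v = - 2 * (\<Sum>c\<in>Ch_BC. f \<kappa> (v + 1) c - g \<kappa> (v + 1) c)"
          if "1 \<le> v" "v \<le> M - 2" "P \<kappa> = {}" for \<kappa> v
          unfolding cnt_def sum_distrib_left
        proof (intro sum.cong refl)
          fix c assume c: "c \<in> Ch_BC"
          show "\<nu> \<kappa> c * ((if lo c = v then 1 else 0) + (if hi c = v then 1 else 0)) =
              - 2 * (f \<kappa> (v + 1) c - g \<kappa> (v + 1) c)"
          proof (cases "\<kappa> c = 0")
            case False
            then have "M \<le> snd c" using outer[OF that(3), of "fst c" "snd c"] c by simp
            then show ?thesis using that(1,2)
              by (auto simp: \<nu>_def lo_def hi_def f_def g_def)
          qed (simp add: \<nu>_def f_def g_def)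
        qed
        have cm: "cnt \<mu> v = cnt \<mu>' v" if "1 \<le> v" "v \<le> M - 2" for v
          using mid[OF that 3(1)] mid[OF that 3(2)] s[of "v + 1"] that by simp
        have sfe: "sf \<mu> = sf \<mu>'"
        proof -
          have "gD \<mu> c = 0" "gD \<mu>' c = 0" for c using D0 by (auto simp: gD_def)
          then show ?thesis using sM by (simp add: sf_def)
        qed
        \<comment> \<open>Since \<open>r * \<rho> = 2\<close>, coordinate \<open>M\<close> accounts
          for all chords without an end at \<open>M - 1\<close>.\<close>
        have qe: "q \<kappa> = r * sf \<kappa> + cnt \<kappa> (M - 1)" if "P \<kappa> = {}" "\<kappa> D = 0" for \<kappa>
          unfolding q_def sf_def cnt_def sum_distrib_left sum.distrib[symmetric]
        proof (intro sum.cong refl)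
          fix c assume c: "c \<in> Ch_BC"
          show "\<nu> \<kappa> c = r * fM \<kappa> c + \<nu> \<kappa> c * ((if lo c = M - 1 then 1 else 0) + (if hi c = M - 1 then 1 else 0))"
          proof (cases "\<kappa> c = 0")
            case False
            have o: "M \<le> snd c" using outer[OF that(1), of "fst c" "snd c"] c False by simp
            have "c \<noteq> D" using False that(2) by auto
            then have "\<not> (snd c = fst c + M \<and> fst c = M - 1)" by (cases c) (auto simp: D_def)
            then show ?thesis using o c rr \<open>c \<noteq> D\<close>
              by (cases c) (auto simp: \<nu>_def fM_def lo_def hi_def Ch_BC_def)
          qed (simp add: \<nu>_def fM_def)
        qed
        have tot: "2 * q \<kappa> = (\<Sum>v\<in>{0..M - 1}. cnt \<kappa> v)" if "P \<kappa> = {}" for \<kappa>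
        proof -
          have "(\<Sum>v\<in>{0..M - 1}. cnt \<kappa> v) = (\<Sum>c\<in>Ch_BC. \<Sum>v\<in>{0..M - 1}. \<nu> \<kappa> c * ((if lo c = v then 1 else 0) + (if hi c = v then 1 else 0)))"
            unfolding cnt_def by (rule sum.swap)
          also have "\<dots> = (\<Sum>c\<in>Ch_BC. 2 * \<nu> \<kappa> c)"
          proof (intro sum.cong refl)
            fix c assume c: "c \<in> Ch_BC"
            show "(\<Sum>v\<in>{0..M - 1}. \<nu> \<kappa> c * ((if lo c = v then 1 else 0) + (if hi c = v then 1 else 0))) = 2 * \<nu> \<kappa> c"
            proof (cases "\<kappa> c = 0")
              case False
              have "M \<le> snd c" using outer[OF that, of "fst c" "snd c"] c False by simp
              then have "lo c \<in> {0..M - 1}" "hi c \<in> {0..M - 1}" using c by (auto simp: lo_def hi_def Ch_BC_def)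
              then show ?thesis by (simp add: sum_distrib_left[symmetric] sum.distrib sum.delta sum.delta')
            qed (simp add: \<nu>_def)
          qed
          finally show ?thesis by (simp add: q_def sum_distrib_left)
        qed
        have split: "(\<Sum>v\<in>{0..M - 1}. cnt \<kappa> v) = cnt \<kappa> 0 + (\<Sum>v\<in>{1..M - 2}. cnt \<kappa> v) + cnt \<kappa> (M - 1)" for \<kappa>
        proof -
          have "{0..M - 1} = insert 0 (insert (M - 1) {1..M - 2})" using M4 by auto
          then show ?thesis using M4 by simp
        qed
        have zero: "cnt \<kappa> 0 = 0 \<or> cnt \<kappa> (M - 1) = 0"
          if ncs: "NC {c \<in> Ch_BC. 0 < \<kappa> c}" and Pe: "P \<kappa> = {}" and "\<kappa> D = 0" for \<kappa>
        proof (rule ccontr)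
          assume "\<not> ?thesis"
          then have nz: "cnt \<kappa> 0 \<noteq> 0" "cnt \<kappa> (M - 1) \<noteq> 0" by auto
          obtain c where c0: "c \<in> Ch_BC" "\<nu> \<kappa> c * ((if lo c = 0 then 1 else 0) + (if hi c = 0 then 1 else 0)) \<noteq> 0"
            using nz(1) unfolding cnt_def by (rule sum.not_neutral_contains_not_neutral)
          then have c: "c \<in> Ch_BC" "\<nu> \<kappa> c \<noteq> 0" "lo c = 0 \<or> hi c = 0" by (auto split: if_splits)
          obtain d where d0: "d \<in> Ch_BC"
            "\<nu> \<kappa> d * ((if lo d = M - 1 then 1 else 0) + (if hi d = M - 1 then 1 else 0)) \<noteq> 0"
            using nz(2) unfolding cnt_def by (rule sum.not_neutral_contains_not_neutral)
          then have d: "d \<in> Ch_BC" "\<nu> \<kappa> d \<noteq> 0" "lo d = M - 1 \<or> hi d = M - 1" by (auto split: if_splits)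
          have k: "\<kappa> c \<noteq> 0" "\<kappa> d \<noteq> 0" using c(2) d(2) by (auto simp: \<nu>_def)
          obtain a1 c1 a2 c2 where cd: "c = (a1, c1)" "d = (a2, c2)" by fastforce
          have o: "M \<le> c1" "M \<le> c2" using outer[OF Pe] c(1) d(1) k cd by auto
          have "d \<noteq> D" using k that(3) by auto
          \<comment> \<open>An interval touching 0 comes from a chord ending at \<open>M\<close>,
            one touching \<open>M - 1\<close> from a chord starting there; such chords
            cross.\<close>
          then have "c1 = M" "a1 < M - 1" "a2 = M - 1" "M < c2" "c2 < 2 * M - 1"
            using c d o M4 by (auto simp: cd lo_def hi_def Ch_BC_def D_def)
          then show False
            using NC_not_crossing[OF ncs, of a1 c1 a2 c2] c(1) d(1) k N_2M
            by (auto simp: cd Ch_BC_def)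
        qed
        have nn: "0 \<le> cnt \<kappa> v" for \<kappa> v unfolding cnt_def using \<nu>pos by (intro sum_nonneg) simp
        have mids: "(\<Sum>v\<in>{1..M - 2}. cnt \<mu> v) = (\<Sum>v\<in>{1..M - 2}. cnt \<mu>' v)" using cm by (intro sum.cong) auto
        have "cnt \<mu> (M - 1) - cnt \<mu> 0 = cnt \<mu>' (M - 1) - cnt \<mu>' 0"
          using qe[where \<kappa> = \<mu>, OF 3(1) D0(1)] qe[where \<kappa> = \<mu>', OF 3(2) D0(2)] tot[OF 3(1)] tot[OF 3(2)] sfe mids
          unfolding split by simp
        then have ends: "cnt \<mu> 0 = cnt \<mu>' 0" "cnt \<mu> (M - 1) = cnt \<mu>' (M - 1)"
          using zero[OF nc 3(1) D0(1)] zero[OF nc' 3(2) D0(2)] nn[of \<mu> 0] nn[of \<mu>' 0] nn[of \<mu> "M - 1"] nn[of \<mu>' "M - 1"]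
          by auto
        consider "v = 0" | "v = M - 1" | "1 \<le> v" "v \<le> M - 2" using v by linarith
        then show ?thesis using ends cm by cases auto
      qed
      have rng: "0 \<le> lo c \<and> lo c \<le> hi c \<and> hi c \<le> M - 1"
        if "c \<in> Ch_BC" "0 < \<nu> \<mu> c \<or> 0 < \<nu> \<mu>' c" for c
      proof -
        obtain a b where c: "c = (a, b)" by fastforce
        have "0 < \<mu> c \<or> 0 < \<mu>' c" using that(2) \<nu>pos by auto
        moreover have "c \<notin> P \<mu>" "c \<notin> P \<mu>'" using 3 by auto
        ultimately have "\<not> b \<le> M - 1" using that(1) by (auto simp: P_def c)
        then show ?thesis using that(1) by (auto simp: c lo_def hi_def Ch_BC_def)
      qed
      have nest: "\<not> (lo c < lo d \<and> hi c < hi d)"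
        if ncs: "NC {c \<in> Ch_BC. 0 < \<kappa> c}" and Pe: "P \<kappa> = {}" and cd: "c \<in> Ch_BC" "d \<in> Ch_BC" "0 < \<nu> \<kappa> c" "0 < \<nu> \<kappa> d" for \<kappa> c d
      proof -
        obtain a1 c1 a2 c2 where e: "c = (a1, c1)" "d = (a2, c2)" by fastforce
        have "M \<le> c1" using Pe cd(1,3) unfolding e \<nu>pos by (force simp: P_def)
        then show ?thesis
          using NC_not_crossing[OF ncs, of a1 c1 a2 c2] cd N_2M unfolding \<nu>pos
          by (auto simp: e lo_def hi_def Ch_BC_def)
      qed
      obtain c0 where c0: "c0 \<in> Ch_BC" "0 < \<nu> \<mu> c0" using ne \<nu>pos by auto
      have "\<exists>c\<in>Ch_BC. 0 < \<nu> \<mu> c \<and> 0 < \<nu> \<mu>' c"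
      proof (rule nested_intervals_shared[where lo = lo and hi = hi and R = "M - 1", OF finite_Ch_BC _ rng _
            nest[OF nc 3(1)] nest[OF nc' 3(2)] main[unfolded cnt_def] c0])
        show "0 \<le> \<nu> \<mu> c \<and> 0 \<le> \<nu> \<mu>' c" for c using \<nu>pos by simp
        show "c = d" if "lo c = lo d" "hi c = hi d" for c d
          using that by (cases c; cases d) (auto simp: lo_def hi_def)
      qed
      then show ?thesis unfolding \<nu>pos by blast
    qed
  qed
qed

end

section \<open>The Groebner cone in polygon coordinates\<close>

definition (in polygon) weak :: "(int set set \<Rightarrow> real) \<Rightarrow> bool" where
  "weak u \<longleftrightarrow> (\<forall>i j. i + 2 \<le> j \<longrightarrow> j \<le> i + N - 2 \<longrightarrow> 0 \<le> cc u i j)"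

definition (in polygon) U :: "(int set set \<Rightarrow> real) set" where
  "U = {u. \<forall>L. L \<notin> variable_labels X n \<longrightarrow> u L = 0}"

context polygon_seed
begin

text \<open>A cluster monomial is given by its chord multiplicities. These are determined by its
  leading exponent through \<open>share\<close>, so leading exponents are distinct and
  \<open>lead_independent\<close> applies.\<close>

lemma independent_from_chords:
  assumes C: "finite C" "V = xxp ` C" "inj_on xxp C" "\<And>c. c \<in> C \<Longrightarrow> L.lead (xxp c) (\<alpha> c)"
    and share: "\<And>\<mu> \<mu>'. NC {c \<in> C. 0 < \<mu> c} \<Longrightarrow> NC {c \<in> C. 0 < \<mu>' c} \<Longrightarrow>
      (\<And>p. (\<Sum>c\<in>C. int (\<mu> c) * \<alpha> c p) = (\<Sum>c\<in>C. int (\<mu>' c) * \<alpha> c p)) \<Longrightarrow>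
      {c \<in> C. 0 < \<mu> c} \<noteq> {} \<Longrightarrow> {c \<in> C. 0 < \<mu> c} \<inter> {c \<in> C. 0 < \<mu>' c} \<noteq> {}"
    and p: "p \<in> polys_in V" "\<And>m. m \<in> Poly_Mapping.keys p \<Longrightarrow> compatible_monomial cmp m"
      "poly_eval \<iota> (\<lambda>v. v) p = 0"
  shows "p = 0"
proof (rule poly_mapping_eqI)
  fix m0
  define \<mu> where "\<mu> m c = Poly_Mapping.lookup m (xxp c)" for m :: "'f \<Rightarrow>\<^sub>0 nat" and c
  define \<beta> where "\<beta> m = (\<lambda>q. \<Sum>c\<in>C. int (\<mu> m c) * \<alpha> c q)" for m
  have keysV: "Poly_Mapping.keys m \<subseteq> V" if "m \<in> Poly_Mapping.keys p" for m
    using polys_in_keysD[OF p(1) that] .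
  have lead: "L.lead (mono_eval (\<lambda>v. v) m) (\<beta> m)" if "m \<in> Poly_Mapping.keys p" for m
  proof -
    have "mono_eval (\<lambda>v. v) m = (\<Prod>v\<in>V. v ^ Poly_Mapping.lookup m v)"
      by (rule mono_eval_superset[OF finite_V keysV[OF that]])
    also have "\<dots> = (\<Prod>c\<in>C. xxp c ^ \<mu> m c)"
      unfolding C(2) prod.reindex[OF C(3)] by (simp add: \<mu>_def)
    finally show ?thesis unfolding \<beta>_def using L.lead_monomial[OF C(1,4)] by simp
  qed
  have nc: "NC {c \<in> C. 0 < \<mu> m c}" if "m \<in> Poly_Mapping.keys p" for m
    using p(2)[OF that] by (auto simp: NC_def compatible_monomial_def \<mu>_def in_keys_iff)
  have inj: "inj_on \<beta> (Poly_Mapping.keys p)"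
  proof (rule inj_onI)
    fix m m' assume m: "m \<in> Poly_Mapping.keys p" "m' \<in> Poly_Mapping.keys p" and eq: "\<beta> m = \<beta> m'"
    have sums: "(\<Sum>c\<in>C. int (\<mu> m c) * \<alpha> c q) = (\<Sum>c\<in>C. int (\<mu> m' c) * \<alpha> c q)" for q
      using fun_cong[OF eq, of q] by (simp add: \<beta>_def)
    have mult: "\<mu> m c = \<mu> m' c" if "c \<in> C" for c
      by (rule multiplicities_determined[where NC = NC and \<alpha> = \<alpha>,
            OF C(1) share NC_mono nc[OF m(1)] nc[OF m(2)] sums that])
    show "m = m'"
    proof (rule poly_mapping_eqI)
      fix v
      show "Poly_Mapping.lookup m v = Poly_Mapping.lookup m' v"
      proof (cases "v \<in> V")
        case True
        then show ?thesis using mult unfolding C(2) by (auto simp: \<mu>_def)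
      next
        case False
        then have "v \<notin> Poly_Mapping.keys m" "v \<notin> Poly_Mapping.keys m'" using keysV m by auto
        then show ?thesis by (simp add: in_keys_iff)
      qed
    qed
  qed
  have zero: "(\<Sum>m\<in>Poly_Mapping.keys p. \<iota> (Poly_Mapping.lookup p m) * mono_eval (\<lambda>v. v) m) = 0"
    using p(3) by (simp add: poly_eval_superset[OF finite_keys subset_refl])
  have "Poly_Mapping.lookup p m = 0" if "m \<in> Poly_Mapping.keys p" for m
    by (rule L.lead_independent[OF finite_keys lead inj zero that])
  then show "Poly_Mapping.lookup p m0 = Poly_Mapping.lookup 0 m0"
    by (cases "m0 \<in> Poly_Mapping.keys p") (auto simp: in_keys_iff)
qed

lemma xx_M_mult: assumes bc shows "xx (i + M * q) (j + M * q) = xx i j"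
proof -
  obtain s where "q = 2 * s \<or> q = 2 * s + 1" by (metis oddE evenE)
  moreover have e: "xx (i + M * (2 * s)) (j + M * (2 * s)) = xx i j" for i j
  proof (rule xx_cong)
    have "M * (2 * s) = N * s" using N_2M by simp
    then show "(i + M * (2 * s)) mod N = i mod N" "(j + M * (2 * s)) mod N = j mod N"
      by (simp_all only: mod_mult_self2)
  qed
  moreover have "xx (i + M * (2 * s + 1)) (j + M * (2 * s + 1)) = xx i j"
    using e[of "i + M" "j + M"] xx_antipode[OF assms, of i j] by (simp add: algebra_simps)
  ultimately show ?thesis by auto
qed

lemma V_Ch_A: "\<not> bc \<Longrightarrow> V = xxp ` Ch_A"
proof (intro set_eqI iffI)
  fix v assume "v \<in> V"
  then obtain i j where ij: "i + 2 \<le> j" "j \<le> i + N - 2" "v = xx i j" unfolding V_eq by blast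
  define a d where "a = i mod N" and "d = j - i"
  have a: "0 \<le> a" "a < N" "a mod N = i mod N" using N_pos by (auto simp: a_def)
  have ad: "(a + d) mod N = j mod N" by (simp add: a_def d_def mod_add_left_eq)
  have d: "2 \<le> d" "d \<le> N - 2" using ij by (auto simp: d_def)
  show "v \<in> xxp ` Ch_A"
  proof (cases "a + d \<le> N - 1")
    case True
    have "v = xxp (a, a + d)" using xx_cong[OF a(3) ad] ij(3) by (simp add: xxp_def)
    moreover have "(a, a + d) \<in> Ch_A" using True a d by (auto simp: Ch_A_def)
    ultimately show ?thesis by blast
  next
    case False
    have "(a + d - N) mod N = j mod N" using ad by simp
    then have "v = xxp (a + d - N, a)"
      using xx_cong[OF a(3), of "a + d - N" j] ij(3) by (simp add: xxp_def xx_commute)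
    moreover have "(a + d - N, a) \<in> Ch_A" using False a d by (auto simp: Ch_A_def)
    ultimately show ?thesis by blast
  qed
next
  fix v assume "v \<in> xxp ` Ch_A"
  then show "v \<in> V" by (auto simp: Ch_A_def xxp_def intro!: xx_in_V)
qed

lemma inj_Ch_A: assumes "\<not> bc" shows "inj_on xxp Ch_A"
proof (rule inj_onI)
  fix c d assume cd: "c \<in> Ch_A" "d \<in> Ch_A" "xxp c = xxp d"
  obtain i j k l where e: "c = (i, j)" "d = (k, l)" by fastforce
  have "lab i j = lab k l" using cd xx_eq_iff[of i j k l] by (auto simp: e Ch_A_def xxp_def)
  moreover have "lab i j = {seg N i j}" for i j using assms by (simp only: lab_eq if_False)
  ultimately have "seg N i j = seg N k l" by simp
  moreover have "i mod N = i" "j mod N = j" "k mod N = k" "l mod N = l"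
    using cd by (auto simp: e Ch_A_def mod_pos_pos_trivial)
  ultimately show "c = d" using cd by (auto simp: seg_eq_iff e Ch_A_def)
qed

lemma V_Ch_BC: assumes bc shows "V = xxp ` Ch_BC"
proof (intro set_eqI iffI)
  have rep: "xx i j \<in> xxp ` Ch_BC" if "i + 2 \<le> j" "j \<le> i + M" for i j
  proof -
    define a where "a = i mod M"
    have a: "0 \<le> a" "a < M" using M_ge by (auto simp: a_def)
    have e1: "a + M * (i div M) = i" by (simp add: a_def)
    then have e2: "a + (j - i) + M * (i div M) = j" by linarith
    have "xx i j = xx a (a + (j - i))"
      using xx_M_mult[OF assms, of a "i div M" "a + (j - i)"] unfolding e1 e2 .
    moreover have "(a, a + (j - i)) \<in> Ch_BC" using a that by (auto simp: Ch_BC_def)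
    ultimately show ?thesis by (force simp: xxp_def)
  qed
  fix v assume "v \<in> V"
  then obtain i j where ij: "i + 2 \<le> j" "j \<le> i + N - 2" "v = xx i j" unfolding V_eq by blast
  show "v \<in> xxp ` Ch_BC"
  proof (cases "j \<le> i + M")
    case True
    then show ?thesis using rep ij by simp
  next
    case False
    then have "xx j (i + N) \<in> xxp ` Ch_BC" using ij N_2M by (intro rep) auto
    then show ?thesis using ij(3) by (simp add: xx_shift xx_commute)
  qed
next
  fix v assume "v \<in> xxp ` Ch_BC"
  then show "v \<in> V" using N_2M M_ge by (auto simp: Ch_BC_def xxp_def intro!: xx_in_V)
qed

lemma inj_Ch_BC: assumes bc shows "inj_on xxp Ch_BC"
proof (rule inj_onI)
  fix c d assume cd: "c \<in> Ch_BC" "d \<in> Ch_BC" "xxp c = xxp d"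
  obtain i j k l where e: "c = (i, j)" "d = (k, l)" by fastforce
  have b: "0 \<le> i" "i < M" "i + 2 \<le> j" "j \<le> i + M" "0 \<le> k" "k < M" "k + 2 \<le> l" "l \<le> k + M"
    using cd by (auto simp: e Ch_BC_def)
  have "lab i j = lab k l" using cd(3) xx_eq_iff[of i j k l] b N_2M M_ge by (auto simp: e xxp_def)
  then have "seg N i j \<in> lab k l" by (auto simp: lab_eq split: if_splits)
  then have "seg N i j = seg N k l \<or> seg N i j = seg N (k + M) (l + M)" by (auto simp: lab_eq split: if_splits)
  then consider "i mod N = k mod N" "j mod N = l mod N" | "i mod N = l mod N" "j mod N = k mod N"
    | "i mod N = (k + M) mod N" "j mod N = (l + M) mod N" | "i mod N = (l + M) mod N" "j mod N = (k + M) mod N"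
    by (auto simp: seg_eq_iff)
  then show "c = d"
  proof cases
    case 1
    then show ?thesis using mod_window[of i N k] mod_window[of j N l] b N_2M by (auto simp: e)
  next
    case 2
    then show ?thesis using mod_window[of i N l] mod_window[of j N k] b N_2M by auto
  next
    case 3
    then show ?thesis using mod_window[of i N "k + M"] b N_2M by auto
  next
    case 4
    have "(l + M) mod N = (l - M) mod N" using shift_N[of "l - M"] by simp
    then have "i = l - M" using 4(1) mod_window[of i N "l - M"] b N_2M by auto
    moreover have "j = k + M" using 4(2) mod_window[of j N "k + M"] b N_2M by auto
    ultimately show ?thesis using b by (auto simp: e)
  qed
qed

lemma lead_Ch_BC: assumes bc "c \<in> Ch_BC" shows "L.lead (xxp c) (\<alpha>pBC c)"
proof -
  obtain a d where c: "c = (a, d)" by fastforce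
  have b: "0 \<le> a" "a \<le> M - 1" "a + 2 \<le> d" "d \<le> a + M" using assms(2) by (auto simp: c Ch_BC_def)
  consider "d \<le> M - 1" | "M \<le> d" "d = a + M" | "M \<le> d" "d < a + M" using b by linarith
  then show ?thesis
  proof cases
    case 1
    then have "L.lead (xx a d) (e d - e (a + 1))" using b assms(1) by (intro lead_inner) auto
    then show ?thesis using 1 unfolding xxp_def \<alpha>pBC_def c by (simp only: fst_conv snd_conv if_True)
  next
    case 2
    have "L.lead (xx a (a + M)) (\<alpha>D a)" using b assms(1) by (intro lead_diameter) auto
    moreover have "\<not> a + M \<le> M - 1" using b by simp
    ultimately show ?thesis using 2(2) unfolding xxp_def \<alpha>pBC_def c by (simp only: fst_conv snd_conv if_True if_False simp_thms)
  next
    case 3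
    have "L.lead (xx a ((d - M) + M)) (ehat M - e ((d - M) + 1) - ehat (a + 1))"
      using b 3 assms(1) by (intro lead_outer) auto
    moreover have "\<not> d \<le> M - 1" "d \<noteq> a + M" using 3 by auto
    ultimately show ?thesis unfolding xxp_def \<alpha>pBC_def c by (simp only: fst_conv snd_conv if_False diff_add_cancel)
  qed
qed

lemma cluster_monomials_independent:
  assumes "p \<in> polys_in V" "\<And>m. m \<in> Poly_Mapping.keys p \<Longrightarrow> compatible_monomial cmp m"
    "poly_eval \<iota> (\<lambda>v. v) p = 0"
  shows "p = 0"
proof (cases bc)
  case True
  show ?thesis
    by (rule independent_from_chords[OF finite_Ch_BC V_Ch_BC[OF True] inj_Ch_BC[OF True]
          lead_Ch_BC[OF True] share_BC[OF True] assms])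
next
  case False
  have Jm: "k \<in> J \<longleftrightarrow> 2 \<le> k \<and> k \<le> N - 2" for k unfolding J_def using False by simp
  have lead: "L.lead (xxp c) (\<alpha>pA c)" if "c \<in> Ch_A" for c
    unfolding xxp_def \<alpha>pA_def using that by (intro lead_A[OF False]) (auto simp: Ch_A_def)
  show ?thesis
    by (rule independent_from_chords[OF finite_Ch_A V_Ch_A[OF False] inj_Ch_A[OF False]
          lead share_A[OF Jm] assms])
qed

lemma initial_ideal_iff_strict:
  "initial_ideal V \<omega> relations = ideal_generated V incompatibles \<longleftrightarrow> strict (Om \<omega>)"
proof
  assume "strict (Om \<omega>)"
  interpret straightening_basis \<iota> V cmp Str \<omega>0 h0
  proof
    show "\<omega>0 \<in> Str" by (rule \<omega>0_Str)
    show "\<omega>0 v = real (h0 v)" if "v \<in> V" for v using that by (simp add: \<omega>0_def)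
  qed (fact straighten_pair cluster_monomials_independent)+
  show "initial_ideal V \<omega> relations = ideal_generated V incompatibles"
    using \<open>strict (Om \<omega>)\<close> by (intro initial_ideal_eq) (simp add: Str_def)
qed (rule strict_of_initial_ideal)

lemma Om_add_scale: "Om (\<lambda>v. \<omega> v + s * \<omega>' v) L = Om \<omega> L + s * Om \<omega>' L"
  by (simp add: Om_def)

lemma cc_Om_add_scale: "cc (Om (\<lambda>v. \<omega> v + s * \<omega>' v)) i j = cc (Om \<omega>) i j + s * cc (Om \<omega>') i j"
  by (simp add: cc_def F_def Om_add_scale algebra_simps)

lemma continuous_Om: "continuous_on UNIV (\<lambda>\<omega>. Om \<omega> L)"
  by (cases "L \<in> variable_labels X n") (auto simp: Om_def intro: continuous_on_product_coordinates)

lemma continuous_cc: "continuous_on UNIV (\<lambda>\<omega>. cc (Om \<omega>) i j)"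
  unfolding cc_def F_def by (intro continuous_intros continuous_Om)

text \<open>The weak inequalities define a closed set, and each of its points is a limit of points
  obtained by adding small positive multiples of the strict weight \<open>\<omega>0\<close>.\<close>

lemma groebner_cone_eq:
  "groebner_cone \<iota> n S = {\<omega>. (\<forall>v. v \<notin> V \<longrightarrow> \<omega> v = 0) \<and> weak (Om \<omega>)}" (is "_ = ?W")
proof -
  have eq: "groebner_cone \<iota> n S = closure {\<omega>. (\<forall>v. v \<notin> V \<longrightarrow> \<omega> v = 0) \<and> strict (Om \<omega>)}" (is "_ = closure ?A")
  proof -
    have "relation_ideal \<iota> n S = relations" by (simp add: relation_ideal_def relations_def)
    moreover have "incompatibility_ideal n S = ideal_generated V (incompatibles :: ('f, 'k) mpolynomial set)"
      by (simp add: incompatibility_ideal_def incompatibles_def cmp_def)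
    ultimately show ?thesis unfolding groebner_cone_def by (simp add: initial_ideal_iff_strict)
  qed
  have "closed ?W"
  proof -
    have "?W = (\<Inter>v\<in>- V. {\<omega>. \<omega> v = 0}) \<inter>
        (\<Inter>(i, j)\<in>{(i, j). i + 2 \<le> j \<and> j \<le> i + N - 2}. {\<omega>. 0 \<le> cc (Om \<omega>) i j})"
      by (auto simp: weak_def)
    moreover have "closed {\<omega> :: 'f \<Rightarrow> real. \<omega> v = 0}" for v
      by (intro closed_Collect_eq continuous_on_product_coordinates continuous_on_const)
    moreover have "closed {\<omega>. 0 \<le> cc (Om \<omega>) i j}" for i j
      by (intro closed_Collect_le continuous_cc continuous_on_const)
    ultimately show ?thesis by (auto intro!: closed_Int closed_INT)
  qed
  moreover have "?A \<subseteq> ?W" by (force simp: strict_def weak_def)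
  ultimately have "closure ?A \<subseteq> ?W" by (rule closure_minimal[rotated])
  moreover have "?W \<subseteq> closure ?A"
  proof
    fix \<omega> assume \<omega>: "\<omega> \<in> ?W"
    define f where "f s = (\<lambda>v. \<omega> v + s * \<omega>0 v)" for s
    have cont: "continuous_on (closure {0<..}) f"
      unfolding f_def by (intro continuous_on_coordinatewise_then_product continuous_intros)
    have "f s \<in> ?A" if "0 < s" for s
    proof -
      have "strict (Om (f s))" unfolding strict_def
      proof (intro allI impI)
        fix i j assume ij: "i + 2 \<le> j" "j \<le> i + N - 2"
        have "0 \<le> cc (Om \<omega>) i j" "0 < cc (Om \<omega>0) i j"
          using \<omega> \<omega>0_Str ij by (auto simp: weak_def Str_def strict_def)
        then show "0 < cc (Om (f s)) i j" using that unfolding f_def cc_Om_add_scale by (simp add: add_nonneg_pos)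
      qed
      then show ?thesis using \<omega> by (auto simp: f_def \<omega>0_def)
    qed
    then have "f ` {0<..} \<subseteq> closure ?A" using closure_subset by fastforce
    then have "f ` closure {0<..} \<subseteq> closure ?A" by (rule image_closure_subset[OF cont closed_closure])
    moreover have "(0::real) \<in> closure {0<..}" by simp
    ultimately have "f 0 \<in> closure ?A" by blast
    then show "\<omega> \<in> closure ?A" by (simp add: f_def)
  qed
  ultimately show ?thesis unfolding eq by blast
qed

lemma polygon_groebner_cone_eq: "polygon_groebner_cone \<iota> X n S x = {u \<in> U. weak u}"
proof -
  have "polygon_groebner_cone \<iota> X n S x = Om ` groebner_cone \<iota> n S"
    unfolding polygon_groebner_cone_def by (intro image_cong refl ext) (simp add: Om_def)
  also have "\<dots> = {u \<in> U. weak u}"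
  proof (intro set_eqI iffI)
    fix u assume "u \<in> Om ` groebner_cone \<iota> n S"
    then show "u \<in> {u \<in> U. weak u}" by (auto simp: groebner_cone_eq U_def Om_supported)
  next
    fix u assume u: "u \<in> {u \<in> U. weak u}"
    define \<omega> where "\<omega> v = (if v \<in> V then u (inv_into (variable_labels X n) x v) else 0)" for v
    have "Om \<omega> L = u L" for L
      using u bij_x by (auto simp: Om_def \<omega>_def U_def bij_betw_def)
    then have "Om \<omega> = u" by (rule ext)
    moreover have "\<omega> \<in> groebner_cone \<iota> n S"
      using u calculation by (auto simp: groebner_cone_eq \<omega>_def)
    ultimately show "u \<in> Om ` groebner_cone \<iota> n S" by blast
  qed
  finally show ?thesis .
qed

end

section \<open>Rays of a cone with one relation between its facet functionals\<close>

lemma coset_eq_iff: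
  assumes "subspace L" shows "coset L a = coset L b \<longleftrightarrow> a - b \<in> L"
proof
  assume "coset L a = coset L b"
  moreover have "a \<in> coset L a"
    using subspace_0[OF assms] by (force simp: coset_def)
  ultimately obtain z where "z \<in> L" "a = b + z" by (auto simp: coset_def)
  then show "a - b \<in> L" by simp
next
  assume ab: "a - b \<in> L"
  have "coset L a \<subseteq> coset L b" if "a - b \<in> L" for a b
  proof
    fix z assume "z \<in> coset L a"
    then obtain y where y: "y \<in> L" "z = a + y" by (auto simp: coset_def)
    have "(a - b) + y \<in> L" using that y(1) by (rule subspace_add[OF assms])
    moreover have "z = b + ((a - b) + y)" using y(2) by simp
    ultimately show "z \<in> coset L b" unfolding coset_def by (rule rev_image_eqI)
  qed
  moreover have "b - a \<in> L" using subspace_neg[OF assms ab] by simp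
  ultimately show "coset L a = coset L b" using ab by blast
qed

lemma coset_in_quotient_ray:
  assumes "subspace L"
  shows "coset L a \<in> quotient_ray L u \<longleftrightarrow> (\<exists>c\<ge>0. a - c *\<^sub>R u \<in> L)"
  using coset_eq_iff[OF assms] by (auto simp: quotient_ray_def)

lemma quotient_ray_eqI:
  assumes L: "subspace L" and "c > 0" "u - c *\<^sub>R v \<in> L"
  shows "quotient_ray L u = quotient_ray L v"
proof -
  have *: "quotient_ray L u \<subseteq> quotient_ray L v" if c: "c > 0" "u - c *\<^sub>R v \<in> L" for c u v
  proof
    fix R assume "R \<in> quotient_ray L u"
    then obtain d where d: "d \<ge> 0" "R = coset L (d *\<^sub>R u)" by (auto simp: quotient_ray_def)
    have "d *\<^sub>R (u - c *\<^sub>R v) \<in> L" using subspace_scale[OF L c(2)] .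
    then have "d *\<^sub>R u - (d * c) *\<^sub>R v \<in> L" by (simp add: scaleR_diff_right)
    then show "R \<in> quotient_ray L v"
      unfolding d(2) coset_in_quotient_ray[OF L] using d(1) c(1) by (intro exI[of _ "d * c"]) auto
  qed
  have "(- (1 / c)) *\<^sub>R (u - c *\<^sub>R v) \<in> L" using subspace_scale[OF L assms(3)] .
  then have "v - (1 / c) *\<^sub>R u \<in> L" using assms(2) by (simp add: scaleR_diff_right)
  then show ?thesis using *[OF assms(2,3)] *[of "1 / c" v u] assms(2) by auto
qed

text \<open>The functionals \<open>f k\<close> cut out the cone and satisfy the relation \<open>\<sigma>\<close>. A ray is positive on one
  functional not involved in the relation, or on two functionals of opposite signs.\<close>

locale cone_with_relation =
  fixes U :: "'a::real_vector set" and \<Lambda> :: "'k set" and f :: "'k \<Rightarrow> 'a \<Rightarrow> real" and \<sigma> :: "'k \<Rightarrow> real"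
    and G0 G1 :: "'a set"
  assumes U: "subspace U" and fin: "finite \<Lambda>"
    and f_add: "f k (a + b) = f k a + f k b" and f_scale: "f k (c *\<^sub>R a) = c * f k a"
    and rel: "u \<in> U \<Longrightarrow> (\<Sum>k\<in>\<Lambda>. \<sigma> k * f k u) = 0"
    and G0: "g \<in> G0 \<Longrightarrow> \<exists>l\<in>\<Lambda>. \<sigma> l = 0 \<and> g \<in> U \<and> 0 < f l g \<and>
       (\<forall>k\<in>\<Lambda>. 0 \<le> f k g \<and> (f k g \<noteq> 0 \<longrightarrow> (\<forall>u\<in>U. f k u = f l u)))"
    and G0_ex: "l \<in> \<Lambda> \<Longrightarrow> \<sigma> l = 0 \<Longrightarrow> \<exists>g\<in>G0. g \<in> U \<and> 0 < f l g \<and>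
       (\<forall>k\<in>\<Lambda>. 0 \<le> f k g \<and> (f k g \<noteq> 0 \<longrightarrow> (\<forall>u\<in>U. f k u = f l u)))"
    and G1: "g \<in> G1 \<Longrightarrow> \<exists>l\<in>\<Lambda>. \<exists>m\<in>\<Lambda>. 0 < \<sigma> l \<and> \<sigma> m < 0 \<and> g \<in> U \<and> 0 < f l g \<and> 0 < f m g \<and>
       (\<forall>k\<in>\<Lambda>. 0 \<le> f k g \<and> (f k g \<noteq> 0 \<longrightarrow>
          (\<forall>u\<in>U. f k u = f l u) \<or> \<sigma> k < 0 \<and> (\<forall>u\<in>U. f k u = f m u)))"
    and G1_ex: "l \<in> \<Lambda> \<Longrightarrow> m \<in> \<Lambda> \<Longrightarrow> 0 < \<sigma> l \<Longrightarrow> \<sigma> m < 0 \<Longrightarrow> \<exists>g\<in>G1. g \<in> U \<and>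
       (\<forall>k\<in>\<Lambda>. 0 \<le> f k g \<and> (f k g \<noteq> 0 \<longrightarrow>
          (\<forall>u\<in>U. f k u = f l u) \<or> (\<forall>u\<in>U. f k u = f m u)))"
begin

definition C :: "'a set" where "C = {u \<in> U. \<forall>k\<in>\<Lambda>. 0 \<le> f k u}"

definition K :: "'a set" where "K = {u \<in> U. \<forall>k\<in>\<Lambda>. f k u = 0}"

lemma f_minus: "f k (- a) = - f k a" and f_diff: "f k (a - b) = f k a - f k b" and f_zero: "f k 0 = 0"
proof -
  show m: "f k (- a) = - f k a" for a using f_scale[of k "- 1" a] by simp
  show "f k (a - b) = f k a - f k b" using f_add[of k a "- b"] m by simp
  show "f k 0 = 0" using f_scale[of k 0 0] by simp
qed

lemma lineality: "lineality_space C = K"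
proof (intro set_eqI iffI)
  fix u assume "u \<in> lineality_space C"
  then have "u \<in> U" "\<forall>k\<in>\<Lambda>. 0 \<le> f k u \<and> 0 \<le> - f k u"
    by (auto simp: lineality_space_def C_def f_minus)
  then show "u \<in> K" by (force simp: K_def)
next
  fix u assume "u \<in> K"
  then show "u \<in> lineality_space C"
    using subspace_neg[OF U] by (auto simp: lineality_space_def C_def K_def f_minus)
qed

lemma K: "subspace K"
  using U by (auto simp: subspace_def K_def f_add f_scale f_zero)

definition face :: "'a \<Rightarrow> bool" where
  "face u \<longleftrightarrow> (\<forall>a\<in>C. \<forall>b\<in>C. coset K (a + b) \<in> quotient_ray K u \<longrightarrow>
            coset K a \<in> quotient_ray K u \<and> coset K b \<in> quotient_ray K u)"

lemma rays: "rays_mod_lineality C = {quotient_ray K u | u. u \<in> C \<and> u \<notin> K \<and> face u}"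
  unfolding rays_mod_lineality_def lineality face_def by blast

text \<open>If \<open>g\<close> is positive only where \<open>u\<close> is, a small positive
  multiple of \<open>g\<close> can be split off from \<open>u\<close> inside the cone; the face
  property then puts \<open>g\<close> on the ray of \<open>u\<close>.\<close>

lemma face_generator:
  assumes u: "u \<in> C" "u \<notin> K" "face u" and g: "g \<in> C" "g \<notin> K"
    and dom: "\<And>k. k \<in> \<Lambda> \<Longrightarrow> 0 < f k g \<Longrightarrow> 0 < f k u"
  shows "quotient_ray K u = quotient_ray K g"
proof -
  \<comment> \<open>The smallest of the relevant quotients, capped at 1 so that the set is
    nonempty.\<close>
  define \<epsilon> where "\<epsilon> = Min (insert 1 ((\<lambda>k. f k u / f k g) ` {k \<in> \<Lambda>. 0 < f k g}))"
  have fin': "finite (insert 1 ((\<lambda>k. f k u / f k g) ` {k \<in> \<Lambda>. 0 < f k g}))" using fin by simp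
  have pos: "0 < \<epsilon>" unfolding \<epsilon>_def using fin' dom by (subst Min_gr_iff) auto
  have le: "\<epsilon> * f k g \<le> f k u" if "k \<in> \<Lambda>" for k
  proof (cases "0 < f k g")
    case True
    then have "\<epsilon> \<le> f k u / f k g" unfolding \<epsilon>_def using fin' that by (intro Min_le) auto
    then show ?thesis using True by (simp add: pos_le_divide_eq)
  next
    case False
    then have "f k g = 0" using g(1) that by (force simp: C_def)
    then show ?thesis using u(1) that by (simp add: C_def)
  qed
  have gU: "g \<in> U" "u \<in> U" using g u by (auto simp: C_def)
  have a: "\<epsilon> *\<^sub>R g \<in> C" using g(1) pos subspace_scale[OF U] by (auto simp: C_def f_scale)
  have b: "u - \<epsilon> *\<^sub>R g \<in> C"
    using gU le subspace_diff[OF U] subspace_scale[OF U] by (auto simp: C_def f_scale f_diff)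
  have "coset K (\<epsilon> *\<^sub>R g + (u - \<epsilon> *\<^sub>R g)) \<in> quotient_ray K u"
    unfolding coset_in_quotient_ray[OF K] using subspace_0[OF K] by (intro exI[of _ 1]) simp
  then have "coset K (\<epsilon> *\<^sub>R g) \<in> quotient_ray K u" using u(3) a b unfolding face_def by blast
  then obtain c where c: "c \<ge> 0" "\<epsilon> *\<^sub>R g - c *\<^sub>R u \<in> K" unfolding coset_in_quotient_ray[OF K] by blast
  have s: "(1 / \<epsilon>) *\<^sub>R (\<epsilon> *\<^sub>R g - c *\<^sub>R u) \<in> K" using subspace_scale[OF K c(2)] .
  then have gK: "g - (c / \<epsilon>) *\<^sub>R u \<in> K" using pos by (simp add: scaleR_diff_right)
  have "c \<noteq> 0" using gK g(2) by auto
  then have "0 < c / \<epsilon>" using c(1) pos by simp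
  from quotient_ray_eqI[OF K this gK] show ?thesis by simp
qed

text \<open>Where \<open>g\<close> vanishes, a sum proportional to \<open>g\<close> modulo
  \<open>K\<close> vanishes too, hence so do its nonnegative summands; they fall under the
  assumption.\<close>

lemma faceI:
  assumes g: "g \<in> C" and *: "\<And>a. a \<in> C \<Longrightarrow> (\<And>k. k \<in> \<Lambda> \<Longrightarrow> f k g = 0 \<Longrightarrow> f k a = 0) \<Longrightarrow> \<exists>c\<ge>0. a - c *\<^sub>R g \<in> K"
  shows "face g"
  unfolding face_def
proof (intro ballI impI)
  fix a b assume a: "a \<in> C" and b: "b \<in> C" and "coset K (a + b) \<in> quotient_ray K g"
  then obtain c where c: "a + b - c *\<^sub>R g \<in> K" unfolding coset_in_quotient_ray[OF K] by blast
  have "f k a = 0 \<and> f k b = 0" if k: "k \<in> \<Lambda>" "f k g = 0" for k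
  proof -
    have "f k (a + b - c *\<^sub>R g) = 0" using c k(1) by (simp add: K_def)
    then have "f k a + f k b = 0" using k(2) by (simp add: f_add f_diff f_scale)
    moreover have "0 \<le> f k a" "0 \<le> f k b" using a b k(1) by (auto simp: C_def)
    ultimately show ?thesis by linarith
  qed
  then show "coset K a \<in> quotient_ray K g \<and> coset K b \<in> quotient_ray K g"
    unfolding coset_in_quotient_ray[OF K] using *[OF a] *[OF b] by blast
qed

lemma generator_C:
  assumes "g \<in> G0 \<union> G1" shows "g \<in> C" "g \<notin> K"
proof -
  have "g \<in> U \<and> (\<forall>k\<in>\<Lambda>. 0 \<le> f k g) \<and> (\<exists>l\<in>\<Lambda>. 0 < f l g)"
    using assms G0[of g] G1[of g] by blast
  then show "g \<in> C" "g \<notin> K" by (force simp: C_def K_def)+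
qed

text \<open>The functionals nonzero at \<open>g\<close> all coincide on \<open>U\<close>, so modulo
  \<open>K\<close> a point vanishing wherever \<open>g\<close> does is fixed by one value.\<close>

lemma face_G0: assumes "g \<in> G0" shows "face g"
proof (rule faceI)
  show gC: "g \<in> C" using generator_C assms by blast
  obtain l where l: "l \<in> \<Lambda>" "0 < f l g" "\<And>k. k \<in> \<Lambda> \<Longrightarrow> f k g \<noteq> 0 \<Longrightarrow> (\<forall>u\<in>U. f k u = f l u)"
    using G0[OF assms] by blast
  fix a assume a: "a \<in> C" and z: "\<And>k. k \<in> \<Lambda> \<Longrightarrow> f k g = 0 \<Longrightarrow> f k a = 0"
  define c where "c = f l a / f l g"
  have aU: "a \<in> U" "g \<in> U" using a gC by (auto simp: C_def)
  have "0 \<le> f l a" using a l(1) by (simp add: C_def)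
  then have "c \<ge> 0" using l(2) by (simp add: c_def)
  moreover have dU: "a - c *\<^sub>R g \<in> U" using aU subspace_diff[OF U] subspace_scale[OF U] by blast
  moreover have "f k (a - c *\<^sub>R g) = 0" if "k \<in> \<Lambda>" for k
  proof (cases "f k g = 0")
    case True
    then show ?thesis using z that by (simp add: f_diff f_scale)
  next
    case False
    then have "f k (a - c *\<^sub>R g) = f l (a - c *\<^sub>R g)" using l(3) that dU by blast
    then show ?thesis using l(2) by (simp add: f_diff f_scale c_def)
  qed
  ultimately show "\<exists>c\<ge>0. a - c *\<^sub>R g \<in> K" by (auto simp: K_def)
qed

text \<open>Two values are left, at \<open>l\<close> and at \<open>m\<close>. After subtraction of
  the multiple of \<open>g\<close> that kills the first, the surviving functionals all equal
  \<open>f m\<close> and have negative \<open>\<sigma>\<close>, so the relation forces the second to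
  vanish.\<close>

lemma face_G1: assumes "g \<in> G1" shows "face g"
proof (rule faceI)
  show gC: "g \<in> C" using generator_C assms by blast
  obtain l m where l: "l \<in> \<Lambda>" "0 < f l g" "m \<in> \<Lambda>" "\<sigma> m < 0" "0 < f m g"
    "\<And>k. k \<in> \<Lambda> \<Longrightarrow> f k g \<noteq> 0 \<Longrightarrow>
       (\<forall>u\<in>U. f k u = f l u) \<or> \<sigma> k < 0 \<and> (\<forall>u\<in>U. f k u = f m u)"
    using G1[OF assms] by blast
  fix a assume a: "a \<in> C" and z: "\<And>k. k \<in> \<Lambda> \<Longrightarrow> f k g = 0 \<Longrightarrow> f k a = 0"
  define c where "c = f l a / f l g"
  define d where "d = a - c *\<^sub>R g"
  have aU: "a \<in> U" "g \<in> U" using a gC by (auto simp: C_def)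
  have dU: "d \<in> U" unfolding d_def using aU subspace_diff[OF U] subspace_scale[OF U] by blast
  have fl: "f l d = 0" using l(2) by (simp add: d_def f_diff f_scale c_def)
  have cases: "f k d = 0 \<or> \<sigma> k < 0 \<and> f k d = f m d" if "k \<in> \<Lambda>" for k
  proof (cases "f k g = 0")
    case True
    then show ?thesis using z that by (simp add: d_def f_diff f_scale)
  next
    case False
    then show ?thesis using l(6)[OF that] dU fl by auto
  qed
  have fm: "f m d = 0"
  proof (rule ccontr)
    assume nz: "f m d \<noteq> 0"
    \<comment> \<open>Division by \<open>f m d\<close> makes every term nonpositive, whatever the
      sign of \<open>f m d\<close>.\<close>
    have "(\<Sum>k\<in>\<Lambda>. \<sigma> k * (f k d / f m d)) = (\<Sum>k\<in>\<Lambda>. \<sigma> k * f k d) / f m d"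
      by (simp add: sum_divide_distrib)
    then have "(\<Sum>k\<in>\<Lambda>. \<sigma> k * (f k d / f m d)) = 0" using rel[OF dU] by simp
    moreover have "(\<Sum>k\<in>\<Lambda>. \<sigma> k * (f k d / f m d)) < (\<Sum>k\<in>\<Lambda>. 0)"
    proof (rule sum_strict_mono_ex1[OF fin])
      show "\<forall>k\<in>\<Lambda>. \<sigma> k * (f k d / f m d) \<le> 0" using cases nz by fastforce
      show "\<exists>k\<in>\<Lambda>. \<sigma> k * (f k d / f m d) < 0" using l(3,4) nz by (intro bexI[of _ m]) auto
    qed
    ultimately show False by simp
  qed
  have "0 \<le> f l a" using a l(1) by (simp add: C_def)
  then have "c \<ge> 0" using l(2) by (simp add: c_def)
  moreover have "d \<in> K" using dU cases fm by (auto simp: K_def)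
  ultimately show "\<exists>c\<ge>0. a - c *\<^sub>R g \<in> K" unfolding d_def by blast
qed

text \<open>A point outside \<open>K\<close> is positive at some \<open>l\<close>. If
  \<open>\<sigma> l\<close> is nonzero, the relation forces a positive value at some
  \<open>m\<close> of opposite sign. The generator attached to \<open>l\<close>, or to
  \<open>l\<close> and \<open>m\<close>, is supported where the point is positive.\<close>

theorem rays_generated: "rays_mod_lineality C = quotient_ray K ` (G0 \<union> G1)"
proof
  show "quotient_ray K ` (G0 \<union> G1) \<subseteq> rays_mod_lineality C"
    unfolding rays using generator_C face_G0 face_G1 by blast
  show "rays_mod_lineality C \<subseteq> quotient_ray K ` (G0 \<union> G1)"
  proof
    fix R assume "R \<in> rays_mod_lineality C"
    then obtain u where u: "u \<in> C" "u \<notin> K" "face u" "R = quotient_ray K u" unfolding rays by blast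
    have uU: "u \<in> U" and nn: "\<And>k. k \<in> \<Lambda> \<Longrightarrow> 0 \<le> f k u" using u(1) by (auto simp: C_def)
    have key: "R \<in> quotient_ray K ` (G0 \<union> G1)"
      if "g \<in> G0 \<union> G1" "\<And>k. k \<in> \<Lambda> \<Longrightarrow> 0 < f k g \<Longrightarrow> 0 < f k u" for g
      using face_generator[OF u(1-3) generator_C[OF that(1)] that(2)] that(1) u(4) by blast
    obtain l where l: "l \<in> \<Lambda>" "0 < f l u" using u(2) uU nn by (force simp: K_def less_le)
    show "R \<in> quotient_ray K ` (G0 \<union> G1)"
    proof (cases "\<sigma> l = 0")
      case True
      obtain g where "g \<in> G0" "\<And>k. k \<in> \<Lambda> \<Longrightarrow> f k g \<noteq> 0 \<Longrightarrow> (\<forall>u\<in>U. f k u = f l u)"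
        using G0_ex[OF l(1) True] by blast
      then show ?thesis using key[of g] l(2) uU by fastforce
    next
      case False
      have "\<exists>m\<in>\<Lambda>. \<sigma> l * \<sigma> m < 0 \<and> 0 < f m u"
      proof (rule ccontr)
        assume "\<not> ?thesis"
        then have "\<forall>m\<in>\<Lambda>. 0 \<le> \<sigma> l * (\<sigma> m * f m u)" using nn by (metis less_eq_real_def linorder_not_less mult.assoc mult_nonneg_nonneg mult_zero_right)
        moreover have "0 < \<sigma> l * (\<sigma> l * f l u)"
        proof -
          have "0 < \<sigma> l * \<sigma> l" using False not_real_square_gt_zero by blast
          then have "0 < (\<sigma> l * \<sigma> l) * f l u" using l(2) by (rule mult_pos_pos)
          then show ?thesis unfolding mult.assoc .
        qed
        ultimately have "0 < (\<Sum>m\<in>\<Lambda>. \<sigma> l * (\<sigma> m * f m u))" using fin l(1) by (intro sum_pos2) auto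
        then show False using rel[OF uU] by (simp add: sum_distrib_left[symmetric])
      qed
      then obtain m where m: "m \<in> \<Lambda>" "\<sigma> l * \<sigma> m < 0" "0 < f m u" by blast
      have "\<exists>g\<in>G1. \<forall>k\<in>\<Lambda>. f k g \<noteq> 0 \<longrightarrow> (\<forall>u\<in>U. f k u = f l u) \<or> (\<forall>u\<in>U. f k u = f m u)"
      proof (cases "0 < \<sigma> l")
        case True
        then have "\<sigma> m < 0" using m(2) by (simp add: mult_less_0_iff)
        then show ?thesis using G1_ex[OF l(1) m(1) True] by blast
      next
        case lneg: False
        then have "\<sigma> l < 0" using False by simp
        moreover have "0 < \<sigma> m" using m(2) calculation by (simp add: mult_less_0_iff)
        ultimately show ?thesis using G1_ex[OF m(1) l(1)] by blast
      qed
      then obtain g where g: "g \<in> G1" "\<And>k. k \<in> \<Lambda> \<Longrightarrow> f k g \<noteq> 0 \<Longrightarrow>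
          (\<forall>u\<in>U. f k u = f l u) \<or> (\<forall>u\<in>U. f k u = f m u)" by blast
      show ?thesis
      proof (rule key)
        fix k assume "k \<in> \<Lambda>" "0 < f k g"
        then have "f k u = f l u \<or> f k u = f m u" using g(2)[of k] uU by auto
        then show "0 < f k u" using l(2) m(3) by auto
      qed (use g in blast)
    qed
  qed
qed

end

section \<open>The generating vectors\<close>

lemma sum_fun_at: "(\<Sum>a\<in>A. f a) y = (\<Sum>a\<in>A. f a y)" for f :: "'a \<Rightarrow> 'b \<Rightarrow> 'c::comm_monoid_add"
  by (induction A rule: infinite_finite_induct) auto

definition sg :: "int \<Rightarrow> real" where "sg i = (if even i then 1 else - 1)"

lemma sg_Suc [simp]: "sg (i + 1) = - sg i" and sg_pred [simp]: "sg (i - 1) = - sg i"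
  by (auto simp: sg_def)

lemma sg_of_nat: "sg (int k) = (- 1) ^ k"
  by (auto simp: sg_def)

lemma periodic_sum:
  fixes h :: "int \<Rightarrow> real" and N s :: int
  assumes "N > 0" "\<And>p q. p mod N = q mod N \<Longrightarrow> h p = h q"
  shows "(\<Sum>p\<in>{0..<N}. h (p + s)) = (\<Sum>p\<in>{0..<N}. h p)"
proof (rule sum.reindex_bij_witness[where i = "\<lambda>p. (p - s) mod N" and j = "\<lambda>p. (p + s) mod N"])
  fix p assume "p \<in> {0..<N}"
  then show "((p + s) mod N - s) mod N = p" "((p - s) mod N + s) mod N = p"
    by (simp_all add: mod_diff_left_eq mod_add_left_eq mod_pos_pos_trivial)
  show "h ((p + s) mod N) = h (p + s)" by (rule assms(2)) simp
qed (use assms(1) in auto)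

context polygon
begin

lemma F_add: "F (u + v) i j = F u i j + F v i j"
  and F_scale: "F (c *\<^sub>R u) i j = c * F u i j"
  and F_zero: "F 0 i j = 0"
  by (simp_all add: F_def scaleR_fun_def algebra_simps)

lemma F_sum: "F (\<Sum>a\<in>A. u a) i j = (\<Sum>a\<in>A. F (u a) i j)"
  by (simp only: F_def sum_fun_at sum_distrib_left)

lemma cc_add: "cc (u + v) i j = cc u i j + cc v i j"
  and cc_scale: "cc (c *\<^sub>R u) i j = c * cc u i j"
  by (simp_all add: cc_def F_add F_scale algebra_simps)

lemma cc_sum: "cc (\<Sum>a\<in>A. u a) i j = (\<Sum>a\<in>A. cc (u a) i j)"
  by (simp only: cc_def F_sum sum.distrib sum_subtractf)

lemma F_cong: "i mod N = i' mod N \<Longrightarrow> j mod N = j' mod N \<Longrightarrow> F u i j = F u i' j'"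
  unfolding F_def kap_def by (simp add: lab_cong[of i i' j j'] mod_diff_cong[of j N j' i i'])

lemma cc_cong:
  assumes "i mod N = i' mod N" "j mod N = j' mod N" shows "cc u i j = cc u i' j'"
proof -
  have "(i + 1) mod N = (i' + 1) mod N" "(j + 1) mod N = (j' + 1) mod N"
    using assms by (auto intro: mod_add_cong)
  then show ?thesis
    unfolding cc_def using assms by (intro arg_cong2[where f = "(+)"] arg_cong2[where f = "(-)"] F_cong)
qed

lemma cc_antipode: "bc \<Longrightarrow> cc u (i + M) (j + M) = cc u i j"
  using F_antipode[of u "i + 1" "j + 1"] F_antipode[of u "i + 1" j] F_antipode[of u i "j + 1"]
  by (simp add: cc_def F_antipode algebra_simps)

definition chi :: "int \<Rightarrow> int \<Rightarrow> real" where "chi a b = (if a mod N = b mod N then 1 else 0)"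

text \<open>Vertices are identified with their antipodes in types B and C, as \<open>vec_E\<close>
  collects the pairs meeting either of them.\<close>

definition chis :: "int \<Rightarrow> int \<Rightarrow> real" where
  "chis q a = chi a q + (if bc then chi a (q + M) else 0)"

lemma chi_shift: "chi (a + c) (b + c) = chi a b"
proof -
  have "(a + c) mod N = (b + c) mod N \<longleftrightarrow> a mod N = b mod N" by (simp add: mod_eq_dvd_iff)
  then show ?thesis by (simp add: chi_def)
qed

lemma chi_Suc: "chi (a + 1) b = chi a (b - 1)"
  using chi_shift[of a 1 "b - 1"] by simp

lemma chi_M: "chi (a + M) b = chi a (b + M)"
proof -
  have "(b + M + M) mod N = b mod N" by (rule shift_N)
  then have "chi (a + M) b = chi (a + M) (b + M + M)" by (simp add: chi_def)
  then show ?thesis using chi_shift[of a M "b + M"] by simp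
qed

lemma chis_Suc: "chis q (a + 1) = chis (q - 1) a"
proof -
  have "q + M - 1 = q - 1 + M" by simp
  then show ?thesis unfolding chis_def chi_Suc by (simp only:)
qed

lemma opposite_iff: "(b - a) mod N = M \<longleftrightarrow> b mod N = (a + M) mod N"
proof -
  have "M = M mod N" using N_2M M_ge by simp
  then have "(b - a) mod N = M \<longleftrightarrow> (b - a) mod N = M mod N" by simp
  also have "\<dots> \<longleftrightarrow> b mod N = (a + M) mod N" by (simp add: mod_eq_dvd_iff algebra_simps)
  finally show ?thesis .
qed

lemma diameter_iff: "seg N a b \<in> diameters N \<longleftrightarrow> b mod N = (a + M) mod N"
proof
  assume "seg N a b \<in> diameters N"
  then obtain k where k: "seg N a b = seg N k (k + M)"
    by (auto simp: diameters_def antipode_def M_def seg_def)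
  then consider "a mod N = k mod N" "b mod N = (k + M) mod N" | "a mod N = (k + M) mod N" "b mod N = k mod N"
    by (auto simp: seg_eq_iff)
  then show "b mod N = (a + M) mod N"
  proof cases
    case 1
    then show ?thesis by (metis mod_add_left_eq)
  next
    case 2
    then have "(a + M) mod N = (k + M + M) mod N" by (metis mod_add_left_eq)
    then show ?thesis using 2(2) shift_N[of k] by simp
  qed
next
  assume "b mod N = (a + M) mod N"
  then have "seg N a b = seg N a (antipode N a)" by (simp add: seg_def antipode_def M_def)
  then show "seg N a b \<in> diameters N" by (auto simp: diameters_def)
qed

lemma seg_segment: "a mod N \<noteq> b mod N \<Longrightarrow> seg N a b \<in> segments N"
  by (auto simp: segments_def)

lemma segmentE: assumes "l \<in> segments N" obtains a b where "l = seg N a b" "a mod N \<noteq> b mod N"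
  using assms by (auto simp: segments_def)

lemma diameter_lab_eq:
  assumes bc shows "lab i (i + M) = lab a b \<longleftrightarrow>
    b mod N = (a + M) mod N \<and> (a mod N = i mod N \<or> b mod N = i mod N)"
proof -
  have e: "seg N (i + M) (i + M + M) = seg N i (i + M)" for i
    using seg_cong[OF refl shift_N, of "i + M" i] by (simp add: seg_commute)
  have l: "lab i (i + M) = {seg N i (i + M)}" for i using assms e by (simp add: lab_eq)
  show ?thesis
  proof
    assume "lab i (i + M) = lab a b"
    then have s: "seg N a b = seg N i (i + M)" using l assms by (auto simp: lab_eq)
    then have "seg N a b \<in> diameters N" using diameter_iff[of i "i + M"] by simp
    then show "b mod N = (a + M) mod N \<and> (a mod N = i mod N \<or> b mod N = i mod N)"
      using s unfolding diameter_iff seg_eq_iff by blast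
  next
    assume *: "b mod N = (a + M) mod N \<and> (a mod N = i mod N \<or> b mod N = i mod N)"
    have "seg N a b = seg N i (i + M)"
    proof (cases "a mod N = i mod N")
      case True
      then have "b mod N = (i + M) mod N" using * by (metis mod_add_left_eq)
      then show ?thesis using True by (intro seg_cong)
    next
      case False
      then have "b mod N = i mod N" using * by blast
      moreover have "(i + M) mod N = (a + M + M) mod N" using * calculation by (metis mod_add_left_eq)
      ultimately show ?thesis using shift_N[of a] by (auto simp: seg_def)
    qed
    then have "lab a b = label X n (seg N i (i + M))" by (simp add: lab_def)
    then show "lab i (i + M) = lab a b" by (simp add: lab_def)
  qed
qed

text \<open>The value is a function of \<open>a\<close> plus a function of \<open>b\<close>, which
  is why \<open>cc\<close> annihilates it. At diameters the coefficient \<open>type_r X\<close> and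
  the factor \<open>2 / type_r X\<close> multiply to 2, one for each end.\<close>

lemma vec_E_at:
  assumes ab: "a mod N \<noteq> b mod N"
  shows "F (vec_E X n i) a b = chis i a + chis i b"
proof (cases bc)
  case False
  have fin: "finite {l \<in> segments N. i mod N \<in> l}" using finite_segments[OF N_pos] by simp
  have l: "label X n l = {l}" for l using False by (simp add: label_def)
  have k: "kap a b = 1" unfolding kap_def using False by simp
  have E: "vec_E X n i = (\<Sum>l\<in>{l \<in> segments N. i mod N \<in> l}. unit_vec {l})"
    unfolding vec_E_def N_def Let_def l using False by simp
  have lb: "lab a b = {seg N a b}" unfolding lab_def l ..
  have "vec_E X n i (lab a b) = (\<Sum>l\<in>{l \<in> segments N. i mod N \<in> l}. if l = seg N a b then 1 else 0)"
    unfolding E sum_fun_at lb by (intro sum.cong) (auto simp: unit_vec_def)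
  also have "\<dots> = (if i mod N \<in> seg N a b then 1 else 0)" using fin seg_segment[OF ab] by (simp add: sum.delta)
  finally have "F (vec_E X n i) a b = chi a i + chi b i" using ab by (auto simp: F_def k chi_def seg_def)
  then show ?thesis unfolding chis_def using False by simp
next
  case True
  let ?S = "{L \<in> label X n ` (segments N - diameters N). i mod N \<in> \<Union> L}"
  have fin: "finite ?S" using finite_segments[OF N_pos] by simp
  have sa: "seg N i (antipode N i) = seg N i (i + M)" by (simp add: seg_def antipode_def M_def)
  have E: "vec_E X n i = real (type_r X) *\<^sub>R unit_vec (lab i (i + M)) + (\<Sum>L\<in>?S. unit_vec L)"
    using True by (simp add: vec_E_def Let_def N_def[symmetric] sa lab_def)
  have mem: "lab a b \<in> ?S \<longleftrightarrow> b mod N \<noteq> (a + M) mod N \<and>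
      (i mod N = a mod N \<or> i mod N = b mod N \<or> i mod N = (a + M) mod N \<or> i mod N = (b + M) mod N)"
  proof -
    have "lab a b \<in> label X n ` (segments N - diameters N) \<longleftrightarrow> b mod N \<noteq> (a + M) mod N"
    proof
      assume "lab a b \<in> label X n ` (segments N - diameters N)"
      then obtain l where l: "l \<in> segments N" "l \<notin> diameters N" "lab a b = label X n l" by auto
      show "b mod N \<noteq> (a + M) mod N"
      proof
        assume d: "b mod N = (a + M) mod N"
        have "lab a (a + M) = lab a b" using d by (intro lab_cong) auto
        moreover have "l \<in> lab a b" using l(3) True by (simp add: label_def)
        ultimately have "l \<in> lab a (a + M)" by simp
        then have "l = seg N a (a + M) \<or> l = seg N (a + M) (a + M + M)" using True by (auto simp: lab_eq)
        then have "l \<in> diameters N" by (auto simp: diameter_iff)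
        then show False using l(2) by blast
      qed
    next
      assume "b mod N \<noteq> (a + M) mod N"
      then have "seg N a b \<in> segments N - diameters N" using seg_segment[OF ab] diameter_iff by blast
      then show "lab a b \<in> label X n ` (segments N - diameters N)" unfolding lab_def by blast
    qed
    moreover have "\<Union> (lab a b) = {a mod N, b mod N, (a + M) mod N, (b + M) mod N}"
      using True by (auto simp: lab_eq seg_def)
    ultimately show ?thesis by auto
  qed
  have "(\<Sum>L\<in>?S. unit_vec L) (lab a b) = (\<Sum>L\<in>?S. if L = lab a b then 1 else 0)"
    unfolding sum_fun_at by (intro sum.cong) (auto simp: unit_vec_def)
  also have "\<dots> = (if lab a b \<in> ?S then 1 else 0)" using fin by (simp add: sum.delta)
  finally have S: "(\<Sum>L\<in>?S. unit_vec L) (lab a b) = (if lab a b \<in> ?S then 1 else 0)" .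
  have u: "unit_vec (lab i (i + M)) (lab a b) = (if lab i (i + M) = lab a b then 1 else 0)"
    by (auto simp: unit_vec_def)
  have val: "vec_E X n i (lab a b) = real (type_r X) * (if lab i (i + M) = lab a b then 1 else 0)
      + (if lab a b \<in> ?S then 1 else 0)"
    unfolding E plus_fun_apply S by (simp add: scaleR_fun_def u)
  have aM: "(x + M) mod N = y mod N \<longleftrightarrow> x mod N = (y + M) mod N" for x y
    by (metis mod_add_left_eq shift_N)
  have nM: "x mod N \<noteq> (x + M) mod N" for x using mod_window[of x N "x + M"] N_2M M_ge by auto
  show ?thesis
  proof (cases "b mod N = (a + M) mod N")
    case d: True
    have k: "kap a b = 2 / real (type_r X)" using d True by (simp add: kap_def opposite_iff)
    have "F (vec_E X n i) a b = 2 * (if a mod N = i mod N \<or> b mod N = i mod N then 1 else 0)"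
      unfolding F_def k val diameter_lab_eq[OF True] mem using d type_r_cases by auto
    also have "\<dots> = chis i a + chis i b"
    proof -
      have "b mod N = (i + M) mod N \<longleftrightarrow> a mod N = i mod N" using d aM by metis
      moreover have "a mod N = (i + M) mod N \<longleftrightarrow> b mod N = i mod N" using d aM by metis
      ultimately show ?thesis using True nM[of i] ab by (auto simp: chis_def chi_def)
    qed
    finally show ?thesis .
  next
    case d: False
    have k: "kap a b = 1" using d by (simp add: kap_def opposite_iff)
    have d': "a mod N \<noteq> (b + M) mod N" using d aM by metis
    have "F (vec_E X n i) a b = (if i mod N = a mod N \<or> i mod N = b mod N \<or> i mod N = (a + M) mod N \<or> i mod N = (b + M) mod N then 1 else 0)"
      unfolding F_def k val diameter_lab_eq[OF True] mem using d by auto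
    also have "\<dots> = chis i a + chis i b"
    proof -
      have ab': "(b + M) mod N \<noteq> (a + M) mod N" using ab by (auto simp: mod_eq_dvd_iff dvd_diff_commute)
      have x: "y mod N = (i + M) mod N \<longleftrightarrow> i mod N = (y + M) mod N" for y using aM by metis
      show ?thesis
        using True nM[of a] nM[of b] ab ab' d d' by (auto simp: chis_def chi_def x)
    qed
    finally show ?thesis .
  qed
qed

section \<open>Arcs and the vectors attached to them\<close>

definition ar :: "int \<Rightarrow> nat \<Rightarrow> int \<Rightarrow> real" where
  "ar p k a = (if (a - p) mod N \<le> int k then 1 else 0)"

definition arc :: "int \<Rightarrow> nat \<Rightarrow> int set" where "arc p k = seg N p (p + int k)"

lemma len_seg: assumes "k \<ge> 1" "int k \<le> M" shows "len N (seg N p (p + int k)) = k"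
  unfolding len_def
proof (rule Least_equality)
  show "\<exists>i. seg N p (p + int k) = seg N i (i + int k)" by blast
  fix k' assume "\<exists>i. seg N p (p + int k) = seg N i (i + int k')"
  then obtain i where i: "seg N p (p + int k) = seg N i (i + int k')" by blast
  show "k \<le> k'"
  proof (rule ccontr)
    assume lt: "\<not> k \<le> k'"
    have "p mod N = i mod N \<and> (p + int k) mod N = (i + int k') mod N \<or>
        p mod N = (i + int k') mod N \<and> (p + int k) mod N = i mod N"
      using i by (simp add: seg_eq_iff)
    then show False
    proof
      assume *: "p mod N = i mod N \<and> (p + int k) mod N = (i + int k') mod N"
      then have "N dvd (p + int k) - (i + int k') - (p - i)" by (metis dvd_diff mod_eq_dvd_iff)
      then have "N dvd int k - int k'" by (simp add: algebra_simps)
      moreover have "0 < int k - int k'" "int k - int k' < N" using lt assms N_2M M_ge by auto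
      ultimately show False using zdvd_not_zless by blast
    next
      assume *: "p mod N = (i + int k') mod N \<and> (p + int k) mod N = i mod N"
      then have "N dvd ((p + int k) - i) - (p - (i + int k'))" by (metis dvd_diff mod_eq_dvd_iff)
      then have "N dvd int k + int k'" by (simp add: algebra_simps)
      moreover have "0 < int k + int k'" "int k + int k' < N" using lt assms N_2M M_ge by auto
      ultimately show False using zdvd_not_zless by blast
    qed
  qed
qed

text \<open>A second shortest arc would be the reversed one, which requires \<open>2 * k\<close> to
  be divisible by \<open>N\<close>.\<close>

lemma first_vertices_arc:
  assumes "0 \<le> p" "p < N" "k \<ge> 1" "int k \<le> M - 1"
  shows "first_vertices N (arc p k) = {p}"
proof -
  have len: "len N (arc p k) = k" unfolding arc_def using assms by (intro len_seg) auto
  have "i = p" if i: "0 \<le> i" "i < N" "arc p k = seg N i (i + int k)" for i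
  proof -
    have "p mod N = i mod N \<or> p mod N = (i + int k) mod N \<and> (p + int k) mod N = i mod N"
      using i(3) by (auto simp: arc_def seg_eq_iff)
    then show ?thesis
    proof
      assume "p mod N = i mod N"
      then show ?thesis using mod_window[of p N i] i assms by auto
    next
      assume *: "p mod N = (i + int k) mod N \<and> (p + int k) mod N = i mod N"
      then have "N dvd ((p + int k) - i) - (p - (i + int k))" by (metis dvd_diff mod_eq_dvd_iff)
      then have "N dvd int k + int k" by (simp add: algebra_simps)
      moreover have "0 < int k + int k" "int k + int k < N" using assms N_2M M_ge by auto
      ultimately show ?thesis using zdvd_not_zless by blast
    qed
  qed
  then show ?thesis unfolding first_vertices_def len using assms by (auto simp: arc_def)
qed

lemma arc_data:
  assumes "0 \<le> p" "p < N" "k \<ge> 1" "int k \<le> M - 1"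
  shows "len N (arc p k) = k" "delta_minus N (arc p k) = p" "delta_plus N (arc p k) = (p + int k) mod N"
    "non_maximal N (arc p k)" "arc p k \<in> segments N"
    "a mod N \<in> minor_arc N (arc p k) \<longleftrightarrow> (a - p) mod N \<le> int k"
proof -
  show len: "len N (arc p k) = k" unfolding arc_def using assms by (intro len_seg) auto
  show dm: "delta_minus N (arc p k) = p" by (simp add: delta_minus_def first_vertices_arc[OF assms])
  show "delta_plus N (arc p k) = (p + int k) mod N" by (simp add: delta_plus_def dm len)
  show "non_maximal N (arc p k)" using assms by (simp add: non_maximal_def len M_def[symmetric])
  have "p mod N \<noteq> (p + int k) mod N" using mod_window[of p N "p + int k"] assms N_2M by auto
  then show "arc p k \<in> segments N" unfolding arc_def by (rule seg_segment)
  show "a mod N \<in> minor_arc N (arc p k) \<longleftrightarrow> (a - p) mod N \<le> int k"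
  proof
    assume "a mod N \<in> minor_arc N (arc p k)"
    then obtain i where i: "i \<le> k" "a mod N = (p + int i) mod N" by (auto simp: minor_arc_def dm len)
    then have "(a - p) mod N = (p + int i - p) mod N" by (metis mod_diff_left_eq)
    also have "\<dots> = int i" using i assms N_2M by (simp add: mod_pos_pos_trivial)
    finally show "(a - p) mod N \<le> int k" using i by simp
  next
    assume *: "(a - p) mod N \<le> int k"
    define i where "i = nat ((a - p) mod N)"
    have "int i = (a - p) mod N" using N_pos by (simp add: i_def)
    then have "a mod N = (p + int i) mod N" "i \<le> k" using * by (simp_all add: mod_add_right_eq)
    then show "a mod N \<in> minor_arc N (arc p k)" by (auto simp: minor_arc_def dm len)
  qed
qed

lemma first_vertices_nonempty:
  assumes "l \<in> segments N" obtains i where "i \<in> first_vertices N l"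
proof -
  obtain a b where ab: "l = seg N a b" using segmentE[OF assms] .
  define k0 where "k0 = nat ((b - a) mod N)"
  have "int k0 = (b - a) mod N" using N_pos by (simp add: k0_def)
  then have "(a + int k0) mod N = b mod N" by (simp add: mod_add_right_eq)
  then have ex: "\<exists>k i. l = seg N i (i + int k)" using ab seg_cong[of a N a b "a + int k0"] by metis
  obtain i where i: "l = seg N i (i + int (len N l))"
    using LeastI_ex[OF ex] unfolding len_def by blast
  have "l = seg N (i mod N) (i mod N + int (len N l))"
    by (subst i, rule seg_cong) (simp_all add: mod_add_left_eq)
  then have "i mod N \<in> first_vertices N l" using N_pos by (simp add: first_vertices_def)
  then show thesis by (rule that)
qed

lemma non_maximal_arc:
  assumes "l \<in> segments N" "non_maximal N l"
  obtains p k where "0 \<le> p" "p < N" "k \<ge> 1" "int k \<le> M - 1" "l = arc p k" "len N l = k"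
proof -
  obtain p where "p \<in> first_vertices N l" using first_vertices_nonempty[OF assms(1)] .
  then have p: "0 \<le> p" "p < N" and lp: "l = arc p (len N l)"
    by (auto simp: first_vertices_def arc_def)
  obtain a b where ab: "l = seg N a b" "a mod N \<noteq> b mod N" using segmentE[OF assms(1)] .
  have "len N l \<noteq> 0"
  proof
    assume "len N l = 0"
    then have "l = {p mod N}" using lp by (simp add: arc_def seg_def)
    then show False using ab by (auto simp: seg_def doubleton_eq_iff)
  qed
  moreover have "int (len N l) \<le> M - 1" using assms(2) by (simp add: non_maximal_def M_def)
  ultimately show thesis using that[OF p _ _ lp] by simp
qed

text \<open>A segment lies on the arc if both ends do, so its indicator is a product and
  \<open>cc\<close> will factor into two differences. At diameters both products vanish, because an
  arc shorter than \<open>M\<close> contains no antipodal pair.\<close>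

lemma vec_v_at:
  assumes ab: "a mod N \<noteq> b mod N" and pk: "0 \<le> p" "p < N" "k \<ge> 1" "int k \<le> M - 1"
  shows "F (vec_v X n (arc p k)) a b =
    - (ar p k a * ar p k b) - (if bc then ar p k (a + M) * ar p k (b + M) else 0)"
proof -
  let ?S = "{l \<in> segments N. l \<subseteq> minor_arc N (arc p k)}"
  have fin: "finite ?S" using finite_segments[OF N_pos] by simp
  have mem: "seg N c d \<in> ?S \<longleftrightarrow> ar p k c * ar p k d = 1" if "c mod N \<noteq> d mod N" for c d
    using seg_segment[OF that] arc_data(6)[OF pk] by (auto simp: seg_def ar_def)
  have val: "vec_v X n (arc p k) (lab a b) = - (\<Sum>l\<in>?S. if label X n l = lab a b then 1 else 0)"
    unfolding vec_v_def N_def[symmetric] Let_def fun_Compl_def uminus_apply sum_fun_at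
    by (intro arg_cong[where f = uminus] sum.cong refl) (auto simp: unit_vec_def)
  have arc01: "ar p k c * ar p k d = 1 \<or> ar p k c * ar p k d = 0" for c d by (auto simp: ar_def)
  show ?thesis
  proof (cases bc)
    case False
    have l: "label X n l = {l}" for l using False by (simp add: label_def)
    have k: "kap a b = 1" unfolding kap_def using False by simp
    have "(\<Sum>l\<in>?S. if label X n l = lab a b then 1 else 0) = (\<Sum>l\<in>?S. if l = seg N a b then 1 else (0::real))"
      unfolding lab_def l by (intro sum.cong) auto
    also have "\<dots> = (if seg N a b \<in> ?S then 1 else 0)" using fin by (simp add: sum.delta)
    also have "\<dots> = ar p k a * ar p k b" using mem[OF ab] arc01[of a b] by auto
    finally show ?thesis unfolding F_def k val using False by simp
  next
    case True
    have ab': "(a + M) mod N \<noteq> (b + M) mod N" using ab by (simp add: mod_eq_dvd_iff)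
    have same: "label X n l = lab a b \<longleftrightarrow> l = seg N a b \<or> l = seg N (a + M) (b + M)" for l
    proof
      assume "label X n l = lab a b"
      moreover have "l \<in> label X n l" by (simp add: label_def)
      ultimately show "l = seg N a b \<or> l = seg N (a + M) (b + M)" using True by (auto simp: lab_eq)
    next
      assume "l = seg N a b \<or> l = seg N (a + M) (b + M)"
      then show "label X n l = lab a b" using lab_antipode[OF True, of a b] by (auto simp: lab_def)
    qed
    show ?thesis
    proof (cases "seg N a b = seg N (a + M) (b + M)")
      case eq: True
      have nM: "x mod N \<noteq> (x + M) mod N" for x using mod_window[of x N "x + M"] N_2M M_ge by auto
      have bM: "b mod N = (a + M) mod N" using eq nM[of a] by (auto simp: seg_eq_iff)
      have z: "ar p k c * ar p k d = 0" if "d mod N = (c + M) mod N" for c d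
      proof (rule ccontr)
        assume "ar p k c * ar p k d \<noteq> 0"
        then have *: "(c - p) mod N \<le> int k" "(d - p) mod N \<le> int k" by (auto simp: ar_def split: if_splits)
        define s where "s = (c - p) mod N"
        have s: "0 \<le> s" "s < M" using * pk N_pos by (auto simp: s_def)
        have "(d - p) mod N = (c + M - p) mod N" using that by (metis mod_diff_left_eq)
        also have "\<dots> = (s + M) mod N" unfolding s_def mod_add_left_eq by (simp add: algebra_simps)
        also have "\<dots> = s + M" using s N_2M by (simp add: mod_pos_pos_trivial)
        finally show False using *(2) s pk by simp
      qed
      have "(b + M) mod N = (a + M + M) mod N" using bM by (metis mod_add_left_eq)
      then have e: "ar p k a * ar p k b = 0" "ar p k (a + M) * ar p k (b + M) = 0" using z bM by auto
      have "(\<Sum>l\<in>?S. if label X n l = lab a b then 1 else 0) = (0::real)"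
      proof (intro sum.neutral ballI)
        fix l assume l: "l \<in> ?S"
        have "l \<noteq> seg N a b" using l mem[OF ab] e(1) by auto
        then show "(if label X n l = lab a b then 1 else 0) = (0::real)" using same eq by auto
      qed
      then show ?thesis unfolding F_def val e using True by simp
    next
      case ne: False
      have nd: "b mod N \<noteq> (a + M) mod N"
      proof
        assume "b mod N = (a + M) mod N"
        then have "(b + M) mod N = (a + M + M) mod N" by (metis mod_add_left_eq)
        then have "(b + M) mod N = a mod N" using shift_N by simp
        then show False using ne \<open>b mod N = (a + M) mod N\<close> by (auto simp: seg_def)
      qed
      then have k: "kap a b = 1" by (simp add: kap_def opposite_iff)
      have "(\<Sum>l\<in>?S. if label X n l = lab a b then 1 else 0) =
          (\<Sum>l\<in>?S. (if l = seg N a b then 1 else 0) + (if l = seg N (a + M) (b + M) then 1 else (0::real)))"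
        using ne by (intro sum.cong) (auto simp: same)
      also have "\<dots> = (if seg N a b \<in> ?S then 1 else 0) + (if seg N (a + M) (b + M) \<in> ?S then 1 else 0)"
        using fin by (simp add: sum.distrib sum.delta)
      also have "\<dots> = ar p k a * ar p k b + ar p k (a + M) * ar p k (b + M)"
        using mem[OF ab] mem[OF ab'] arc01[of a b] arc01[of "a + M" "b + M"] by auto
      finally show ?thesis unfolding F_def k val using True by simp
    qed
  qed
qed

lemma valid_distinct: "i < j \<Longrightarrow> j < i + N \<Longrightarrow> i mod N \<noteq> j mod N"
  using mod_window[of i N j] by auto

lemma cc_vec_E: assumes "i + 2 \<le> j" "j \<le> i + N - 2" shows "cc (vec_E X n q) i j = 0"
proof -
  have "i mod N \<noteq> j mod N" "(i + 1) mod N \<noteq> (j + 1) mod N" "i mod N \<noteq> (j + 1) mod N" "(i + 1) mod N \<noteq> j mod N"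
    by (rule valid_distinct; use assms in simp)+
  then show ?thesis by (simp add: cc_def vec_E_at)
qed

text \<open>The indicator of an arc changes only where the arc is left, after \<open>p + k\<close>,
  and where it is entered, after \<open>p - 1\<close>.\<close>

lemma ar_step: assumes "int k \<le> M - 1" shows "ar p k a - ar p k (a + 1) = chi a (p + int k) - chi a (p - 1)"
proof -
  define s where "s = (a - p) mod N"
  have s: "0 \<le> s" "s < N" using N_pos by (auto simp: s_def)
  have c1: "chi a (p + int k) = (if s = int k then 1 else 0)"
  proof -
    have "a mod N = (p + int k) mod N \<longleftrightarrow> (a - p) mod N = int k mod N" by (simp add: mod_eq_dvd_iff algebra_simps)
    also have "int k mod N = int k" using assms N_2M M_ge by (simp add: mod_pos_pos_trivial)
    finally show ?thesis by (simp add: chi_def s_def)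
  qed
  have c2: "chi a (p - 1) = (if s = N - 1 then 1 else 0)"
  proof -
    have "a mod N = (p - 1) mod N \<longleftrightarrow> (a - p) mod N = (N - 1) mod N"
    proof -
      have "(a - p) mod N = (N - 1) mod N \<longleftrightarrow> N dvd (a - p) - (N - 1)" by (rule mod_eq_dvd_iff)
      also have "(a - p) - (N - 1) = (a - (p - 1)) - N" by simp
      also have "N dvd (a - (p - 1)) - N \<longleftrightarrow> N dvd a - (p - 1)" by (rule dvd_diff_left_iff) simp
      finally show ?thesis unfolding mod_eq_dvd_iff by blast
    qed
    also have "(N - 1) mod N = N - 1" using N_pos by (intro mod_pos_pos_trivial) auto
    finally show ?thesis by (simp add: chi_def s_def)
  qed
  have "(a + 1 - p) mod N = (s + 1) mod N" unfolding s_def mod_add_left_eq by (simp add: algebra_simps)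
  also have "\<dots> = (if s = N - 1 then 0 else s + 1)" using s by (auto simp: mod_pos_pos_trivial)
  finally have "ar p k (a + 1) = (if s = N - 1 \<or> s + 1 \<le> int k then 1 else 0)" by (simp add: ar_def)
  moreover have "ar p k a = (if s \<le> int k then 1 else 0)" by (simp add: ar_def s_def)
  ultimately show ?thesis using c1 c2 s assms N_2M M_ge by auto
qed

text \<open>Arcs of length \<open>M - 1\<close> with antipodal starting points are identified, since
  \<open>cc\<close> is evaluated at the two ends of one diameter, in either order.\<close>

definition same :: "int \<Rightarrow> nat \<Rightarrow> int \<Rightarrow> nat \<Rightarrow> bool" where
  "same q m p k \<longleftrightarrow> m = k \<and> (q mod N = p mod N \<or> int k = M - 1 \<and> q mod N = (p + M) mod N)"

text \<open>The products with the same vertex in both factors vanish because \<open>q - 1\<close>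
  and \<open>q + m\<close> differ; the other two express the alternatives of
  \<open>same\<close>.\<close>

lemma step_product:
  assumes "m \<ge> 1" "int m \<le> M - 1" "k \<ge> 1" "int k \<le> M - 1"
  shows "- ((chi (q - 1) (p + int k) - chi (q - 1) (p - 1)) * (chi (q + int m) (p + int k) - chi (q + int m) (p - 1)))
    = (if same q m p k then 1 else 0)"
proof -
  have ne: "(q - 1) mod N \<noteq> (q + int m) mod N" using assms N_2M by (intro valid_distinct) auto
  have a: "(q - 1) mod N = (p - 1) mod N \<and> (q + int m) mod N = (p + int k) mod N \<longleftrightarrow> q mod N = p mod N \<and> m = k"
  proof
    assume *: "(q - 1) mod N = (p - 1) mod N \<and> (q + int m) mod N = (p + int k) mod N"
    then have q: "q mod N = p mod N" by (simp add: mod_eq_dvd_iff)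
    have "N dvd (q + int m - (p + int k)) - (q - p)" using * q by (metis dvd_diff mod_eq_dvd_iff)
    then have "int m mod N = int k mod N" by (simp add: mod_eq_dvd_iff algebra_simps)
    then show "q mod N = p mod N \<and> m = k"
      using q mod_window[of "int m" N "int k"] assms N_2M M_ge by auto
  next
    assume "q mod N = p mod N \<and> m = k"
    then show "(q - 1) mod N = (p - 1) mod N \<and> (q + int m) mod N = (p + int k) mod N"
      by (auto simp: mod_eq_dvd_iff)
  qed
  have b: "(q - 1) mod N = (p + int k) mod N \<and> (q + int m) mod N = (p - 1) mod N \<longleftrightarrow>
      m = k \<and> int k = M - 1 \<and> q mod N = (p + M) mod N"
  proof
    assume *: "(q - 1) mod N = (p + int k) mod N \<and> (q + int m) mod N = (p - 1) mod N"
    then have "N dvd (q + int m - (p - 1)) - (q - 1 - (p + int k))" by (metis dvd_diff mod_eq_dvd_iff)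
    then have d: "N dvd int m + int k + 2" by (simp add: algebra_simps)
    have "int m + int k + 2 \<le> N" using assms N_2M by simp
    moreover have "N \<le> int m + int k + 2" using d by (intro zdvd_imp_le) auto
    ultimately have mk: "m = k" "int k = M - 1" using assms N_2M by auto
    have "q - 1 - (p + int k) = q - (p + M)" using mk by simp
    then have "q mod N = (p + M) mod N" using * by (metis mod_eq_dvd_iff)
    then show "m = k \<and> int k = M - 1 \<and> q mod N = (p + M) mod N" using mk by blast
  next
    assume *: "m = k \<and> int k = M - 1 \<and> q mod N = (p + M) mod N"
    have "q - 1 - (p + int k) = q - (p + M)" using * by simp
    then have 1: "(q - 1) mod N = (p + int k) mod N" using * by (metis mod_eq_dvd_iff)
    have "q + int m - (p - 1) = q - (p + M) + N" using * N_2M by simp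
    moreover have "N dvd q - (p + M) + N" using * by (intro dvd_add dvd_refl) (simp add: mod_eq_dvd_iff)
    ultimately have "N dvd q + int m - (p - 1)" by (simp only:)
    then show "(q - 1) mod N = (p + int k) mod N \<and> (q + int m) mod N = (p - 1) mod N"
      using 1 by (simp add: mod_eq_dvd_iff)
  qed
  have nM: "p mod N \<noteq> (p + M) mod N" using mod_window[of p N "p + M"] N_2M M_ge by auto
  have z: "chi (q - 1) c * chi (q + int m) c = 0" for c using ne by (auto simp: chi_def)
  have A: "chi (q - 1) (p - 1) * chi (q + int m) (p + int k) = (if q mod N = p mod N \<and> m = k then 1 else 0)"
    unfolding a[symmetric] chi_def by simp
  have B: "chi (q - 1) (p + int k) * chi (q + int m) (p - 1) =
      (if m = k \<and> int k = M - 1 \<and> q mod N = (p + M) mod N then 1 else 0)"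
    unfolding b[symmetric] chi_def by simp
  have "- ((chi (q - 1) (p + int k) - chi (q - 1) (p - 1)) * (chi (q + int m) (p + int k) - chi (q + int m) (p - 1)))
    = chi (q - 1) (p - 1) * chi (q + int m) (p + int k) + chi (q - 1) (p + int k) * chi (q + int m) (p - 1)
      - chi (q - 1) (p + int k) * chi (q + int m) (p + int k) - chi (q - 1) (p - 1) * chi (q + int m) (p - 1)"
    by (simp add: algebra_simps)
  also have "\<dots> = (if q mod N = p mod N \<and> m = k then 1 else 0) +
      (if m = k \<and> int k = M - 1 \<and> q mod N = (p + M) mod N then 1 else 0)"
    unfolding A B z by simp
  also have "\<dots> = (if same q m p k then 1 else 0)" using nM by (auto simp: same_def)
  finally show ?thesis .
qed

text \<open>The functional dual to \<open>vec_v X n (arc p k)\<close>, indexed by \<open>(p, k)\<close>.\<close>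

definition cf :: "int \<times> nat \<Rightarrow> (int set set \<Rightarrow> real) \<Rightarrow> real" where
  "cf c u = cc u (fst c - 1) (fst c + int (snd c))"

text \<open>\<open>cc\<close> of a product of indicators is a product of two differences, evaluated
  by \<open>ar_step\<close>. Up to \<open>same\<close> and the antipodal map this is a Kronecker
  delta.\<close>

lemma cf_vec_v:
  assumes pk: "0 \<le> p" "p < N" "k \<ge> 1" "int k \<le> M - 1" and m: "m \<ge> 1" "int m \<le> M - 1"
  shows "cf (q, m) (vec_v X n (arc p k)) = (if same q m p k then 1 else 0) + (if bc \<and> same (q + M) m p k then 1 else 0)"
proof -
  let ?i = "q - 1" and ?j = "q + int m"
  have ne: "?i mod N \<noteq> ?j mod N" "(?i + 1) mod N \<noteq> (?j + 1) mod N" "?i mod N \<noteq> (?j + 1) mod N" "(?i + 1) mod N \<noteq> ?j mod N"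
    by (rule valid_distinct; use m pk N_2M M_ge in simp)+
  have st: "ar p k a - ar p k (a + 1) = chi a (p + int k) - chi a (p - 1)" for a using ar_step[OF pk(4)] .
  have "cf (q, m) (vec_v X n (arc p k)) =
      - ((ar p k ?i - ar p k (?i + 1)) * (ar p k ?j - ar p k (?j + 1)))
      - (if bc then (ar p k (?i + M) - ar p k (?i + M + 1)) * (ar p k (?j + M) - ar p k (?j + M + 1)) else 0)"
    unfolding cf_def cc_def fst_conv snd_conv vec_v_at[OF ne(1) pk] vec_v_at[OF ne(2) pk] vec_v_at[OF ne(3) pk] vec_v_at[OF ne(4) pk]
    by (simp add: algebra_simps)
  also have "\<dots> = (if same q m p k then 1 else 0) + (if bc \<and> same (q + M) m p k then 1 else 0)"
  proof -
    have e: "?i + M = (q + M) - 1" "?j + M = (q + M) + int m" by simp_all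
    show ?thesis unfolding st e using step_product[OF m pk(3,4), of q p] step_product[OF m pk(3,4), of "q + M" p] by auto
  qed
  finally show ?thesis .
qed

lemma cf_same: assumes "same q m p k" shows "cf (q, m) u = cf (p, k) u"
proof -
  have mk: "m = k" and c: "q mod N = p mod N \<or> int k = M - 1 \<and> q mod N = (p + M) mod N"
    using assms by (auto simp: same_def)
  show ?thesis using c
  proof
    assume "q mod N = p mod N"
    then show ?thesis unfolding cf_def mk fst_conv snd_conv by (intro cc_cong) (auto simp: mod_eq_dvd_iff)
  next
    assume *: "int k = M - 1 \<and> q mod N = (p + M) mod N"
    have "cc u (p - 1) (p + int k) = cc u (p + int k) (p - 1 + N)" by (rule cc_commute)
    also have "\<dots> = cc u (q - 1) (q + int m)"
    proof (rule cc_cong)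
      have d: "N dvd q - (p + M)" using * by (simp add: mod_eq_dvd_iff)
      have "p + int k - (q - 1) = - (q - (p + M))" using * by simp
      then show "(p + int k) mod N = (q - 1) mod N" using d by (metis dvd_minus_iff mod_eq_dvd_iff)
      have "p - 1 + N - (q + int m) = - (q - (p + M))" using * mk N_2M by simp
      then show "(p - 1 + N) mod N = (q + int m) mod N" using d by (metis dvd_minus_iff mod_eq_dvd_iff)
    qed
    finally show ?thesis by (simp add: cf_def)
  qed
qed

lemma cf_antipode: "bc \<Longrightarrow> cf (q + M, m) u = cf (q, m) u"
  using cc_antipode[of u "q - 1" "q + int m"] by (simp add: cf_def algebra_simps)

end

section \<open>Rays and lineality space\<close>

context polygon
begin

lemma suc_distinct: "i mod N \<noteq> (i + 1) mod N"
  by (rule valid_distinct) (use N_ge in auto)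

lemma chi_offset: "0 \<le> m \<Longrightarrow> m < N \<Longrightarrow> chi a (p + m) = (if (a - p) mod N = m then 1 else 0)"
proof -
  assume m: "0 \<le> m" "m < N"
  have "a mod N = (p + m) mod N \<longleftrightarrow> (a - p) mod N = m mod N" by (simp add: mod_eq_dvd_iff algebra_simps)
  then show ?thesis using m by (simp add: chi_def mod_pos_pos_trivial)
qed

lemma chis_alt: "chis q a = chi a q + (if bc then chi (a + M) q else 0)"
  unfolding chis_def chi_M ..

lemma chis_cong: "q mod N = q' mod N \<Longrightarrow> chis q a = chis q' a"
  unfolding chis_alt chi_def by (simp only:)

section \<open>Edge coordinates of the vectors\<close>

lemma F_edge_vec_E: "F (vec_E X n q) i (i + 1) = chis q i + chis (q - 1) i"
  unfolding vec_E_at[OF suc_distinct] chis_Suc ..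

definition be :: "int \<Rightarrow> nat \<Rightarrow> int \<Rightarrow> real" where
  "be p k i = (if (i - p) mod N < int k then 1 else 0)"

lemma ar_ar_edge: assumes "int k \<le> M - 1" shows "ar p k i * ar p k (i + 1) = be p k i"
proof -
  define s where "s = (i - p) mod N"
  have s: "0 \<le> s" "s < N" using N_pos by (auto simp: s_def)
  have "(i + 1 - p) mod N = (s + 1) mod N" unfolding s_def mod_add_left_eq by (simp add: algebra_simps)
  also have "\<dots> = (if s = N - 1 then 0 else s + 1)" using s by (auto simp: mod_pos_pos_trivial)
  finally have "ar p k (i + 1) = (if s = N - 1 \<or> s + 1 \<le> int k then 1 else 0)" by (simp add: ar_def)
  moreover have "ar p k i = (if s \<le> int k then 1 else 0)" "be p k i = (if s < int k then 1 else 0)"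
    by (simp_all add: ar_def be_def s_def)
  ultimately show ?thesis using s assms N_2M M_ge by auto
qed

lemma F_edge_vec_v:
  assumes pk: "0 \<le> p" "p < N" "k \<ge> 1" "int k \<le> M - 1"
  shows "F (vec_v X n (arc p k)) i (i + 1) = - be p k i - (if bc then be p k (i + M) else 0)"
proof -
  have e: "i + 1 + M = (i + M) + 1" by simp
  show ?thesis unfolding vec_v_at[OF suc_distinct pk] e ar_ar_edge[OF pk(4)] ..
qed

lemma be_0: "be p 0 i = 0"
  using N_pos by (auto simp: be_def not_less)

lemma be_Suc: "int k < N \<Longrightarrow> be p (Suc k) i = be p k i + chi i (p + int k)"
  by (auto simp: be_def chi_offset)

text \<open>Each vertex meets the edges on both of its sides, so every second vertex of the arc
  covers its first \<open>2 * h\<close> edges, each once.\<close>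

lemma be_sum: "2 * int h \<le> N \<Longrightarrow>
    (\<Sum>t = 1..h. chi i (p + 2 * int t - 1) + chi i (p + 2 * int t - 1 - 1)) = be p (2 * h) i"
proof (induction h)
  case 0
  show ?case by (simp add: be_0)
next
  case (Suc h)
  have "be p (2 * Suc h) i = be p (2 * h) i + chi i (p + int (2 * h)) + chi i (p + int (2 * h + 1))"
    using Suc.prems be_Suc[of "2 * h" p i] be_Suc[of "2 * h + 1" p i] by simp
  moreover have "(\<Sum>t = 1..Suc h. chi i (p + 2 * int t - 1) + chi i (p + 2 * int t - 1 - 1)) =
      be p (2 * h) i + (chi i (p + 2 * int (Suc h) - 1) + chi i (p + 2 * int (Suc h) - 1 - 1))"
    using Suc by simp
  moreover have e: "p + 2 * int (Suc h) - 1 = p + int (2 * h + 1)" "p + int (2 * h + 1) - 1 = p + int (2 * h)" by simp_all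
  ultimately show ?case unfolding e by linarith
qed

lemma F_edge_vec_E_seg:
  assumes pk: "0 \<le> p" "p < N" "k \<ge> 1" "int k \<le> M - 1"
  shows "F (vec_E_seg X n (arc p k)) i (i + 1) =
    be p (2 * (k div 2)) i + (if bc then be p (2 * (k div 2)) (i + M) else 0)"
proof -
  have h: "2 * int (k div 2) \<le> N" using pk N_2M by linarith
  have E: "vec_E_seg X n (arc p k) = (\<Sum>t = 1..k div 2. vec_E X n (p + 2 * int t - 1))"
    unfolding vec_E_seg_def N_def[symmetric] Let_def arc_data(1,2)[OF pk] ..
  have "F (vec_E_seg X n (arc p k)) i (i + 1) =
      (\<Sum>t = 1..k div 2. chi i (p + 2 * int t - 1) + chi i (p + 2 * int t - 1 - 1)) +
      (\<Sum>t = 1..k div 2. if bc then chi (i + M) (p + 2 * int t - 1) + chi (i + M) (p + 2 * int t - 1 - 1) else 0)"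
    unfolding E F_sum F_edge_vec_E chis_alt sum.distrib[symmetric] by (intro sum.cong refl) auto
  also have "\<dots> = be p (2 * (k div 2)) i + (if bc then be p (2 * (k div 2)) (i + M) else 0)"
    unfolding be_sum[OF h] using be_sum[OF h, of "i + M" p] by (cases bc) simp_all
  finally show ?thesis .
qed

text \<open>The correction cancels the edges of the arc in pairs; for odd length the last edge, from
  \<open>p + k - 1\<close> to \<open>p + k\<close>, is left over. Removing two such leftovers is the
  purpose of \<open>vec_H\<close>.\<close>

lemma F_edge_vec_v_tilde:
  assumes pk: "0 \<le> p" "p < N" "k \<ge> 1" "int k \<le> M - 1"
  shows "F (vec_v_tilde X n (arc p k)) i (i + 1) = - (if odd k then chis (p + int k - 1) i else 0)"
proof (cases "odd k")
  case False
  then have "2 * (k div 2) = k" by simp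
  then show ?thesis
    unfolding vec_v_tilde_def F_add F_edge_vec_v[OF pk] F_edge_vec_E_seg[OF pk] using False by simp
next
  case True
  then obtain h where h: "k = Suc (2 * h)" by (auto elim: oddE)
  have b: "be p k i = be p (2 * h) i + chi i (p + int (2 * h))" for i
    unfolding h by (rule be_Suc) (use pk h N_2M in auto)
  have e: "2 * (k div 2) = 2 * h" "p + int k - 1 = p + int (2 * h)" using h by simp_all
  then show ?thesis
    unfolding vec_v_tilde_def F_add F_edge_vec_v[OF pk] F_edge_vec_E_seg[OF pk] b chis_alt e using True by auto
qed

text \<open>Neighbouring terms share an edge with opposite signs, so only the edge before
  \<open>a\<close> and the last one survive.\<close>

lemma F_edge_vec_H:
  "F (\<Sum>k<K. (- 1) ^ k *\<^sub>R vec_E X n (a + int k)) i (i + 1) =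
    chis (a - 1) i - (- 1) ^ K * chis (a + int K - 1) i"
proof (induction K)
  case 0
  show ?case by (simp add: F_zero[unfolded zero_fun_def] F_zero)
next
  case (Suc K)
  have "a + int (Suc K) - 1 = a + int K" by simp
  then show ?case
    unfolding sum.lessThan_Suc F_add Suc.IH F_scale F_edge_vec_E by (simp add: algebra_simps)
qed

text \<open>The ambient space with coordinates at diagonals and edges, in which vectors are
  assembled before their edge coordinates cancel.\<close>

definition W :: "(int set set \<Rightarrow> real) set" where
  "W = {u. \<forall>L. L \<notin> label X n ` segments N \<longrightarrow> u L = 0}"

lemma subspace_W: "subspace W" and subspace_U: "subspace U"
  by (auto simp: subspace_def W_def U_def scaleR_fun_def)

lemma unit_vec_W: "l \<in> segments N \<Longrightarrow> unit_vec (label X n l) \<in> W"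
  by (auto simp: W_def unit_vec_def indicator_def)

lemma vec_E_W: "vec_E X n i \<in> W"
proof (cases bc)
  case False
  then have "vec_E X n i = (\<Sum>l\<in>{l \<in> segments N. i mod N \<in> l}. unit_vec (label X n l))"
    unfolding vec_E_def N_def[symmetric] Let_def by argo
  then show ?thesis by (simp only:) (intro subspace_sum[OF subspace_W] unit_vec_W, blast)
next
  case True
  have "i mod N \<noteq> (i + M) mod N" by (rule valid_distinct) (use M_ge N_2M in auto)
  then have "seg N i (antipode N i) \<in> segments N"
    using seg_segment[of i "i + M"] by (simp add: seg_def antipode_def M_def)
  moreover have "vec_E X n i = real (type_r X) *\<^sub>R unit_vec (label X n (seg N i (antipode N i))) +
      (\<Sum>L\<in>{L \<in> label X n ` (segments N - diameters N). i mod N \<in> \<Union> L}. unit_vec L)"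
    unfolding vec_E_def N_def[symmetric] Let_def using True by argo
  moreover have "unit_vec L \<in> W" if "L \<in> label X n ` (segments N - diameters N)" for L
    using that unit_vec_W by blast
  ultimately show ?thesis
    by (simp only:) (intro subspace_add[OF subspace_W] subspace_scale[OF subspace_W] subspace_sum[OF subspace_W] unit_vec_W; blast)
qed

lemma vec_v_W: "vec_v X n l \<in> W"
  unfolding vec_v_def N_def[symmetric] Let_def
  by (intro subspace_neg[OF subspace_W] subspace_sum[OF subspace_W] unit_vec_W) blast

lemma vec_v_tilde_W: "vec_v_tilde X n l \<in> W"
  unfolding vec_v_tilde_def vec_E_seg_def Let_def
  by (intro subspace_add[OF subspace_W] subspace_sum[OF subspace_W] vec_v_W vec_E_W)

lemma vec_H_W: "vec_H X n i l \<in> W"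
  unfolding vec_H_def by (intro subspace_sum[OF subspace_W] subspace_scale[OF subspace_W] vec_E_W)

lemma edge_vanishes:
  assumes "u \<in> U" shows "F u i (i + 1) = 0"
  using assms by (simp add: F_def U_def edge_not_variable)

lemma U_I:
  assumes "u \<in> W" "\<And>i. F u i (i + 1) = 0" shows "u \<in> U"
  unfolding U_def
proof (intro CollectI allI impI)
  fix L assume L: "L \<notin> variable_labels X n"
  show "u L = 0"
  proof (cases "L \<in> label X n ` segments N")
    case False
    then show ?thesis using assms(1) by (simp add: W_def)
  next
    case True
    then obtain l where l: "L = label X n l" "l \<in> segments N" by blast
    have "l \<notin> diagonals N" using L l(1) unfolding variable_labels_def N_def[symmetric] by blast
    then have "l \<in> edges N" using l(2) by (simp add: diagonals_def)
    then obtain i where i: "l = seg N i (i + 1)" by (auto simp: edges_def)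
    have "F u i (i + 1) = u (lab i (i + 1))" by (rule F_nondiameter) (use N_ge M_ge in auto)
    then show ?thesis using assms(2) l(1) i by (simp add: lab_def)
  qed
qed

text \<open>Repetitions are kept: arcs of length \<open>M - 1\<close> in all types, and antipodal
  arcs in types B and C, give equal functionals. The ray criterion is stated so as to allow
  this.\<close>

definition \<Lambda> :: "(int \<times> nat) set" where "\<Lambda> = {0..<N} \<times> {1..nat (M - 1)}"

lemma \<Lambda>_iff: "(p, k) \<in> \<Lambda> \<longleftrightarrow> 0 \<le> p \<and> p < N \<and> k \<ge> 1 \<and> int k \<le> M - 1"
  by (auto simp: \<Lambda>_def)

section \<open>The facet functionals and the relation between them\<close>

lemma cf_add: "cf c (u + v) = cf c u + cf c v" and cf_scale: "cf c (a *\<^sub>R u) = a * cf c u"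
  and cf_sum: "cf c (\<Sum>i\<in>A. w i) = (\<Sum>i\<in>A. cf c (w i))"
  unfolding cf_def by (rule cc_add cc_scale cc_sum)+

lemma cf_vec_E: "c \<in> \<Lambda> \<Longrightarrow> cf c (vec_E X n q) = 0"
proof -
  assume "c \<in> \<Lambda>"
  moreover obtain p k where c: "c = (p, k)" by (cases c)
  ultimately have "0 \<le> p \<and> p < N \<and> k \<ge> 1 \<and> int k \<le> M - 1" using \<Lambda>_iff by blast
  then show ?thesis unfolding c cf_def fst_conv snd_conv using N_2M M_ge by (intro cc_vec_E) auto
qed

text \<open>The pair \<open>i, j\<close> belongs to the arc from \<open>i + 1\<close> to
  \<open>j\<close>; beyond half a turn the ends are exchanged.\<close>

lemma cc_cf:
  assumes "i + 2 \<le> j" "j \<le> i + N - 2"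
  shows "\<exists>c\<in>\<Lambda>. \<forall>u. cc u i j = cf c u"
proof -
  have short: "\<exists>c\<in>\<Lambda>. \<forall>u. cc u i j = cf c u" if "i + 2 \<le> j" "j \<le> i + M" for i j
  proof (intro bexI allI)
    fix u
    show "((i + 1) mod N, nat (j - i - 1)) \<in> \<Lambda>" unfolding \<Lambda>_iff using that N_pos by auto
    have "cc u i j = cc u ((i + 1) mod N - 1) ((i + 1) mod N + (j - i - 1))"
    proof (rule cc_cong)
      have "((i + 1) mod N - 1) mod N = (i + 1 - 1) mod N" by (rule mod_diff_left_eq)
      then show "i mod N = ((i + 1) mod N - 1) mod N" by simp
      have "((i + 1) mod N + (j - i - 1)) mod N = (i + 1 + (j - i - 1)) mod N" by (rule mod_add_left_eq)
      then show "j mod N = ((i + 1) mod N + (j - i - 1)) mod N" by simp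
    qed
    then show "cc u i j = cf ((i + 1) mod N, nat (j - i - 1)) u" using that by (simp add: cf_def)
  qed
  show ?thesis
  proof (cases "j \<le> i + M")
    case True
    then show ?thesis using short assms by blast
  next
    case False
    then have "\<exists>c\<in>\<Lambda>. \<forall>u. cc u j (i + N) = cf c u" using assms N_2M by (intro short) auto
    then show ?thesis unfolding cc_commute[symmetric] .
  qed
qed

lemma weak_iff: "weak u \<longleftrightarrow> (\<forall>c\<in>\<Lambda>. 0 \<le> cf c u)"
proof
  assume w: "weak u"
  have "0 \<le> cf (p, k) u" if "(p, k) \<in> \<Lambda>" for p k
  proof -
    have "p - 1 + 2 \<le> p + int k" "p + int k \<le> p - 1 + N - 2" using that N_2M M_ge by (auto simp: \<Lambda>_iff)
    then show ?thesis using w unfolding weak_def cf_def fst_conv snd_conv by blast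
  qed
  then show "\<forall>c\<in>\<Lambda>. 0 \<le> cf c u" by auto
next
  assume "\<forall>c\<in>\<Lambda>. 0 \<le> cf c u"
  then show "weak u" unfolding weak_def using cc_cf by metis
qed

text \<open>Arcs of length \<open>M - 1\<close> starting at antipodal vertices give the same functional, hence the
  factor \<open>1 / 2\<close>. For these weights the sum telescopes in \<open>k\<close>.\<close>

definition sig :: "int \<times> nat \<Rightarrow> real" where
  "sig c = (if odd (snd c) then sg (fst c) * (if int (snd c) = M - 1 then 1 / 2 else 1) else 0)"

lemma sg_mod: "p mod N = q mod N \<Longrightarrow> sg p = sg q"
proof -
  assume "p mod N = q mod N"
  then have "even (p - q)" using N_2M by (metis dvd_mult_left mod_eq_dvd_iff)
  then show ?thesis by (auto simp: sg_def)
qed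

lemma telescope:
  fixes S :: "int \<Rightarrow> real"
  shows "(\<Sum>k = 1..K. if odd k then S (int k + 2) - S (int k) else 0) =
    S (if odd K then int K + 2 else int K + 1) - S 1"
proof (induction K)
  case (Suc K)
  have "int (Suc K) + 2 = int K + 3" "int (Suc K) + 1 = int K + 2" "int (Suc K) = int K + 1" by simp_all
  then show ?case using Suc by (auto simp: algebra_simps)
qed simp

text \<open>The alternating sum \<open>S m\<close> runs over all segments spanning \<open>m\<close>
  steps, and functionals of length \<open>k\<close> sum up to \<open>S (k + 2) - S k\<close>. For
  odd \<open>k\<close> this telescopes from the edges, where \<open>S 1 = 0\<close>, to the middle
  of the polygon, where reflection closes the sum.\<close>

lemma sum_sig_cf:
  assumes u: "u \<in> U" shows "(\<Sum>c\<in>\<Lambda>. sig c * cf c u) = 0"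
proof -
  define S where "S m = (\<Sum>p\<in>{0..<N}. sg p * F u p (p + m))" for m
  have shift: "(\<Sum>p\<in>{0..<N}. sg (p + s) * F u (p + s) (p + s + m)) = S m" for s m
    unfolding S_def
  proof (rule periodic_sum[OF N_pos, where h = "\<lambda>p. sg p * F u p (p + m)"])
    fix p q assume pq: "p mod N = q mod N"
    then have "(p + m) mod N = (q + m) mod N" by (intro mod_add_cong) auto
    then show "sg p * F u p (p + m) = sg q * F u q (q + m)" using pq sg_mod F_cong by metis
  qed
  have S1: "S 1 = 0" unfolding S_def edge_vanishes[OF u] by simp
  \<comment> \<open>The same segments are counted from their other ends, which for odd
    \<open>m\<close> have the opposite sign.\<close>
  have reflect: "S (N - m) = - S m" if "odd m" for m
  proof -
    have "sg p * F u p (p + (N - m)) = - (sg (p + - m) * F u (p + - m) (p + - m + m))" for p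
    proof -
      have "F u p (p + (N - m)) = F u p (p - m + N)" by (simp add: algebra_simps)
      also have "\<dots> = F u p (p - m)" by (rule F_shift)
      also have "\<dots> = F u (p + - m) (p + - m + m)" using F_commute[of u p "p - m"] by simp
      finally have "F u p (p + (N - m)) = F u (p + - m) (p + - m + m)" .
      moreover have "sg (p + - m) = - sg p" using that by (auto simp: sg_def)
      ultimately show ?thesis by simp
    qed
    then have "S (N - m) = (\<Sum>p\<in>{0..<N}. - (sg (p + - m) * F u (p + - m) (p + - m + m)))"
      unfolding S_def by (intro sum.cong) auto
    also have "\<dots> = - S m" unfolding sum_negf shift ..
    finally show ?thesis .
  qed
  \<comment> \<open>The terms of span \<open>k + 1\<close> start at neighbouring vertices and cancel
    in the alternating sum.\<close>
  have T: "(\<Sum>p\<in>{0..<N}. sg p * cf (p, k) u) = S (int k + 2) - S (int k)" for k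
  proof -
    have "sg p * cf (p, k) u =
        - (sg (p + - 1) * F u (p + - 1) (p + - 1 + (int k + 1))) + sg (p + 0) * F u (p + 0) (p + 0 + (int k + 1))
        + sg (p + - 1) * F u (p + - 1) (p + - 1 + (int k + 2)) - sg (p + 0) * F u (p + 0) (p + 0 + int k)" for p
    proof -
      have e: "p - 1 = p + - 1" "p + - 1 + (int k + 1) = p + int k" "p + - 1 + (int k + 2) = p + int k + 1"
        "p + 0 + (int k + 1) = p + int k + 1" "p + 0 + int k = p + int k" "p + 0 = p" "p + - 1 + 1 = p" by simp_all
      have "sg (p + - 1) = - sg p" by (auto simp: sg_def)
      then show ?thesis unfolding cf_def cc_def fst_conv snd_conv e by (simp add: algebra_simps)
    qed
    then have "(\<Sum>p\<in>{0..<N}. sg p * cf (p, k) u) = - S (int k + 1) + S (int k + 1) + S (int k + 2) - S (int k)"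
      by (simp only: sum.distrib sum_subtractf sum_negf shift)
    then show ?thesis by simp
  qed
  define w :: "nat \<Rightarrow> real" where "w k = (if odd k then if int k = M - 1 then 1 / 2 else 1 else 0)" for k
  define m where "m = nat (M - 1)"
  have m: "int m = M - 1" using M_ge by (simp add: m_def)
  have "(\<Sum>c\<in>\<Lambda>. sig c * cf c u) = (\<Sum>p\<in>{0..<N}. \<Sum>k\<in>{1..m}. sig (p, k) * cf (p, k) u)"
    unfolding \<Lambda>_def m_def by (rule sum.cartesian_product')
  also have "\<dots> = (\<Sum>k\<in>{1..m}. \<Sum>p\<in>{0..<N}. sig (p, k) * cf (p, k) u)" by (rule sum.swap)
  also have "\<dots> = (\<Sum>k\<in>{1..m}. w k * (S (int k + 2) - S (int k)))"
  proof (rule sum.cong[OF refl])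
    fix k
    have "(\<Sum>p\<in>{0..<N}. sig (p, k) * cf (p, k) u) = w k * (\<Sum>p\<in>{0..<N}. sg p * cf (p, k) u)"
      unfolding sum_distrib_left by (intro sum.cong refl) (simp add: sig_def w_def)
    then show "(\<Sum>p\<in>{0..<N}. sig (p, k) * cf (p, k) u) = w k * (S (int k + 2) - S (int k))" unfolding T .
  qed
  \<comment> \<open>For odd \<open>M\<close> the telescope ends at \<open>S M\<close>, which
    reflection makes zero. For even \<open>M\<close> its last term is half of
    \<open>S (M + 1) - S (M - 1) = - 2 * S (M - 1)\<close> and cancels the rest.\<close>
  also have "\<dots> = 0"
  proof (cases "even M")
    case False
    then have em: "even m" using m by presburger
    have "(\<Sum>k\<in>{1..m}. w k * (S (int k + 2) - S (int k))) =
        (\<Sum>k = 1..m. if odd k then S (int k + 2) - S (int k) else 0)"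
      using em by (intro sum.cong refl) (auto simp: w_def m[symmetric])
    also have "\<dots> = S M - S 1" unfolding telescope using em m by simp
    also have "S M = 0" using reflect[of M] False N_2M by simp
    finally show ?thesis using S1 by simp
  next
    case True
    then have om: "odd m" using m by presburger
    then obtain m' where m': "m = Suc m'" by (cases m) auto
    have "(\<Sum>k\<in>{1..m'}. w k * (S (int k + 2) - S (int k))) =
        (\<Sum>k = 1..m'. if odd k then S (int k + 2) - S (int k) else 0)"
      using m m' by (intro sum.cong refl) (auto simp: w_def)
    also have "\<dots> = S (M - 1) - S 1"
    proof -
      have e: "M - 1 = int m' + 1" using m m' by simp
      show ?thesis unfolding telescope e using om m' by simp
    qed
    finally have "(\<Sum>k\<in>{1..m}. w k * (S (int k + 2) - S (int k))) = S (M - 1) + w m * (S (int m + 2) - S (int m))"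
      using S1 by (simp add: m')
    moreover have "S (int m + 2) = - S (M - 1)"
    proof -
      have "int m + 2 = N - (M - 1)" using m N_2M by simp
      then have "S (int m + 2) = S (N - (M - 1))" by (rule arg_cong)
      also have "\<dots> = - S (M - 1)" by (rule reflect) (use True in simp)
      finally show ?thesis .
    qed
    moreover have "w m = 1 / 2" using om m by (simp add: w_def)
    ultimately show ?thesis using m by simp
  qed
  finally show ?thesis .
qed

section \<open>The lineality space\<close>

definition Z :: "int set set \<Rightarrow> real" where
  "Z = (\<Sum>i = 1..nat N. (- 1) ^ i *\<^sub>R vec_E X n (int i))"

definition \<mu> :: real where "\<mu> = (if bc then 2 else 1)"

lemma alternating_chi: "(\<Sum>i = 1..nat N. (- 1) ^ i * chi a (int i)) = sg a"
proof -
  define i0 where "i0 = nat ((a - 1) mod N) + 1"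
  have i0: "int i0 = (a - 1) mod N + 1" "1 \<le> i0" "i0 \<le> nat N"
    using N_pos by (auto simp: i0_def nat_le_iff Suc_le_eq zless_nat_eq_int_zless)
  have a0: "int i0 mod N = a mod N" unfolding i0(1) mod_add_left_eq by simp
  have "(- 1) ^ i * chi a (int i) = (if i = i0 then (- 1) ^ i else 0)" if "i \<in> {1..nat N}" for i
  proof -
    have "1 \<le> int i" "int i \<le> N" "1 \<le> int i0" "int i0 \<le> N" using that i0(2,3) N_pos by auto
    then have "a mod N = int i mod N \<longleftrightarrow> i = i0"
      using mod_window[of "int i" N "int i0"] a0 by auto
    then show ?thesis by (simp add: chi_def)
  qed
  then have "(\<Sum>i = 1..nat N. (- 1) ^ i * chi a (int i)) = (\<Sum>i = 1..nat N. if i = i0 then (- 1) ^ i else 0)"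
    by (intro sum.cong) auto
  also have "\<dots> = sg (int i0)" using i0(2,3) by (simp add: sum.delta sg_of_nat)
  also have "\<dots> = sg a" using a0 by (rule sg_mod)
  finally show ?thesis .
qed

lemma alternating_chis: "(\<Sum>i = 1..nat N. (- 1) ^ i * chis (int i) a) = \<mu> * sg a"
proof (cases bc)
  case False
  then show ?thesis unfolding chis_alt \<mu>_def using alternating_chi[of a] by simp
next
  case True
  have "sg (a + M) = sg a" using M_bc(3)[OF True] by (auto simp: sg_def)
  then have "(\<Sum>i = 1..nat N. (- 1) ^ i * chi a (int i)) + (\<Sum>i = 1..nat N. (- 1) ^ i * chi (a + M) (int i)) = 2 * sg a"
    unfolding alternating_chi by simp
  then show ?thesis unfolding chis_alt \<mu>_def sum.distrib[symmetric] using True by (simp add: distrib_left)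
qed

lemma Z_at: assumes "a mod N \<noteq> b mod N" shows "F Z a b = \<mu> * (sg a + sg b)"
proof -
  have "F Z a b = (\<Sum>i = 1..nat N. (- 1) ^ i * chis (int i) a) + (\<Sum>i = 1..nat N. (- 1) ^ i * chis (int i) b)"
    unfolding Z_def F_sum F_scale vec_E_at[OF assms] distrib_left sum.distrib ..
  then show ?thesis unfolding alternating_chis distrib_left .
qed

lemma Z_U: "Z \<in> U"
proof (rule U_I)
  show "Z \<in> W" unfolding Z_def by (intro subspace_sum[OF subspace_W] subspace_scale[OF subspace_W] vec_E_W)
  show "F Z i (i + 1) = 0" for i unfolding Z_at[OF suc_distinct] by simp
qed

lemma cf_Z: "c \<in> \<Lambda> \<Longrightarrow> cf c Z = 0"
  unfolding Z_def cf_sum cf_scale by (simp add: cf_vec_E)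

text \<open>If \<open>cc\<close> vanishes, the increment of \<open>F u i\<close> as the second end
  moves does not depend on \<open>i\<close>. Closing up at an edge gives
  \<open>a (i + 1) = - a i\<close>, and summing the increments from the vanishing edge yields the
  formula.\<close>

lemma kernel_form:
  assumes u: "u \<in> U" and z: "\<And>c. c \<in> \<Lambda> \<Longrightarrow> cf c u = 0"
  obtains t where "\<And>i j. i < j \<Longrightarrow> j < i + N \<Longrightarrow> F u i j = t * (sg i + sg j)"
proof -
  have cc0: "cc u i j = 0" if "i + 2 \<le> j" "j \<le> i + N - 2" for i j using cc_cf[OF that] z by metis
  define a where "a i = F u i (i + 2)" for i
  have step: "F u i (i + int d + 1) - F u i (i + int d) = a (i + int d - 1)" if "d \<ge> 1" "int d \<le> N - 2" for d i
    using that
  proof (induction d arbitrary: i rule: nat_induct_at_least)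
    case base
    have "i + int 1 + 1 = i + 2" "i + int 1 = i + 1" "i + int 1 - 1 = i" by simp_all
    then show ?case unfolding a_def by (simp only: edge_vanishes[OF u])
  next
    case (Suc d)
    have e: "i + 1 + int d + 1 = i + int (Suc d) + 1" "i + 1 + int d = i + int (Suc d)" "i + 1 + int d - 1 = i + int (Suc d) - 1"
      by simp_all
    have "cc u i (i + int (Suc d)) = 0" using Suc by (intro cc0) auto
    moreover have "F u (i + 1) (i + int (Suc d) + 1) - F u (i + 1) (i + int (Suc d)) = a (i + int (Suc d) - 1)"
      using Suc.IH[of "i + 1"] Suc.prems unfolding e by simp
    ultimately show ?case unfolding cc_def by linarith
  qed
  have wrap: "a (i + 1) = - a i" for i
  proof -
    \<comment> \<open>This is the increment leading to the closing edge, whose coordinate is zero;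
      the segment before it also defines \<open>a (i' + N - 2)\<close>.\<close>
    define d where "d = nat (N - 2)"
    have d: "int d = N - 2" "d \<ge> 1" using N_ge by (auto simp: d_def)
    define i' where "i' = i - N + 3"
    have "F u i' (i' + N - 1) - F u i' (i' + N - 2) = a (i' + N - 3)"
      using step[of d i'] d by (simp add: algebra_simps)
    moreover have "F u i' (i' + N - 1) = 0"
    proof -
      have "F u i' (i' - 1 + N) = F u i' (i' - 1)" by (rule F_shift)
      also have "\<dots> = F u (i' - 1) (i' - 1 + 1)" using F_commute[of u i' "i' - 1"] by simp
      finally show ?thesis using edge_vanishes[OF u, of "i' - 1"] by (simp add: algebra_simps)
    qed
    moreover have "F u i' (i' + N - 2) = a (i' + N - 2)"
    proof -
      have "a (i' - 2 + N) = F u (i' - 2 + N) (i' + N)" by (simp add: a_def algebra_simps)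
      also have "\<dots> = F u (i' - 2 + N) i'" by (rule F_shift)
      also have "\<dots> = F u i' (i' - 2 + N)" by (rule F_commute)
      finally show ?thesis by (simp add: algebra_simps)
    qed
    moreover have "i' + N - 3 = i" "i' + N - 2 = i + 1" by (simp_all add: i'_def)
    ultimately show ?thesis by simp
  qed
  have a: "a i = sg i * a 0" for i
  proof (induction i rule: int_induct[where k = 0])
    case base
    show ?case by (simp add: sg_def)
  next
    case (step1 i)
    then show ?case using wrap[of i] by simp
  next
    case (step2 i)
    then show ?case using wrap[of "i - 1"] by simp
  qed
  have form: "F u i (i + int d) = a 0 / 2 * (sg i + sg (i + int d))" if "d \<ge> 1" "int d \<le> N - 1" for d i
    using that
  proof (induction d rule: nat_induct_at_least)
    case base
    have "i + int 1 = i + 1" by simp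
    then show ?case by (simp only: edge_vanishes[OF u] sg_Suc) simp
  next
    case (Suc d)
    have e: "i + int (Suc d) = i + int d + 1" by simp
    have "sg (i + int d - 1) = - sg (i + int d)" by simp
    then have "F u i (i + int d + 1) = F u i (i + int d) - sg (i + int d) * a 0"
      using step[of d i] Suc a[of "i + int d - 1"] by simp
    moreover have "F u i (i + int d) = a 0 / 2 * (sg i + sg (i + int d))" using Suc by simp
    ultimately show ?case unfolding e sg_Suc by (simp add: field_simps)
  qed
  then have "F u i j = a 0 / 2 * (sg i + sg j)" if "i < j" "j < i + N" for i j
  proof -
    have "j = i + int (nat (j - i))" "nat (j - i) \<ge> 1" "int (nat (j - i)) \<le> N - 1" using that by auto
    with form show ?thesis by metis
  qed
  then show thesis using that by blast
qed

lemma kap_nonzero: "kap i j \<noteq> 0"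
  using type_r_cases by (auto simp: kap_def)

lemma kernel_eq: "{u \<in> U. \<forall>c\<in>\<Lambda>. cf c u = 0} = span {Z}"
proof
  have "subspace {u \<in> U. \<forall>c\<in>\<Lambda>. cf c u = 0}"
    using subspace_U cf_scale[of _ 0 0] by (auto simp: subspace_def cf_add cf_scale)
  then show "span {Z} \<subseteq> {u \<in> U. \<forall>c\<in>\<Lambda>. cf c u = 0}"
    using Z_U cf_Z by (intro span_minimal) auto
  show "{u \<in> U. \<forall>c\<in>\<Lambda>. cf c u = 0} \<subseteq> span {Z}"
  proof
    fix u assume *: "u \<in> {u \<in> U. \<forall>c\<in>\<Lambda>. cf c u = 0}"
    then obtain t where l: "\<And>i j. i < j \<Longrightarrow> j < i + N \<Longrightarrow> F u i j = t * (sg i + sg j)"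
      using kernel_form[of u] by blast
    have "u = (t / \<mu>) *\<^sub>R Z"
    proof (rule ext)
      fix L
      show "u L = ((t / \<mu>) *\<^sub>R Z) L"
      proof (cases "L \<in> variable_labels X n")
        case False
        then show ?thesis using * Z_U by (simp add: U_def scaleR_fun_def)
      next
        case True
        then obtain i j where L: "L = lab i j" and ij: "i + 2 \<le> j" "j \<le> i + N - 2"
          unfolding variable_labels_eq by blast
        have "F ((t / \<mu>) *\<^sub>R Z) i j = (t / \<mu>) * (\<mu> * (sg i + sg j))"
          unfolding F_scale using Z_at[OF valid_distinct, of i j] ij by simp
        also have "\<dots> = F u i j" using l[of i j] ij by (simp add: \<mu>_def)
        finally show ?thesis unfolding L F_def using kap_nonzero by simp
      qed
    qed
    then show "u \<in> span {Z}" by (simp add: span_base span_scale)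
  qed
qed

section \<open>The generators and the ray criterion\<close>

lemma cf_vec_v_tilde:
  assumes "c \<in> \<Lambda>" shows "cf c (vec_v_tilde X n l) = cf c (vec_v X n l)"
  unfolding vec_v_tilde_def vec_E_seg_def Let_def cf_add cf_sum cf_vec_E[OF assms] by simp

lemma cf_vec_H: "c \<in> \<Lambda> \<Longrightarrow> cf c (vec_H X n i l) = 0"
  unfolding vec_H_def cf_sum cf_scale by (simp add: cf_vec_E)

text \<open>The corrections are invisible to the functionals, so the duality of \<open>vec_v\<close>
  carries over. Signs agree on identified indices: a shift by \<open>M\<close> preserves parity in
  types B and C, and in all types when the length \<open>M - 1\<close> is odd.\<close>

lemma cf_arc:
  assumes pk: "(p, k) \<in> \<Lambda>"
  shows "0 < cf (p, k) (vec_v_tilde X n (arc p k))"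
    and "c \<in> \<Lambda> \<Longrightarrow> 0 \<le> cf c (vec_v_tilde X n (arc p k))"
    and "c \<in> \<Lambda> \<Longrightarrow> cf c (vec_v_tilde X n (arc p k)) \<noteq> 0 \<Longrightarrow> cf c u = cf (p, k) u"
    and "c \<in> \<Lambda> \<Longrightarrow> cf c (vec_v_tilde X n (arc p k)) \<noteq> 0 \<Longrightarrow> sig c = sig (p, k)"
proof -
  have pk': "0 \<le> p" "p < N" "k \<ge> 1" "int k \<le> M - 1" using pk by (auto simp: \<Lambda>_iff)
  have val: "cf (q, m) (vec_v_tilde X n (arc p k)) =
      (if same q m p k then 1 else 0) + (if bc \<and> same (q + M) m p k then 1 else 0)" if "(q, m) \<in> \<Lambda>" for q m
    unfolding cf_vec_v_tilde[OF that] by (rule cf_vec_v[OF pk']) (use that \<Lambda>_iff in auto)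
  have "same p k p k" by (simp add: same_def)
  then show "0 < cf (p, k) (vec_v_tilde X n (arc p k))" unfolding val[OF pk] by simp
  obtain q m where c: "c = (q, m)" by (cases c)
  show "0 \<le> cf c (vec_v_tilde X n (arc p k))" if "c \<in> \<Lambda>" using val that unfolding c by simp
  have s: "same q m p k \<or> bc \<and> same (q + M) m p k" if "c \<in> \<Lambda>" "cf c (vec_v_tilde X n (arc p k)) \<noteq> 0"
    using that val[of q m] unfolding c by argo
  show "cf c u = cf (p, k) u" if "c \<in> \<Lambda>" "cf c (vec_v_tilde X n (arc p k)) \<noteq> 0"
    using s[OF that] cf_same[of q m p k u] cf_same[of "q + M" m p k u] cf_antipode[where q = q and m = m and u = u] unfolding c by metis
  have sig: "sig (q', m) = sig (p, k)" if "same q' m p k" for q'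
  proof (cases "odd k")
    case False
    then show ?thesis using that by (simp add: sig_def same_def)
  next
    case True
    have "sg q' = sg p"
    proof (cases "q' mod N = p mod N")
      case True
      then show ?thesis by (rule sg_mod)
    next
      case False
      then have M: "M = int k + 1" and "q' mod N = (p + M) mod N" using that by (auto simp: same_def)
      from this(2) have "sg q' = sg (p + M)" by (rule sg_mod)
      also have "\<dots> = sg p" using \<open>odd k\<close> unfolding M by (auto simp: sg_def)
      finally show ?thesis .
    qed
    then show ?thesis using that by (simp add: sig_def same_def)
  qed
  have "sig (q + M, m) = sig (q, m)" if bc
    using M_bc(3)[OF that] by (auto simp: sig_def sg_def)
  then show "sig c = sig (p, k)" if "c \<in> \<Lambda>" "cf c (vec_v_tilde X n (arc p k)) \<noteq> 0"
    using s[OF that] sig[of q] sig[of "q + M"] unfolding c by metis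
qed

lemma v_tilde_even_U:
  assumes "(p, k) \<in> \<Lambda>" "even k" shows "vec_v_tilde X n (arc p k) \<in> U"
proof (rule U_I[OF vec_v_tilde_W])
  have pk: "0 \<le> p" "p < N" "k \<ge> 1" "int k \<le> M - 1" using assms by (auto simp: \<Lambda>_iff)
  show "F (vec_v_tilde X n (arc p k)) i (i + 1) = 0" for i
    unfolding F_edge_vec_v_tilde[OF pk] using assms(2) by simp
qed

text \<open>The edges left over by the two arcs are those at which \<open>vec_H\<close> survives.
  Its number of terms is odd, so both contributions have the same sign, and it does not matter which
  end of the segment comes first.\<close>

lemma odd_generator_U:
  assumes 1: "(p, k) \<in> \<Lambda>" "odd k" and 2: "(p', k') \<in> \<Lambda>" "odd k'" and par: "odd (p + p')"
    and i: "i \<in> first_vertices N (seg N (p + int k) (p' + int k'))"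
  shows "vec_v_tilde X n (arc p k) + vec_v_tilde X n (arc p' k') +
    vec_H X n i (seg N (p + int k) (p' + int k')) \<in> U"
proof (rule U_I)
  let ?m = "seg N (p + int k) (p' + int k')"
  show "vec_v_tilde X n (arc p k) + vec_v_tilde X n (arc p' k') + vec_H X n i ?m \<in> W"
    by (intro subspace_add[OF subspace_W] vec_v_tilde_W vec_H_W)
  have pk: "0 \<le> p" "p < N" "k \<ge> 1" "int k \<le> M - 1" using 1 by (auto simp: \<Lambda>_iff)
  have pk': "0 \<le> p'" "p' < N" "k' \<ge> 1" "int k' \<le> M - 1" using 2 by (auto simp: \<Lambda>_iff)
  define K where "K = len N ?m"
  have "?m = seg N i (i + int K)" using i by (simp add: first_vertices_def K_def)
  then consider (eq) "(p + int k) mod N = i mod N" "(p' + int k') mod N = (i + int K) mod N"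
    | (swap) "(p + int k) mod N = (i + int K) mod N" "(p' + int k') mod N = i mod N"
    unfolding seg_eq_iff by blast
  note ends = this
  have "odd K"
  proof -
    \<comment> \<open>A product of signs is unaffected by exchanging the ends; ends of opposite
      parity force an odd length.\<close>
    have "sg (p + int k) * sg (p' + int k') = sg i * sg (i + int K)"
      using ends by cases (metis sg_mod mult.commute)+
    moreover have "sg (p + int k) * sg (p' + int k') = - 1"
      using par 1(2) 2(2) by (auto simp: sg_def)
    ultimately show ?thesis by (auto simp: sg_def split: if_splits)
  qed
  have pred: "chis (a - 1) j = chis (b - 1) j" if "a mod N = b mod N" for a b j
    using that by (intro chis_cong mod_diff_cong refl)
  fix j
  have H: "F (vec_H X n i ?m) j (j + 1) = chis (i - 1) j + chis (i + int K - 1) j"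
    unfolding vec_H_def N_def[symmetric] K_def[symmetric] F_edge_vec_H using \<open>odd K\<close> by simp
  have "chis (p + int k - 1) j + chis (p' + int k' - 1) j = chis (i - 1) j + chis (i + int K - 1) j"
    using ends by cases (use pred in \<open>metis add.commute\<close>)+
  then show "F (vec_v_tilde X n (arc p k) + vec_v_tilde X n (arc p' k') + vec_H X n i ?m) j (j + 1) = 0"
    unfolding F_add F_edge_vec_v_tilde[OF pk] F_edge_vec_v_tilde[OF pk'] H using 1(2) 2(2) by simp
qed

lemma even_generators_eq: "even_generators X n = {vec_v_tilde X n (arc p k) | p k. (p, k) \<in> \<Lambda> \<and> even k}"
proof (intro set_eqI iffI)
  fix g assume "g \<in> even_generators X n"
  then obtain l where l: "g = vec_v_tilde X n l" "l \<in> diagonals N" "even (len N l)" "non_maximal N l"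
    unfolding even_generators_def N_def[symmetric] Let_def by blast
  have "l \<in> segments N" using l(2) by (simp add: diagonals_def)
  then obtain p k where pk: "0 \<le> p" "p < N" "k \<ge> 1" "int k \<le> M - 1" "l = arc p k" "len N l = k"
    using non_maximal_arc l(4) by blast
  have "(p, k) \<in> \<Lambda>" "even k" using pk l(3) by (auto simp: \<Lambda>_iff)
  then show "g \<in> {vec_v_tilde X n (arc p k) | p k. (p, k) \<in> \<Lambda> \<and> even k}" unfolding l(1) pk(5) by blast
next
  fix g assume "g \<in> {vec_v_tilde X n (arc p k) | p k. (p, k) \<in> \<Lambda> \<and> even k}"
  then obtain p k where g: "g = vec_v_tilde X n (arc p k)" "(p, k) \<in> \<Lambda>" "even k" by blast
  then have pk: "0 \<le> p" "p < N" "k \<ge> 1" "int k \<le> M - 1" by (auto simp: \<Lambda>_iff)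
  have "k \<ge> 2" using g(3) pk(3) by presburger
  then have "arc p k \<in> diagonals N" unfolding arc_def using pk N_2M M_ge by (intro seg_diagonal) auto
  moreover have "even (len N (arc p k))" unfolding arc_data(1)[OF pk] by (rule g(3))
  moreover have "non_maximal N (arc p k)" by (rule arc_data(4)[OF pk])
  ultimately show "g \<in> even_generators X n"
    unfolding even_generators_def N_def[symmetric] Let_def g(1) by blast
qed

lemma odd_generators_eq: "odd_generators X n =
  {vec_v_tilde X n (arc p k) + vec_v_tilde X n (arc p' k') + vec_H X n i (seg N (p + int k) (p' + int k')) |
    p k p' k' i. (p, k) \<in> \<Lambda> \<and> odd k \<and> (p', k') \<in> \<Lambda> \<and> odd k' \<and> odd (p + p') \<and>
      i \<in> first_vertices N (seg N (p + int k) (p' + int k'))}" (is "_ = ?R")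
proof -
  have evN: "even N" using N_2M by simp
  have seg: "seg N ((p + int k) mod N) ((p' + int k') mod N) = seg N (p + int k) (p' + int k')" for p k p' k'
    by (simp add: seg_mod)
  have par: "odd ((p + int k) mod N + (p' + int k') mod N) \<longleftrightarrow> odd (p + p')" if "odd k" "odd k'" for p k p' k'
  proof -
    have "even (a mod N) \<longleftrightarrow> even a" for a using evN by (simp add: dvd_mod_iff)
    then show ?thesis using that by simp
  qed
  show ?thesis
  proof (intro set_eqI iffI)
    fix g assume "g \<in> odd_generators X n"
    then obtain l l' i where g: "g = vec_v_tilde X n l + vec_v_tilde X n l' +
        vec_H X n i (seg N (delta_plus N l) (delta_plus N l'))"
      and l: "l \<in> segments N" "odd (len N l)" "non_maximal N l"
      and l': "l' \<in> segments N" "odd (len N l')" "non_maximal N l'"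
      and od: "odd (delta_plus N l + delta_plus N l')"
      and i: "i \<in> first_vertices N (seg N (delta_plus N l) (delta_plus N l'))"
      unfolding odd_generators_def N_def[symmetric] Let_def by blast
    obtain p k where pk: "0 \<le> p" "p < N" "k \<ge> 1" "int k \<le> M - 1" and lk: "l = arc p k" "len N l = k"
      using non_maximal_arc[OF l(1,3)] by blast
    obtain p' k' where pk': "0 \<le> p'" "p' < N" "k' \<ge> 1" "int k' \<le> M - 1" and lk': "l' = arc p' k'" "len N l' = k'"
      using non_maximal_arc[OF l'(1,3)] by blast
    have k: "odd k" "odd k'" using l(2) l'(2) lk(2) lk'(2) by simp_all
    have d: "delta_plus N l = (p + int k) mod N" "delta_plus N l' = (p' + int k') mod N"
      using arc_data(3)[OF pk] arc_data(3)[OF pk'] lk(1) lk'(1) by simp_all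
    have "(p, k) \<in> \<Lambda>" "(p', k') \<in> \<Lambda>" using pk pk' by (simp_all add: \<Lambda>_iff)
    moreover have "odd (p + p')" using od unfolding d par[OF k] .
    ultimately show "g \<in> ?R" using k g i unfolding d seg unfolding lk(1) lk'(1) by blast
  next
    fix g assume "g \<in> ?R"
    then obtain p k p' k' i where g: "g = vec_v_tilde X n (arc p k) + vec_v_tilde X n (arc p' k') +
        vec_H X n i (seg N (p + int k) (p' + int k'))"
      and 1: "(p, k) \<in> \<Lambda>" "odd k" "(p', k') \<in> \<Lambda>" "odd k'" "odd (p + p')"
      and i: "i \<in> first_vertices N (seg N (p + int k) (p' + int k'))" by blast
    have pk: "0 \<le> p" "p < N" "k \<ge> 1" "int k \<le> M - 1" using 1 by (auto simp: \<Lambda>_iff)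
    have pk': "0 \<le> p'" "p' < N" "k' \<ge> 1" "int k' \<le> M - 1" using 1 by (auto simp: \<Lambda>_iff)
    have d: "seg N (delta_plus N (arc p k)) (delta_plus N (arc p' k')) = seg N (p + int k) (p' + int k')"
      unfolding arc_data(3)[OF pk] arc_data(3)[OF pk'] by (rule seg)
    have "arc p k \<in> segments N" "odd (len N (arc p k))" "non_maximal N (arc p k)"
      "arc p' k' \<in> segments N" "odd (len N (arc p' k'))" "non_maximal N (arc p' k')"
      using arc_data(1,4,5)[OF pk] arc_data(1,4,5)[OF pk'] 1 by simp_all
    moreover have "odd (delta_plus N (arc p k) + delta_plus N (arc p' k'))"
      unfolding arc_data(3)[OF pk] arc_data(3)[OF pk'] par[OF 1(2,4)] by (rule 1(5))
    moreover have "i \<in> first_vertices N (seg N (delta_plus N (arc p k)) (delta_plus N (arc p' k')))"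
      unfolding d by (rule i)
    moreover have "g = vec_v_tilde X n (arc p k) + vec_v_tilde X n (arc p' k') +
        vec_H X n i (seg N (delta_plus N (arc p k)) (delta_plus N (arc p' k')))" unfolding d by (rule g)
    ultimately show "g \<in> odd_generators X n"
      unfolding odd_generators_def N_def[symmetric] Let_def by blast
  qed
qed

lemma sig_eq_0_iff: "sig (p, k) = 0 \<longleftrightarrow> even k" and sig_pos_iff: "0 < sig (p, k) \<longleftrightarrow> odd k \<and> even p"
  and sig_neg_iff: "sig (p, k) < 0 \<longleftrightarrow> odd k \<and> odd p"
  by (auto simp: sig_def sg_def)

lemma odd_generator_cf:
  assumes "(p, k) \<in> \<Lambda>" "(p', k') \<in> \<Lambda>"
    and g: "g = vec_v_tilde X n (arc p k) + vec_v_tilde X n (arc p' k') + vec_H X n i l"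
  shows "0 < cf (p, k) g" "0 < cf (p', k') g"
    and "c \<in> \<Lambda> \<Longrightarrow> 0 \<le> cf c g"
    and "c \<in> \<Lambda> \<Longrightarrow> cf c g \<noteq> 0 \<Longrightarrow> (\<forall>u. cf c u = cf (p, k) u) \<and> sig c = sig (p, k) \<or>
      (\<forall>u. cf c u = cf (p', k') u) \<and> sig c = sig (p', k')"
proof -
  have v: "cf c g = cf c (vec_v_tilde X n (arc p k)) + cf c (vec_v_tilde X n (arc p' k'))" if "c \<in> \<Lambda>" for c
    unfolding g cf_add cf_vec_H[OF that] by simp
  show "0 < cf (p, k) g" unfolding v[OF assms(1)] using cf_arc(1)[OF assms(1)] cf_arc(2)[OF assms(2,1)] by simp
  show "0 < cf (p', k') g" unfolding v[OF assms(2)] using cf_arc(1)[OF assms(2)] cf_arc(2)[OF assms(1,2)] by simp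
  show "0 \<le> cf c g" if "c \<in> \<Lambda>" unfolding v[OF that] using cf_arc(2) assms(1,2) that by simp
  show "(\<forall>u. cf c u = cf (p, k) u) \<and> sig c = sig (p, k) \<or> (\<forall>u. cf c u = cf (p', k') u) \<and> sig c = sig (p', k')"
    if "c \<in> \<Lambda>" "cf c g \<noteq> 0"
  proof (cases "cf c (vec_v_tilde X n (arc p k)) = 0")
    case False
    then show ?thesis using cf_arc(3,4)[OF assms(1) that(1) False] by blast
  next
    case True
    then have "cf c (vec_v_tilde X n (arc p' k')) \<noteq> 0" using that v by simp
    then show ?thesis using cf_arc(3,4)[OF assms(2) that(1)] by blast
  qed
qed

text \<open>The sign of an odd arc is the parity of its first vertex. The parity condition on two
  odd arcs therefore says that one index is positive and the other negative.\<close>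

sublocale cone: cone_with_relation U \<Lambda> cf sig "even_generators X n" "odd_generators X n"
proof
  show "subspace U" by (rule subspace_U)
  show "finite \<Lambda>" by (simp add: \<Lambda>_def)
  show "cf k (a + b) = cf k a + cf k b" for k a b by (rule cf_add)
  show "cf k (c *\<^sub>R a) = c * cf k a" for k c a by (rule cf_scale)
  show "u \<in> U \<Longrightarrow> (\<Sum>k\<in>\<Lambda>. sig k * cf k u) = 0" for u by (rule sum_sig_cf)
next
  fix g assume "g \<in> even_generators X n"
  then obtain p k where g: "g = vec_v_tilde X n (arc p k)" "(p, k) \<in> \<Lambda>" "even k"
    unfolding even_generators_eq by blast
  show "\<exists>l\<in>\<Lambda>. sig l = 0 \<and> g \<in> U \<and> 0 < cf l g \<and>
      (\<forall>k\<in>\<Lambda>. 0 \<le> cf k g \<and> (cf k g \<noteq> 0 \<longrightarrow> (\<forall>u\<in>U. cf k u = cf l u)))"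
    using g cf_arc[OF g(2)] v_tilde_even_U[OF g(2,3)] sig_eq_0_iff by (intro bexI[OF _ g(2)]) blast
next
  fix l assume l: "l \<in> \<Lambda>" "sig l = 0"
  obtain p k where pk: "l = (p, k)" by (cases l)
  have g: "(p, k) \<in> \<Lambda>" "even k" using l pk sig_eq_0_iff by auto
  show "\<exists>g\<in>even_generators X n. g \<in> U \<and> 0 < cf l g \<and>
      (\<forall>k\<in>\<Lambda>. 0 \<le> cf k g \<and> (cf k g \<noteq> 0 \<longrightarrow> (\<forall>u\<in>U. cf k u = cf l u)))"
  proof (rule bexI)
    show "vec_v_tilde X n (arc p k) \<in> even_generators X n" unfolding even_generators_eq using g by blast
  qed (use cf_arc[OF g(1)] v_tilde_even_U[OF g] pk in blast)
next
  fix g assume "g \<in> odd_generators X n"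
  then obtain p k p' k' i where g: "g = vec_v_tilde X n (arc p k) + vec_v_tilde X n (arc p' k') +
      vec_H X n i (seg N (p + int k) (p' + int k'))"
    and 1: "(p, k) \<in> \<Lambda>" "odd k" and 2: "(p', k') \<in> \<Lambda>" "odd k'" and par: "odd (p + p')"
    and i: "i \<in> first_vertices N (seg N (p + int k) (p' + int k'))" unfolding odd_generators_eq by blast
  have gU: "g \<in> U" unfolding g by (rule odd_generator_U[OF 1 2 par i])
  have facets: "\<exists>l\<in>\<Lambda>. \<exists>m\<in>\<Lambda>. 0 < sig l \<and> sig m < 0 \<and> g \<in> U \<and> 0 < cf l g \<and> 0 < cf m g \<and>
     (\<forall>k\<in>\<Lambda>. 0 \<le> cf k g \<and> (cf k g \<noteq> 0 \<longrightarrow> (\<forall>u\<in>U. cf k u = cf l u) \<or> sig k < 0 \<and> (\<forall>u\<in>U. cf k u = cf m u)))"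
    if l: "l \<in> \<Lambda>" "0 < sig l" "0 < cf l g" and m: "m \<in> \<Lambda>" "sig m < 0" "0 < cf m g"
      and nonneg: "\<And>c. c \<in> \<Lambda> \<Longrightarrow> 0 \<le> cf c g"
      and eq: "\<And>c. c \<in> \<Lambda> \<Longrightarrow> cf c g \<noteq> 0 \<Longrightarrow> (\<forall>u. cf c u = cf l u) \<and> sig c = sig l \<or>
        (\<forall>u. cf c u = cf m u) \<and> sig c = sig m" for l m
  proof (rule bexI[OF _ l(1)], rule bexI[OF _ m(1)], intro conjI ballI impI l m gU)
    fix c assume c: "c \<in> \<Lambda>"
    show "0 \<le> cf c g" by (rule nonneg[OF c])
    assume "cf c g \<noteq> 0"
    from eq[OF c this]
    show "(\<forall>u\<in>U. cf c u = cf l u) \<or> sig c < 0 \<and> (\<forall>u\<in>U. cf c u = cf m u)"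
      using m(2) by (elim disjE conjE) simp_all
  qed
  show "\<exists>l\<in>\<Lambda>. \<exists>m\<in>\<Lambda>. 0 < sig l \<and> sig m < 0 \<and> g \<in> U \<and> 0 < cf l g \<and> 0 < cf m g \<and>
     (\<forall>k\<in>\<Lambda>. 0 \<le> cf k g \<and> (cf k g \<noteq> 0 \<longrightarrow> (\<forall>u\<in>U. cf k u = cf l u) \<or> sig k < 0 \<and> (\<forall>u\<in>U. cf k u = cf m u)))"
  \<comment> \<open>The parity of \<open>p\<close> decides which of the two arcs is the positive
    one.\<close>
  proof (cases "even p")
    case True
    then have "0 < sig (p, k)" "sig (p', k') < 0" using 1 2 par by (auto simp: sig_pos_iff sig_neg_iff)
    then show ?thesis
      by (rule facets[OF 1(1) _ odd_generator_cf(1)[OF 1(1) 2(1) g] 2(1) _ odd_generator_cf(2,3,4)[OF 1(1) 2(1) g]])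
  next
    case False
    then have "0 < sig (p', k')" "sig (p, k) < 0" using 1 2 par by (auto simp: sig_pos_iff sig_neg_iff)
    then show ?thesis
      by (rule facets[OF 2(1) _ odd_generator_cf(2)[OF 1(1) 2(1) g] 1(1) _ odd_generator_cf(1,3)[OF 1(1) 2(1) g]
            disj_comms(1)[THEN iffD1, OF odd_generator_cf(4)[OF 1(1) 2(1) g]]])
  qed
next
  fix l m assume lm: "l \<in> \<Lambda>" "m \<in> \<Lambda>" "0 < sig l" "sig m < 0"
  obtain p k where l: "l = (p, k)" by (cases l)
  obtain p' k' where m: "m = (p', k')" by (cases m)
  have 1: "(p, k) \<in> \<Lambda>" "odd k" and 2: "(p', k') \<in> \<Lambda>" "odd k'" and par: "odd (p + p')"
    using lm unfolding l m sig_pos_iff sig_neg_iff by auto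
  \<comment> \<open>Opposite parities make the last vertices of the arcs distinct, so they span a
    segment for \<open>vec_H\<close>.\<close>
  have "sg (p + int k) \<noteq> sg (p' + int k')" using par 1 2 by (auto simp: sg_def)
  then have "seg N (p + int k) (p' + int k') \<in> segments N" using sg_mod by (intro seg_segment) blast
  then obtain i where i: "i \<in> first_vertices N (seg N (p + int k) (p' + int k'))"
    by (rule first_vertices_nonempty)
  let ?g = "vec_v_tilde X n (arc p k) + vec_v_tilde X n (arc p' k') + vec_H X n i (seg N (p + int k) (p' + int k'))"
  show "\<exists>g\<in>odd_generators X n. g \<in> U \<and>
     (\<forall>c\<in>\<Lambda>. 0 \<le> cf c g \<and> (cf c g \<noteq> 0 \<longrightarrow> (\<forall>u\<in>U. cf c u = cf l u) \<or> (\<forall>u\<in>U. cf c u = cf m u)))"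
  proof (rule bexI)
    show "?g \<in> odd_generators X n" unfolding odd_generators_eq using 1 2 par i by blast
    show "?g \<in> U \<and>
     (\<forall>c\<in>\<Lambda>. 0 \<le> cf c ?g \<and> (cf c ?g \<noteq> 0 \<longrightarrow> (\<forall>u\<in>U. cf c u = cf l u) \<or> (\<forall>u\<in>U. cf c u = cf m u)))"
      using odd_generator_U[OF 1 2 par i] odd_generator_cf(3,4)[OF 1(1) 2(1) refl] unfolding l m by blast
  qed
qed

end

theorem theorem6p1p2:
  fixes \<iota> :: "'k::field_char_0 \<Rightarrow> 'f::field"
    and X :: cartan_type and n :: nat
    and S :: "'f seed" and x :: "int set set \<Rightarrow> 'f"
  assumes "odd n"
    and "X = Type_A \<and> n \<ge> 1 \<or> (X = Type_B \<or> X = Type_C) \<and> n \<ge> 3"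
    and "field_embedding \<iota>"
    and "is_seed \<iota> n S"
    and "has_cartan_type X n S"
    and "polygon_model X n S x"
  shows "lineality_space (polygon_groebner_cone \<iota> X n S x) =
           span {\<Sum>i = 1..nat (polygon_size X n). (- 1) ^ i *\<^sub>R vec_E X n (int i)}
    \<and> rays_mod_lineality (polygon_groebner_cone \<iota> X n S x) =
           quotient_ray (lineality_space (polygon_groebner_cone \<iota> X n S x)) `
             (even_generators X n \<union> odd_generators X n)"
proof -
  interpret polygon_seed X n \<iota> S x
    by unfold_locales (fact assms)+
  have "polygon_groebner_cone \<iota> X n S x = cone.C"
    unfolding polygon_groebner_cone_eq cone.C_def weak_iff ..
  moreover have "cone.K = span {\<Sum>i = 1..nat (polygon_size X n). (- 1) ^ i *\<^sub>R vec_E X n (int i)}"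
    unfolding cone.K_def kernel_eq Z_def N_def ..
  ultimately show ?thesis using cone.lineality cone.rays_generated by simp
qed

end
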